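(* Let $d\in\mathbb{N}$ and let $\Theta=[\nu_{\min},\nu_{\max}]$ with $0<\nu_{\min}\le\nu_{\max}<\infty$ and $\nu_{\max}>d/2$. Let $K_\nu$, $\nu\in\Theta$, be the Matérn kernels on $\mathbb{R}^d$ with fixed $\sigma,\lambda>0$ and positive scaling factor $c(\nu)$, and suppose that $\inf_{\nu\in[\nu_{\min},\nu_{\max}]}c(\nu)>0$. Suppose that $\Omega\subset\mathbb{R}^d$ is a bounded connected open set which satisfies an interior cone condition and has a Lipschitz boundary, and that $\{x_i\}_{i=1}^\infty\subset\Omega$ is a sequence of pairwise distinct points that is quasi-uniform on $\Omega$. Let $\nu_0\in(d/2,\nu_{\max}]$. (1) If $B$ is a bounded subset of the Sobolev space $H^{\nu_0}(\Omega)$, then $$\liminf_{n\to\infty}\inf_{f_0\in B}\hat\nu_{\mathrm{ML}}^{f_0}(X_n)\ge\nu_0\quad\text{and}\quad\liminf_{n\to\infty}\inf_{f_0\in B}\hat\nu_{\mathrm{CV}}^{f_0}(X_n)\ge\nu_0-\frac d2 .$$ (2) Suppose in addition that $\sup_{\nu\in[\nu_{\min},\nu_{\max}]}c(\nu)<\infty$ and that $\nu_0\ge\nu_{\min}$. Then the bound for maximum likelihood estimation is sharp in the sense that for every $\varepsilon>0$ there is $f_0\in H^{\nu_0}(\Omega)$ such that $$\limsup_{n\to\infty}\hat\nu_{\mathrm{ML}}^{f_0}(X_n)\le\nu_0+\varepsilon .$$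
   Context: Matérn kernels: $\sigma,\lambda>0$ are fixed, $c(\nu)>0$ is a scaling factor, and for $\nu>0$, $x,y\in\mathbb{R}^d$, $$K_\nu(x,y)=\sigma^2c(\nu)\Big(\tfrac{\sqrt{2\nu}\,\|x-y\|}{\lambda}\Big)^{\nu}\mathcal K_\nu\Big(\tfrac{\sqrt{2\nu}\,\|x-y\|}{\lambda}\Big),$$ where $\mathcal K_\nu$ is the modified Bessel function of the second kind of order $\nu$, $\|\cdot\|$ is the Euclidean norm, and the value at $x=y$ is defined by continuity. $K_\nu$ is symmetric and strictly positive-definite. Notation: $X_n=\{x_i\}_{i=1}^n$, $X_n^i=X_n\setminus\{x_i\}$, $f_0(X)$ is the column vector of values of $f_0$ at the points of $X$, $K_\nu(X)$ is the matrix with entries $K_\nu(x_i,x_j)$, $x_i,x_j\in X$, and $K_\nu(x,X)$ is the column vector with entries $K_\nu(x,x_i)$. The conditional mean and variance are $$\mu_{\nu,f_0}(x\mid X)=K_\nu(x,X)^{\mathsf T}K_\nu(X)^{-1}f_0(X),\qquad \mathbb V_\nu(x\mid X)=K_\nu(x,x)-K_\nu(x,X)^{\mathsf T}K_\nu(X)^{-1}K_\nu(x,X),$$ with $\mu_{\nu,f_0}(x\mid\emptyset)=0$ and $\mathbb V_\nu(x\mid\emptyset)=K_\nu(x,x)$. Estimators: $\hat\nu_{\mathrm{ML}}^{f_0}(X_n)$ is any minimiser over $\nu\in\Theta$ of $$\ell_{\mathrm{ML}}^{f_0}(\nu\mid X_n)=f_0(X_n)^{\mathsf T}K_\nu(X_n)^{-1}f_0(X_n)+\log\det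 K_\nu(X_n),$$ and $\hat\nu_{\mathrm{CV}}^{f_0}(X_n)$ is any minimiser over $\nu\in\Theta$ of $$\ell_{\mathrm{CV}}^{f_0}(\nu\mid X_n)=\sum_{i=1}^n\Big[\frac{(f_0(x_i)-\mu_{\nu,f_0}(x_i\mid X_n^i))^2}{\mathbb V_\nu(x_i\mid X_n^i)}+\log\mathbb V_\nu(x_i\mid X_n^i)\Big].$$ Minimisers are assumed to exist; results hold for an arbitrary choice of minimisers. Quasi-uniformity: with fill-distance $h_{n,\Omega}=\sup_{x\in\Omega}\min_{1\le i\le n}\|x-x_i\|$ and separation radius $q_n=\frac12\min_{1\le i\ne j\le n}\|x_i-x_j\|$, the sequence is quasi-uniform on $\Omega$ if there is a constant $c_{\mathrm{qu}}>0$ with $q_n\le h_{n,\Omega}\le c_{\mathrm{qu}}q_n$ for every $n\ge2$. Interior cone condition: there are an angle in $(0,\pi/2)$ and a radius $r>0$ such that every $x\in\Omega$ is the vertex of a cone of that angle and radius contained in $\Omega$. Sobolev spaces: with $\widehat f(\xi)=\int_{\mathbb{R}^d}f(x)e^{-\mathrm i x^{\mathsf T}\xi}\,dx$, $H^\alpha(\mathbb{R}^d)$ consists of $f\in L^2(\mathbb{R}^d)$ with $\|f\|_{H^\alpha(\mathbb{R}^d)}^2=\int_{\mathbb{R}^d}(1+\|\xi\|^2)^\alpha|\widehat f(\xi)|^2\,d\xi<\infty$; for $\alpha>d/2$ its elements are identified with continuous functions. $H^\alpha(\Omega)$ is the set of $f:\Omega\to\mathbb{R}$ having an extension $f_e\in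 H^\alpha(\mathbb{R}^d)$ with $f_e|_\Omega=f$, with norm equal to the minimum of $\|f_e\|_{H^\alpha(\mathbb{R}^d)}$ over all such extensions. *)

theory Defs
  imports
    "HOL-Analysis.Analysis"
    "Jordan_Normal_Form.Determinant"
    "Jordan_Normal_Form.Gauss_Jordan_Elimination"
begin

section \<open>Matern kernels\<close>

text \<open>Modified Bessel function of the second kind of real order, for argument \<open>z > 0\<close>
  (Wendland, Scattered Data Approximation, Definition 5.10).\<close>

definition bessel_K :: "real \<Rightarrow> real \<Rightarrow> real" where
  "bessel_K \<nu> z = (LBINT t:{0..}. exp (- z * cosh t) * cosh (\<nu> * t))"

text \<open>The function \<open>r\<^sup>\<nu> K\<^sub>\<nu>(r)\<close> on \<open>[0, \<infinity>)\<close>, extended to \<open>r = 0\<close> by continuity.\<close>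

definition matern_profile :: "real \<Rightarrow> real \<Rightarrow> real" where
  "matern_profile \<nu> r =
     (if r = 0 then Lim (at_right 0) (\<lambda>s. s powr \<nu> * bessel_K \<nu> s)
      else r powr \<nu> * bessel_K \<nu> r)"

definition matern ::
    "real \<Rightarrow> real \<Rightarrow> (real \<Rightarrow> real) \<Rightarrow> real \<Rightarrow> real ^ 'n \<Rightarrow> real ^ 'n \<Rightarrow> real" where
  "matern \<sigma> lam c \<nu> x y =
     \<sigma>\<^sup>2 * c \<nu> * matern_profile \<nu> (sqrt (2 * \<nu>) * norm (x - y) / lam)"


section \<open>Conditional mean and variance, objective functions\<close>

text \<open>Finite sets of pairwise distinct points are represented by distinct lists; all
  quantities below are invariant under permutations of the list. Matrices and vectors
  are those of \<open>Jordan_Normal_Form\<close>, as their dimension depends on the number of points.\<close>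

definition kernel_matrix :: "('a \<Rightarrow> 'a \<Rightarrow> real) \<Rightarrow> 'a list \<Rightarrow> real mat" where
  "kernel_matrix K X = mat (length X) (length X) (\<lambda>(i, j). K (X ! i) (X ! j))"

definition kernel_matrix_inv :: "('a \<Rightarrow> 'a \<Rightarrow> real) \<Rightarrow> 'a list \<Rightarrow> real mat" where
  "kernel_matrix_inv K X = the (mat_inverse (kernel_matrix K X))"

definition values_at :: "('a \<Rightarrow> real) \<Rightarrow> 'a list \<Rightarrow> real Matrix.vec" where
  "values_at f X = vec_of_list (map f X)"

definition cond_mean ::
    "('a \<Rightarrow> 'a \<Rightarrow> real) \<Rightarrow> ('a \<Rightarrow> real) \<Rightarrow> 'a list \<Rightarrow> 'a \<Rightarrow> real" where
  "cond_mean K f X x =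
     (if X = [] then 0
      else scalar_prod (values_at (K x) X) (kernel_matrix_inv K X *\<^sub>v values_at f X))"

definition cond_var :: "('a \<Rightarrow> 'a \<Rightarrow> real) \<Rightarrow> 'a list \<Rightarrow> 'a \<Rightarrow> real" where
  "cond_var K X x =
     (if X = [] then K x x
      else K x x - scalar_prod (values_at (K x) X)
                     (kernel_matrix_inv K X *\<^sub>v values_at (K x) X))"

definition loss_ML :: "('a \<Rightarrow> 'a \<Rightarrow> real) \<Rightarrow> ('a \<Rightarrow> real) \<Rightarrow> 'a list \<Rightarrow> real" where
  "loss_ML K f X =
     scalar_prod (values_at f X) (kernel_matrix_inv K X *\<^sub>v values_at f X)
     + ln (Determinant.det (kernel_matrix K X))"

definition loss_CV :: "('a \<Rightarrow> 'a \<Rightarrow> real) \<Rightarrow> ('a \<Rightarrow> real) \<Rightarrow> 'a list \<Rightarrow> real" where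
  "loss_CV K f X =
     (\<Sum>x\<leftarrow>X. (f x - cond_mean K f (removeAll x X) x)\<^sup>2 / cond_var K (removeAll x X) x
              + ln (cond_var K (removeAll x X) x))"

text \<open>The points of a sequence are numbered from 1; the value \<open>x 0\<close> is not used.\<close>

definition first_points :: "(nat \<Rightarrow> 'a) \<Rightarrow> nat \<Rightarrow> 'a list" where
  "first_points x n = map x [1..<Suc n]"

text \<open>An estimator on a class \<open>F\<close> of functions is an arbitrary selection of minimisers over
  \<open>\<Theta>\<close>, one for every \<open>f \<in> F\<close> and every \<open>n \<ge> 1\<close>; such a selection exists if and only if
  all these minimisers do. \<open>K\<close> is the family of kernels indexed by the parameter.\<close>

definition estimator_ML ::
    "(real \<Rightarrow> 'a \<Rightarrow> 'a \<Rightarrow> real) \<Rightarrow> real set \<Rightarrow> (nat \<Rightarrow> 'a) \<Rightarrow> ('a \<Rightarrow> real) set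
     \<Rightarrow> (('a \<Rightarrow> real) \<Rightarrow> nat \<Rightarrow> real) \<Rightarrow> bool" where
  "estimator_ML K \<Theta> x F est \<longleftrightarrow>
     (\<forall>f\<in>F. \<forall>n\<ge>1.
        is_arg_min (\<lambda>\<nu>. loss_ML (K \<nu>) f (first_points x n)) (\<lambda>\<nu>. \<nu> \<in> \<Theta>) (est f n))"

definition estimator_CV ::
    "(real \<Rightarrow> 'a \<Rightarrow> 'a \<Rightarrow> real) \<Rightarrow> real set \<Rightarrow> (nat \<Rightarrow> 'a) \<Rightarrow> ('a \<Rightarrow> real) set
     \<Rightarrow> (('a \<Rightarrow> real) \<Rightarrow> nat \<Rightarrow> real) \<Rightarrow> bool" where
  "estimator_CV K \<Theta> x F est \<longleftrightarrow>
     (\<forall>f\<in>F. \<forall>n\<ge>1.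
        is_arg_min (\<lambda>\<nu>. loss_CV (K \<nu>) f (first_points x n)) (\<lambda>\<nu>. \<nu> \<in> \<Theta>) (est f n))"


section \<open>Quasi-uniform sequences\<close>

definition fill_distance ::
    "'a::real_normed_vector set \<Rightarrow> (nat \<Rightarrow> 'a) \<Rightarrow> nat \<Rightarrow> real" where
  "fill_distance \<Omega> x n = (SUP y\<in>\<Omega>. MIN i\<in>{1..n}. norm (y - x i))"

definition separation_radius :: "(nat \<Rightarrow> 'a::real_normed_vector) \<Rightarrow> nat \<Rightarrow> real" where
  "separation_radius x n =
     1 / 2 * Min {norm (x i - x j) | i j. i \<in> {1..n} \<and> j \<in> {1..n} \<and> i \<noteq> j}"

definition quasi_uniform ::
    "'a::real_normed_vector set \<Rightarrow> (nat \<Rightarrow> 'a) \<Rightarrow> bool" where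
  "quasi_uniform \<Omega> x \<longleftrightarrow>
     (\<exists>c>0. \<forall>n\<ge>2. separation_radius x n \<le> fill_distance \<Omega> x n \<and>
                   fill_distance \<Omega> x n \<le> c * separation_radius x n)"


section \<open>Domains\<close>

text \<open>The cone with vertex \<open>x\<close>, axis in the direction of the unit vector \<open>e\<close>, angle \<open>\<theta>\<close>
  (between axis and boundary) and radius \<open>r\<close>.\<close>

definition cone_at ::
    "'a::real_inner \<Rightarrow> 'a \<Rightarrow> real \<Rightarrow> real \<Rightarrow> 'a set" where
  "cone_at x e \<theta> r =
     {x + t *\<^sub>R y | t y. 0 \<le> t \<and> t \<le> r \<and> norm y = 1 \<and> cos \<theta> \<le> inner y e}"

definition interior_cone_condition :: "'a::real_inner set \<Rightarrow> bool" where
  "interior_cone_condition \<Omega> \<longleftrightarrow>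
     (\<exists>\<theta> r. 0 < \<theta> \<and> \<theta> < pi / 2 \<and> 0 < r \<and>
        (\<forall>x\<in>\<Omega>. \<exists>e. norm e = 1 \<and> cone_at x e \<theta> r \<subseteq> \<Omega>))"

text \<open>Near each boundary point, \<open>\<Omega>\<close> is the part of a ball lying above the graph of a Lipschitz
  function. The graph is taken over the hyperplane orthogonal to a unit vector \<open>e\<close>, which plays
  the role of the last coordinate axis after a rotation.\<close>

definition lipschitz_boundary :: "'a::real_inner set \<Rightarrow> bool" where
  "lipschitz_boundary \<Omega> \<longleftrightarrow>
     (\<forall>p\<in>frontier \<Omega>. \<exists>r>0. \<exists>e (\<phi> :: 'a \<Rightarrow> real) L. norm e = 1 \<and>
        L-lipschitz_on {y. inner y e = 0} \<phi> \<and>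
        \<Omega> \<inter> ball p r = {y \<in> ball p r. \<phi> (y - inner y e *\<^sub>R e) < inner y e})"


section \<open>Sobolev spaces\<close>

definition square_integrable :: "(real ^ 'n \<Rightarrow> real) \<Rightarrow> bool" where
  "square_integrable f \<longleftrightarrow>
     f \<in> borel_measurable lborel \<and> integrable lborel (\<lambda>x. (f x)\<^sup>2)"

text \<open>The integral defining the Fourier transform need not converge for square-integrable
  \<open>f\<close>. As usual, the transform is then the \<open>L\<^sup>2\<close>-limit of the transforms of the
  truncations of \<open>f\<close> to balls (Plancherel); it is unique up to null sets.\<close>

definition truncated_fourier ::
    "(real ^ 'n \<Rightarrow> real) \<Rightarrow> real \<Rightarrow> real ^ 'n \<Rightarrow> complex" where
  "truncated_fourier f R \<xi> =
     (LINT x:ball 0 R|lborel. complex_of_real (f x) * exp (- \<i> * complex_of_real (inner x \<xi>)))"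

definition is_fourier_transform ::
    "(real ^ 'n \<Rightarrow> real) \<Rightarrow> (real ^ 'n \<Rightarrow> complex) \<Rightarrow> bool" where
  "is_fourier_transform f g \<longleftrightarrow>
     g \<in> borel_measurable lborel \<and>
     ((\<lambda>R. \<integral>\<^sup>+ \<xi>. ennreal ((cmod (truncated_fourier f R \<xi> - g \<xi>))\<^sup>2) \<partial>lborel) \<longlongrightarrow> 0) at_top"

definition fourier_transform :: "(real ^ 'n \<Rightarrow> real) \<Rightarrow> real ^ 'n \<Rightarrow> complex" where
  "fourier_transform f = (SOME g. is_fourier_transform f g)"

definition sobolev_energy :: "real \<Rightarrow> (real ^ 'n \<Rightarrow> real) \<Rightarrow> ennreal" where
  "sobolev_energy \<alpha> f =
     (\<integral>\<^sup>+ \<xi>. ennreal ((1 + (norm \<xi>)\<^sup>2) powr \<alpha> * (cmod (fourier_transform f \<xi>))\<^sup>2) \<partial>lborel)"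

definition sobolev_space :: "real \<Rightarrow> (real ^ 'n \<Rightarrow> real) set" where
  "sobolev_space \<alpha> = {f. square_integrable f \<and> sobolev_energy \<alpha> f < \<infinity>}"

definition sobolev_norm :: "real \<Rightarrow> (real ^ 'n \<Rightarrow> real) \<Rightarrow> real" where
  "sobolev_norm \<alpha> f = sqrt (enn2real (sobolev_energy \<alpha> f))"

text \<open>Spaces on a domain, for \<open>\<alpha> > d/2\<close> only: elements of \<open>sobolev_space \<alpha>\<close> are represented
  by continuous functions, so that \<open>f\<close> has well-defined values at points. Functions on
  \<open>\<Omega>\<close> are total functions whose values outside \<open>\<Omega>\<close> are irrelevant.\<close>

definition sobolev_extensions ::
    "real \<Rightarrow> (real ^ 'n) set \<Rightarrow> (real ^ 'n \<Rightarrow> real) \<Rightarrow> (real ^ 'n \<Rightarrow> real) set" where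
  "sobolev_extensions \<alpha> \<Omega> f =
     {g \<in> sobolev_space \<alpha>. continuous_on UNIV g \<and> (\<forall>x\<in>\<Omega>. g x = f x)}"

definition sobolev_space_on ::
    "real \<Rightarrow> (real ^ 'n) set \<Rightarrow> (real ^ 'n \<Rightarrow> real) set" where
  "sobolev_space_on \<alpha> \<Omega> = {f. sobolev_extensions \<alpha> \<Omega> f \<noteq> {}}"

definition sobolev_norm_on ::
    "real \<Rightarrow> (real ^ 'n) set \<Rightarrow> (real ^ 'n \<Rightarrow> real) \<Rightarrow> real" where
  "sobolev_norm_on \<alpha> \<Omega> f = (INF g\<in>sobolev_extensions \<alpha> \<Omega> f. sobolev_norm \<alpha> g)"

definition sobolev_bounded ::
    "real \<Rightarrow> (real ^ 'n) set \<Rightarrow> (real ^ 'n \<Rightarrow> real) set \<Rightarrow> bool" where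
  "sobolev_bounded \<alpha> \<Omega> B \<longleftrightarrow>
     B \<subseteq> sobolev_space_on \<alpha> \<Omega> \<and> (\<exists>M. \<forall>f\<in>B. sobolev_norm_on \<alpha> \<Omega> f \<le> M)"

end

theory Submission
  imports Defs "HOL-Probability.Probability" "HOL-Real_Asymp.Real_Asymp"
begin

text \<open>The Matern kernel is a mixture of Gaussian kernels \<open>exp (-|x - y|\<^sup>2 / (4 t))\<close> with weight \<open>t\<^bsup>\<nu>-1\<^esup> e\<^bsup>-\<kappa>t\<^esup>\<close>,
  \<open>\<kappa> = 2 \<nu> / \<lambda>\<^sup>2\<close>. For points with separation radius \<open>q\<close>, the Gaussian Gram matrices with \<open>t\<close> up to \<open>q\<^sup>2 / ln (2 n)\<close>
  are close to the identity, so all conditional variances are at least of order \<open>n\<^bsup>-2\<nu>/d\<^esup>\<close> up to logarithms. Conversely,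
  coefficients that annihilate enough polynomials on a cluster of diameter \<open>\<delta>\<close> make the quadratic form of order
  \<open>\<delta>\<^bsup>2\<nu>\<^esup>\<close>; as a bounded domain has \<open>O(\<delta>\<^bsup>-d\<^esup>)\<close> cells of size \<open>\<delta>\<close>, most conditional variances are that small. Hence
  the log-determinant is about \<open>-(2\<nu>/d) n ln n\<close>.

  By Fourier inversion against Gaussian means, \<open>(\<Sum> u f)\<^sup>2\<close> is at most a constant times the quadratic form of order \<open>\<nu>\<^sub>0 - d/2\<close> for
  \<open>f\<close> in a bounded subset of the Sobolev space. So the data-fit term at \<open>\<nu> < \<nu>\<^sub>0\<close> is of lower order than \<open>n\<close>, and a
  parameter bounded away from \<open>\<nu>\<^sub>0\<close> from below loses against one closer to it; for cross-validation the comparison is made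
  with \<open>\<nu>\<^sub>0 - d/2\<close>, where each term of the sum is bounded.

  For sharpness, a lacunary series of bumps with heights \<open>r\<^bsup>\<beta>\<^esup>\<close> at the scales \<open>r = 2\<^bsup>-j/d\<^esup>\<close>, with \<open>\<beta>\<close> slightly above
  \<open>\<nu>\<^sub>0 - d/2\<close>, belongs to the Sobolev space, but testing it against annihilating coefficients makes the data-fit term
  at \<open>\<nu> \<ge> \<nu>\<^sub>0 + \<epsilon>\<close> grow faster than \<open>n ln n\<close>.\<close>

no_notation scalar_prod (infix "\<bullet>" 70)

section \<open>Conditional moments and quadratic forms\<close>

text \<open>The gap d/2 between the two estimators comes from the data fit. The native space of the
  kernel of order \<nu> has Sobolev order \<nu> + d/2, so a function of smoothness \<nu>0 is
  controlled by the form of order \<nu>0 - d/2 only. Passing to order \<nu> costs n^(2 (\<nu> -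
  \<nu>0 + d/2)/d) up to logarithms, which stays below n exactly for \<nu> < \<nu>0 and is attained,
  up to small exponents, by rough functions. The likelihood pays this cost once, cross-validation
  possibly in each of its n summands, so there the comparison takes place where no cost arises. The
  shape of the proof is dictated by uniformity: the minimiser is unknown, so losses over a whole
  range of parameters are compared with the loss at one fixed parameter. Lower bounds must therefore
  hold uniformly in \<nu>, upper bounds at a single parameter only. The gap is of order n ln n, so
  that the loss of n ln ln n caused by the time scale q^2 / ln (2 n) and a vanishing proportion of
  badly predicted points do no harm.\<close>

definition quad :: "('a \<Rightarrow> 'a \<Rightarrow> real) \<Rightarrow> 'a set \<Rightarrow> ('a \<Rightarrow> real) \<Rightarrow> real" where
  "quad K A u = (\<Sum>x\<in>A. \<Sum>y\<in>A. u x * u y * K x y)"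

text \<open>Positivity is tied to a set of points because coefficients are functions on the whole
  space; restriction to a subset then amounts to extension by zero.\<close>

definition pos_def_on :: "'a set \<Rightarrow> ('a \<Rightarrow> 'a \<Rightarrow> real) \<Rightarrow> bool" where
  "pos_def_on A K \<longleftrightarrow> (\<forall>x y. K x y = K y x) \<and> (\<forall>u. (\<exists>x\<in>A. u x \<noteq> 0) \<longrightarrow> 0 < quad K A u)"

lemma quad_cong:
  assumes "\<And>x. x \<in> A \<Longrightarrow> u x = v x"
  shows "quad K A u = quad K A v"
  unfolding quad_def using assms by (intro sum.cong) auto

lemma quad_mono_neutral:
  assumes "finite B" "A \<subseteq> B" "\<And>x. x \<in> B - A \<Longrightarrow> u x = 0"
  shows "quad K B u = quad K A u"
proof -
  have "quad K A u = (\<Sum>x\<in>B. \<Sum>y\<in>A. u x * u y * K x y)"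
    unfolding quad_def by (intro sum.mono_neutral_left) (use assms in auto)
  also have "\<dots> = quad K B u"
    unfolding quad_def by (intro sum.cong refl sum.mono_neutral_left) (use assms in auto)
  finally show ?thesis by simp
qed

lemma pos_def_on_subset:
  fixes K :: "'a \<Rightarrow> 'a \<Rightarrow> real"
  assumes "pos_def_on B K" "finite B" "A \<subseteq> B"
  shows "pos_def_on A K"
  unfolding pos_def_on_def
proof (intro conjI allI impI)
  fix u :: "'a \<Rightarrow> real" assume nz: "\<exists>x\<in>A. u x \<noteq> 0"
  define v where "v x = (if x \<in> A then u x else 0)" for x
  have "\<exists>x\<in>B. v x \<noteq> 0" using nz assms(3) by (auto simp: v_def)
  then have "0 < quad K B v" using assms(1) unfolding pos_def_on_def by blast
  also have "quad K B v = quad K A v"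
    using assms by (intro quad_mono_neutral) (auto simp: v_def)
  also have "\<dots> = quad K A u" by (intro quad_cong) (simp add: v_def)
  finally show "0 < quad K A u" .
qed (use assms in \<open>auto simp: pos_def_on_def\<close>)

lemma quad_nonneg:
  assumes "pos_def_on A K" shows "0 \<le> quad K A u"
proof (cases "\<exists>x\<in>A. u x \<noteq> 0")
  case True then show ?thesis using assms unfolding pos_def_on_def by (meson less_imp_le)
next
  case False then have "quad K A u = 0" unfolding quad_def by (intro sum.neutral) auto
  then show ?thesis by simp
qed

lemma quad_add_scaled:
  assumes sym: "\<And>x y. K x y = K y x" and "finite A"
  shows "quad K A (\<lambda>x. u x + t * w x) =
    quad K A u + 2 * t * (\<Sum>x\<in>A. u x * (\<Sum>y\<in>A. K x y * w y)) + t\<^sup>2 * quad K A w"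
proof -
  have e: "(u x + t * w x) * (u y + t * w y) * K x y =
     u x * u y * K x y + t * (u x * (K x y * w y)) + t * (u y * (K y x * w x)) + t\<^sup>2 * (w x * w y * K x y)" for x y
    by (subst sym[of y x]) (simp add: algebra_simps power2_eq_square)
  have s: "(\<Sum>x\<in>A. \<Sum>y\<in>A. u y * (K y x * w x)) = (\<Sum>x\<in>A. u x * (\<Sum>y\<in>A. K x y * w y))"
    by (subst sum.swap) (simp add: sum_distrib_left)
  show ?thesis
    unfolding quad_def e sum.distrib sum_distrib_left[symmetric] s by simp
qed

lemma quad_Cauchy_Schwarz:
  assumes pd: "pos_def_on A K" and fin: "finite A"
  shows "(\<Sum>x\<in>A. u x * (\<Sum>y\<in>A. K x y * w y))\<^sup>2 \<le> quad K A u * quad K A w"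
proof -
  define b where "b = (\<Sum>x\<in>A. u x * (\<Sum>y\<in>A. K x y * w y))"
  have nn: "0 \<le> quad K A u + 2 * t * b + t\<^sup>2 * quad K A w" for t
    using quad_nonneg[OF pd, of "\<lambda>x. u x + t * w x"] quad_add_scaled[of K A u t w] pd fin
    by (simp add: pos_def_on_def b_def)
  show ?thesis
  proof (cases "\<exists>x\<in>A. w x \<noteq> 0")
    case True
    then have p: "0 < quad K A w" using pd by (auto simp: pos_def_on_def)
    \<comment> \<open>This is the quadratic polynomial in t at its minimiser t = - b /
      \<open>quad K A w\<close>.\<close>
    have "0 \<le> quad K A u + 2 * (- b / quad K A w) * b + (- b / quad K A w)\<^sup>2 * quad K A w" by (rule nn)
    also have "\<dots> = quad K A u - b\<^sup>2 / quad K A w"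
      using p by (simp add: power2_eq_square field_simps)
    finally have "b\<^sup>2 / quad K A w \<le> quad K A u" by simp
    then show ?thesis using p by (simp add: pos_divide_le_eq b_def)
  next
    case False
    then have "b = 0" unfolding b_def by (intro sum.neutral ballI) (simp add: sum.neutral)
    moreover have "quad K A w = 0" unfolding quad_def using False by (intro sum.neutral) auto
    ultimately show ?thesis by (simp add: b_def)
  qed
qed

section \<open>Matrix expressions as finite sums over the points\<close>

lemma dim_values_at [simp]: "dim_vec (values_at u X) = length X"
  by (simp add: values_at_def)

lemma values_at_carrier [simp]: "values_at u X \<in> carrier_vec (length X)"
  by (intro carrier_vecI) simp

lemma index_values_at [simp]: "i < length X \<Longrightarrow> values_at u X $ i = u (X ! i)"
  unfolding values_at_def vec_of_list_index by simp

lemma kernel_matrix_carrier [simp]: "kernel_matrix K X \<in> carrier_mat (length X) (length X)"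
  by (simp add: kernel_matrix_def)

lemma scalar_prod_values_at:
  assumes "distinct X"
  shows "scalar_prod (values_at u X) (values_at w X) = (\<Sum>x\<in>set X. u x * w x)"
proof -
  have "scalar_prod (values_at u X) (values_at w X) = (\<Sum>i<length X. u (X ! i) * w (X ! i))"
    by (simp add: scalar_prod_def lessThan_atLeast0)
  also have "\<dots> = (\<Sum>x\<in>set X. u x * w x)"
    by (rule sum.reindex_bij_betw[OF bij_betw_nth[OF assms refl refl]])
  finally show ?thesis .
qed

lemma kernel_matrix_mult_values_at:
  assumes "distinct X"
  shows "kernel_matrix K X *\<^sub>v values_at w X = values_at (\<lambda>x. \<Sum>y\<in>set X. K x y * w y) X"
proof (rule eq_vecI)
  fix i assume "i < dim_vec (values_at (\<lambda>x. \<Sum>y\<in>set X. K x y * w y) X)"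
  then have i: "i < length X" by simp
  have "Matrix.row (kernel_matrix K X) i = values_at (K (X ! i)) X"
    using i by (intro eq_vecI) (auto simp: kernel_matrix_def)
  then show "(kernel_matrix K X *\<^sub>v values_at w X) $ i = values_at (\<lambda>x. \<Sum>y\<in>set X. K x y * w y) X $ i"
    using i by (simp add: scalar_prod_values_at[OF assms] kernel_matrix_def)
qed (simp add: kernel_matrix_def)

text \<open>As the points are distinct, an index can be recovered from its point, so every vector
  consists of the values of a function. This is how vectors are exchanged for functions and matrix
  products for sums over the points.\<close>

lemma ex_values_at:
  assumes "distinct X" "v \<in> carrier_vec (length X)"
  obtains u where "v = values_at u X"
proof
  show "v = values_at (\<lambda>x. v $ (inv_into {..<length X} ((!) X) x)) X"
    using assms by (intro eq_vecI)
      (auto simp: inv_into_f_f inj_on_nth)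
qed

lemma kernel_matrix_det_nonzero:
  assumes "distinct X" "pos_def_on (set X) K"
  shows "Determinant.det (kernel_matrix K X) \<noteq> 0"
proof
  assume "Determinant.det (kernel_matrix K X) = 0"
  then obtain v where v: "v \<in> carrier_vec (length X)" "v \<noteq> 0\<^sub>v (length X)"
    "kernel_matrix K X *\<^sub>v v = 0\<^sub>v (length X)"
    using det_0_iff_vec_prod_zero_field[OF kernel_matrix_carrier] by blast
  obtain u where u: "v = values_at u X" using ex_values_at assms v by metis
  have "\<exists>i<length X. v $ i \<noteq> 0"
    using v(1,2) by (metis carrier_vecD dim_vec eq_vecI index_zero_vec(1) zero_carrier_vec)
  then have "\<exists>x\<in>set X. u x \<noteq> 0" using u by auto
  then have "0 < quad K (set X) u" using assms by (simp add: pos_def_on_def)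
  also have "quad K (set X) u = (\<Sum>x\<in>set X. u x * (\<Sum>y\<in>set X. K x y * u y))"
    by (simp add: quad_def sum_distrib_left mult_ac)
  also have "\<dots> = scalar_prod v (kernel_matrix K X *\<^sub>v v)"
    unfolding u kernel_matrix_mult_values_at[OF assms(1)] scalar_prod_values_at[OF assms(1)] by simp
  also have "\<dots> = 0" using v by simp
  finally show False by simp
qed

text \<open>\<open>kernel_matrix_inv\<close> unwraps the option returned by
  \<open>mat_inverse\<close>; the non-zero determinant rules out \<open>None\<close>.\<close>

lemma kernel_matrix_inv:
  assumes "distinct X" "pos_def_on (set X) K"
  shows "kernel_matrix K X * kernel_matrix_inv K X = 1\<^sub>m (length X)"
    "kernel_matrix_inv K X * kernel_matrix K X = 1\<^sub>m (length X)"
    "kernel_matrix_inv K X \<in> carrier_mat (length X) (length X)"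
proof -
  have "kernel_matrix K X \<in> Units (ring_mat TYPE(real) (length X) ())"
    using det_non_zero_imp_unit[OF kernel_matrix_carrier kernel_matrix_det_nonzero[OF assms]] .
  then obtain B where "mat_inverse (kernel_matrix K X) = Some B"
    using mat_inverse(1)[OF kernel_matrix_carrier, where b="()"] by (cases "mat_inverse (kernel_matrix K X)") auto
  with mat_inverse(2)[OF kernel_matrix_carrier this]
  show "kernel_matrix K X * kernel_matrix_inv K X = 1\<^sub>m (length X)"
    "kernel_matrix_inv K X * kernel_matrix K X = 1\<^sub>m (length X)"
    "kernel_matrix_inv K X \<in> carrier_mat (length X) (length X)"
    by (auto simp: kernel_matrix_inv_def)
qed

text \<open>The function w holds the coefficients of the kernel interpolant of f. Later arguments
  meet the inverse matrix only through this linear system.\<close>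

lemma kernel_coefficients:
  assumes "distinct X" "pos_def_on (set X) K"
  obtains w where "kernel_matrix_inv K X *\<^sub>v values_at f X = values_at w X"
    "\<And>x. x \<in> set X \<Longrightarrow> (\<Sum>y\<in>set X. K x y * w y) = f x"
proof -
  note inv = kernel_matrix_inv[OF assms]
  have "kernel_matrix_inv K X *\<^sub>v values_at f X \<in> carrier_vec (length X)"
    using inv(3) by simp
  then obtain w where w: "kernel_matrix_inv K X *\<^sub>v values_at f X = values_at w X"
    using ex_values_at[OF assms(1)] by metis
  have "values_at (\<lambda>x. \<Sum>y\<in>set X. K x y * w y) X
      = kernel_matrix K X *\<^sub>v (kernel_matrix_inv K X *\<^sub>v values_at f X)"
    unfolding w kernel_matrix_mult_values_at[OF assms(1)] ..
  also have "\<dots> = values_at f X"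
    using inv by (subst assoc_mult_mat_vec[symmetric, OF kernel_matrix_carrier]) auto
  finally have eq: "values_at (\<lambda>x. \<Sum>y\<in>set X. K x y * w y) X = values_at f X" .
  have "(\<Sum>y\<in>set X. K x y * w y) = f x" if x: "x \<in> set X" for x
  proof -
    obtain i where "i < length X" "x = X ! i" using x by (metis in_set_conv_nth)
    then show ?thesis using arg_cong[OF eq, of "\<lambda>v. v $ i"] by simp
  qed
  then show ?thesis using w that by blast
qed

text \<open>The squared native-space norm of the kernel interpolant of f, which is the first summand
  of \<open>loss_ML\<close>.\<close>

definition data_fit :: "('a \<Rightarrow> 'a \<Rightarrow> real) \<Rightarrow> ('a \<Rightarrow> real) \<Rightarrow> 'a list \<Rightarrow> real" where
  "data_fit K f X = scalar_prod (values_at f X) (kernel_matrix_inv K X *\<^sub>v values_at f X)"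

lemma quad_altdef: "quad K A u = (\<Sum>x\<in>A. u x * (\<Sum>y\<in>A. K x y * u y))"
  by (simp add: quad_def sum_distrib_left mult_ac)

text \<open>By duality the data fit is the least C \<ge> 0 with (\<Sum> u f)^2 \<le> C
  \<open>quad K (set X) u\<close> for all u: Cauchy-Schwarz against the interpolation coefficients w
  gives one inequality, the choice u = w the other. Later estimates of the data fit use this
  description, so that no inverse matrix has to be estimated.\<close>

lemma data_fit_ge:
  assumes "distinct X" "pos_def_on (set X) K"
  shows "(\<Sum>x\<in>set X. u x * f x)\<^sup>2 \<le> quad K (set X) u * data_fit K f X"
    and data_fit_nonneg: "0 \<le> data_fit K f X"
    and data_fit_le: "(\<And>u. (\<Sum>x\<in>set X. u x * f x)\<^sup>2 \<le> C * quad K (set X) u) \<Longrightarrow> 0 \<le> C \<Longrightarrow> data_fit K f X \<le> C"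
proof -
  obtain w where w: "kernel_matrix_inv K X *\<^sub>v values_at f X = values_at w X"
    "\<And>x. x \<in> set X \<Longrightarrow> (\<Sum>y\<in>set X. K x y * w y) = f x"
    using kernel_coefficients[OF assms] by metis
  have fit: "data_fit K f X = quad K (set X) w"
    "quad K (set X) w = (\<Sum>x\<in>set X. w x * f x)"
    unfolding data_fit_def w(1) scalar_prod_values_at[OF assms(1)] quad_altdef
    using w(2) by (auto intro!: sum.cong)
  have "(\<Sum>x\<in>set X. u x * f x) = (\<Sum>x\<in>set X. u x * (\<Sum>y\<in>set X. K x y * w y))"
    using w(2) by (intro sum.cong) auto
  then show "(\<Sum>x\<in>set X. u x * f x)\<^sup>2 \<le> quad K (set X) u * data_fit K f X"
    using quad_Cauchy_Schwarz[OF assms(2), of u w] by (simp add: fit(1))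
  show nn: "0 \<le> data_fit K f X" using quad_nonneg[OF assms(2), of w] by (simp add: fit(1))
  show "data_fit K f X \<le> C" if C: "\<And>u. (\<Sum>x\<in>set X. u x * f x)\<^sup>2 \<le> C * quad K (set X) u" "0 \<le> C"
  proof (rule ccontr)
    assume "\<not> data_fit K f X \<le> C"
    then have "C < data_fit K f X" by simp
    moreover from this have "0 < data_fit K f X" using C(2) by simp
    moreover have "data_fit K f X * data_fit K f X \<le> C * data_fit K f X"
      using C(1)[of w] by (simp add: fit(1) fit(2)[symmetric] power2_eq_square)
    ultimately show False by simp
  qed
qed

text \<open>Here u is the prediction error as a functional: 1 at x and minus the kriging weights on
  X. The kernel applied to u vanishes on X and equals the conditional variance at x
  (\<open>Ku\<close>), so its product with any v is v x times the variance (\<open>B\<close>), and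
  Cauchy-Schwarz makes u the minimiser among coefficients with value 1 at x. A single u thus yields
  the variance, its minimality and the residual of every f.\<close>

lemma cond_var_variational:
  assumes X: "distinct X" "x \<notin> set X" and pd: "pos_def_on (insert x (set X)) K"
  obtains u where "u x = 1" "cond_var K X x = quad K (insert x (set X)) u"
    "\<And>f. f x - cond_mean K f X x = (\<Sum>y\<in>insert x (set X). u y * f y)"
    "\<And>v. v x = 1 \<Longrightarrow> cond_var K X x \<le> quad K (insert x (set X)) v"
proof -
  have pdX: "pos_def_on (set X) K" by (rule pos_def_on_subset[OF pd]) auto
  have sym: "K y z = K z y" for y z using pd by (simp add: pos_def_on_def)
  obtain w where w: "kernel_matrix_inv K X *\<^sub>v values_at (K x) X = values_at w X"
    "\<And>y. y \<in> set X \<Longrightarrow> (\<Sum>z\<in>set X. K y z * w z) = K x y"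
    using kernel_coefficients[OF X(1) pdX] by metis
  define u where "u y = (if y = x then 1 else - w y)" for y
  let ?A = "insert x (set X)"
  have uX: "(\<Sum>y\<in>set X. g y * u y) = - (\<Sum>y\<in>set X. g y * w y)" for g
    unfolding sum_negf[symmetric] using X by (intro sum.cong) (auto simp: u_def)
  have V: "cond_var K X x = K x x - (\<Sum>y\<in>set X. K x y * w y)"
    by (cases "X = []") (simp_all add: cond_var_def w(1) scalar_prod_values_at[OF X(1)])
  have Ku: "(\<Sum>z\<in>?A. K y z * u z) = (if y = x then cond_var K X x else 0)" if "y \<in> ?A" for y
    using that X uX[of "K y"] w(2)[of y] by (auto simp: V u_def[of x] sym[of x y])
  have B: "(\<Sum>y\<in>?A. v y * (\<Sum>z\<in>?A. K y z * u z)) = v x * cond_var K X x" for v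
  proof -
    have "(\<Sum>y\<in>?A. v y * (\<Sum>z\<in>?A. K y z * u z)) = (\<Sum>y\<in>?A. if y = x then v x * cond_var K X x else 0)"
      by (intro sum.cong refl) (simp only: Ku, auto)
    then show ?thesis by simp
  qed
  have q: "cond_var K X x = quad K ?A u"
    unfolding quad_altdef B by (simp add: u_def)
  show ?thesis
  proof
    show "u x = 1" by (simp add: u_def)
    show "cond_var K X x = quad K ?A u" by (rule q)
    show "f x - cond_mean K f X x = (\<Sum>y\<in>?A. u y * f y)" for f
    proof -
      obtain wf where wf: "kernel_matrix_inv K X *\<^sub>v values_at f X = values_at wf X"
        "\<And>y. y \<in> set X \<Longrightarrow> (\<Sum>z\<in>set X. K y z * wf z) = f y"
        using kernel_coefficients[OF X(1) pdX] by metis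
      have "cond_mean K f X x = (\<Sum>y\<in>set X. K x y * wf y)"
        by (cases "X = []") (simp_all add: cond_mean_def wf(1) scalar_prod_values_at[OF X(1)])
      also have "\<dots> = (\<Sum>y\<in>set X. \<Sum>z\<in>set X. K y z * w z * wf y)"
        by (intro sum.cong) (simp_all add: w(2)[symmetric] sum_distrib_right)
      also have "\<dots> = (\<Sum>z\<in>set X. w z * (\<Sum>y\<in>set X. K z y * wf y))"
        by (subst sum.swap) (simp add: sum_distrib_left sym mult_ac)
      also have "\<dots> = (\<Sum>z\<in>set X. f z * w z)"
        by (intro sum.cong) (simp_all add: wf(2))
      finally show ?thesis using X uX[of f] by (simp add: u_def[of x] mult.commute)
    qed
    show "cond_var K X x \<le> quad K ?A v" if "v x = 1" for v
    proof -
      have "0 < cond_var K X x"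
        using pd unfolding q pos_def_on_def by (auto simp: u_def)
      moreover have "cond_var K X x * cond_var K X x \<le> quad K ?A v * cond_var K X x"
        using quad_Cauchy_Schwarz[OF pd, of v u] unfolding B q[symmetric]
        by (simp add: that power2_eq_square)
      ultimately show ?thesis by simp
    qed
  qed
qed

lemma cond_var_pos:
  assumes "distinct X" "x \<notin> set X" "pos_def_on (insert x (set X)) K"
  shows "0 < cond_var K X x"
proof -
  obtain u where "u x = 1" "cond_var K X x = quad K (insert x (set X)) u"
    using cond_var_variational[OF assms] by metis
  then show ?thesis using assms(3) unfolding pos_def_on_def by (metis insertI1 zero_neq_one)
qed

text \<open>Elimination of the last column: the unit upper triangular U has the prediction error
  functional as its last column, so the product of the kernel matrix with U is block lower
  triangular with the conditional variance in the corner. By iteration the determinant is a product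
  of conditional variances.\<close>

lemma det_kernel_matrix_snoc:
  assumes X: "distinct X" "x \<notin> set X" and pd: "pos_def_on (insert x (set X)) K"
  shows "Determinant.det (kernel_matrix K (X @ [x])) = Determinant.det (kernel_matrix K X) * cond_var K X x"
proof -
  have pdX: "pos_def_on (set X) K" by (rule pos_def_on_subset[OF pd]) auto
  have sym: "K y z = K z y" for y z using pd by (simp add: pos_def_on_def)
  obtain w where w: "kernel_matrix_inv K X *\<^sub>v values_at (K x) X = values_at w X"
    "\<And>y. y \<in> set X \<Longrightarrow> (\<Sum>z\<in>set X. K y z * w z) = K x y"
    using kernel_coefficients[OF X(1) pdX] by metis
  have V: "cond_var K X x = K x x - (\<Sum>y\<in>set X. K x y * w y)"
    by (cases "X = []") (simp_all add: cond_var_def w(1) scalar_prod_values_at[OF X(1)])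
  define n where "n = length X"
  have swx: "(\<Sum>i = 0..<n. g (X ! i)) = (\<Sum>y\<in>set X. g y)" for g :: "'a \<Rightarrow> real"
    unfolding n_def lessThan_atLeast0[symmetric]
    by (rule sum.reindex_bij_betw[OF bij_betw_nth[OF X(1) refl refl]])
  define U where "U = mat (Suc n) (Suc n) (\<lambda>(i, j). if i = j then 1 else if j = n then - w (X ! i) else 0)"
  let ?A = "kernel_matrix K (X @ [x])"
  have cA: "?A \<in> carrier_mat (Suc n) (Suc n)" by (simp add: kernel_matrix_def n_def)
  have cU: "U \<in> carrier_mat (Suc n) (Suc n)" by (simp add: U_def)
  have detU: "Determinant.det U = 1"
  proof -
    have "Determinant.det U = prod_list (diag_mat U)"
      by (rule det_upper_triangular[OF _ cU]) (auto simp: upper_triangular_def U_def)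
    also have "diag_mat U = replicate (Suc n) 1"
      by (intro nth_equalityI) (auto simp: diag_mat_def U_def simp del: replicate_Suc upt_Suc)
    finally show ?thesis by simp
  qed
  define B where "B = four_block_mat (kernel_matrix K X) (0\<^sub>m n 1)
     (mat 1 n (\<lambda>(i, j). K x (X ! j))) (mat 1 1 (\<lambda>(i, j). cond_var K X x))"
  have "?A * U = B"
  proof (rule eq_matI)
    fix i j assume ij: "i < dim_row B" "j < dim_col B"
    then have i: "i < Suc n" and j: "j < Suc n" by (auto simp: B_def kernel_matrix_def n_def)
    let ?z = "(X @ [x]) ! i"
    have zi: "?z = (if i = n then x else X ! i)" using i by (auto simp: nth_append n_def)
    have "(?A * U) $$ (i, j) = (\<Sum>k = 0..<Suc n. ?A $$ (i, k) * U $$ (k, j))"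
      using i j cA cU by (simp add: scalar_prod_def)
    also have "\<dots> = (\<Sum>k = 0..<n. K ?z (X ! k) * U $$ (k, j)) + K ?z x * U $$ (n, j)"
      using i by (simp add: kernel_matrix_def n_def nth_append)
    also have "\<dots> = (if j = n then K ?z x - (\<Sum>y\<in>set X. K ?z y * w y) else K ?z (X ! j))"
    proof (cases "j = n")
      case True
      have "(\<Sum>k = 0..<n. K ?z (X ! k) * U $$ (k, j)) = (\<Sum>k = 0..<n. - (K ?z (X ! k) * w (X ! k)))"
        using True by (intro sum.cong) (auto simp: U_def)
      also have "\<dots> = - (\<Sum>y\<in>set X. K ?z y * w y)"
        by (simp add: sum_negf swx[of "\<lambda>y. K ?z y * w y"])
      finally show ?thesis using True by (simp add: U_def)
    next
      case False
      then have jn: "j < n" using j by simp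
      have "(\<Sum>k = 0..<n. K ?z (X ! k) * U $$ (k, j)) = (\<Sum>k = 0..<n. if k = j then K ?z (X ! k) else 0)"
        using jn by (intro sum.cong) (auto simp: U_def)
      then show ?thesis using False jn by (simp add: U_def)
    qed
    also have "\<dots> = B $$ (i, j)"
    proof -
      have "K (X ! i) x - (\<Sum>y\<in>set X. K (X ! i) y * w y) = 0" if "i < n"
        using w(2)[of "X ! i"] that sym[of x "X ! i"] by (simp add: n_def)
      then show ?thesis
        using i j by (auto simp: B_def zi V kernel_matrix_def n_def)
    qed
    finally show "(?A * U) $$ (i, j) = B $$ (i, j)" .
  qed (use cA cU in \<open>auto simp: B_def kernel_matrix_def n_def\<close>)
  then have "Determinant.det ?A * Determinant.det U = Determinant.det B"
    using det_mult[OF cA cU] by simp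
  also have "Determinant.det B = Determinant.det (kernel_matrix K X) * cond_var K X x"
    unfolding B_def n_def
    by (subst det_four_block_mat_upper_right_zero_col) (auto simp: det_single)
  finally show ?thesis using detU by simp
qed

text \<open>Rows and columns are permuted simultaneously, so the two signs cancel. Any point may
  thus be treated as the last one in \<open>det_kernel_matrix_snoc\<close>.\<close>

lemma det_kernel_matrix_perm:
  assumes "mset X = mset Y"
  shows "Determinant.det (kernel_matrix K X) = Determinant.det (kernel_matrix K Y)"
proof -
  let ?n = "length Y"
  obtain p where p: "p permutes {..<?n}" "permute_list p Y = X"
    using mset_eq_permutation[OF assms] by metis
  have len: "length X = ?n" using p(2) by (metis length_permute_list)
  have p0: "p permutes {0..<?n}" using p(1) by (simp add: lessThan_atLeast0)
  define A where "A = kernel_matrix K Y"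
  define B where "B = Matrix.mat ?n ?n (\<lambda>(i, j). A $$ (p i, j))"
  have cA: "A \<in> carrier_mat ?n ?n" by (simp add: A_def)
  have cB: "B \<in> carrier_mat ?n ?n" by (simp add: B_def)
  have pl: "p i < ?n" if "i < ?n" for i using permutes_in_image[OF p(1), of i] that by simp
  have nth: "X ! i = Y ! p i" if "i < ?n" for i
    using p that by (metis permute_list_nth)
  have "kernel_matrix K X = transpose_mat (Matrix.mat ?n ?n (\<lambda>(i, j). transpose_mat B $$ (p i, j)))"
    by (rule eq_matI) (auto simp: kernel_matrix_def len B_def A_def pl nth)
  then have "Determinant.det (kernel_matrix K X) = Determinant.det (Matrix.mat ?n ?n (\<lambda>(i, j). transpose_mat B $$ (p i, j)))"
    by (simp add: det_transpose[of _ ?n])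
  also have "\<dots> = signof p * Determinant.det (transpose_mat B)"
    by (rule det_permute_rows[OF _ p0]) (use cB in auto)
  also have "Determinant.det (transpose_mat B) = Determinant.det B" by (rule det_transpose[OF cB])
  also have "Determinant.det B = signof p * Determinant.det A"
    unfolding B_def by (rule det_permute_rows[OF cA p0])
  finally have "Determinant.det (kernel_matrix K X) = (signof p * signof p) * Determinant.det A"
    by simp
  also have "(signof p * signof p :: real) = 1" by (simp add: sign_def)
  finally show ?thesis by (simp add: A_def)
qed

section \<open>Matern kernels as Gaussian mixtures\<close>

lemma set_integrable_gamma_kernel:
  fixes \<alpha> c :: real
  assumes "0 < \<alpha>" "0 < c"
  shows "set_integrable lborel {0<..} (\<lambda>t. t powr (\<alpha> - 1) * exp (- c * t))"
    and "(LBINT t:{0<..}. t powr (\<alpha> - 1) * exp (- c * t)) = Gamma \<alpha> * c powr (- \<alpha>)"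
proof -
  let ?f = "\<lambda>t. indicator {0<..} t *\<^sub>R (t powr (\<alpha> - 1) * exp (- c * t))"
  have "(\<integral>\<^sup>+t. ennreal (?f t) \<partial>lborel) = (1 / c) * (\<integral>\<^sup>+t. ennreal (?f (0 + (1 / c) * t)) \<partial>lborel)"
    using nn_integral_real_affine[of "\<lambda>t. ennreal (?f t)" "1 / c" 0] assms
    by (simp add: ennreal_mult')
  also have "(\<integral>\<^sup>+t. ennreal (?f (0 + (1 / c) * t)) \<partial>lborel)
     = (\<integral>\<^sup>+t. ennreal (c powr (1 - \<alpha>)) * ennreal (indicator {0..} t * t powr (\<alpha> - 1) / exp t) \<partial>lborel)"
  proof (intro nn_integral_cong)
    fix t :: real
    have "c powr (1 - \<alpha>) = 1 / c powr (\<alpha> - 1)" by (simp add: powr_minus[symmetric] inverse_eq_divide[symmetric])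
    then show "ennreal (?f (0 + (1 / c) * t)) = ennreal (c powr (1 - \<alpha>)) * ennreal (indicator {0..} t * t powr (\<alpha> - 1) / exp t)"
      using assms by (cases "t > 0"; cases "t = 0")
        (auto simp: ennreal_mult'[symmetric] powr_divide exp_minus field_simps indicator_def)
  qed
  also have "\<dots> = ennreal (c powr (1 - \<alpha>)) * ennreal (Gamma \<alpha>)"
    by (subst nn_integral_cmult) (simp_all add: Gamma_conv_nn_integral_real[OF assms(1)])
  also have "ennreal (1 / c) * (ennreal (c powr (1 - \<alpha>)) * ennreal (Gamma \<alpha>)) = ennreal (Gamma \<alpha> * c powr (- \<alpha>))"
    using assms by (simp add: ennreal_mult'[symmetric] powr_diff powr_minus field_simps)
  finally have nn: "(\<integral>\<^sup>+t. ennreal (?f t) \<partial>lborel) = ennreal (Gamma \<alpha> * c powr (- \<alpha>))" .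
  have hb: "has_bochner_integral lborel ?f (Gamma \<alpha> * c powr (- \<alpha>))"
    by (rule has_bochner_integral_nn_integral[OF _ _ _ nn]) (use assms in \<open>auto simp: Gamma_real_pos less_imp_le\<close>)
  show "set_integrable lborel {0<..} (\<lambda>t. t powr (\<alpha> - 1) * exp (- c * t))"
    "(LBINT t:{0<..}. t powr (\<alpha> - 1) * exp (- c * t)) = Gamma \<alpha> * c powr (- \<alpha>)"
    using hb by (auto simp: set_integrable_def set_lebesgue_integral_def has_bochner_integral_iff)
qed

text \<open>Gaussian mixture with respect to a Gamma density; after multiplication by a constant
  this is the Matern kernel as a function of the distance \<open>r\<close>.\<close>

definition gauss_mix :: "real \<Rightarrow> real \<Rightarrow> real \<Rightarrow> real" where
  "gauss_mix \<nu> \<kappa> r = (LBINT t:{0<..}. t powr (\<nu> - 1) * exp (- \<kappa> * t) * exp (- r\<^sup>2 / (4 * t)))"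

lemma set_integrable_gauss_mix:
  fixes \<nu> \<kappa> r :: real
  assumes "0 < \<nu>" "0 < \<kappa>"
  shows "set_integrable lborel {0<..} (\<lambda>t. t powr (\<nu> - 1) * exp (- \<kappa> * t) * exp (- r\<^sup>2 / (4 * t)))"
  unfolding set_integrable_def
proof (rule Bochner_Integration.integrable_bound)
  show "integrable lborel (\<lambda>t. indicator {0<..} t *\<^sub>R (t powr (\<nu> - 1) * exp (- \<kappa> * t)))"
    using set_integrable_gamma_kernel(1)[OF assms] by (simp add: set_integrable_def)
  show "AE t in lborel. norm (indicator {0<..} t *\<^sub>R (t powr (\<nu> - 1) * exp (- \<kappa> * t) * exp (- r\<^sup>2 / (4 * t))))
      \<le> norm (indicator {0<..} t *\<^sub>R (t powr (\<nu> - 1) * exp (- \<kappa> * t)))"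
    by (intro AE_I2) (auto simp: indicator_def abs_mult mult_le_cancel_left1)
qed measurable

text \<open>The change of variables below concerns Lebesgue integrability, while
  \<open>bessel_K\<close> is defined with \<open>lborel\<close>; for Borel functions and sets the
  two notions agree.\<close>

lemma absolutely_integrable_on_lborel:
  fixes f :: "'a::euclidean_space \<Rightarrow> real"
  assumes "f \<in> borel_measurable borel" "S \<in> sets borel"
  shows "f absolutely_integrable_on S \<longleftrightarrow> set_integrable lborel S f"
  unfolding set_integrable_def
  by (rule integrable_completion) (use assms in measurable)

text \<open>Substitute s = (z/2) e^t, which maps the line onto the half-line: s + z^2/(4 s) becomes
  z cosh t, and s^(\<nu> - 1) ds becomes (z/2)^\<nu> e^(\<nu> t) dt. Folding the line at 0 turns
  e^(\<nu> t) into 2 cosh (\<nu> t), as in the integrand of \<open>bessel_K\<close>.\<close>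

lemma bessel_K_mixture:
  assumes z: "0 < z" and \<nu>: "0 < \<nu>"
  shows "z powr \<nu> * bessel_K \<nu> z
    = 2 powr (\<nu> - 1) * (LBINT s:{0<..}. s powr (\<nu> - 1) * exp (- s) * exp (- z\<^sup>2 / (4 * s)))"
proof -
  define f where "f s = s powr (\<nu> - 1) * exp (- s) * exp (- z\<^sup>2 / (4 * s))" for s
  define h where "h t = exp (- z * cosh t + \<nu> * t)" for t
  have fm: "f \<in> borel_measurable borel" unfolding f_def by measurable
  have hm: "h \<in> borel_measurable borel"
    unfolding h_def by (intro borel_measurable_continuous_onI continuous_intros)
  have intf: "set_integrable lborel {0<..} f"
    using set_integrable_gauss_mix[OF \<nu>, of 1 z] by (simp add: f_def[abs_def])
  have im: "(\<lambda>t. z / 2 * exp t) ` UNIV = {0<..}"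
  proof -
    have "y \<in> (\<lambda>t. z / 2 * exp t) ` UNIV" if "0 < y" for y
      using that z by (intro image_eqI[of _ _ "ln (2 * y / z)"]) (auto simp: exp_ln)
    then show ?thesis using z by auto
  qed
  have gf: "\<bar>z / 2 * exp t\<bar> * f (z / 2 * exp t) = (z / 2) powr \<nu> * h t" for t
  proof -
    have p: "0 < z / 2 * exp t" using z by simp
    have "z / 2 * exp t * (z / 2 * exp t) powr (\<nu> - 1) = (z / 2 * exp t) powr \<nu>"
      using p by (metis powr_mult_base add.commute diff_add_cancel less_imp_le)
    also have "\<dots> = (z / 2) powr \<nu> * exp (\<nu> * t)"
      using z by (subst powr_mult) (auto simp: powr_def)
    finally have 1: "z / 2 * exp t * (z / 2 * exp t) powr (\<nu> - 1) = (z / 2) powr \<nu> * exp (\<nu> * t)" .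
    have "z\<^sup>2 / (4 * (z / 2 * exp t)) = z / 2 * exp (- t)"
      using z by (simp add: power2_eq_square exp_minus field_simps)
    then have 2: "exp (- (z / 2 * exp t)) * exp (- z\<^sup>2 / (4 * (z / 2 * exp t))) = exp (- z * cosh t)"
      by (simp add: exp_add[symmetric] cosh_def algebra_simps)
    have "\<bar>g\<bar> * f g = (g * g powr (\<nu> - 1)) * (exp (- g) * exp (- z\<^sup>2 / (4 * g)))" if "0 < g" for g
      using that by (simp add: f_def)
    from this[OF p] show ?thesis unfolding 1 2 h_def by (simp add: exp_add[symmetric])
  qed
  have "f absolutely_integrable_on ((\<lambda>t. z / 2 * exp t) ` UNIV) \<and> integral ((\<lambda>t. z / 2 * exp t) ` UNIV) f = (LBINT s:{0<..}. f s)"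
    using intf fm unfolding im
    by (auto simp: absolutely_integrable_on_lborel set_borel_integral_eq_integral)
  then have "(\<lambda>t. \<bar>z / 2 * exp t\<bar> * f (z / 2 * exp t)) absolutely_integrable_on UNIV \<and>
      integral UNIV (\<lambda>t. \<bar>z / 2 * exp t\<bar> * f (z / 2 * exp t)) = (LBINT s:{0<..}. f s)"
    by (subst has_absolute_integral_change_of_variables_1'[of UNIV "\<lambda>t. z / 2 * exp t"])
       (use z in \<open>auto intro!: derivative_eq_intros injI\<close>)
  then have "(\<lambda>t. (z / 2) powr \<nu> * h t) absolutely_integrable_on UNIV"
    and e1: "integral UNIV (\<lambda>t. (z / 2) powr \<nu> * h t) = (LBINT s:{0<..}. f s)"
    unfolding gf by auto
  then have ih: "set_integrable lborel UNIV (\<lambda>t. (z / 2) powr \<nu> * h t)"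
    using hm by (subst (asm) absolutely_integrable_on_lborel) auto
  have ih': "integrable lborel h"
    using ih z by (simp add: set_integrable_def)
  have e2: "(z / 2) powr \<nu> * integral\<^sup>L lborel h = (LBINT s:{0<..}. f s)"
    using set_borel_integral_eq_integral(2)[OF ih] e1 z by (auto simp: set_lebesgue_integral_def)
  have hs: "set_integrable lborel {0..} h" "set_integrable lborel {..0} h"
    using ih' unfolding set_integrable_def by (auto intro!: integrable_mult_indicator simp del: real_scaleR_def)
  have hr: "set_integrable lborel {0..} (\<lambda>t. h (- t))"
  proof -
    have "integrable lborel (\<lambda>t. h (- t))"
      using lborel_integrable_real_affine[OF ih', of "-1" 0] by simp
    then show ?thesis unfolding set_integrable_def by (auto intro!: integrable_mult_indicator simp del: real_scaleR_def)
  qed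
  have U: "{0..} \<union> {..<0} = (UNIV :: real set)" by auto
  have "integral\<^sup>L lborel h = (LBINT t:{0..} \<union> {..<0}. h t)"
    by (simp add: set_lebesgue_integral_def U)
  also have "\<dots> = (LBINT t:{0..}. h t) + (LBINT t:{..<0}. h t)"
    by (rule set_integral_Un) (use ih' in \<open>auto simp: set_integrable_def intro!: integrable_mult_indicator simp del: real_scaleR_def\<close>)
  also have "(LBINT t:{..<0}. h t) = (LBINT t:{0<..}. h (- t))"
    by (subst set_integral_reflect) (auto intro!: arg_cong2[where f="set_lebesgue_integral lborel"])
  also have "\<dots> = (LBINT t:{0..}. h (- t))"
    unfolding set_lebesgue_integral_def
    by (rule integral_discrete_difference[where X="{0}"]) (auto simp: indicator_def)
  also have "(LBINT t:{0..}. h t) + (LBINT t:{0..}. h (- t)) = (LBINT t:{0..}. h t + h (- t))"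
    by (rule set_integral_add(2)[symmetric]) (use hs hr in auto)
  also have "\<dots> = (LBINT t:{0..}. 2 * (exp (- z * cosh t) * cosh (\<nu> * t)))"
  proof -
    have "h t + h (- t) = 2 * (exp (- z * cosh t) * cosh (\<nu> * t))" for t
    proof -
      have "2 * cosh (\<nu> * t) = exp (\<nu> * t) + exp (\<nu> * - t)" by (simp add: cosh_def)
      then have "exp (- z * cosh t) * (2 * cosh (\<nu> * t)) = exp (- z * cosh t) * exp (\<nu> * t) + exp (- z * cosh t) * exp (\<nu> * - t)"
        by (simp only: distrib_left)
      then show ?thesis unfolding h_def by (simp only: exp_add cosh_minus)
    qed
    then show ?thesis by simp
  qed
  also have "\<dots> = 2 * bessel_K \<nu> z" unfolding bessel_K_def by simp
  finally have e3: "integral\<^sup>L lborel h = 2 * bessel_K \<nu> z" .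
  have "z powr \<nu> * bessel_K \<nu> z = 2 powr (\<nu> - 1) * ((z / 2) powr \<nu> * (2 * bessel_K \<nu> z))"
    using z by (simp add: powr_divide powr_diff)
  also have "\<dots> = 2 powr (\<nu> - 1) * (LBINT s:{0<..}. f s)" using e2 e3 by simp
  finally show ?thesis by (simp add: f_def)
qed

lemma dominated_convergence_within:
  fixes f :: "real \<Rightarrow> 'a \<Rightarrow> 'b::{banach, second_countable_topology}"
  assumes [measurable]: "g \<in> borel_measurable M" "\<And>s. s \<in> S - {a} \<Longrightarrow> f s \<in> borel_measurable M"
    and w: "integrable M w"
    and lim: "AE x in M. ((\<lambda>s. f s x) \<longlongrightarrow> g x) (at a within S)"
    and bound: "\<And>s. s \<in> S - {a} \<Longrightarrow> AE x in M. norm (f s x) \<le> w x"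
  shows "((\<lambda>s. integral\<^sup>L M (f s)) \<longlongrightarrow> integral\<^sup>L M g) (at a within S)"
  unfolding tendsto_at_iff_sequentially comp_def
proof (intro allI impI)
  fix X :: "nat \<Rightarrow> real" assume X: "\<forall>i. X i \<in> S - {a}" "X \<longlonglongrightarrow> a"
  show "(\<lambda>i. integral\<^sup>L M (f (X i))) \<longlonglongrightarrow> integral\<^sup>L M g"
  proof (rule integral_dominated_convergence[OF _ _ w])
    show "AE x in M. (\<lambda>i. f (X i) x) \<longlonglongrightarrow> g x"
      using lim by eventually_elim (use X in \<open>auto simp: tendsto_at_iff_sequentially comp_def\<close>)
  qed (use X bound assms(2) in auto)
qed

lemma gauss_mix_tendsto_0:
  assumes \<nu>: "0 < \<nu>" and \<kappa>: "0 < \<kappa>"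
  shows "(gauss_mix \<nu> \<kappa> \<longlongrightarrow> gauss_mix \<nu> \<kappa> 0) (at_right 0)"
  unfolding gauss_mix_def set_lebesgue_integral_def
proof (rule dominated_convergence_within)
  show "integrable lborel (\<lambda>t. indicator {0<..} t *\<^sub>R (t powr (\<nu> - 1) * exp (- \<kappa> * t)))"
    using set_integrable_gamma_kernel(1)[OF assms] by (simp add: set_integrable_def)
  show "AE t in lborel. ((\<lambda>r. indicator {0<..} t *\<^sub>R (t powr (\<nu> - 1) * exp (- \<kappa> * t) * exp (- r\<^sup>2 / (4 * t))))
      \<longlongrightarrow> indicator {0<..} t *\<^sub>R (t powr (\<nu> - 1) * exp (- \<kappa> * t) * exp (- 0\<^sup>2 / (4 * t)))) (at_right 0)"
  proof (intro AE_I2)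
    fix t :: real
    show "((\<lambda>r. indicator {0<..} t *\<^sub>R (t powr (\<nu> - 1) * exp (- \<kappa> * t) * exp (- r\<^sup>2 / (4 * t))))
      \<longlongrightarrow> indicator {0<..} t *\<^sub>R (t powr (\<nu> - 1) * exp (- \<kappa> * t) * exp (- 0\<^sup>2 / (4 * t)))) (at_right 0)"
    proof (cases "t > 0")
      case True
      then have "((\<lambda>r. - r\<^sup>2 / (4 * t)) \<longlongrightarrow> - 0\<^sup>2 / (4 * t)) (at_right 0)"
        by (intro tendsto_intros) auto
      then show ?thesis by (intro tendsto_mult[OF tendsto_const] tendsto_exp tendsto_scaleR[OF tendsto_const])
    qed simp
  qed
  show "AE t in lborel. norm (indicator {0<..} t *\<^sub>R (t powr (\<nu> - 1) * exp (- \<kappa> * t) * exp (- r\<^sup>2 / (4 * t))))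
      \<le> indicator {0<..} t *\<^sub>R (t powr (\<nu> - 1) * exp (- \<kappa> * t))" for r
    by (intro AE_I2) (auto simp: indicator_def abs_mult mult_le_cancel_left1)
qed measurable

lemma matern_profile_mixture:
  assumes r: "0 \<le> r" and \<nu>: "0 < \<nu>"
  shows "matern_profile \<nu> r = 2 powr (\<nu> - 1) * gauss_mix \<nu> 1 r"
proof (cases "r = 0")
  case False
  then show ?thesis using bessel_K_mixture[of r \<nu>] assms
    by (simp add: matern_profile_def gauss_mix_def)
next
  case True
  \<comment> \<open>The value at 0 is a one-sided \<open>Lim\<close>; it is identified by the right
    continuity of the mixture at 0.\<close>
  have "((\<lambda>s. 2 powr (\<nu> - 1) * gauss_mix \<nu> 1 s) \<longlongrightarrow> 2 powr (\<nu> - 1) * gauss_mix \<nu> 1 0) (at_right 0)"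
    by (intro tendsto_intros gauss_mix_tendsto_0 \<nu>) simp
  moreover have "\<forall>\<^sub>F s in at_right 0. 2 powr (\<nu> - 1) * gauss_mix \<nu> 1 s = s powr \<nu> * bessel_K \<nu> s"
    using bessel_K_mixture \<nu> by (auto simp: eventually_at_right_field gauss_mix_def intro!: exI[of _ 1])
  ultimately have "((\<lambda>s. s powr \<nu> * bessel_K \<nu> s) \<longlongrightarrow> 2 powr (\<nu> - 1) * gauss_mix \<nu> 1 0) (at_right 0)"
    by (rule Lim_transform_eventually)
  then have "Lim (at_right 0) (\<lambda>s. s powr \<nu> * bessel_K \<nu> s) = 2 powr (\<nu> - 1) * gauss_mix \<nu> 1 0"
    by (intro tendsto_Lim) auto
  then show ?thesis using True by (simp add: matern_profile_def)
qed

text \<open>The substitution s = \<kappa> t moves the scaling of the distance into the rate of the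
  Gamma weight. All Matern kernels thereby become mixtures of the same Gaussians and differ only in
  the weight, so bounds for Gaussian forms at fixed t serve every \<nu>.\<close>

lemma gauss_mix_rescale:
  assumes \<kappa>: "0 < \<kappa>"
  shows "gauss_mix \<nu> 1 (sqrt \<kappa> * r) = \<kappa> powr \<nu> * gauss_mix \<nu> \<kappa> r"
proof -
  let ?f = "\<lambda>s. indicator {0<..} s *\<^sub>R (s powr (\<nu> - 1) * exp (- 1 * s) * exp (- (sqrt \<kappa> * r)\<^sup>2 / (4 * s)))"
  have e: "?f (0 + \<kappa> * t) = \<kappa> powr (\<nu> - 1) * (indicator {0<..} t *\<^sub>R (t powr (\<nu> - 1) * exp (- \<kappa> * t) * exp (- r\<^sup>2 / (4 * t))))" for t
  proof (cases "t > 0")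
    case True
    have "(sqrt \<kappa> * r)\<^sup>2 / (4 * (\<kappa> * t)) = r\<^sup>2 / (4 * t)" using \<kappa> True by (simp add: power_mult_distrib)
    then show ?thesis using True \<kappa> by (simp add: powr_mult)
  next
    case False
    then have "\<not> 0 < \<kappa> * t" using \<kappa> by (simp add: zero_less_mult_iff)
    then show ?thesis using False by simp
  qed
  have "gauss_mix \<nu> 1 (sqrt \<kappa> * r) = integral\<^sup>L lborel ?f"
    by (simp add: gauss_mix_def set_lebesgue_integral_def)
  also have "\<dots> = \<bar>\<kappa>\<bar> *\<^sub>R integral\<^sup>L lborel (\<lambda>t. ?f (0 + \<kappa> * t))"
    by (rule lborel_integral_real_affine) (use \<kappa> in simp)
  also have "\<dots> = \<kappa> * (\<kappa> powr (\<nu> - 1) * gauss_mix \<nu> \<kappa> r)"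
    unfolding e using \<kappa> by (simp add: gauss_mix_def set_lebesgue_integral_def)
  also have "\<dots> = \<kappa> powr \<nu> * gauss_mix \<nu> \<kappa> r"
    using \<kappa> by (simp add: powr_diff)
  finally show ?thesis .
qed

lemma matern_mixture:
  assumes "0 < lam" "0 < \<nu>"
  shows "matern \<sigma> lam c \<nu> x y
    = \<sigma>\<^sup>2 * c \<nu> * 2 powr (\<nu> - 1) * (2 * \<nu> / lam\<^sup>2) powr \<nu> * gauss_mix \<nu> (2 * \<nu> / lam\<^sup>2) (norm (x - y))"
proof -
  have "sqrt (2 * \<nu>) * norm (x - y) / lam = sqrt (2 * \<nu> / lam\<^sup>2) * norm (x - y)"
    using assms by (simp add: real_sqrt_divide)
  then show ?thesis
    unfolding matern_def using assms
    by (simp add: matern_profile_mixture gauss_mix_rescale)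
qed

section \<open>Gaussian kernels\<close>

definition gauss :: "real \<Rightarrow> 'a::real_normed_vector \<Rightarrow> 'a \<Rightarrow> real" where
  "gauss t x y = exp (- (norm (x - y))\<^sup>2 / (4 * t))"

text \<open>Up to the sign of \<xi>, the Fourier transform of the measure with mass u x at each x in
  A.\<close>

definition expsum :: "'a::real_inner set \<Rightarrow> ('a \<Rightarrow> real) \<Rightarrow> 'a \<Rightarrow> complex" where
  "expsum A u \<xi> = (\<Sum>x\<in>A. complex_of_real (u x) * cis (x \<bullet> \<xi>))"

lemma
  fixes f :: "'a::euclidean_space \<Rightarrow> real \<Rightarrow> complex"
  assumes int: "\<And>b. b \<in> Basis \<Longrightarrow> integrable lborel (f b)"
  shows integrable_lborel_prod: "integrable lborel (\<lambda>x::'a. \<Prod>b\<in>Basis. f b (x \<bullet> b))"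
    and integral_lborel_prod: "(\<integral>x. (\<Prod>b\<in>Basis. f b ((x::'a) \<bullet> b)) \<partial>lborel) = (\<Prod>b\<in>Basis. \<integral>s. f b s \<partial>lborel)"
proof -
  interpret product_sigma_finite "\<lambda>_::'a. lborel :: real measure" by standard
  let ?T = "\<lambda>g::'a \<Rightarrow> real. \<Sum>b\<in>Basis. g b *\<^sub>R b"
  let ?F = "\<lambda>x::'a. \<Prod>b\<in>Basis. f b (x \<bullet> b)"
  have m: "f b \<in> borel_measurable borel" if "b \<in> Basis" for b
    using borel_measurable_integrable[OF int[OF that]] by simp
  have F: "?F \<in> borel_measurable borel"
    by (intro borel_measurable_prod measurable_compose[OF _ m]) auto
  have T: "?T \<in> measurable (\<Pi>\<^sub>M b\<in>Basis. lborel) borel" by measurable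
  have FT: "?F (?T g) = (\<Prod>b\<in>Basis. f b (g b))" for g
    by (intro prod.cong refl) (simp add: inner_sum_left_Basis)
  show "integrable lborel ?F"
    by (subst lborel_eq, subst integrable_distr_eq[OF T F], unfold FT)
       (rule product_integrable_prod[OF finite_Basis int])
  show "integral\<^sup>L lborel ?F = (\<Prod>b\<in>Basis. \<integral>s. f b s \<partial>lborel)"
    by (subst lborel_eq, subst integral_distr[OF T F], unfold FT)
       (rule product_integral_prod[OF finite_Basis int])
qed

text \<open>The characteristic function of the standard normal distribution, rescaled by sqrt (2 t);
  the frequency becomes v / sqrt (2 t).\<close>

lemma gauss_fourier_real:
  fixes t v :: real assumes t: "0 < t"
  shows "has_bochner_integral lborel (\<lambda>s. cis (v * s) * complex_of_real (exp (- t * s\<^sup>2)))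
    (complex_of_real (sqrt (pi / t) * exp (- v\<^sup>2 / (4 * t))))"
proof -
  let ?w = "v / sqrt (2 * t)"
  let ?F = "\<lambda>x. std_normal_density x *\<^sub>R iexp (?w * x)"
  have iF: "integrable lborel ?F"
    by (rule Bochner_Integration.integrable_bound[OF integrable_normal_density[of 1 0]])
       (auto simp: norm_mult)
  have vF: "integral\<^sup>L lborel ?F = complex_of_real (exp (- ?w\<^sup>2 / 2))"
    using fun_cong[OF char_std_normal_distribution, of ?w] unfolding char_def
    by (subst (asm) integral_density) auto
  have c: "sqrt (2 * t) \<noteq> 0" using t by simp
  have G: "?F (0 + sqrt (2 * t) * s) = complex_of_real (1 / sqrt (2 * pi)) * (cis (v * s) * complex_of_real (exp (- t * s\<^sup>2)))" for s
  proof -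
    have "?w * (sqrt (2 * t) * s) = v * s" using t by simp
    moreover have "(sqrt (2 * t) * s)\<^sup>2 / 2 = t * s\<^sup>2" using t by (simp add: power_mult_distrib)
    ultimately show ?thesis
      by (simp add: std_normal_density_def cis_conv_exp scaleR_conv_of_real mult_ac)
  qed
  have "integrable lborel (\<lambda>s. ?F (0 + sqrt (2 * t) * s))"
    by (rule lborel_integrable_real_affine[OF iF c])
  then have "integrable lborel (\<lambda>s. complex_of_real (sqrt (2 * pi)) * (complex_of_real (1 / sqrt (2 * pi)) * (cis (v * s) * complex_of_real (exp (- t * s\<^sup>2)))))"
    unfolding G by (rule integrable_mult_right)
  moreover have "complex_of_real (sqrt (2 * pi)) * (complex_of_real (1 / sqrt (2 * pi)) * X) = X" for X
    by (simp add: mult.assoc[symmetric] flip: of_real_mult)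
  ultimately have i: "integrable lborel (\<lambda>s. cis (v * s) * complex_of_real (exp (- t * s\<^sup>2)))"
    by simp
  have "complex_of_real (exp (- ?w\<^sup>2 / 2)) = \<bar>sqrt (2 * t)\<bar> *\<^sub>R integral\<^sup>L lborel (\<lambda>s. ?F (0 + sqrt (2 * t) * s))"
    unfolding vF[symmetric] by (rule lborel_integral_real_affine[OF c])
  also have "\<dots> = complex_of_real (sqrt (2 * t) / sqrt (2 * pi)) * integral\<^sup>L lborel (\<lambda>s. cis (v * s) * complex_of_real (exp (- t * s\<^sup>2)))"
    unfolding G integral_mult_right_zero using t by (simp add: scaleR_conv_of_real)
  also have "sqrt (2 * t) / sqrt (2 * pi) = 1 / sqrt (pi / t)"
    using t by (simp add: real_sqrt_divide real_sqrt_mult)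
  finally have "integral\<^sup>L lborel (\<lambda>s. cis (v * s) * complex_of_real (exp (- t * s\<^sup>2)))
      = complex_of_real (sqrt (pi / t)) * complex_of_real (exp (- ?w\<^sup>2 / 2))"
    using t by (simp add: field_simps)
  also have "- ?w\<^sup>2 / 2 = - v\<^sup>2 / (4 * t)" using t by (simp add: power_divide)
  finally show ?thesis using i by (simp add: has_bochner_integral_iff)
qed

lemma gauss_fourier:
  fixes v :: "'a::euclidean_space" assumes t: "0 < t"
  shows "has_bochner_integral lborel (\<lambda>\<xi>::'a. cis (v \<bullet> \<xi>) * complex_of_real (exp (- t * (norm \<xi>)\<^sup>2)))
    (complex_of_real (sqrt (pi / t) ^ DIM('a) * exp (- (norm v)\<^sup>2 / (4 * t))))"
proof -
  have ns: "(norm \<xi>)\<^sup>2 = (\<Sum>b\<in>Basis. (\<xi> \<bullet> b)\<^sup>2)" for \<xi> :: 'a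
    unfolding power2_norm_eq_inner by (subst euclidean_inner) (simp add: power2_eq_square)
  have cs: "cis (\<Sum>b\<in>B. g b) = (\<Prod>b\<in>B. cis (g b))" if "finite B" for g and B :: "'a set"
    using that by (induction B rule: finite_induct) (auto simp: cis_mult[symmetric])
  let ?f = "\<lambda>b s. cis ((v \<bullet> b) * s) * complex_of_real (exp (- t * s\<^sup>2))"
  have e: "(\<Prod>b\<in>Basis. ?f b (\<xi> \<bullet> b)) = cis (v \<bullet> \<xi>) * complex_of_real (exp (- t * (norm \<xi>)\<^sup>2))" for \<xi>
    by (subst euclidean_inner[of v \<xi>])
       (simp add: prod.distrib cs ns exp_sum[symmetric] sum_distrib_left sum_negf flip: of_real_prod)
  note h = gauss_fourier_real[OF t, unfolded has_bochner_integral_iff]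
  have "(\<Prod>b\<in>(Basis::'a set). \<integral>s. ?f b s \<partial>lborel) = (\<Prod>b\<in>(Basis::'a set). complex_of_real (sqrt (pi / t) * exp (- (v \<bullet> b)\<^sup>2 / (4 * t))))"
    using h by (intro prod.cong) auto
  also have "\<dots> = complex_of_real (sqrt (pi / t) ^ DIM('a) * exp (- (norm v)\<^sup>2 / (4 * t)))"
    by (simp add: prod.distrib ns exp_sum[symmetric] sum_divide_distrib sum_negf flip: of_real_prod)
  finally show ?thesis
    using integrable_lborel_prod[of ?f] integral_lborel_prod[of ?f] h
    unfolding e has_bochner_integral_iff by auto
qed

lemma expsum_cmod_square:
  "complex_of_real ((cmod (expsum A u \<xi>))\<^sup>2)
    = (\<Sum>x\<in>A. \<Sum>y\<in>A. complex_of_real (u x * u y) * cis ((x - y) \<bullet> \<xi>))"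
proof -
  have "complex_of_real ((cmod (expsum A u \<xi>))\<^sup>2) = expsum A u \<xi> * cnj (expsum A u \<xi>)"
    by (rule complex_norm_square)
  also have "\<dots> = (\<Sum>x\<in>A. \<Sum>y\<in>A. (complex_of_real (u x) * cis (x \<bullet> \<xi>)) * (complex_of_real (u y) * cis (- (y \<bullet> \<xi>))))"
    by (simp add: expsum_def sum_product cis_cnj)
  also have "\<dots> = (\<Sum>x\<in>A. \<Sum>y\<in>A. complex_of_real (u x * u y) * cis ((x - y) \<bullet> \<xi>))"
  proof -
    have "cis ((x - y) \<bullet> \<xi>) = cis (x \<bullet> \<xi>) * cis (- (y \<bullet> \<xi>))" for x y
      by (simp add: cis_mult inner_diff_left)
    then show ?thesis by (simp only: of_real_mult mult_ac)
  qed
  finally show ?thesis .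
qed

lemma expsum_measurable [measurable]: "expsum (A :: 'a::euclidean_space set) u \<in> borel_measurable borel"
  unfolding expsum_def[abs_def] cis_conv_exp by measurable

text \<open>Expanding the squared modulus gives one Gaussian Fourier integral per pair of points.
  The Gaussian form is thus the integral of a squared modulus against a positive weight, which gives
  its nonnegativity and, after mixing over t, the link to Sobolev norms.\<close>

lemma gauss_quad_fourier:
  fixes A :: "'a::euclidean_space set" assumes t: "0 < t"
  shows "has_bochner_integral lborel (\<lambda>\<xi>. (cmod (expsum A u \<xi>))\<^sup>2 * exp (- t * (norm \<xi>)\<^sup>2))
    (sqrt (pi / t) ^ DIM('a) * quad (gauss t) A u)"
proof -
  have "has_bochner_integral lborel
     (\<lambda>\<xi>. \<Sum>x\<in>A. \<Sum>y\<in>A. complex_of_real (u x * u y) * (cis ((x - y) \<bullet> \<xi>) * complex_of_real (exp (- t * (norm \<xi>)\<^sup>2))))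
     (\<Sum>x\<in>A. \<Sum>y\<in>A. complex_of_real (u x * u y) * complex_of_real (sqrt (pi / t) ^ DIM('a) * exp (- (norm (x - y))\<^sup>2 / (4 * t))))"
    by (intro has_bochner_integral_sum has_bochner_integral_mult_right gauss_fourier t)
  also have "(\<Sum>x\<in>A. \<Sum>y\<in>A. complex_of_real (u x * u y) * complex_of_real (sqrt (pi / t) ^ DIM('a) * exp (- (norm (x - y))\<^sup>2 / (4 * t))))
     = complex_of_real (sqrt (pi / t) ^ DIM('a) * quad (gauss t) A u)"
    by (simp add: quad_def gauss_def sum_distrib_left mult_ac)
  also have "(\<lambda>\<xi>. \<Sum>x\<in>A. \<Sum>y\<in>A. complex_of_real (u x * u y) * (cis ((x - y) \<bullet> \<xi>) * complex_of_real (exp (- t * (norm \<xi>)\<^sup>2))))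
     = (\<lambda>\<xi>. complex_of_real ((cmod (expsum A u \<xi>))\<^sup>2 * exp (- t * (norm \<xi>)\<^sup>2)))"
    unfolding of_real_mult expsum_cmod_square by (simp only: sum_distrib_right mult.assoc of_real_mult)
  finally show ?thesis by (simp only: has_bochner_integral_iff complex_of_real_integrable_eq integral_complex_of_real of_real_eq_iff)
qed

lemma quad_gauss_nonneg:
  fixes A :: "'a::euclidean_space set" assumes t: "0 < t"
  shows "0 \<le> quad (gauss t) A u"
proof -
  have "0 \<le> integral\<^sup>L lborel (\<lambda>\<xi>. (cmod (expsum A u \<xi>))\<^sup>2 * exp (- t * (norm \<xi>)\<^sup>2))"
    by (intro Bochner_Integration.integral_nonneg) auto
  then have "0 \<le> sqrt (pi / t) ^ DIM('a) * quad (gauss t) A u"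
    using gauss_quad_fourier[OF t, of A u] by (simp only: has_bochner_integral_iff)
  moreover have "0 < sqrt (pi / t) ^ DIM('a)" using t by simp
  ultimately show ?thesis by (simp add: zero_le_mult_iff)
qed

text \<open>For t up to q^2 / ln (2 n) an off-diagonal entry is at most exp (- ln (2 n)) = 1/(2 n),
  so every row sum off the diagonal is at most 1/2. The logarithm is the price of this crude count.
  As n only bounds the cardinality, one scale serves all subsets of n points.\<close>

lemma quad_gauss_near_diagonal:
  fixes A :: "'a::euclidean_space set"
  assumes fin: "finite A" and n: "card A \<le> n" "1 \<le> n" and q: "0 < q"
    and sep: "\<And>x y. x \<in> A \<Longrightarrow> y \<in> A \<Longrightarrow> x \<noteq> y \<Longrightarrow> 2 * q \<le> norm (x - y)"
    and t: "0 < t" "t \<le> q\<^sup>2 / ln (2 * real n)"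
  shows "\<bar>quad (gauss t) A u - (\<Sum>x\<in>A. (u x)\<^sup>2)\<bar> \<le> (\<Sum>x\<in>A. (u x)\<^sup>2) / 2"
proof -
  have ln: "0 < ln (2 * real n)" using n(2) by simp
  have off: "\<bar>gauss t x y - of_bool (x = y)\<bar> \<le> 1 / (2 * real n)" if "x \<in> A" "y \<in> A" for x y
  proof (cases "x = y")
    case False
    have "t * ln (2 * real n) \<le> q\<^sup>2" using t(2) ln by (simp add: pos_le_divide_eq)
    then have "ln (2 * real n) \<le> q\<^sup>2 / t" using t(1) by (simp add: pos_le_divide_eq mult.commute)
    also have "q\<^sup>2 / t = (2 * q)\<^sup>2 / (4 * t)" by (simp add: power_mult_distrib)
    also have "\<dots> \<le> (norm (x - y))\<^sup>2 / (4 * t)"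
      using sep[OF that False] q t by (intro divide_right_mono power_mono) auto
    finally have "gauss t x y \<le> exp (- ln (2 * real n))" by (simp add: gauss_def)
    also have "\<dots> = 1 / (2 * real n)" using n(2) by (simp add: exp_minus inverse_eq_divide)
    finally show ?thesis using False by (simp add: gauss_def)
  qed (simp add: gauss_def)
  have "quad (gauss t) A u - (\<Sum>x\<in>A. (u x)\<^sup>2) = (\<Sum>x\<in>A. \<Sum>y\<in>A. u x * u y * (gauss t x y - of_bool (x = y)))"
  proof -
    have "(\<Sum>x\<in>A. (u x)\<^sup>2) = (\<Sum>x\<in>A. \<Sum>y\<in>A. u x * u y * of_bool (x = y))"
      using fin by (intro sum.cong refl) (simp add: of_bool_def if_distrib power2_eq_square cong: if_cong)
    then show ?thesis by (simp add: quad_def right_diff_distrib sum_subtractf)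
  qed
  also have "\<bar>\<dots>\<bar> \<le> (\<Sum>x\<in>A. \<Sum>y\<in>A. ((u x)\<^sup>2 + (u y)\<^sup>2) / 2 * (1 / (2 * real n)))"
  proof (intro order_trans[OF sum_abs] sum_mono)
    fix x y assume xy: "x \<in> A" "y \<in> A"
    have "\<bar>u x * u y\<bar> \<le> ((u x)\<^sup>2 + (u y)\<^sup>2) / 2"
      using sum_squares_bound[of "\<bar>u x\<bar>" "\<bar>u y\<bar>"] by (simp add: abs_mult)
    then show "\<bar>u x * u y * (gauss t x y - of_bool (x = y))\<bar> \<le> ((u x)\<^sup>2 + (u y)\<^sup>2) / 2 * (1 / (2 * real n))"
      unfolding abs_mult[of "u x * u y"] using off[OF xy] by (intro mult_mono) auto
  qed
  also have "\<dots> = card A * (\<Sum>x\<in>A. (u x)\<^sup>2) / (2 * real n)"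
    by (simp add: sum_divide_distrib[symmetric] sum.distrib add_divide_distrib sum_distrib_left[symmetric] del: sum_divide_distrib)
  also have "\<dots> \<le> (\<Sum>x\<in>A. (u x)\<^sup>2) / 2"
    using n mult_right_mono[of "real (card A)" "real n" "\<Sum>x\<in>A. (u x)\<^sup>2"] by (simp add: field_simps sum_nonneg)
  finally show ?thesis .
qed

section \<open>Annihilating polynomials\<close>

text \<open>Left factors in the rank d + 2 factorisation of the squared distance: - 2 times a
  coordinate of x is paired with that coordinate of y, the squared norm of x with 1, and 1 with the
  squared norm of y. The partners are the values of \<open>dist_right\<close>.\<close>

definition dist_left :: "'a::euclidean_space + bool \<Rightarrow> 'a \<Rightarrow> real" where
  "dist_left i x = (case i of Inl b \<Rightarrow> - 2 * (x \<bullet> b) | Inr c \<Rightarrow> if c then (norm x)\<^sup>2 else 1)"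

definition dist_right :: "'a::euclidean_space + bool \<Rightarrow> 'a \<Rightarrow> real" where
  "dist_right i x = (case i of Inl b \<Rightarrow> x \<bullet> b | Inr c \<Rightarrow> if c then 1 else (norm x)\<^sup>2)"

lemma dist_square_finite_rank:
  fixes x y :: "'a::euclidean_space"
  shows "(norm (x - y))\<^sup>2 = (\<Sum>i\<in>Basis <+> UNIV. dist_left i x * dist_right i y)"
proof -
  have "(norm (x - y))\<^sup>2 = (norm x)\<^sup>2 - 2 * (x \<bullet> y) + (norm y)\<^sup>2"
    by (simp add: power2_norm_eq_inner inner_diff inner_commute)
  moreover have "x \<bullet> y = (\<Sum>b\<in>Basis. (x \<bullet> b) * (y \<bullet> b))" by (rule euclidean_inner)
  ultimately show ?thesis
    by (subst sum.Plus) (auto simp: dist_left_def dist_right_def UNIV_bool sum_negf sum_distrib_left mult_ac)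
qed

text \<open>Words of length m < k in the d + 2 left factors, as they arise from expanding the m-th
  power of the squared distance. Different words may give the same polynomial; only the finiteness
  of their number matters.\<close>

definition monomial_index :: "nat \<Rightarrow> (nat \<times> (nat \<Rightarrow> 'a::euclidean_space + bool)) set" where
  "monomial_index k = (SIGMA m:{..<k}. PiE {..<m} (\<lambda>_. Basis <+> UNIV))"

definition monomial :: "nat \<times> (nat \<Rightarrow> 'a::euclidean_space + bool) \<Rightarrow> 'a \<Rightarrow> real" where
  "monomial j x = (\<Prod>l<fst j. dist_left (snd j l) x)"

lemma finite_monomial_index [simp]: "finite (monomial_index k)"
  unfolding monomial_index_def by (intro finite_SigmaI finite_PiE) auto

text \<open>Orthogonality to every x-dependent factor in the powers 0, ..., k - 1 of the squared
  distance, hence to the first k Taylor terms of any Gaussian kernel.\<close>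

definition annihilates :: "nat \<Rightarrow> 'a::euclidean_space set \<Rightarrow> ('a \<Rightarrow> real) \<Rightarrow> bool" where
  "annihilates k A u \<longleftrightarrow> (\<forall>j\<in>monomial_index k. (\<Sum>x\<in>A. u x * monomial j x) = 0)"

lemma annihilates_norm_power:
  fixes A :: "'a::euclidean_space set"
  assumes "annihilates k A u" "m < k"
  shows "(\<Sum>x\<in>A. u x * ((norm (x - y))\<^sup>2) ^ m) = 0"
proof -
  have "((norm (x - y))\<^sup>2) ^ m = (\<Sum>g\<in>PiE {..<m} (\<lambda>_. Basis <+> UNIV). monomial (m, g) x * (\<Prod>l<m. dist_right (g l) y))" for x
  proof -
    have "((norm (x - y))\<^sup>2) ^ m = (\<Prod>l<m. \<Sum>i\<in>Basis <+> UNIV. dist_left i x * dist_right i y)"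
      by (simp add: dist_square_finite_rank)
    also have "\<dots> = (\<Sum>g\<in>PiE {..<m} (\<lambda>_. Basis <+> UNIV). \<Prod>l<m. dist_left (g l) x * dist_right (g l) y)"
      by (rule prod_sum_PiE) auto
    finally show ?thesis by (simp add: prod.distrib monomial_def)
  qed
  then have "(\<Sum>x\<in>A. u x * ((norm (x - y))\<^sup>2) ^ m)
    = (\<Sum>x\<in>A. \<Sum>g\<in>PiE {..<m} (\<lambda>_. Basis <+> UNIV). u x * monomial (m, g) x * (\<Prod>l<m. dist_right (g l) y))"
    by (simp add: sum_distrib_left mult.assoc)
  also have "\<dots> = (\<Sum>g\<in>PiE {..<m} (\<lambda>_. Basis <+> UNIV). (\<Sum>x\<in>A. u x * monomial (m, g) x) * (\<Prod>l<m. dist_right (g l) y))"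
    by (subst sum.swap) (simp add: sum_distrib_right)
  also have "\<dots> = 0"
    using assms by (intro sum.neutral ballI) (auto simp: annihilates_def monomial_index_def)
  finally show ?thesis .
qed

lemma exp_minus_Taylor_bound:
  fixes a :: real assumes "0 \<le> a"
  shows "\<bar>exp (- a) - (\<Sum>m<k. (- a) ^ m / fact m)\<bar> \<le> a ^ k"
\<comment> \<open>The Lagrange remainder is taken at a negative argument and for a positive order,
  so these two cases are separate.\<close>
proof (cases "a = 0 \<or> k = 0")
  case True then show ?thesis using assms
    by (cases k) (auto simp: sum.lessThan_Suc_shift simp del: sum.lessThan_Suc)
next
  case False
  then have "\<exists>t. - a < t \<and> t < 0 \<and> exp (- a) = (\<Sum>m<k. exp 0 / fact m * (- a) ^ m) + exp t / fact k * (- a) ^ k"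
    using assms by (intro Maclaurin_minus[where diff="\<lambda>_. exp"]) (auto intro: DERIV_exp)
  then obtain t where t: "t < 0" "exp (- a) = (\<Sum>m<k. exp 0 / fact m * (- a) ^ m) + exp t / fact k * (- a) ^ k" by auto
  then have "\<bar>exp (- a) - (\<Sum>m<k. (- a) ^ m / fact m)\<bar> = exp t / fact k * a ^ k"
    using assms by (simp add: abs_mult power_abs)
  also have "\<dots> \<le> 1 * a ^ k"
  proof (intro mult_right_mono)
    have "exp t \<le> 1" using t by simp
    also have "1 \<le> (fact k :: real)" by simp
    finally show "exp t / fact k \<le> 1" by (simp add: divide_le_eq)
  qed (use assms in auto)
  finally show ?thesis by simp
qed

lemma quad_abs_bound:
  assumes "\<And>x y. x \<in> A \<Longrightarrow> y \<in> A \<Longrightarrow> \<bar>K x y\<bar> \<le> M"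
  shows "\<bar>quad K A u\<bar> \<le> (\<Sum>x\<in>A. \<bar>u x\<bar>)\<^sup>2 * M"
proof -
  have "\<bar>quad K A u\<bar> \<le> (\<Sum>x\<in>A. \<Sum>y\<in>A. \<bar>u x\<bar> * \<bar>u y\<bar> * M)"
    unfolding quad_def
    by (intro order_trans[OF sum_abs] sum_mono) (auto simp: abs_mult intro!: mult_left_mono assms)
  also have "\<dots> = (\<Sum>x\<in>A. \<bar>u x\<bar>)\<^sup>2 * M"
    unfolding power2_eq_square sum_product by (simp add: sum_distrib_right)
  finally show ?thesis .
qed

text \<open>The first k Taylor terms contribute nothing, because for fixed y the coefficients u
  annihilate each power of the squared distance to y. What is left is the Taylor remainder, at most
  (\<delta>^2/(4 t))^k for points at distance up to \<delta>.\<close>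

lemma quad_gauss_annihilates:
  fixes A :: "'a::euclidean_space set"
  assumes ann: "annihilates k A u" and t: "0 < t"
    and diam: "\<And>x y. x \<in> A \<Longrightarrow> y \<in> A \<Longrightarrow> norm (x - y) \<le> \<delta>"
  shows "\<bar>quad (gauss t) A u\<bar> \<le> (\<Sum>x\<in>A. \<bar>u x\<bar>)\<^sup>2 * (\<delta>\<^sup>2 / (4 * t)) ^ k"
proof -
  let ?p = "\<lambda>x y. \<Sum>m<k. (- ((norm (x - y))\<^sup>2 / (4 * t))) ^ m / fact m"
  have z: "quad ?p A u = 0"
  proof -
    have "quad ?p A u = (\<Sum>y\<in>A. \<Sum>x\<in>A. \<Sum>m<k. u y * ((- 1 / (4 * t)) ^ m / fact m) * (u x * ((norm (x - y))\<^sup>2) ^ m))"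
      unfolding quad_def
      by (subst sum.swap) (simp add: sum_distrib_left power_mult_distrib[symmetric] power_divide mult_ac)
    also have "\<dots> = (\<Sum>y\<in>A. \<Sum>m<k. u y * ((- 1 / (4 * t)) ^ m / fact m) * (\<Sum>x\<in>A. u x * ((norm (x - y))\<^sup>2) ^ m))"
      by (intro sum.cong refl) (subst sum.swap, simp add: sum_distrib_left)
    also have "\<dots> = 0"
      using annihilates_norm_power[OF ann] by (intro sum.neutral ballI) auto
    finally show ?thesis .
  qed
  have "quad (gauss t) A u = quad (\<lambda>x y. gauss t x y - ?p x y) A u + quad ?p A u"
    by (simp add: quad_def sum.distrib[symmetric] algebra_simps)
  then have "\<bar>quad (gauss t) A u\<bar> = \<bar>quad (\<lambda>x y. gauss t x y - ?p x y) A u\<bar>" using z by simp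
  also have "\<dots> \<le> (\<Sum>x\<in>A. \<bar>u x\<bar>)\<^sup>2 * (\<delta>\<^sup>2 / (4 * t)) ^ k"
  proof (rule quad_abs_bound)
    fix x y assume xy: "x \<in> A" "y \<in> A"
    have "\<bar>gauss t x y - ?p x y\<bar> \<le> ((norm (x - y))\<^sup>2 / (4 * t)) ^ k"
      using exp_minus_Taylor_bound[of "(norm (x - y))\<^sup>2 / (4 * t)" k] t by (simp add: gauss_def)
    also have "\<dots> \<le> (\<delta>\<^sup>2 / (4 * t)) ^ k"
      using t diam[OF xy] by (intro power_mono divide_right_mono) auto
    finally show "\<bar>gauss t x y - ?p x y\<bar> \<le> (\<delta>\<^sup>2 / (4 * t)) ^ k" .
  qed
  finally show ?thesis .
qed

text \<open>Gaussian elimination by induction on the equations: a pivot q of equation i is removed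
  from the unknowns and from the other equations, and its value is recovered from equation i at the
  end. Without a pivot, equation i holds for every u.\<close>

lemma underdetermined_system:
  fixes F :: "'j \<Rightarrow> 'p \<Rightarrow> real"
  assumes "finite J" "finite P" "card J < card P"
  obtains u where "\<exists>p\<in>P. u p \<noteq> 0" "\<And>j. j \<in> J \<Longrightarrow> (\<Sum>p\<in>P. u p * F j p) = 0"
proof -
  have "\<exists>u. (\<exists>p\<in>P. u p \<noteq> 0) \<and> (\<forall>j\<in>J. (\<Sum>p\<in>P. u p * F j p) = 0)"
    using assms
  proof (induction J arbitrary: P F rule: finite_induct)
    case empty
    then have "P \<noteq> {}" by auto
    then show ?case by (intro exI[of _ "\<lambda>_. 1"]) auto
  next
    case (insert i J)
    show ?case
    proof (cases "\<exists>q\<in>P. F i q \<noteq> 0")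
      case False
      obtain u where "\<exists>p\<in>P. u p \<noteq> 0" "\<forall>j\<in>J. (\<Sum>p\<in>P. u p * F j p) = 0"
        using insert.IH[of P F] insert.prems insert.hyps by auto
      then show ?thesis using False by (intro exI[of _ u]) (auto intro!: sum.neutral)
    next
      case True
      then obtain q where q: "q \<in> P" "F i q \<noteq> 0" by auto
      let ?P = "P - {q}"
      have "card J < card ?P" using insert q by simp
      then obtain u where u: "\<exists>p\<in>?P. u p \<noteq> 0"
        "\<forall>j\<in>J. (\<Sum>p\<in>?P. u p * (F j p - F j q * F i p / F i q)) = 0"
        using insert.IH[of ?P "\<lambda>j p. F j p - F j q * F i p / F i q"] insert.prems by auto
      define v where "v p = (if p = q then - (\<Sum>p\<in>?P. u p * F i p) / F i q else u p)" for p
      have s: "(\<Sum>p\<in>P. v p * F j p) = (\<Sum>p\<in>?P. u p * F j p) - (\<Sum>p\<in>?P. u p * F i p) / F i q * F j q" for j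
      proof -
        have "(\<Sum>p\<in>P. v p * F j p) = v q * F j q + (\<Sum>p\<in>?P. v p * F j p)"
          using insert.prems q by (intro sum.remove) auto
        also have "(\<Sum>p\<in>?P. v p * F j p) = (\<Sum>p\<in>?P. u p * F j p)"
          by (intro sum.cong) (auto simp: v_def)
        finally show ?thesis by (simp add: v_def)
      qed
      have "(\<Sum>p\<in>P. v p * F j p) = 0" if "j \<in> J" for j
      proof -
        have "0 = (\<Sum>p\<in>?P. u p * F j p) - (\<Sum>p\<in>?P. u p * F i p * (F j q / F i q))"
          using u(2) that by (simp add: right_diff_distrib sum_subtractf mult_ac)
        then show ?thesis unfolding s sum_distrib_right[symmetric] by simp
      qed
      moreover have "(\<Sum>p\<in>P. v p * F i p) = 0" unfolding s using q by simp
      moreover have "\<exists>p\<in>P. v p \<noteq> 0" using u(1) by (auto simp: v_def)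
      ultimately show ?thesis by auto
    qed
  qed
  then show ?thesis using that by blast
qed

text \<open>Dividing by the entry of largest modulus makes one coefficient equal to 1 and keeps the
  others bounded by 1. The former is what the variational formula for conditional variances asks
  for, the latter bounds the sum of moduli.\<close>

lemma ex_annihilating_coefficients:
  fixes P :: "'a::euclidean_space set"
  assumes "finite P" "card (monomial_index k :: (nat \<times> (nat \<Rightarrow> 'a + bool)) set) < card P"
  obtains u z where "z \<in> P" "u z = 1" "\<And>p. p \<in> P \<Longrightarrow> \<bar>u p\<bar> \<le> 1" "annihilates k P u"
proof -
  obtain u where u: "\<exists>p\<in>P. u p \<noteq> 0" "\<And>j. j \<in> monomial_index k \<Longrightarrow> (\<Sum>p\<in>P. u p * monomial j p) = 0"
    using underdetermined_system[OF finite_monomial_index assms(1) assms(2), of monomial] by blast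
  have ne: "(\<lambda>p. \<bar>u p\<bar>) ` P \<noteq> {}" using u(1) by auto
  obtain z where z: "z \<in> P" "\<bar>u z\<bar> = Max ((\<lambda>p. \<bar>u p\<bar>) ` P)"
    using Max_in[OF _ ne] assms(1) by auto
  have le: "\<bar>u p\<bar> \<le> \<bar>u z\<bar>" if "p \<in> P" for p using z(2) assms(1) that by simp
  then have nz: "u z \<noteq> 0" using u(1) by fastforce
  show ?thesis
  proof (rule that[of z "\<lambda>p. u p / u z"])
    show "annihilates k P (\<lambda>p. u p / u z)"
      using u(2) by (simp add: annihilates_def sum_divide_distrib[symmetric])
  qed (use z le nz in \<open>auto simp: divide_le_eq\<close>)
qed

section \<open>Bounds for Matern kernels\<close>

lemma
  fixes \<nu> T :: real
  assumes "0 < \<nu>" "0 < T"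
  shows set_integrable_powr_Ioc: "set_integrable lborel {0<..T} (\<lambda>t. t powr (\<nu> - 1))"
    and integral_powr_Ioc: "(LBINT t:{0<..T}. t powr (\<nu> - 1)) = T powr \<nu> / \<nu>"
proof -
  have "((\<lambda>x. x powr (\<nu> - 1)) has_integral (T powr \<nu> / \<nu>)) {0..T}"
    using has_integral_powr_from_0[of "\<nu> - 1" T] assms by simp
  then have "(\<integral>\<^sup>+x. ennreal (indicator {0..T} x * x powr (\<nu> - 1)) \<partial>lborel) = ennreal (T powr \<nu> / \<nu>)"
    by (intro nn_integral_has_integral_lebesgue) auto
  moreover have "indicator {0..T} x * x powr (\<nu> - 1) = indicator {0<..T} x *\<^sub>R x powr (\<nu> - 1)" for x
    by (cases "x = 0") (auto simp: indicator_def)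
  ultimately have "has_bochner_integral lborel (\<lambda>x. indicator {0<..T} x *\<^sub>R x powr (\<nu> - 1)) (T powr \<nu> / \<nu>)"
    using assms by (intro has_bochner_integral_nn_integral) auto
  then show "set_integrable lborel {0<..T} (\<lambda>t. t powr (\<nu> - 1))"
    "(LBINT t:{0<..T}. t powr (\<nu> - 1)) = T powr \<nu> / \<nu>"
    by (auto simp: has_bochner_integral_iff set_integrable_def set_lebesgue_integral_def)
qed

lemma
  fixes p T :: real
  assumes "0 < p" "0 < T"
  shows set_integrable_powr_Ici: "set_integrable lborel {T..} (\<lambda>t. t powr (- p - 1))"
    and integral_powr_Ici: "(LBINT t:{T..}. t powr (- p - 1)) = T powr (- p) / p"
proof -
  have "((\<lambda>x. x powr (- p - 1)) has_integral (T powr (- p) / p)) {T..}"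
    using has_integral_powr_to_inf[of "- p - 1" T] assms by simp
  then have "(\<integral>\<^sup>+x. ennreal (indicator {T..} x * x powr (- p - 1)) \<partial>lborel) = ennreal (T powr (- p) / p)"
    by (intro nn_integral_has_integral_lebesgue) auto
  then have "has_bochner_integral lborel (\<lambda>x. indicator {T..} x *\<^sub>R x powr (- p - 1)) (T powr (- p) / p)"
    using assms by (intro has_bochner_integral_nn_integral) auto
  then show "set_integrable lborel {T..} (\<lambda>t. t powr (- p - 1))"
    "(LBINT t:{T..}. t powr (- p - 1)) = T powr (- p) / p"
    by (auto simp: has_bochner_integral_iff set_integrable_def set_lebesgue_integral_def)
qed

abbreviation mix_kernel :: "real \<Rightarrow> real \<Rightarrow> 'a::real_normed_vector \<Rightarrow> 'a \<Rightarrow> real" where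
  "mix_kernel \<nu> \<kappa> x y \<equiv> gauss_mix \<nu> \<kappa> (norm (x - y))"

lemma
  fixes A :: "'a::euclidean_space set"
  assumes "0 < \<nu>" "0 < \<kappa>"
  shows set_integrable_quad_mix: "set_integrable lborel {0<..} (\<lambda>t. t powr (\<nu> - 1) * exp (- \<kappa> * t) * quad (gauss t) A u)"
    and quad_mix: "quad (mix_kernel \<nu> \<kappa>) A u = (LBINT t:{0<..}. t powr (\<nu> - 1) * exp (- \<kappa> * t) * quad (gauss t) A u)"
proof -
  let ?f = "\<lambda>r t. indicator {0<..} t *\<^sub>R (t powr (\<nu> - 1) * exp (- \<kappa> * t) * exp (- r\<^sup>2 / (4 * t)))"
  have "has_bochner_integral lborel (?f r) (gauss_mix \<nu> \<kappa> r)" for r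
    using set_integrable_gauss_mix[OF assms, of r]
    by (simp only: has_bochner_integral_iff gauss_mix_def set_integrable_def set_lebesgue_integral_def simp_thms)
  then have "has_bochner_integral lborel (\<lambda>t. \<Sum>x\<in>A. \<Sum>y\<in>A. u x * u y * ?f (norm (x - y)) t)
     (\<Sum>x\<in>A. \<Sum>y\<in>A. u x * u y * gauss_mix \<nu> \<kappa> (norm (x - y)))"
    by (intro has_bochner_integral_sum has_bochner_integral_mult_right)
  also have "(\<lambda>t. \<Sum>x\<in>A. \<Sum>y\<in>A. u x * u y * ?f (norm (x - y)) t)
     = (\<lambda>t. indicator {0<..} t *\<^sub>R (t powr (\<nu> - 1) * exp (- \<kappa> * t) * quad (gauss t) A u))"
    by (intro ext) (simp add: quad_def gauss_def sum_distrib_left mult_ac)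
  finally show "set_integrable lborel {0<..} (\<lambda>t. t powr (\<nu> - 1) * exp (- \<kappa> * t) * quad (gauss t) A u)"
    "quad (mix_kernel \<nu> \<kappa>) A u = (LBINT t:{0<..}. t powr (\<nu> - 1) * exp (- \<kappa> * t) * quad (gauss t) A u)"
    by (auto simp: has_bochner_integral_iff set_integrable_def set_lebesgue_integral_def quad_def)
qed

lemma set_integral_mono_indicator:
  fixes f g :: "real \<Rightarrow> real"
  assumes f: "set_integrable lborel A f" and g: "set_integrable lborel B g"
    and le: "\<And>t. indicator A t * f t \<le> indicator B t * g t"
  shows "(LBINT t:A. f t) \<le> (LBINT t:B. g t)"
  unfolding set_lebesgue_integral_def
  by (rule integral_mono) (use assms in \<open>auto simp: set_integrable_def\<close>)

text \<open>Times beyond T are discarded, as the Gaussian forms are nonnegative; up to T the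
  exponential weight is at least exp (- \<kappa> T).\<close>

lemma quad_mix_lower:
  fixes A :: "'a::euclidean_space set"
  assumes \<nu>: "0 < \<nu>" and \<kappa>: "0 < \<kappa>" and T: "0 < T"
    and low: "\<And>t. 0 < t \<Longrightarrow> t \<le> T \<Longrightarrow> S / 2 \<le> quad (gauss t) A u" and S: "0 \<le> S"
  shows "exp (- \<kappa> * T) * T powr \<nu> / (2 * \<nu>) * S \<le> quad (mix_kernel \<nu> \<kappa>) A u"
proof -
  have "exp (- \<kappa> * T) * T powr \<nu> / (2 * \<nu>) * S = (LBINT t:{0<..T}. (exp (- \<kappa> * T) * S / 2) * t powr (\<nu> - 1))"
    by (simp add: integral_powr_Ioc[OF \<nu> T] mult_ac)
  also have "\<dots> \<le> quad (mix_kernel \<nu> \<kappa>) A u"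
    unfolding quad_mix[OF \<nu> \<kappa>]
  proof (rule set_integral_mono_indicator)
    show "set_integrable lborel {0<..T} (\<lambda>t. (exp (- \<kappa> * T) * S / 2) * t powr (\<nu> - 1))"
      by (rule set_integrable_mult_right) (simp add: set_integrable_powr_Ioc[OF \<nu> T])
    show "set_integrable lborel {0<..} (\<lambda>t. t powr (\<nu> - 1) * exp (- \<kappa> * t) * quad (gauss t) A u)"
      by (rule set_integrable_quad_mix[OF \<nu> \<kappa>])
    fix t
    show "indicator {0<..T} t * (exp (- \<kappa> * T) * S / 2 * t powr (\<nu> - 1))
        \<le> indicator {0<..} t * (t powr (\<nu> - 1) * exp (- \<kappa> * t) * quad (gauss t) A u)"
    proof (cases "0 < t \<and> t \<le> T")
      case True
      then have "t powr (\<nu> - 1) * (exp (- \<kappa> * T) * (S / 2)) \<le> t powr (\<nu> - 1) * (exp (- \<kappa> * t) * quad (gauss t) A u)"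
        using low[of t] \<kappa> S by (intro mult_left_mono mult_mono) auto
      then show ?thesis using True by (simp add: mult_ac)
    next
      case False
      then show ?thesis using quad_gauss_nonneg[of t A u] by (auto simp: indicator_def)
    qed
  qed
  finally show ?thesis .
qed

text \<open>The two bounds for a Gaussian form, the trivial one and the Taylor remainder (T/t)^k,
  meet at T = \<delta>^2/4, where the integral over t is split. Both parts are multiples of T^\<nu>;
  convergence of the second at infinity is what requires \<nu> < k.\<close>

lemma quad_mix_upper:
  fixes A :: "'a::euclidean_space set"
  assumes \<nu>: "0 < \<nu>" "\<nu> < real k" and \<kappa>: "0 < \<kappa>" and \<delta>: "0 < \<delta>"
    and ann: "annihilates k A u" and diam: "\<And>x y. x \<in> A \<Longrightarrow> y \<in> A \<Longrightarrow> norm (x - y) \<le> \<delta>"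
  shows "quad (mix_kernel \<nu> \<kappa>) A u \<le> (1 / \<nu> + 1 / (real k - \<nu>)) / 4 powr \<nu> * (\<Sum>x\<in>A. \<bar>u x\<bar>)\<^sup>2 * \<delta> powr (2 * \<nu>)"
proof -
  define T where "T = \<delta>\<^sup>2 / 4"
  define S where "S = (\<Sum>x\<in>A. \<bar>u x\<bar>)\<^sup>2"
  have T: "0 < T" using \<delta> by (simp add: T_def)
  have S: "0 \<le> S" by (simp add: S_def)
  have p: "0 < real k - \<nu>" using \<nu> by simp
  let ?g = "\<lambda>t. S * (indicator {0<..T} t * t powr (\<nu> - 1)) + S * T ^ k * (indicator {T..} t * t powr (- (real k - \<nu>) - 1))"
  have i1: "integrable lborel (\<lambda>t. indicator {0<..T} t * t powr (\<nu> - 1))"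
    using set_integrable_powr_Ioc[OF \<nu>(1) T] by (simp add: set_integrable_def)
  have i2: "integrable lborel (\<lambda>t. indicator {T..} t * t powr (- (real k - \<nu>) - 1))"
    using set_integrable_powr_Ici[OF p T] by (simp add: set_integrable_def)
  have "quad (mix_kernel \<nu> \<kappa>) A u \<le> (LBINT t:UNIV. ?g t)"
    unfolding quad_mix[OF \<nu>(1) \<kappa>]
  proof (rule set_integral_mono_indicator[OF set_integrable_quad_mix[OF \<nu>(1) \<kappa>]])
    show "set_integrable lborel UNIV ?g"
      unfolding set_integrable_def using i1 i2 by simp
    fix t
    show "indicator {0<..} t * (t powr (\<nu> - 1) * exp (- \<kappa> * t) * quad (gauss t) A u) \<le> indicator UNIV t * ?g t"
    proof (cases "0 < t")
      case False then show ?thesis using S T by simp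
    next
      case t: True
      have q1: "quad (gauss t) A u \<le> S"
        using quad_abs_bound[of A "gauss t" 1 u] t by (simp add: S_def gauss_def)
      have q2: "quad (gauss t) A u \<le> S * (T / t) ^ k"
        using quad_gauss_annihilates[OF ann t diam] by (simp add: S_def T_def)
      have e: "t powr (\<nu> - 1) * exp (- \<kappa> * t) * quad (gauss t) A u \<le> t powr (\<nu> - 1) * 1 * quad (gauss t) A u"
        using t \<kappa> quad_gauss_nonneg[OF t, of A u] by (intro mult_right_mono mult_left_mono) auto
      show ?thesis
      proof (cases "t \<le> T")
        case True
        have "t powr (\<nu> - 1) * quad (gauss t) A u \<le> t powr (\<nu> - 1) * S"
          using q1 by (intro mult_left_mono) auto
        with e have main: "t powr (\<nu> - 1) * exp (- \<kappa> * t) * quad (gauss t) A u \<le> S * t powr (\<nu> - 1)"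
          by (simp only: mult_1_right mult.commute[of S])
        have "S * t powr (\<nu> - 1) \<le> ?g t" using S T t True by simp
        from order_trans[OF main this] show ?thesis using t by simp
      next
        case False
        have "t powr (\<nu> - 1) * quad (gauss t) A u \<le> t powr (\<nu> - 1) * (S * (T / t) ^ k)"
          using q2 by (intro mult_left_mono) auto
        also have "\<dots> = S * T ^ k * (t powr (\<nu> - 1) / t powr (real k))"
          using t by (simp add: power_divide powr_realpow)
        also have "t powr (\<nu> - 1) / t powr (real k) = t powr (- (real k - \<nu>) - 1)"
          by (simp add: powr_diff[symmetric] algebra_simps)
        finally have "t powr (\<nu> - 1) * quad (gauss t) A u \<le> S * T ^ k * t powr (- (real k - \<nu>) - 1)" .
        with e have main: "t powr (\<nu> - 1) * exp (- \<kappa> * t) * quad (gauss t) A u \<le> S * T ^ k * t powr (- (real k - \<nu>) - 1)"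
          by (simp only: mult_1_right)
        have "S * T ^ k * t powr (- (real k - \<nu>) - 1) \<le> ?g t" using t False by simp
        from order_trans[OF main this] show ?thesis using t by simp
      qed
    qed
  qed
  also have "(LBINT t:UNIV. ?g t) = S * (T powr \<nu> / \<nu>) + S * T ^ k * (T powr (- (real k - \<nu>)) / (real k - \<nu>))"
    using i1 i2 integral_powr_Ioc[OF \<nu>(1) T] integral_powr_Ici[OF p T]
    by (simp add: set_lebesgue_integral_def)
  also have "\<dots> = S * (T powr \<nu> / \<nu>) + S * ((T ^ k * T powr (- (real k - \<nu>))) / (real k - \<nu>))"
    by simp
  also have "T ^ k * T powr (- (real k - \<nu>)) = T powr \<nu>"
  proof -
    have "T ^ k = T powr real k" using T by (simp add: powr_realpow)
    then show ?thesis by (simp add: powr_add[symmetric])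
  qed
  also have "S * (T powr \<nu> / \<nu>) + S * (T powr \<nu> / (real k - \<nu>)) = (1 / \<nu> + 1 / (real k - \<nu>)) * S * T powr \<nu>"
    by (simp add: distrib_right)
  also have "T powr \<nu> = \<delta> powr (2 * \<nu>) / 4 powr \<nu>"
  proof -
    have "\<delta>\<^sup>2 = \<delta> powr 2" using \<delta> by simp
    then have "T powr \<nu> = (\<delta> powr 2 / 4) powr \<nu>" by (simp only: T_def)
    then show ?thesis using \<delta> by (simp only: powr_divide powr_powr powr_ge_zero)
  qed
  finally show ?thesis by (simp add: S_def mult_ac)
qed

text \<open>An inverse inequality: the form of the lower order a is bounded by that of order \<nu>
  at the cost T^(a - \<nu>). Beyond T the weights compare pointwise. Up to T the Gaussian forms are
  comparable to S, so this part is at most a multiple of S T^a, which \<open>quad_mix_lower\<close>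
  absorbs into the form of order \<nu>.\<close>

lemma quad_mix_compare:
  fixes A :: "'a::euclidean_space set"
  assumes a: "0 < a" "a \<le> \<nu>" and \<kappa>: "0 < \<kappa>" and T: "0 < T" and S: "0 \<le> S"
    and near: "\<And>t. 0 < t \<Longrightarrow> t \<le> T \<Longrightarrow> \<bar>quad (gauss t) A u - S\<bar> \<le> S / 2"
  shows "quad (mix_kernel a \<kappa>) A u \<le> (3 * \<nu> / a * exp (\<kappa> * T) + 1) * T powr (a - \<nu>) * quad (mix_kernel \<nu> \<kappa>) A u"
proof -
  have \<nu>: "0 < \<nu>" using a by simp
  have i1: "integrable lborel (\<lambda>t. indicator {0<..T} t * t powr (a - 1))"
    using set_integrable_powr_Ioc[OF a(1) T] by (simp add: set_integrable_def)
  have i2: "integrable lborel (\<lambda>t. indicator {0<..} t * (t powr (\<nu> - 1) * exp (- \<kappa> * t) * quad (gauss t) A u))"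
    using set_integrable_quad_mix[OF \<nu> \<kappa>, of A u] by (simp add: set_integrable_def)
  let ?g = "\<lambda>t. 3 / 2 * S * (indicator {0<..T} t * t powr (a - 1))
     + T powr (a - \<nu>) * (indicator {0<..} t * (t powr (\<nu> - 1) * exp (- \<kappa> * t) * quad (gauss t) A u))"
  have "quad (mix_kernel a \<kappa>) A u \<le> (LBINT t:UNIV. ?g t)"
    unfolding quad_mix[OF a(1) \<kappa>]
  proof (rule set_integral_mono_indicator[OF set_integrable_quad_mix[OF a(1) \<kappa>]])
    show "set_integrable lborel UNIV ?g"
      unfolding set_integrable_def using i1 i2 by simp
    fix t
    show "indicator {0<..} t * (t powr (a - 1) * exp (- \<kappa> * t) * quad (gauss t) A u) \<le> indicator UNIV t * ?g t"
    proof (cases "0 < t")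
      case t: True
      have q0: "0 \<le> quad (gauss t) A u" by (rule quad_gauss_nonneg[OF t])
      show ?thesis
      proof (cases "t \<le> T")
        case True
        have "t powr (a - 1) * exp (- \<kappa> * t) * quad (gauss t) A u \<le> t powr (a - 1) * 1 * (3 / 2 * S)"
        proof (intro mult_mono)
          show "quad (gauss t) A u \<le> 3 / 2 * S" using near[OF t True] by linarith
        qed (use t \<kappa> q0 in auto)
        then have main: "t powr (a - 1) * exp (- \<kappa> * t) * quad (gauss t) A u \<le> 3 / 2 * S * t powr (a - 1)"
          by (simp only: mult_1_right mult.commute[of "t powr (a - 1)" "3 / 2 * S"])
        have "3 / 2 * S * t powr (a - 1) \<le> ?g t" using q0 t True by simp
        from order_trans[OF main this] show ?thesis using t by simp
      next
        case False
        have "t powr (a - 1) = t powr (a - \<nu>) * t powr (\<nu> - 1)"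
          by (simp add: powr_add[symmetric])
        also have "\<dots> \<le> T powr (a - \<nu>) * t powr (\<nu> - 1)"
          using a T False by (intro mult_right_mono powr_mono2') auto
        finally have "t powr (a - 1) * (exp (- \<kappa> * t) * quad (gauss t) A u)
           \<le> T powr (a - \<nu>) * t powr (\<nu> - 1) * (exp (- \<kappa> * t) * quad (gauss t) A u)"
          using q0 by (intro mult_right_mono) auto
        then show ?thesis using t False by (simp add: mult_ac)
      qed
    qed simp
  qed
  also have "(LBINT t:UNIV. ?g t) = 3 / 2 * S * (T powr a / a) + T powr (a - \<nu>) * quad (mix_kernel \<nu> \<kappa>) A u"
    using i1 i2 integral_powr_Ioc[OF a(1) T] quad_mix[OF \<nu> \<kappa>, of A u]
    by (simp add: set_lebesgue_integral_def)
  also have "3 / 2 * S * (T powr a / a) \<le> 3 * \<nu> / a * exp (\<kappa> * T) * T powr (a - \<nu>) * quad (mix_kernel \<nu> \<kappa>) A u"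
  proof -
    have "exp (- \<kappa> * T) * T powr \<nu> / (2 * \<nu>) * S \<le> quad (mix_kernel \<nu> \<kappa>) A u"
    proof (rule quad_mix_lower[OF \<nu> \<kappa> T _ S])
      show "S / 2 \<le> quad (gauss t) A u" if "0 < t" "t \<le> T" for t using near[OF that] by linarith
    qed
    then have "3 * \<nu> / a * exp (\<kappa> * T) * T powr (a - \<nu>) * (exp (- \<kappa> * T) * T powr \<nu> / (2 * \<nu>) * S)
       \<le> 3 * \<nu> / a * exp (\<kappa> * T) * T powr (a - \<nu>) * quad (mix_kernel \<nu> \<kappa>) A u"
      using a \<nu> by (intro mult_left_mono) auto
    also have "3 * \<nu> / a * exp (\<kappa> * T) * T powr (a - \<nu>) * (exp (- \<kappa> * T) * T powr \<nu> / (2 * \<nu>) * S)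
       = 3 / 2 * S * ((T powr (a - \<nu>) * T powr \<nu>) / a) * (exp (\<kappa> * T) * exp (- \<kappa> * T))"
      using \<nu> a by (simp add: field_simps)
    also have "\<dots> = 3 / 2 * S * (T powr a / a)" by (simp add: powr_add[symmetric] exp_add[symmetric])
    finally show ?thesis .
  qed
  finally show ?thesis by (simp add: algebra_simps)
qed

section \<open>Quadratic forms of the Matern kernels, uniformly in \<nu>\<close>

lemma continuous_positive_bounds:
  fixes g :: "real \<Rightarrow> real"
  assumes "a \<le> b" "continuous_on {a..b} g" "\<And>x. x \<in> {a..b} \<Longrightarrow> 0 < g x"
  obtains m M where "0 < m" "0 < M" "\<And>x. x \<in> {a..b} \<Longrightarrow> m \<le> g x" "\<And>x. x \<in> {a..b} \<Longrightarrow> g x \<le> M"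
proof -
  obtain x1 where "x1 \<in> {a..b}" "\<And>x. x \<in> {a..b} \<Longrightarrow> g x1 \<le> g x"
    using continuous_attains_inf[of "{a..b}" g] assms by auto
  moreover obtain x2 where "x2 \<in> {a..b}" "\<And>x. x \<in> {a..b} \<Longrightarrow> g x \<le> g x2"
    using continuous_attains_sup[of "{a..b}" g] assms by auto
  ultimately show ?thesis using assms(3) by (intro that[of "g x1" "g x2"]) auto
qed

text \<open>The factor c \<nu> is kept apart: what remains is continuous in \<nu>, hence bounded
  above and below on the parameter interval, whereas c is only known through its bounds.\<close>

definition matern_factor :: "real \<Rightarrow> real \<Rightarrow> real \<Rightarrow> real" where
  "matern_factor \<sigma> lam \<nu> = \<sigma>\<^sup>2 * 2 powr (\<nu> - 1) * (2 * \<nu> / lam\<^sup>2) powr \<nu>"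

lemma matern_factor_pos: "0 < \<sigma> \<Longrightarrow> 0 < lam \<Longrightarrow> 0 < \<nu> \<Longrightarrow> 0 < matern_factor \<sigma> lam \<nu>"
  by (simp add: matern_factor_def)

lemma quad_matern:
  fixes A :: "(real ^ 'n) set"
  assumes "0 < lam" "0 < \<nu>"
  shows "quad (matern \<sigma> lam c \<nu>) A u
    = c \<nu> * matern_factor \<sigma> lam \<nu> * quad (mix_kernel \<nu> (2 * \<nu> / lam\<^sup>2)) A u"
  unfolding quad_def sum_distrib_left
  by (intro sum.cong refl) (simp add: matern_mixture[OF assms] matern_factor_def mult_ac)

lemma matern_sym: "matern \<sigma> lam c \<nu> x y = matern \<sigma> lam c \<nu> y x"
  by (simp add: matern_def norm_minus_commute)

text \<open>The constants of the mixture bound are continuous and positive in \<nu>, so one m serves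
  the whole parameter interval. A scale T of at most 1 allows exp (- \<kappa> T) to be replaced by
  exp (- \<kappa>).\<close>

lemma quad_matern_lower:
  assumes lam: "0 < lam" and \<sigma>: "0 < \<sigma>" and \<nu>min: "0 < \<nu>min" "\<nu>min \<le> \<nu>max"
  obtains m where "0 < m"
    "\<And>\<nu> n q (A :: (real ^ 'n) set) u c. \<nu> \<in> {\<nu>min..\<nu>max} \<Longrightarrow> finite A \<Longrightarrow> card A \<le> n \<Longrightarrow> 1 \<le> n \<Longrightarrow> 0 < q \<Longrightarrow>
       (\<And>x y. x \<in> A \<Longrightarrow> y \<in> A \<Longrightarrow> x \<noteq> y \<Longrightarrow> 2 * q \<le> norm (x - y)) \<Longrightarrow> q\<^sup>2 / ln (2 * real n) \<le> 1 \<Longrightarrow> 0 \<le> c \<nu> \<Longrightarrow>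
       m * c \<nu> * (q\<^sup>2 / ln (2 * real n)) powr \<nu> * (\<Sum>x\<in>A. (u x)\<^sup>2) \<le> quad (matern \<sigma> lam c \<nu>) A u"
proof -
  define g where "g \<nu> = matern_factor \<sigma> lam \<nu> * (exp (- (2 * \<nu> / lam\<^sup>2)) / (2 * \<nu>))" for \<nu>
  have "continuous_on {\<nu>min..\<nu>max} g"
    unfolding g_def matern_factor_def using \<nu>min lam
    by (intro continuous_intros) auto
  moreover have "0 < g \<nu>" if "\<nu> \<in> {\<nu>min..\<nu>max}" for \<nu>
    using that \<nu>min lam \<sigma> matern_factor_pos[of \<sigma> lam \<nu>] by (simp add: g_def)
  ultimately obtain m M where m: "0 < m" "\<And>\<nu>. \<nu> \<in> {\<nu>min..\<nu>max} \<Longrightarrow> m \<le> g \<nu>"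
    using continuous_positive_bounds[OF \<nu>min(2), of g] by metis
  show ?thesis
  proof (rule that[OF m(1)])
    fix \<nu> n q and u :: "real ^ 'n \<Rightarrow> real" and c and A :: "(real ^ 'n) set"
    assume \<nu>: "\<nu> \<in> {\<nu>min..\<nu>max}" and A: "finite A" "card A \<le> n" "1 \<le> n" and q: "0 < q"
      and sep: "\<And>x y. x \<in> A \<Longrightarrow> y \<in> A \<Longrightarrow> x \<noteq> y \<Longrightarrow> 2 * q \<le> norm (x - y)"
      and T1: "q\<^sup>2 / ln (2 * real n) \<le> 1" and c: "0 \<le> (c \<nu> :: real)"
    define T where "T = q\<^sup>2 / ln (2 * real n)"
    define S :: real where "S = (\<Sum>x\<in>A. (u x)\<^sup>2)"
    have S: "0 \<le> S" unfolding S_def by (intro sum_nonneg) auto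
    have T: "0 < T" "T \<le> 1" using q T1 A(3) by (auto simp: T_def)
    have \<nu>0: "0 < \<nu>" using \<nu> \<nu>min by auto
    define \<kappa> where "\<kappa> = 2 * \<nu> / lam\<^sup>2"
    have \<kappa>: "0 < \<kappa>" using \<nu>0 lam by (simp add: \<kappa>_def)
    have "\<bar>quad (gauss t) A u - S\<bar> \<le> S / 2" if "0 < t" "t \<le> T" for t
      unfolding S_def by (rule quad_gauss_near_diagonal[OF A q sep]) (use that T_def in auto)
    then have "S / 2 \<le> quad (gauss t) A u" if "0 < t" "t \<le> T" for t
      using abs_le_D2[of "quad (gauss t) A u - S" "S / 2"] that by fastforce
    from quad_mix_lower[OF \<nu>0 \<kappa> T(1) this S]
    have "exp (- \<kappa> * T) * T powr \<nu> / (2 * \<nu>) * S \<le> quad (mix_kernel \<nu> \<kappa>) A u" by simp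
    moreover have "exp (- \<kappa>) * T powr \<nu> / (2 * \<nu>) * S \<le> exp (- \<kappa> * T) * T powr \<nu> / (2 * \<nu>) * S"
      using T \<kappa> \<nu>0 S by (intro mult_right_mono divide_right_mono) auto
    ultimately have "exp (- \<kappa>) * T powr \<nu> / (2 * \<nu>) * S \<le> quad (mix_kernel \<nu> \<kappa>) A u" by simp
    then have "c \<nu> * matern_factor \<sigma> lam \<nu> * (exp (- \<kappa>) * T powr \<nu> / (2 * \<nu>) * S) \<le> quad (matern \<sigma> lam c \<nu>) A u"
      unfolding quad_matern[OF lam \<nu>0] \<kappa>_def[symmetric]
      using c matern_factor_pos[OF \<sigma> lam \<nu>0] by (intro mult_left_mono) auto
    moreover have "m * (c \<nu> * T powr \<nu> * S) \<le> g \<nu> * (c \<nu> * T powr \<nu> * S)"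
      using m(2)[OF \<nu>] c S by (intro mult_right_mono) auto
    ultimately show "m * c \<nu> * (q\<^sup>2 / ln (2 * real n)) powr \<nu> * (\<Sum>x\<in>A. (u x)\<^sup>2) \<le> quad (matern \<sigma> lam c \<nu>) A u"
      unfolding T_def[symmetric] S_def[symmetric] g_def \<kappa>_def[symmetric] by (simp add: mult_ac)
  qed
qed

lemma finite_separation:
  fixes A :: "'a::real_normed_vector set"
  assumes "finite A"
  obtains q where "0 < q" "q \<le> 1 / 2" "\<And>x y. x \<in> A \<Longrightarrow> y \<in> A \<Longrightarrow> x \<noteq> y \<Longrightarrow> 2 * q \<le> norm (x - y)"
proof -
  \<comment> \<open>The extra element 1 keeps the set non-empty when A has fewer than two points and
    caps q at 1/2.\<close>
  let ?D = "insert 1 ((\<lambda>(x, y). norm (x - y)) ` ({(x, y). x \<in> A \<and> y \<in> A \<and> x \<noteq> y}))"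
  have "{(x, y). x \<in> A \<and> y \<in> A \<and> x \<noteq> y} \<subseteq> A \<times> A" by auto
  then have fin: "finite ?D" using assms by (meson finite.insertI finite_SigmaI finite_imageI finite_subset)
  have "0 < Min ?D" using fin by (subst Min_gr_iff) auto
  moreover have "Min ?D \<le> 1" using fin by (intro Min_le) auto
  moreover have "Min ?D \<le> norm (x - y)" if "x \<in> A" "y \<in> A" "x \<noteq> y" for x y
    using fin that by (intro Min_le) auto
  ultimately show ?thesis by (intro that[of "Min ?D / 2"]) auto
qed

lemma pos_def_matern:
  fixes A :: "(real ^ 'n) set"
  assumes "0 < lam" "0 < \<sigma>" "0 < \<nu>" "0 < c \<nu>" "finite A"
  shows "pos_def_on A (matern \<sigma> lam c \<nu>)"
  unfolding pos_def_on_def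
proof (intro conjI allI impI)
  fix u :: "real ^ 'n \<Rightarrow> real" assume nz: "\<exists>x\<in>A. u x \<noteq> 0"
  \<comment> \<open>Strict positivity is the lower bound on the degenerate interval from \<nu> to
    \<nu>. The bounds q \<le> 1/2 and 1/2 \<le> ln 2 keep the scale at most 1.\<close>
  obtain m where m: "0 < m"
    "\<And>\<nu>' n q (A :: (real ^ 'n) set) u c. \<nu>' \<in> {\<nu>..\<nu>} \<Longrightarrow> finite A \<Longrightarrow> card A \<le> n \<Longrightarrow> 1 \<le> n \<Longrightarrow> 0 < q \<Longrightarrow>
       (\<And>x y. x \<in> A \<Longrightarrow> y \<in> A \<Longrightarrow> x \<noteq> y \<Longrightarrow> 2 * q \<le> norm (x - y)) \<Longrightarrow> q\<^sup>2 / ln (2 * real n) \<le> 1 \<Longrightarrow> 0 \<le> c \<nu>' \<Longrightarrow>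
       m * c \<nu>' * (q\<^sup>2 / ln (2 * real n)) powr \<nu>' * (\<Sum>x\<in>A. (u x)\<^sup>2) \<le> quad (matern \<sigma> lam c \<nu>') A u"
    using quad_matern_lower[OF assms(1,2,3) order_refl] by blast
  obtain q where q: "0 < q" "q \<le> 1 / 2" "\<And>x y. x \<in> A \<Longrightarrow> y \<in> A \<Longrightarrow> x \<noteq> y \<Longrightarrow> 2 * q \<le> norm (x - y)"
    using finite_separation[OF assms(5)] by metis
  have c1: "1 \<le> card A" using nz assms(5) by (metis One_nat_def Suc_leI card_gt_0_iff empty_iff)
  have "1 / 2 \<le> ln (2::real)" using ln2_ge_two_thirds by simp
  also have "ln 2 \<le> ln (2 * real (card A))" using c1 by simp
  finally have l: "1 / 2 \<le> ln (2 * real (card A))" .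
  have "q\<^sup>2 \<le> (1 / 2)\<^sup>2" using q by (intro power_mono) auto
  also have "(1 / 2)\<^sup>2 \<le> (1/2::real)" by (simp add: power2_eq_square)
  finally have "q\<^sup>2 / ln (2 * real (card A)) \<le> 1" using l by (simp add: divide_le_eq)
  from m(2)[of \<nu> A "card A" q c u, OF _ assms(5) order_refl c1 q(1) q(3) this]
  have "m * c \<nu> * (q\<^sup>2 / ln (2 * real (card A))) powr \<nu> * (\<Sum>x\<in>A. (u x)\<^sup>2) \<le> quad (matern \<sigma> lam c \<nu>) A u"
    using assms(4) by simp
  moreover have "0 < (\<Sum>x\<in>A. (u x)\<^sup>2)"
    using nz assms(5) by (meson sum_pos2 zero_le_power2 zero_less_power2)
  then have "0 < m * c \<nu> * (q\<^sup>2 / ln (2 * real (card A))) powr \<nu> * (\<Sum>x\<in>A. (u x)\<^sup>2)"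
    using m(1) assms(4) l q(1) by simp
  ultimately show "0 < quad (matern \<sigma> lam c \<nu>) A u" by simp
qed (rule matern_sym)

lemma quad_matern_annihilates:
  assumes lam: "0 < lam" and \<sigma>: "0 < \<sigma>" and \<nu>min: "0 < \<nu>min" "\<nu>min \<le> \<nu>max" "\<nu>max < real k"
  obtains M where "0 < M"
    "\<And>\<nu> \<delta> (A :: (real ^ 'n) set) u c. \<nu> \<in> {\<nu>min..\<nu>max} \<Longrightarrow> annihilates k A u \<Longrightarrow> 0 < \<delta> \<Longrightarrow>
       (\<And>x y. x \<in> A \<Longrightarrow> y \<in> A \<Longrightarrow> norm (x - y) \<le> \<delta>) \<Longrightarrow> 0 \<le> c \<nu> \<Longrightarrow>
       quad (matern \<sigma> lam c \<nu>) A u \<le> M * c \<nu> * (\<Sum>x\<in>A. \<bar>u x\<bar>)\<^sup>2 * \<delta> powr (2 * \<nu>)"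
proof -
  define g where "g \<nu> = matern_factor \<sigma> lam \<nu> * ((1 / \<nu> + 1 / (real k - \<nu>)) / 4 powr \<nu>)" for \<nu>
  have "continuous_on {\<nu>min..\<nu>max} g"
    unfolding g_def matern_factor_def using \<nu>min lam
    by (intro continuous_intros) auto
  moreover have "0 < g \<nu>" if "\<nu> \<in> {\<nu>min..\<nu>max}" for \<nu>
    using that \<nu>min lam \<sigma> matern_factor_pos[of \<sigma> lam \<nu>] by (auto simp: g_def intro!: mult_pos_pos divide_pos_pos add_pos_pos)
  ultimately obtain m M where M: "0 < M" "\<And>\<nu>. \<nu> \<in> {\<nu>min..\<nu>max} \<Longrightarrow> g \<nu> \<le> M"
    using continuous_positive_bounds[OF \<nu>min(2), of g] by metis
  show ?thesis
  proof (rule that[OF M(1)])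
    fix \<nu> \<delta> and u :: "real ^ 'n \<Rightarrow> real" and c and A :: "(real ^ 'n) set"
    assume \<nu>: "\<nu> \<in> {\<nu>min..\<nu>max}" and ann: "annihilates k A u" and \<delta>: "0 < \<delta>"
      and diam: "\<And>x y. x \<in> A \<Longrightarrow> y \<in> A \<Longrightarrow> norm (x - y) \<le> \<delta>" and c: "0 \<le> (c \<nu> :: real)"
    have \<nu>0: "0 < \<nu>" "\<nu> < real k" using \<nu> \<nu>min by auto
    have \<kappa>: "0 < 2 * \<nu> / lam\<^sup>2" using \<nu>0 lam by simp
    have "quad (matern \<sigma> lam c \<nu>) A u \<le> c \<nu> * matern_factor \<sigma> lam \<nu> *
       ((1 / \<nu> + 1 / (real k - \<nu>)) / 4 powr \<nu> * (\<Sum>x\<in>A. \<bar>u x\<bar>)\<^sup>2 * \<delta> powr (2 * \<nu>))"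
      unfolding quad_matern[OF lam \<nu>0(1)]
      using c matern_factor_pos[OF \<sigma> lam \<nu>0(1)] quad_mix_upper[OF \<nu>0 \<kappa> \<delta> ann diam]
      by (intro mult_left_mono) auto
    also have "\<dots> = g \<nu> * (c \<nu> * (\<Sum>x\<in>A. \<bar>u x\<bar>)\<^sup>2 * \<delta> powr (2 * \<nu>))" by (simp add: g_def mult_ac)
    also have "\<dots> \<le> M * (c \<nu> * (\<Sum>x\<in>A. \<bar>u x\<bar>)\<^sup>2 * \<delta> powr (2 * \<nu>))"
      using M(2)[OF \<nu>] c by (intro mult_right_mono) auto
    finally show "quad (matern \<sigma> lam c \<nu>) A u \<le> M * c \<nu> * (\<Sum>x\<in>A. \<bar>u x\<bar>)\<^sup>2 * \<delta> powr (2 * \<nu>)"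
      by (simp add: mult_ac)
  qed
qed

section \<open>The Fourier transform of square-integrable functions\<close>

definition ft :: "(real ^ 'n \<Rightarrow> real) \<Rightarrow> real ^ 'n \<Rightarrow> complex" where
  "ft f \<xi> = (LINT x|lborel. complex_of_real (f x) * cis (- (x \<bullet> \<xi>)))"

lemma cis_measurable [measurable]: "cis \<in> borel_measurable borel"
  by (intro borel_measurable_continuous_onI continuous_on_cis continuous_on_id)

lemma cnj_measurable [measurable]: "cnj \<in> borel_measurable borel"
  by (intro borel_measurable_continuous_onI continuous_on_cnj continuous_on_id)

lemma ft_measurable [measurable]:
  assumes [measurable]: "f \<in> borel_measurable borel"
  shows "ft f \<in> borel_measurable borel"
  unfolding ft_def[abs_def]
  by (rule sigma_finite_measure.borel_measurable_lebesgue_integral[OF sigma_finite_lborel]) measurable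

lemma ft_integrable_integrand:
  assumes "integrable lborel f"
  shows "integrable lborel (\<lambda>x. complex_of_real (f x) * cis (- (x \<bullet> \<xi>)))"
proof (rule Bochner_Integration.integrable_bound[OF assms])
  have [measurable]: "f \<in> borel_measurable borel" using assms by auto
  show "(\<lambda>x. complex_of_real (f x) * cis (- (x \<bullet> \<xi>))) \<in> borel_measurable lborel" by measurable
qed (auto simp: norm_mult)

lemma cmod_ft_le:
  assumes "integrable lborel f"
  shows "cmod (ft f \<xi>) \<le> (LINT x|lborel. \<bar>f x\<bar>)"
proof -
  have "cmod (ft f \<xi>) \<le> (LINT x|lborel. cmod (complex_of_real (f x) * cis (- (x \<bullet> \<xi>))))"
    unfolding ft_def by (rule integral_norm_bound)
  then show ?thesis by (simp add: norm_mult)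
qed

lemma ft_diff:
  assumes "integrable lborel f" "integrable lborel g"
  shows "ft (\<lambda>x. f x - g x) \<xi> = ft f \<xi> - ft g \<xi>"
  using Bochner_Integration.integral_diff[OF ft_integrable_integrand[OF assms(1)] ft_integrable_integrand[OF assms(2)], of \<xi> \<xi>]
  by (simp add: ft_def left_diff_distrib)

text \<open>Fubini's theorem moves the transform from g to h. The damped inversion formula and the
  Plancherel inequality below both start from it.\<close>

lemma ft_multiplication_formula:
  fixes g :: "real ^ 'n \<Rightarrow> real" and h :: "real ^ 'n \<Rightarrow> complex"
  assumes g: "integrable lborel g" and h: "integrable lborel h"
  shows "(LINT \<xi>|lborel. ft g \<xi> * h \<xi>) = (LINT x|lborel. complex_of_real (g x) * (LINT \<xi>|lborel. h \<xi> * cis (- (x \<bullet> \<xi>))))"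
proof -
  have [measurable]: "g \<in> borel_measurable borel" "h \<in> borel_measurable borel" using assms by auto
  let ?F = "\<lambda>\<xi> x. complex_of_real (g x) * cis (- (x \<bullet> \<xi>)) * h \<xi>"
  have i: "integrable (lborel \<Otimes>\<^sub>M lborel) (\<lambda>(\<xi>, x). ?F \<xi> x)"
  proof (rule lborel_pair.Fubini_integrable)
    show "(\<lambda>(\<xi>, x). ?F \<xi> x) \<in> borel_measurable (lborel \<Otimes>\<^sub>M lborel)" by measurable
    have "(LINT x|lborel. norm (?F \<xi> x)) = (LINT x|lborel. \<bar>g x\<bar>) * cmod (h \<xi>)" for \<xi>
      by (simp add: norm_mult)
    then show "integrable lborel (\<lambda>\<xi>. LINT x|lborel. norm (case (\<xi>, x) of (\<xi>, x) \<Rightarrow> ?F \<xi> x))"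
      using h by simp
    show "AE \<xi> in lborel. integrable lborel (\<lambda>x. case (\<xi>, x) of (\<xi>, x) \<Rightarrow> ?F \<xi> x)"
      using ft_integrable_integrand[OF g] by simp
  qed
  have "(LINT \<xi>|lborel. ft g \<xi> * h \<xi>) = (LINT \<xi>|lborel. LINT x|lborel. ?F \<xi> x)"
    by (simp add: ft_def)
  also have "\<dots> = (LINT x|lborel. LINT \<xi>|lborel. ?F \<xi> x)"
    by (rule lborel_pair.Fubini_integral[symmetric, OF i])
  also have "\<dots> = (LINT x|lborel. complex_of_real (g x) * (LINT \<xi>|lborel. h \<xi> * cis (- (x \<bullet> \<xi>))))"
    unfolding integral_mult_right_zero[symmetric] by (simp add: mult_ac)
  finally show ?thesis .
qed

lemma
  fixes f :: "'a::euclidean_space \<Rightarrow> 'b::{banach, second_countable_topology}"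
  assumes c: "c \<noteq> 0" and f: "integrable lborel f"
  shows integrable_lborel_affine: "integrable lborel (\<lambda>x. f (a + c *\<^sub>R x))"
    and integral_lborel_affine: "integral\<^sup>L lborel f = \<bar>c\<bar> ^ DIM('a) *\<^sub>R (LINT x|lborel. f (a + c *\<^sub>R x))"
proof -
  let ?T = "\<lambda>x::'a. a + c *\<^sub>R x"
  have [measurable]: "f \<in> borel_measurable borel" using f by auto
  note l = lborel_affine[OF c, of a]
  have "integrable (density (distr lborel borel ?T) (\<lambda>_. ennreal (\<bar>c\<bar> ^ DIM('a)))) f"
    using f by (subst (asm) l) simp
  then have "integrable (distr lborel borel ?T) (\<lambda>x. \<bar>c\<bar> ^ DIM('a) *\<^sub>R f x)"
    by (subst (asm) integrable_density) auto
  then show "integrable lborel (\<lambda>x. f (a + c *\<^sub>R x))"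
    using c integrable_scaleR_right[of "1 / \<bar>c\<bar> ^ DIM('a)" lborel "\<lambda>x. \<bar>c\<bar> ^ DIM('a) *\<^sub>R f (a + c *\<^sub>R x)"]
    by (subst (asm) integrable_distr_eq) auto
  have "integral\<^sup>L lborel f = integral\<^sup>L (density (distr lborel borel ?T) (\<lambda>_. ennreal (\<bar>c\<bar> ^ DIM('a)))) f"
    by (subst l) simp
  also have "\<dots> = \<bar>c\<bar> ^ DIM('a) *\<^sub>R (LINT x|lborel. f (a + c *\<^sub>R x))"
    by (subst integral_density) (auto simp: integral_distr)
  finally show "integral\<^sup>L lborel f = \<bar>c\<bar> ^ DIM('a) *\<^sub>R (LINT x|lborel. f (a + c *\<^sub>R x))" .
qed

text \<open>Unnormalised convolution with a Gaussian: its limit for \<open>t \<rightarrow> 0\<close> is \<open>(2\<pi>)\<^sup>d g(x)\<close>.\<close>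

definition gauss_conv :: "real \<Rightarrow> (real ^ 'n \<Rightarrow> real) \<Rightarrow> real ^ 'n \<Rightarrow> real" where
  "gauss_conv t g x = (LINT y|lborel. g y * (sqrt (pi / t) ^ CARD('n) * gauss t x y))"

lemma gauss_fourier_pair:
  fixes x y :: "real ^ 'n" assumes "0 < t"
  shows "(LINT \<xi>|lborel. cis (x \<bullet> \<xi>) * complex_of_real (exp (- t * (norm \<xi>)\<^sup>2)) * cis (- (y \<bullet> \<xi>)))
    = complex_of_real (sqrt (pi / t) ^ CARD('n) * gauss t x y)"
proof -
  have "cis (x \<bullet> \<xi>) * complex_of_real (exp (- t * (norm \<xi>)\<^sup>2)) * cis (- (y \<bullet> \<xi>))
     = cis ((x - y) \<bullet> \<xi>) * complex_of_real (exp (- t * (norm \<xi>)\<^sup>2))" for \<xi>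
  proof -
    have "cis ((x - y) \<bullet> \<xi>) = cis (x \<bullet> \<xi>) * cis (- (y \<bullet> \<xi>))"
      by (simp add: cis_mult inner_diff_left)
    then show ?thesis by (simp only: mult_ac)
  qed
  then show ?thesis
    using gauss_fourier[OF assms, of "x - y"] by (simp only: has_bochner_integral_iff gauss_def DIM_cart DIM_real mult_1_right)
qed

lemma integrable_gauss_weight:
  fixes x :: "'a::euclidean_space" assumes "0 < t"
  shows "integrable lborel (\<lambda>\<xi>. cis (x \<bullet> \<xi>) * complex_of_real (exp (- t * (norm \<xi>)\<^sup>2)))"
  using gauss_fourier[OF assms, of x] by (simp only: has_bochner_integral_iff)

text \<open>With the Gaussian damping the inversion integral converges absolutely for every
  integrable g; in exchange it returns a Gaussian mean of g instead of the value at x.\<close>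

lemma ft_gauss_inversion:
  fixes g :: "real ^ 'n \<Rightarrow> real"
  assumes t: "0 < t" and g: "integrable lborel g"
  shows "(LINT \<xi>|lborel. ft g \<xi> * (cis (x \<bullet> \<xi>) * complex_of_real (exp (- t * (norm \<xi>)\<^sup>2)))) = complex_of_real (gauss_conv t g x)"
proof -
  have "(LINT \<xi>|lborel. ft g \<xi> * (cis (x \<bullet> \<xi>) * complex_of_real (exp (- t * (norm \<xi>)\<^sup>2))))
     = (LINT y|lborel. complex_of_real (g y) * complex_of_real (sqrt (pi / t) ^ CARD('n) * gauss t x y))"
    unfolding ft_multiplication_formula[OF g integrable_gauss_weight[OF t]] gauss_fourier_pair[OF t] ..
  also have "\<dots> = complex_of_real (gauss_conv t g x)"
    unfolding gauss_conv_def integral_complex_of_real[symmetric] of_real_mult ..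
  finally show ?thesis .
qed

lemma gauss_weight_total:
  fixes x :: "real ^ 'n" assumes t: "0 < t"
  shows "has_bochner_integral lborel (\<lambda>y. sqrt (pi / t) ^ CARD('n) * gauss t x y) ((2 * pi) ^ CARD('n))"
proof -
  \<comment> \<open>The Gaussian at time t is the weight in \<open>gauss_fourier\<close> with 1/(4
    t) in place of t, and frequency 0 gives its total mass.\<close>
  have "has_bochner_integral lborel (\<lambda>\<xi>::real^'n. (cis (0 \<bullet> \<xi>) * complex_of_real (exp (- (1 / (4 * t)) * (norm \<xi>)\<^sup>2))))
     (complex_of_real (sqrt (pi / (1 / (4 * t))) ^ CARD('n) * exp (- (norm (0::real^'n))\<^sup>2 / (4 * (1 / (4 * t))))))"
    using gauss_fourier[of "1 / (4 * t)" "0::real^'n"] t by (simp only: DIM_cart DIM_real mult_1_right) simp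
  then have b: "has_bochner_integral lborel (\<lambda>\<xi>::real^'n. exp (- (norm \<xi>)\<^sup>2 / (4 * t))) (sqrt (4 * t * pi) ^ CARD('n))"
    unfolding has_bochner_integral_iff
    by (simp add: complex_of_real_integrable_eq integral_complex_of_real mult_ac del: of_real_exp of_real_power of_real_mult)
  have e: "exp (- (norm (- x + 1 *\<^sub>R y))\<^sup>2 / (4 * t)) = gauss t x y" for y
    by (simp add: gauss_def norm_minus_commute)
  have i: "integrable lborel (\<lambda>y. gauss t x y)"
    and v: "(LINT y|lborel. gauss t x y) = sqrt (4 * t * pi) ^ CARD('n)"
    using integrable_lborel_affine[of 1 "\<lambda>\<xi>::real^'n. exp (- (norm \<xi>)\<^sup>2 / (4 * t))" "- x"]
      integral_lborel_affine[of 1 "\<lambda>\<xi>::real^'n. exp (- (norm \<xi>)\<^sup>2 / (4 * t))" "- x"] b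
    unfolding e has_bochner_integral_iff by simp_all
  have "sqrt (pi / t) ^ CARD('n) * sqrt (4 * t * pi) ^ CARD('n) = (2 * pi) ^ CARD('n)"
  proof -
    have "sqrt (pi / t) * sqrt (4 * t * pi) = sqrt ((2 * pi)\<^sup>2)"
      using t by (simp add: real_sqrt_mult[symmetric] power2_eq_square del: real_sqrt_abs real_sqrt_abs2)
    also have "\<dots> = 2 * pi" by (subst real_sqrt_abs) simp
    finally show ?thesis unfolding power_mult_distrib[symmetric] by (simp only:)
  qed
  then show ?thesis using i v by (simp add: has_bochner_integral_iff)
qed


text \<open>Schur's test: the product of |g x| and |g y| is at most half the sum of their squares,
  and the Gaussian weight has mass (2 pi)^d in either variable. Working with nonnegative integrals
  avoids a separate proof that the products are integrable.\<close>

lemma gauss_conv_Schur: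
  fixes g :: "real ^ 'n \<Rightarrow> real"
  assumes t: "0 < t" and [measurable]: "g \<in> borel_measurable borel" and g2: "integrable lborel (\<lambda>x. (g x)\<^sup>2)"
  shows "ennreal \<bar>LINT x|lborel. g x * gauss_conv t g x\<bar> \<le> ennreal ((2 * pi) ^ CARD('n) * (LINT x|lborel. (g x)\<^sup>2))"
proof -
  define w where "w x y = sqrt (pi / t) ^ CARD('n) * gauss t x y" for x y :: "real ^ 'n"
  let ?C = "(2 * pi) ^ CARD('n)" and ?G = "LINT x|lborel. (g x)\<^sup>2"
  have w0: "0 \<le> w x y" for x y using t by (simp add: gauss_def w_def)
  have wm [measurable]: "(\<lambda>p. w (fst p) (snd p)) \<in> borel_measurable (borel \<Otimes>\<^sub>M borel)"
    unfolding gauss_def w_def by measurable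
  have wm1 [measurable]: "w x \<in> borel_measurable borel" for x
    unfolding gauss_def w_def[abs_def] by measurable
  have wm2 [measurable]: "(\<lambda>x. w x y) \<in> borel_measurable borel" for y
    unfolding gauss_def w_def[abs_def] by measurable
  have conv: "gauss_conv t g x = (LINT y|lborel. g y * w x y)" for x
    by (simp add: gauss_conv_def w_def)
  have wy: "(\<integral>\<^sup>+y. ennreal (w x y) \<partial>lborel) = ennreal ?C" for x
    using gauss_weight_total[OF t, of x] w0 unfolding has_bochner_integral_iff w_def[symmetric]
    by (subst nn_integral_eq_integral) auto
  have wx: "(\<integral>\<^sup>+x. ennreal (w x y) \<partial>lborel) = ennreal ?C" for y
    using wy[of y] by (simp add: gauss_def w_def norm_minus_commute)
  have G: "(\<integral>\<^sup>+x. ennreal ((g x)\<^sup>2) \<partial>lborel) = ennreal ?G"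
    by (rule nn_integral_eq_integral[OF g2]) simp
  have m1: "(\<lambda>p. ennreal ((g (fst p))\<^sup>2 / 2 * w (fst p) (snd p))) \<in> borel_measurable (lborel \<Otimes>\<^sub>M lborel)"
    by measurable
  have m2: "(\<lambda>p. ennreal ((g (snd p))\<^sup>2 / 2 * w (fst p) (snd p))) \<in> borel_measurable (lborel \<Otimes>\<^sub>M lborel)"
    by measurable
  \<comment> \<open>A Bochner integral of a non-integrable function is 0, so the norm bound holds in
    either case.\<close>
  have "ennreal \<bar>LINT x|lborel. g x * gauss_conv t g x\<bar> \<le> (\<integral>\<^sup>+x. ennreal (norm (g x * gauss_conv t g x)) \<partial>lborel)"
    using integral_norm_bound_ennreal not_integrable_integral_eq
    by (metis abs_zero bot.extremum ennreal_0 bot_ennreal real_norm_def)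
  also have "\<dots> \<le> (\<integral>\<^sup>+x. \<integral>\<^sup>+y. ennreal (\<bar>g x\<bar> * \<bar>g y\<bar> * w x y) \<partial>lborel \<partial>lborel)"
  proof (rule nn_integral_mono)
    fix x
    have "ennreal \<bar>gauss_conv t g x\<bar> \<le> (\<integral>\<^sup>+y. ennreal (norm (g y * w x y)) \<partial>lborel)"
      unfolding conv
      using integral_norm_bound_ennreal[of lborel "\<lambda>y. g y * w x y"] not_integrable_integral_eq[of lborel "\<lambda>y. g y * w x y"]
      by (cases "integrable lborel (\<lambda>y. g y * w x y)") auto
    then have "ennreal \<bar>g x\<bar> * ennreal \<bar>gauss_conv t g x\<bar> \<le> ennreal \<bar>g x\<bar> * (\<integral>\<^sup>+y. ennreal (norm (g y * w x y)) \<partial>lborel)"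
      by (rule mult_left_mono) simp
    also have "\<dots> = (\<integral>\<^sup>+y. ennreal (\<bar>g x\<bar> * \<bar>g y\<bar> * w x y) \<partial>lborel)"
      using w0 by (subst nn_integral_cmult[symmetric]) (auto simp: ennreal_mult'[symmetric] abs_mult mult.assoc intro!: nn_integral_cong)
    finally show "ennreal (norm (g x * gauss_conv t g x)) \<le> (\<integral>\<^sup>+y. ennreal (\<bar>g x\<bar> * \<bar>g y\<bar> * w x y) \<partial>lborel)"
      by (simp add: abs_mult ennreal_mult')
  qed
  also have "\<dots> \<le> (\<integral>\<^sup>+x. \<integral>\<^sup>+y. ennreal ((g x)\<^sup>2 / 2 * w x y) + ennreal ((g y)\<^sup>2 / 2 * w x y) \<partial>lborel \<partial>lborel)"
  proof (intro nn_integral_mono)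
    fix x y
    have "\<bar>g x\<bar> * \<bar>g y\<bar> \<le> (g x)\<^sup>2 / 2 + (g y)\<^sup>2 / 2"
      using sum_squares_bound[of "\<bar>g x\<bar>" "\<bar>g y\<bar>"] by simp
    from mult_right_mono[OF this w0[of x y]]
    have "ennreal (\<bar>g x\<bar> * \<bar>g y\<bar> * w x y) \<le> ennreal ((g x)\<^sup>2 / 2 * w x y + (g y)\<^sup>2 / 2 * w x y)"
      by (intro ennreal_leI) (simp only: distrib_right)
    also have "\<dots> = ennreal ((g x)\<^sup>2 / 2 * w x y) + ennreal ((g y)\<^sup>2 / 2 * w x y)"
      using w0 by (intro ennreal_plus) auto
    finally show "ennreal (\<bar>g x\<bar> * \<bar>g y\<bar> * w x y) \<le> ennreal ((g x)\<^sup>2 / 2 * w x y) + ennreal ((g y)\<^sup>2 / 2 * w x y)" .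
  qed
  also have "\<dots> = (\<integral>\<^sup>+x. \<integral>\<^sup>+y. ennreal ((g x)\<^sup>2 / 2 * w x y) \<partial>lborel \<partial>lborel) + (\<integral>\<^sup>+x. \<integral>\<^sup>+y. ennreal ((g y)\<^sup>2 / 2 * w x y) \<partial>lborel \<partial>lborel)"
    using m1 m2 by (simp add: nn_integral_add measurable_split_conv)
  also have "(\<integral>\<^sup>+x. \<integral>\<^sup>+y. ennreal ((g y)\<^sup>2 / 2 * w x y) \<partial>lborel \<partial>lborel) = (\<integral>\<^sup>+y. \<integral>\<^sup>+x. ennreal ((g y)\<^sup>2 / 2 * w x y) \<partial>lborel \<partial>lborel)"
    using lborel_pair.Fubini'[of "\<lambda>x y. ennreal ((g y)\<^sup>2 / 2 * w x y)"] m2 by (simp add: case_prod_beta')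
  also have "(\<integral>\<^sup>+x. \<integral>\<^sup>+y. ennreal ((g x)\<^sup>2 / 2 * w x y) \<partial>lborel \<partial>lborel) = (\<integral>\<^sup>+x. ennreal ((g x)\<^sup>2) * ennreal (?C / 2) \<partial>lborel)"
  proof (intro nn_integral_cong)
    fix x
    have "(\<integral>\<^sup>+y. ennreal ((g x)\<^sup>2 / 2 * w x y) \<partial>lborel) = ennreal ((g x)\<^sup>2 / 2) * (\<integral>\<^sup>+y. ennreal (w x y) \<partial>lborel)"
      using w0 by (subst nn_integral_cmult[symmetric]) (simp, simp only: ennreal_mult[OF _ w0] zero_le_divide_iff zero_le_power2 zero_le_numeral simp_thms)
    also have "\<dots> = ennreal ((g x)\<^sup>2) * ennreal (?C / 2)"
      unfolding wy by (simp add: ennreal_mult'[symmetric])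
    finally show "(\<integral>\<^sup>+y. ennreal ((g x)\<^sup>2 / 2 * w x y) \<partial>lborel) = ennreal ((g x)\<^sup>2) * ennreal (?C / 2)" .
  qed
  also have "(\<integral>\<^sup>+y. \<integral>\<^sup>+x. ennreal ((g y)\<^sup>2 / 2 * w x y) \<partial>lborel \<partial>lborel) = (\<integral>\<^sup>+x. ennreal ((g x)\<^sup>2) * ennreal (?C / 2) \<partial>lborel)"
  proof (intro nn_integral_cong)
    fix y
    have "(\<integral>\<^sup>+x. ennreal ((g y)\<^sup>2 / 2 * w x y) \<partial>lborel) = ennreal ((g y)\<^sup>2 / 2) * (\<integral>\<^sup>+x. ennreal (w x y) \<partial>lborel)"
      using w0 by (subst nn_integral_cmult[symmetric]) (simp, simp only: ennreal_mult[OF _ w0] zero_le_divide_iff zero_le_power2 zero_le_numeral simp_thms)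
    also have "\<dots> = ennreal ((g y)\<^sup>2) * ennreal (?C / 2)"
      unfolding wx by (simp add: ennreal_mult'[symmetric])
    finally show "(\<integral>\<^sup>+x. ennreal ((g y)\<^sup>2 / 2 * w x y) \<partial>lborel) = ennreal ((g y)\<^sup>2) * ennreal (?C / 2)" .
  qed
  also have "(\<integral>\<^sup>+x. ennreal ((g x)\<^sup>2) * ennreal (?C / 2) \<partial>lborel) = ennreal (?C / 2 * ?G)"
    by (subst nn_integral_multc) (simp_all add: G ennreal_mult'[symmetric] mult.commute)
  also have "ennreal (?C / 2 * ?G) + ennreal (?C / 2 * ?G) = ennreal (?C * ?G)"
  proof -
    have "ennreal (?C / 2 * ?G + ?C / 2 * ?G) = ennreal (?C / 2 * ?G) + ennreal (?C / 2 * ?G)"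
      by (intro ennreal_plus mult_nonneg_nonneg Bochner_Integration.integral_nonneg) auto
    moreover have "?C / 2 * ?G + ?C / 2 * ?G = ?C * ?G" by simp
    ultimately show ?thesis by (simp only:)
  qed
  finally show ?thesis .
qed

text \<open>Damping by exp (- t |\<xi>|^2) makes the squared transform integrable and, by the
  multiplication formula, its integral equal to that of g against its Gaussian mean, which Schur's
  test bounds uniformly in t. Fatou's lemma then removes the damping. The inequality makes the
  transforms of the truncations a Cauchy family in L^2.\<close>

lemma Plancherel_le:
  fixes g :: "real ^ 'n \<Rightarrow> real"
  assumes g: "integrable lborel g" and g2: "integrable lborel (\<lambda>x. (g x)\<^sup>2)"
  shows "(\<integral>\<^sup>+\<xi>. ennreal ((cmod (ft g \<xi>))\<^sup>2) \<partial>lborel) \<le> ennreal ((2 * pi) ^ CARD('n) * (LINT x|lborel. (g x)\<^sup>2))"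
proof -
  have [measurable]: "g \<in> borel_measurable borel" using g by auto
  let ?B = "LINT x|lborel. \<bar>g x\<bar>"
  have damped: "(\<integral>\<^sup>+\<xi>. ennreal ((cmod (ft g \<xi>))\<^sup>2 * exp (- t * (norm \<xi>)\<^sup>2)) \<partial>lborel) \<le> ennreal ((2 * pi) ^ CARD('n) * (LINT x|lborel. (g x)\<^sup>2))"
    if t: "0 < t" for t
  proof -
    let ?e = "\<lambda>\<xi>::real^'n. complex_of_real (exp (- t * (norm \<xi>)\<^sup>2))"
    have ie: "integrable lborel ?e" using integrable_gauss_weight[OF t, of "0::real^'n"] by simp
    have ih: "integrable lborel (\<lambda>\<xi>. cnj (ft g \<xi>) * ?e \<xi>)"
    proof (rule Bochner_Integration.integrable_bound)
      show "integrable lborel (\<lambda>\<xi>. complex_of_real ?B * ?e \<xi>)" using ie by (rule integrable_mult_right)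
      show "AE \<xi> in lborel. norm (cnj (ft g \<xi>) * ?e \<xi>) \<le> norm (complex_of_real ?B * ?e \<xi>)"
        using cmod_ft_le[OF g] by (intro AE_I2) (auto simp: norm_mult intro!: mult_right_mono order_trans[OF cmod_ft_le[OF g]])
    qed measurable
    have inner: "(LINT \<xi>|lborel. cnj (ft g \<xi>) * ?e \<xi> * cis (- (x \<bullet> \<xi>))) = complex_of_real (gauss_conv t g x)" for x
    proof -
      have "(LINT \<xi>|lborel. cnj (ft g \<xi>) * ?e \<xi> * cis (- (x \<bullet> \<xi>))) = (LINT \<xi>|lborel. cnj (ft g \<xi> * (cis (x \<bullet> \<xi>) * ?e \<xi>)))"
        by (intro Bochner_Integration.integral_cong refl) (simp only: complex_cnj_mult cis_cnj complex_cnj_complex_of_real mult_ac)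
      also have "\<dots> = cnj (LINT \<xi>|lborel. ft g \<xi> * (cis (x \<bullet> \<xi>) * ?e \<xi>))" by (rule Bochner_Integration.integral_cnj)
      also have "\<dots> = complex_of_real (gauss_conv t g x)" by (subst ft_gauss_inversion[OF t g]) (rule complex_cnj_complex_of_real)
      finally show ?thesis .
    qed
    have "complex_of_real (LINT \<xi>|lborel. (cmod (ft g \<xi>))\<^sup>2 * exp (- t * (norm \<xi>)\<^sup>2)) = (LINT \<xi>|lborel. ft g \<xi> * (cnj (ft g \<xi>) * ?e \<xi>))"
      unfolding integral_complex_of_real[symmetric]
      by (intro Bochner_Integration.integral_cong refl) (simp only: of_real_mult complex_norm_square mult.assoc)
    also have "\<dots> = (LINT x|lborel. complex_of_real (g x) * complex_of_real (gauss_conv t g x))"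
      by (simp only: ft_multiplication_formula[OF g ih] inner)
    also have "\<dots> = complex_of_real (LINT x|lborel. g x * gauss_conv t g x)"
      unfolding integral_complex_of_real[symmetric] by (simp only: of_real_mult)
    finally have eq: "(LINT \<xi>|lborel. (cmod (ft g \<xi>))\<^sup>2 * exp (- t * (norm \<xi>)\<^sup>2)) = (LINT x|lborel. g x * gauss_conv t g x)"
      by (simp only: of_real_eq_iff)
    have i2: "integrable lborel (\<lambda>\<xi>. (cmod (ft g \<xi>))\<^sup>2 * exp (- t * (norm \<xi>)\<^sup>2))"
    proof (rule Bochner_Integration.integrable_bound)
      show "integrable lborel (\<lambda>\<xi>. complex_of_real (?B\<^sup>2) * ?e \<xi>)" using ie by (rule integrable_mult_right)
      show "AE \<xi> in lborel. norm ((cmod (ft g \<xi>))\<^sup>2 * exp (- t * (norm \<xi>)\<^sup>2)) \<le> norm (complex_of_real (?B\<^sup>2) * ?e \<xi>)"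
        using cmod_ft_le[OF g] by (intro AE_I2) (auto simp: norm_mult norm_power intro!: mult_right_mono power_mono)
    qed measurable
    have "(\<integral>\<^sup>+\<xi>. ennreal ((cmod (ft g \<xi>))\<^sup>2 * exp (- t * (norm \<xi>)\<^sup>2)) \<partial>lborel) = ennreal (LINT \<xi>|lborel. (cmod (ft g \<xi>))\<^sup>2 * exp (- t * (norm \<xi>)\<^sup>2))"
      by (rule nn_integral_eq_integral[OF i2]) simp
    also have "\<dots> \<le> ennreal \<bar>LINT x|lborel. g x * gauss_conv t g x\<bar>" unfolding eq by (intro ennreal_leI) simp
    also have "\<dots> \<le> ennreal ((2 * pi) ^ CARD('n) * (LINT x|lborel. (g x)\<^sup>2))"
      by (rule gauss_conv_Schur[OF t _ g2]) measurable
    finally show ?thesis .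
  qed
  let ?h = "\<lambda>n \<xi>. ennreal ((cmod (ft g \<xi>))\<^sup>2 * exp (- (1 / real (Suc n)) * (norm \<xi>)\<^sup>2))"
  have lim: "(\<lambda>n. ?h n \<xi>) \<longlonglongrightarrow> ennreal ((cmod (ft g \<xi>))\<^sup>2)" for \<xi>
  proof -
    have "(\<lambda>n. (cmod (ft g \<xi>))\<^sup>2 * exp (- (1 / real (Suc n)) * (norm \<xi>)\<^sup>2)) \<longlonglongrightarrow> (cmod (ft g \<xi>))\<^sup>2 * exp (- 0 * (norm \<xi>)\<^sup>2)"
      by (intro tendsto_intros LIMSEQ_Suc lim_1_over_n)
    then show ?thesis by (intro tendsto_ennrealI) simp
  qed
  have "(\<integral>\<^sup>+\<xi>. ennreal ((cmod (ft g \<xi>))\<^sup>2) \<partial>lborel) = (\<integral>\<^sup>+\<xi>. liminf (\<lambda>n. ?h n \<xi>) \<partial>lborel)"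
    using lim_imp_Liminf[OF _ lim] by (intro nn_integral_cong) simp
  also have "\<dots> \<le> liminf (\<lambda>n. \<integral>\<^sup>+\<xi>. ?h n \<xi> \<partial>lborel)"
    by (rule nn_integral_liminf) measurable
  also have "\<dots> \<le> limsup (\<lambda>n. \<integral>\<^sup>+\<xi>. ?h n \<xi> \<partial>lborel)" by (rule Liminf_le_Limsup) simp
  also have "\<dots> \<le> ennreal ((2 * pi) ^ CARD('n) * (LINT x|lborel. (g x)\<^sup>2))"
    by (intro Limsup_bounded always_eventually allI damped) simp
  finally show ?thesis .
qed

section \<open>Truncations and the Fourier transform as an L^2-limit\<close>

definition ball_cut :: "real \<Rightarrow> (real ^ 'n \<Rightarrow> real) \<Rightarrow> real ^ 'n \<Rightarrow> real" where
  "ball_cut R f x = (if norm x < R then f x else 0)"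

lemma ball_cut_measurable [measurable]:
  assumes [measurable]: "f \<in> borel_measurable borel"
  shows "ball_cut R f \<in> borel_measurable borel"
  unfolding ball_cut_def[abs_def] by measurable

lemma truncated_fourier_conv_ft: "truncated_fourier f R = ft (ball_cut R f)"
  unfolding truncated_fourier_def ft_def set_lebesgue_integral_def
  by (intro ext Bochner_Integration.integral_cong) (auto simp: ball_cut_def indicator_def cis_conv_exp)

lemma square_integrable_measurable: "square_integrable f \<Longrightarrow> f \<in> borel_measurable borel"
  by (simp add: square_integrable_def)

lemma
  fixes f :: "real ^ 'n \<Rightarrow> real"
  assumes f: "square_integrable f"
  shows integrable_cut: "integrable lborel (ball_cut R f)"
    and integrable_cut_diff_square: "integrable lborel (\<lambda>x. (ball_cut R f x - ball_cut S f x)\<^sup>2)"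
    and integrable_tail_square: "integrable lborel (\<lambda>x. (f x - ball_cut R f x)\<^sup>2)"
proof -
  have [measurable]: "f \<in> borel_measurable borel" using f by (rule square_integrable_measurable)
  have f2: "integrable lborel (\<lambda>x. (f x)\<^sup>2)" using f by (simp add: square_integrable_def)
  have "emeasure lborel (ball (0 :: real ^ 'n) R) < \<infinity>" by (rule emeasure_bounded_finite) simp
  then have ib: "integrable lborel (\<lambda>x :: real ^ 'n. indicator (ball 0 R) x :: real)" by (intro integrable_real_indicator) auto
  show "integrable lborel (ball_cut R f)"
  proof (rule Bochner_Integration.integrable_bound[OF Bochner_Integration.integrable_add[OF ib f2]])
    show "AE x in lborel. norm (ball_cut R f x) \<le> norm (indicator (ball 0 R) x + (f x)\<^sup>2)"
    proof (intro AE_I2)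
      fix x
      have "\<bar>f x\<bar> \<le> 1 + (f x)\<^sup>2" using sum_squares_bound[of "\<bar>f x\<bar>" 1] by simp
      then show "norm (ball_cut R f x) \<le> norm (indicator (ball 0 R) x + (f x)\<^sup>2)"
        by (auto simp: ball_cut_def indicator_def)
    qed
  qed measurable
  have sq: "integrable lborel (\<lambda>x. (h x)\<^sup>2)" if "h \<in> borel_measurable borel" "\<And>x. \<bar>h x\<bar> \<le> \<bar>f x\<bar>" for h
  proof (rule Bochner_Integration.integrable_bound[OF f2])
    show "(\<lambda>x. (h x)\<^sup>2) \<in> borel_measurable lborel" using that(1) by simp
    show "AE x in lborel. norm ((h x)\<^sup>2) \<le> norm ((f x)\<^sup>2)"
      using that(2) by (intro AE_I2) (simp add: abs_le_square_iff)
  qed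
  have m: "ball_cut R f \<in> borel_measurable borel" for R by measurable
  show "integrable lborel (\<lambda>x. (ball_cut R f x - ball_cut S f x)\<^sup>2)"
    by (rule sq[OF borel_measurable_diff[OF m m]]) (simp add: ball_cut_def)
  show "integrable lborel (\<lambda>x. (f x - ball_cut R f x)\<^sup>2)"
    by (rule sq[OF borel_measurable_diff[OF _ m]]) (simp_all add: ball_cut_def)
qed

text \<open>The difference of the two truncations lives outside the smaller ball. The bound is
  independent of S, so it persists as S tends to infinity.\<close>

lemma ft_cut_dist:
  fixes f :: "real ^ 'n \<Rightarrow> real"
  assumes f: "square_integrable f" and RS: "R \<le> S"
  shows "(\<integral>\<^sup>+\<xi>. ennreal ((cmod (ft (ball_cut R f) \<xi> - ft (ball_cut S f) \<xi>))\<^sup>2) \<partial>lborel)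
    \<le> ennreal ((2 * pi) ^ CARD('n) * (LINT x|lborel. (f x - ball_cut R f x)\<^sup>2))"
proof -
  have "(\<integral>\<^sup>+\<xi>. ennreal ((cmod (ft (ball_cut R f) \<xi> - ft (ball_cut S f) \<xi>))\<^sup>2) \<partial>lborel)
     \<le> ennreal ((2 * pi) ^ CARD('n) * (LINT x|lborel. (ball_cut R f x - ball_cut S f x)\<^sup>2))"
    unfolding ft_diff[OF integrable_cut[OF f] integrable_cut[OF f], symmetric]
    by (intro Plancherel_le Bochner_Integration.integrable_diff integrable_cut integrable_cut_diff_square f)
  also have "(LINT x|lborel. (ball_cut R f x - ball_cut S f x)\<^sup>2) \<le> (LINT x|lborel. (f x - ball_cut R f x)\<^sup>2)"
    by (intro integral_mono integrable_cut_diff_square integrable_tail_square f) (use RS in \<open>auto simp: ball_cut_def\<close>)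
  finally show ?thesis by (simp add: ennreal_leI mult_left_mono)
qed

lemma tail_tendsto_0:
  fixes f :: "real ^ 'n \<Rightarrow> real"
  assumes f: "square_integrable f"
  shows "((\<lambda>R. LINT x|lborel. (f x - ball_cut R f x)\<^sup>2) \<longlongrightarrow> 0) at_top"
proof -
  have [measurable]: "f \<in> borel_measurable borel" using f by (rule square_integrable_measurable)
  have "((\<lambda>R. LINT x|lborel. (f x - ball_cut R f x)\<^sup>2) \<longlongrightarrow> (LINT x|(lborel :: (real ^ 'n) measure). 0)) at_top"
  proof (rule integral_dominated_convergence_at_top)
    show "integrable lborel (\<lambda>x. (f x)\<^sup>2)" using f by (simp add: square_integrable_def)
    show "AE x in lborel. ((\<lambda>R. (f x - ball_cut R f x)\<^sup>2) \<longlongrightarrow> 0) at_top"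
    proof (intro AE_I2 tendsto_eventually)
      fix x
      show "\<forall>\<^sub>F R in at_top. (f x - ball_cut R f x)\<^sup>2 = 0"
        using eventually_gt_at_top[of "norm x"] by eventually_elim (simp add: ball_cut_def)
    qed
  qed (auto simp: ball_cut_def)
  then show ?thesis by simp
qed

lemma ennreal_sqrt_bound:
  fixes x :: ennreal
  assumes "x\<^sup>2 \<le> ennreal y" "0 \<le> y"
  shows "x \<le> ennreal (sqrt y)"
proof (cases x)
  case (real r)
  then have "r\<^sup>2 \<le> y" using assms by (simp add: ennreal_power)
  then have "r \<le> sqrt y" by (rule real_le_rsqrt)
  then show ?thesis using real by (simp add: ennreal_leI)
next
  case top
  then show ?thesis using assms by (simp add: top_unique)
qed

text \<open>The limit is taken along radii for which the tails decay geometrically; the transforms of the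
  truncations then converge almost everywhere, and Fatou's lemma identifies the \<open>L\<^sup>2\<close>-limit.\<close>

lemma is_fourier_transform_exists:
  fixes f :: "real ^ 'n \<Rightarrow> real"
  assumes f: "square_integrable f"
  shows "\<exists>g. is_fourier_transform f g"
proof -
  have [measurable]: "f \<in> borel_measurable borel" using f by (rule square_integrable_measurable)
  define tail where "tail R = (LINT x|lborel. (f x - ball_cut R f x)\<^sup>2)" for R
  let ?C = "(2 * pi) ^ CARD('n)"
  have tail0: "0 \<le> tail R" for R unfolding tail_def by (intro Bochner_Integration.integral_nonneg) auto
  have "\<exists>N. \<forall>R\<ge>N. tail R \<le> (1 / 4) ^ k" for k :: nat
  proof -
    have "\<forall>\<^sub>F R in at_top. tail R < (1 / 4) ^ k"
      using tail_tendsto_0[OF f] unfolding tail_def by (rule order_tendstoD) simp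
    then show ?thesis unfolding eventually_at_top_linorder by (meson less_imp_le)
  qed
  then obtain N where N: "\<And>k R. N k \<le> R \<Longrightarrow> tail R \<le> (1 / 4) ^ k" by metis
  \<comment> \<open>The sum of moduli makes the radii increasing and no smaller than the thresholds
    N k; the summand k makes them unbounded.\<close>
  define \<rho> where "\<rho> k = (\<Sum>j\<le>k. \<bar>N j\<bar>) + real k" for k
  have \<rho>mono: "\<rho> k \<le> \<rho> (Suc k)" for k by (simp add: \<rho>_def)
  have \<rho>N: "tail (\<rho> k) \<le> (1 / 4) ^ k" for k
  proof (rule N)
    have "N k \<le> \<bar>N k\<bar>" by simp
    also have "\<dots> \<le> (\<Sum>j\<le>k. \<bar>N j\<bar>)" by (rule member_le_sum) auto
    finally show "N k \<le> \<rho> k" by (simp add: \<rho>_def)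
  qed
  have \<rho>k: "real k \<le> \<rho> k" for k by (simp add: \<rho>_def sum_nonneg)
  define T where "T k = ft (ball_cut (\<rho> k) f)" for k
  have [measurable]: "T k \<in> borel_measurable borel" for k unfolding T_def by measurable
  define D where "D k \<xi> = (cmod (T k \<xi> - T (Suc k) \<xi>))\<^sup>2" for k \<xi>
  have [measurable]: "D k \<in> borel_measurable borel" for k unfolding D_def[abs_def] by measurable
  \<comment> \<open>The integrals of \<open>D k\<close> are at most of order 4^(-k). The weight 2^k
    still leaves a convergent series, and pointwise finiteness of the weighted series gives
    increments of \<open>T k\<close> of order 2^(-k/2), which are summable.\<close>
  have Dk: "(\<integral>\<^sup>+\<xi>. ennreal (2 ^ k * D k \<xi>) \<partial>lborel) \<le> ennreal (?C * (1 / 2) ^ k)" for k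
  proof -
    have "(\<integral>\<^sup>+\<xi>. ennreal (2 ^ k * D k \<xi>) \<partial>lborel) = ennreal (2 ^ k) * (\<integral>\<^sup>+\<xi>. ennreal (D k \<xi>) \<partial>lborel)"
      by (subst nn_integral_cmult[symmetric]) (auto simp: ennreal_mult' D_def)
    also have "\<dots> \<le> ennreal (2 ^ k) * ennreal (?C * tail (\<rho> k))"
      unfolding D_def T_def tail_def by (intro mult_left_mono ft_cut_dist f \<rho>mono) simp
    also have "\<dots> \<le> ennreal (2 ^ k) * ennreal (?C * (1 / 4) ^ k)"
      by (intro mult_left_mono ennreal_leI \<rho>N) auto
    also have "\<dots> = ennreal (2 ^ k * (?C * (1 / 4) ^ k))" by (rule ennreal_mult'[symmetric]) simp
    also have "2 ^ k * (?C * (1 / 4) ^ k) = ?C * (2 * (1 / 4)) ^ k" by (simp only: power_mult_distrib mult_ac)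
    finally show ?thesis by simp
  qed
  have "(\<integral>\<^sup>+\<xi>. (\<Sum>k. ennreal (2 ^ k * D k \<xi>)) \<partial>lborel) = (\<Sum>k. \<integral>\<^sup>+\<xi>. ennreal (2 ^ k * D k \<xi>) \<partial>lborel)"
    by (rule nn_integral_suminf) measurable
  also have "\<dots> \<le> (\<Sum>k. ennreal (?C * (1 / 2) ^ k))" by (intro suminf_le Dk summableI)
  also have "\<dots> = ennreal (\<Sum>k. ?C * (1 / 2) ^ k)"
    by (intro suminf_ennreal2 summable_mult summable_geometric) auto
  also have "\<dots> < \<infinity>" by simp
  finally have "(\<integral>\<^sup>+\<xi>. (\<Sum>k. ennreal (2 ^ k * D k \<xi>)) \<partial>lborel) \<noteq> \<infinity>" by simp
  then have ae: "AE \<xi> in lborel. (\<Sum>k. ennreal (2 ^ k * D k \<xi>)) \<noteq> \<infinity>"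
    by (intro nn_integral_noteq_infinite) measurable
  define g where "g \<xi> = lim (\<lambda>k. T k \<xi>)" for \<xi>
  have [measurable]: "g \<in> borel_measurable borel" unfolding g_def[abs_def] by measurable
  have conv: "AE \<xi> in lborel. (\<lambda>k. T k \<xi>) \<longlonglongrightarrow> g \<xi>"
    using ae
  proof eventually_elim
    case (elim \<xi>)
    then obtain M where M: "0 \<le> M" "(\<Sum>k. ennreal (2 ^ k * D k \<xi>)) = ennreal M" 
      by (cases "\<Sum>k. ennreal (2 ^ k * D k \<xi>)") auto
    have s1: "cmod (T (Suc k) \<xi> - T k \<xi>) \<le> sqrt M * (sqrt (1 / 2)) ^ k" for k
    proof -
      have "ennreal (2 ^ k * D k \<xi>) \<le> ennreal M"
        unfolding M(2)[symmetric] using sum_le_suminf[of "\<lambda>k. ennreal (2 ^ k * D k \<xi>)" "{k}"] by simp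
      then have "2 ^ k * D k \<xi> \<le> M" using M(1) by simp
      then have "(cmod (T (Suc k) \<xi> - T k \<xi>))\<^sup>2 \<le> M * (1 / 2) ^ k"
        by (simp add: D_def norm_minus_commute power_divide field_simps)
      then have "cmod (T (Suc k) \<xi> - T k \<xi>) \<le> sqrt (M * (1 / 2) ^ k)" by (rule real_le_rsqrt)
      also have "\<dots> = sqrt M * (sqrt (1 / 2)) ^ k" by (simp only: real_sqrt_mult real_sqrt_power)
      finally show ?thesis .
    qed
    have s2: "summable (\<lambda>k. sqrt M * (sqrt (1 / 2)) ^ k)"
      by (intro summable_mult summable_geometric) (simp add: real_sqrt_divide)
    have "summable (\<lambda>k. T (Suc k) \<xi> - T k \<xi>)"
      by (rule summable_comparison_test'[OF s2 s1])
    then have "(\<lambda>n. \<Sum>k<n. T (Suc k) \<xi> - T k \<xi>) \<longlonglongrightarrow> (\<Sum>k. T (Suc k) \<xi> - T k \<xi>)"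
      by (rule summable_LIMSEQ)
    moreover have "(\<Sum>k<n. T (Suc k) \<xi> - T k \<xi>) = T n \<xi> - T 0 \<xi>" for n
      by (rule sum_lessThan_telescope[of "\<lambda>n. T n \<xi>"])
    ultimately have "(\<lambda>n. T 0 \<xi> + (T n \<xi> - T 0 \<xi>)) \<longlonglongrightarrow> T 0 \<xi> + (\<Sum>k. T (Suc k) \<xi> - T k \<xi>)"
      by (intro tendsto_add tendsto_const) simp
    then have "convergent (\<lambda>n. T n \<xi>)" by (auto simp: convergent_def)
    then show ?case by (simp add: g_def convergent_LIMSEQ_iff)
  qed
  have dist: "(\<integral>\<^sup>+\<xi>. ennreal ((cmod (ft (ball_cut R f) \<xi> - g \<xi>))\<^sup>2) \<partial>lborel) \<le> ennreal (?C * tail R)" for R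
  proof -
    let ?h = "\<lambda>k \<xi>. ennreal ((cmod (ft (ball_cut R f) \<xi> - T k \<xi>))\<^sup>2)"
    have "AE \<xi> in lborel. ennreal ((cmod (ft (ball_cut R f) \<xi> - g \<xi>))\<^sup>2) = liminf (\<lambda>k. ?h k \<xi>)"
      using conv
    proof eventually_elim
      case (elim \<xi>)
      then have "(\<lambda>k. ?h k \<xi>) \<longlonglongrightarrow> ennreal ((cmod (ft (ball_cut R f) \<xi> - g \<xi>))\<^sup>2)"
        by (intro tendsto_ennrealI tendsto_intros)
      from lim_imp_Liminf[OF trivial_limit_sequentially this] show ?case by (rule sym)
    qed
    then have "(\<integral>\<^sup>+\<xi>. ennreal ((cmod (ft (ball_cut R f) \<xi> - g \<xi>))\<^sup>2) \<partial>lborel) = (\<integral>\<^sup>+\<xi>. liminf (\<lambda>k. ?h k \<xi>) \<partial>lborel)"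
      by (rule nn_integral_cong_AE)
    also have "\<dots> \<le> liminf (\<lambda>k. \<integral>\<^sup>+\<xi>. ?h k \<xi> \<partial>lborel)" by (rule nn_integral_liminf) measurable
    also have "\<dots> \<le> limsup (\<lambda>k. \<integral>\<^sup>+\<xi>. ?h k \<xi> \<partial>lborel)" by (rule Liminf_le_Limsup) simp
    also have "\<dots> \<le> ennreal (?C * tail R)"
    proof (rule Limsup_bounded)
      have "\<forall>\<^sub>F k in sequentially. R \<le> real k"
        using eventually_ge_at_top[of "nat \<lceil>R\<rceil>"] by eventually_elim linarith
      then show "\<forall>\<^sub>F k in sequentially. (\<integral>\<^sup>+\<xi>. ?h k \<xi> \<partial>lborel) \<le> ennreal (?C * tail R)"
      proof eventually_elim
        case (elim k)
        then have "R \<le> \<rho> k" using \<rho>k[of k] by linarith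
        then show ?case unfolding T_def tail_def by (rule ft_cut_dist[OF f])
      qed
    qed
    finally show ?thesis .
  qed
  have "((\<lambda>R. \<integral>\<^sup>+\<xi>. ennreal ((cmod (ft (ball_cut R f) \<xi> - g \<xi>))\<^sup>2) \<partial>lborel) \<longlongrightarrow> 0) at_top"
  proof (rule tendsto_sandwich[OF _ _ tendsto_const])
    have "((\<lambda>R. ennreal (?C * tail R)) \<longlongrightarrow> ennreal (?C * 0)) at_top"
      unfolding tail_def by (intro tendsto_ennrealI tendsto_mult tendsto_const tail_tendsto_0 f)
    then show "((\<lambda>R. ennreal (?C * tail R)) \<longlongrightarrow> 0) at_top" by simp
  qed (intro always_eventually allI dist zero_le)+
  then show ?thesis
    unfolding is_fourier_transform_def truncated_fourier_conv_ft by (intro exI[of _ g]) simp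
qed

lemma fourier_transform_is:
  "square_integrable f \<Longrightarrow> is_fourier_transform f (fourier_transform f)"
  unfolding fourier_transform_def by (rule someI_ex[OF is_fourier_transform_exists])

lemma is_fourier_transform_unique:
  fixes f :: "real ^ 'n \<Rightarrow> real"
  assumes f: "square_integrable f" and g: "is_fourier_transform f g" and h: "is_fourier_transform f h"
  shows "AE \<xi> in lborel. g \<xi> = h \<xi>"
proof -
  have [measurable]: "f \<in> borel_measurable borel" "g \<in> borel_measurable borel" "h \<in> borel_measurable borel"
    using assms by (auto simp: is_fourier_transform_def square_integrable_def)
  let ?e = "\<lambda>R k. \<integral>\<^sup>+\<xi>. ennreal ((cmod (ft (ball_cut R f) \<xi> - k \<xi>))\<^sup>2) \<partial>lborel"
  have lim: "((\<lambda>R. 2 * ?e R g + 2 * ?e R h) \<longlongrightarrow> 2 * 0 + 2 * 0) at_top"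
    using g h unfolding is_fourier_transform_def truncated_fourier_conv_ft
    by (intro tendsto_add ennreal_tendsto_cmult) auto
  have le: "(\<integral>\<^sup>+\<xi>. ennreal ((cmod (g \<xi> - h \<xi>))\<^sup>2) \<partial>lborel) \<le> 2 * ?e R g + 2 * ?e R h" for R
  proof -
    have "(\<integral>\<^sup>+\<xi>. ennreal ((cmod (g \<xi> - h \<xi>))\<^sup>2) \<partial>lborel) \<le>
      (\<integral>\<^sup>+\<xi>. 2 * ennreal ((cmod (ft (ball_cut R f) \<xi> - g \<xi>))\<^sup>2) + 2 * ennreal ((cmod (ft (ball_cut R f) \<xi> - h \<xi>))\<^sup>2) \<partial>lborel)"
    proof (rule nn_integral_mono)
      fix \<xi>
      let ?a = "cmod (ft (ball_cut R f) \<xi> - g \<xi>)" and ?b = "cmod (ft (ball_cut R f) \<xi> - h \<xi>)"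
      have "cmod (g \<xi> - h \<xi>) \<le> ?a + ?b"
        using norm_triangle_ineq4[of "ft (ball_cut R f) \<xi> - h \<xi>" "ft (ball_cut R f) \<xi> - g \<xi>"] by simp
      then have "(cmod (g \<xi> - h \<xi>))\<^sup>2 \<le> (?a + ?b)\<^sup>2" by (intro power_mono) auto
      also have "\<dots> \<le> 2 * ?a\<^sup>2 + 2 * ?b\<^sup>2" using sum_squares_bound[of ?a ?b] by (simp add: power2_sum)
      finally have "ennreal ((cmod (g \<xi> - h \<xi>))\<^sup>2) \<le> ennreal (2 * ?a\<^sup>2 + 2 * ?b\<^sup>2)" by (rule ennreal_leI)
      also have "\<dots> = 2 * ennreal (?a\<^sup>2) + 2 * ennreal (?b\<^sup>2)" by (simp add: ennreal_mult')
      finally show "ennreal ((cmod (g \<xi> - h \<xi>))\<^sup>2) \<le> 2 * ennreal (?a\<^sup>2) + 2 * ennreal (?b\<^sup>2)" .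
    qed
    also have "\<dots> = 2 * ?e R g + 2 * ?e R h" by (simp add: nn_integral_add nn_integral_cmult)
    finally show ?thesis .
  qed
  have "(\<integral>\<^sup>+\<xi>. ennreal ((cmod (g \<xi> - h \<xi>))\<^sup>2) \<partial>lborel) \<le> 0"
    using tendsto_lowerbound[OF lim always_eventually[OF allI[OF le]]] by simp
  then have "(\<integral>\<^sup>+\<xi>. ennreal ((cmod (g \<xi> - h \<xi>))\<^sup>2) \<partial>lborel) = 0" by simp
  then have "AE \<xi> in lborel. ennreal ((cmod (g \<xi> - h \<xi>))\<^sup>2) = 0" by (subst (asm) nn_integral_0_iff_AE) auto
  then show ?thesis by eventually_elim simp
qed

lemma integrable_times_gauss:
  fixes f :: "real ^ 'n \<Rightarrow> real"
  assumes f: "square_integrable f" and t: "0 < t"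
  shows "integrable lborel (\<lambda>y. f y * gauss t x y)"
proof -
  have [measurable]: "f \<in> borel_measurable borel" using f by (rule square_integrable_measurable)
  have [measurable]: "gauss t x \<in> borel_measurable borel" unfolding gauss_def[abs_def] by measurable
  have "integrable lborel (\<lambda>y. sqrt (pi / t) ^ CARD('n) * gauss t x y)"
    using gauss_weight_total[OF t, of x] by (simp add: has_bochner_integral_iff)
  then have g: "integrable lborel (gauss t x)" using t by (simp add: integrable_mult_right_iff)
  have f2: "integrable lborel (\<lambda>y. (f y)\<^sup>2)" using f by (simp add: square_integrable_def)
  show ?thesis
  proof (rule Bochner_Integration.integrable_bound[OF Bochner_Integration.integrable_add[OF g f2]])
    show "AE y in lborel. norm (f y * gauss t x y) \<le> norm (gauss t x y + (f y)\<^sup>2)"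
    proof (intro AE_I2)
      fix y
      have g1: "0 \<le> gauss t x y" "gauss t x y \<le> 1" using t by (auto simp: gauss_def)
      have "\<bar>f y\<bar> * gauss t x y \<le> (1 + (f y)\<^sup>2) * gauss t x y"
        using sum_squares_bound[of "\<bar>f y\<bar>" 1] g1 by (intro mult_right_mono) auto
      also have "\<dots> \<le> gauss t x y + (f y)\<^sup>2" using g1 mult_left_le[of "gauss t x y" "(f y)\<^sup>2"] by (simp add: distrib_right)
      finally show "norm (f y * gauss t x y) \<le> norm (gauss t x y + (f y)\<^sup>2)" using g1 by (simp add: abs_mult)
    qed
  qed measurable
qed

text \<open>Near x the continuity of f controls the integrand. Away from x, where f may be
  unbounded, the Gaussian at time t \<le> 1 is dominated by exp (- \<delta>^2/(8 t)) times the fixed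
  Gaussian at time 2, against which f is integrable; the exponential factor beats the growth of the
  normalisation as t tends to 0.\<close>

lemma gauss_conv_tendsto:
  fixes f :: "real ^ 'n \<Rightarrow> real"
  assumes f: "square_integrable f" and cont: "continuous_on UNIV f"
  shows "((\<lambda>t. gauss_conv t f x) \<longlongrightarrow> (2 * pi) ^ CARD('n) * f x) (at_right 0)"
proof (rule tendstoI)
  fix e :: real assume e: "0 < e"
  let ?C = "(2 * pi) ^ CARD('n)"
  have C: "0 < ?C" by simp
  have [measurable]: "f \<in> borel_measurable borel" using f by (rule square_integrable_measurable)
  have [measurable]: "gauss t x \<in> borel_measurable borel" for t unfolding gauss_def[abs_def] by measurable
  have "isCont f x" using cont by (simp add: continuous_on_eq_continuous_at)
  then obtain \<delta> where \<delta>: "0 < \<delta>" "\<And>y. dist y x < \<delta> \<Longrightarrow> dist (f y) (f x) < e / (2 * ?C)"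
    using e C unfolding continuous_at_eps_delta by (metis divide_pos_pos mult_pos_pos zero_less_numeral)
  define M where "M = (LINT y|lborel. (\<bar>f y\<bar> + \<bar>f x\<bar>) * gauss 2 x y)"
  have g: "integrable lborel (gauss t x)" if "0 < t" for t
    using gauss_weight_total[OF that, of x] that by (simp add: has_bochner_integral_iff integrable_mult_right_iff)
  have iM: "integrable lborel (\<lambda>y. (\<bar>f y\<bar> + \<bar>f x\<bar>) * gauss 2 x y)"
  proof -
    have "integrable lborel (\<lambda>y. \<bar>f y * gauss 2 x y\<bar>)" by (intro integrable_abs integrable_times_gauss f) simp
    then have "integrable lborel (\<lambda>y. \<bar>f y\<bar> * gauss 2 x y)" by (simp add: abs_mult gauss_def)
    then show ?thesis using g[of 2] by (simp add: distrib_right)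
  qed
  define \<eta> where "\<eta> t = sqrt (pi / t) ^ CARD('n) * exp (- (\<delta>\<^sup>2 / 8) / t)" for t
  have \<eta>: "(\<eta> \<longlongrightarrow> 0) (at_right 0)"
  proof -
    have "0 < \<delta>\<^sup>2 / 8" using \<delta> by simp
    then show ?thesis unfolding \<eta>_def by real_asymp
  qed
  then have "((\<lambda>t. \<eta> t * M) \<longlongrightarrow> 0 * M) (at_right 0)" by (intro tendsto_mult tendsto_const)
  then have "\<forall>\<^sub>F t in at_right 0. \<eta> t * M < e / 2" using e by (intro order_tendstoD(2)) auto
  moreover have "\<forall>\<^sub>F t in at_right (0::real). 0 < t \<and> t \<le> 1"
    using eventually_at_right_real[of 0 1] by (auto elim!: eventually_mono)
  ultimately show "\<forall>\<^sub>F t in at_right 0. dist (gauss_conv t f x) (?C * f x) < e"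
  proof eventually_elim
    case (elim t)
    then have t: "0 < t" "t \<le> 1" by auto
    let ?w = "\<lambda>y. sqrt (pi / t) ^ CARD('n) * gauss t x y"
    have w: "integrable lborel ?w" "integral\<^sup>L lborel ?w = ?C"
      using gauss_weight_total[OF t(1), of x] by (auto simp: has_bochner_integral_iff)
    have w0: "0 \<le> ?w y" for y using t by (simp add: gauss_def)
    have fw: "integrable lborel (\<lambda>y. f y * ?w y)"
      using integrable_mult_right[OF integrable_times_gauss[OF f t(1), of x], of "sqrt (pi / t) ^ CARD('n)"] by (simp add: mult_ac)
    have "gauss_conv t f x - ?C * f x = (LINT y|lborel. f y * ?w y) - (LINT y|lborel. f x * ?w y)"
      using w(2) by (simp add: gauss_conv_def)
    also have "\<dots> = (LINT y|lborel. (f y - f x) * ?w y)"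
      unfolding left_diff_distrib by (rule Bochner_Integration.integral_diff[symmetric, OF fw integrable_mult_right[OF w(1)]])
    finally have "\<bar>gauss_conv t f x - ?C * f x\<bar> \<le> (LINT y|lborel. \<bar>(f y - f x) * ?w y\<bar>)"
      by (simp only: integral_abs_bound)
    also have "\<dots> \<le> (LINT y|lborel. e / (2 * ?C) * ?w y + \<eta> t * ((\<bar>f y\<bar> + \<bar>f x\<bar>) * gauss 2 x y))"
    proof (rule integral_mono)
      show "integrable lborel (\<lambda>y. \<bar>(f y - f x) * ?w y\<bar>)"
        unfolding left_diff_distrib by (intro integrable_abs Bochner_Integration.integrable_diff fw integrable_mult_right[OF w(1)])
      show "integrable lborel (\<lambda>y. e / (2 * ?C) * ?w y + \<eta> t * ((\<bar>f y\<bar> + \<bar>f x\<bar>) * gauss 2 x y))"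
        by (intro Bochner_Integration.integrable_add integrable_mult_right[OF w(1)] integrable_mult_right[OF iM])
      fix y
      show "\<bar>(f y - f x) * ?w y\<bar> \<le> e / (2 * ?C) * ?w y + \<eta> t * ((\<bar>f y\<bar> + \<bar>f x\<bar>) * gauss 2 x y)"
      proof (cases "dist y x < \<delta>")
        case True
        have "\<bar>f y - f x\<bar> * ?w y \<le> e / (2 * ?C) * ?w y"
          using \<delta>(2)[OF True] w0 by (intro mult_right_mono) (auto simp: dist_real_def)
        moreover have "0 \<le> \<eta> t * ((\<bar>f y\<bar> + \<bar>f x\<bar>) * gauss 2 x y)"
          using t by (simp add: \<eta>_def gauss_def)
        ultimately show ?thesis unfolding abs_mult[of "f y - f x" "?w y"] abs_of_nonneg[OF w0] by linarith
      next
        case False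
        let ?r = "norm (x - y)"
        have r: "\<delta>\<^sup>2 \<le> ?r\<^sup>2" using False \<delta>(1) by (intro power_mono) (auto simp: dist_norm norm_minus_commute)
        have "\<delta>\<^sup>2 / 8 / t + ?r\<^sup>2 / 8 \<le> ?r\<^sup>2 / 8 / t + ?r\<^sup>2 / 8 / t"
        proof (intro add_mono divide_right_mono)
          show "?r\<^sup>2 / 8 \<le> ?r\<^sup>2 / 8 / t" using t by (simp add: pos_le_divide_eq mult_left_le)
        qed (use r t in auto)
        also have "\<dots> = ?r\<^sup>2 / (4 * t)" by simp
        finally have "gauss t x y \<le> exp (- (\<delta>\<^sup>2 / 8) / t) * gauss 2 x y"
          by (simp add: gauss_def exp_add[symmetric])
        then have wy: "?w y \<le> \<eta> t * gauss 2 x y"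
          unfolding \<eta>_def mult.assoc by (intro mult_left_mono) (use t in auto)
        have "\<bar>f y - f x\<bar> * ?w y \<le> (\<bar>f y\<bar> + \<bar>f x\<bar>) * (\<eta> t * gauss 2 x y)"
          by (intro mult_mono wy) (use w0 in auto)
        moreover have "0 \<le> e / (2 * ?C) * ?w y" using e w0[of y] by simp
        ultimately show ?thesis unfolding abs_mult[of "f y - f x" "?w y"] abs_of_nonneg[OF w0] by (simp add: mult_ac)
      qed
    qed
    also have "\<dots> = e / (2 * ?C) * ?C + \<eta> t * M"
      using w iM by (subst Bochner_Integration.integral_add) (auto simp: M_def)
    also have "\<dots> = e / 2 + \<eta> t * M" using C by simp
    also have "\<dots> < e" using elim by simp
    finally show ?case by (simp add: dist_real_def)
  qed
qed

section \<open>Point evaluation in Sobolev spaces\<close>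

lemma bessel_potential_mixture:
  fixes \<alpha> s :: real
  assumes "0 < \<alpha>" "0 < s"
  shows "(\<integral>\<^sup>+t. ennreal (indicator {0<..} t * (t powr (\<alpha> - 1) * exp (- s * t))) \<partial>lborel) = ennreal (Gamma \<alpha> * s powr (- \<alpha>))"
proof -
  have "(\<integral>\<^sup>+t. ennreal (indicator {0<..} t *\<^sub>R (t powr (\<alpha> - 1) * exp (- s * t))) \<partial>lborel)
     = ennreal (LINT t|lborel. indicator {0<..} t *\<^sub>R (t powr (\<alpha> - 1) * exp (- s * t)))"
    by (rule nn_integral_eq_integral)
       (use set_integrable_gamma_kernel(1)[OF assms] in \<open>auto simp: set_integrable_def\<close>)
  then show ?thesis using set_integrable_gamma_kernel(2)[OF assms] by (simp add: set_lebesgue_integral_def)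
qed

text \<open>The Gamma integral writes (\<kappa> + |\<xi>|^2)^(- \<alpha>) as a mixture of Gaussians
  in \<xi>, and Tonelli's theorem exchanges the integrals. The Gaussian Fourier integral contributes
  t^(- d/2), which lowers the order from \<alpha> to \<alpha> - d/2. This is the spectral density of
  the Matern kernel and the source of the shift by d/2 between kernel order and Sobolev
  order.\<close>

lemma expsum_bessel_potential:
  fixes A :: "(real ^ 'n) set"
  assumes \<alpha>: "real CARD('n) / 2 < \<alpha>" and \<kappa>: "0 < \<kappa>"
  shows "(\<integral>\<^sup>+\<xi>. ennreal ((cmod (expsum A u \<xi>))\<^sup>2 * (\<kappa> + (norm \<xi>)\<^sup>2) powr (- \<alpha>)) \<partial>lborel)
    = ennreal (sqrt pi ^ CARD('n) / Gamma \<alpha> * quad (mix_kernel (\<alpha> - real CARD('n) / 2) \<kappa>) A u)"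
proof -
  define d where "d = real CARD('n)"
  have \<alpha>0: "0 < \<alpha>" using \<alpha> by (meson divide_nonneg_pos of_nat_0_le_iff order_le_less_trans zero_less_numeral)
  have a: "0 < \<alpha> - d / 2" using \<alpha> by (simp add: d_def)
  have \<Gamma>: "0 < Gamma \<alpha>" using \<alpha>0 by (rule Gamma_real_pos)
  let ?S = "\<lambda>\<xi>. (cmod (expsum A u \<xi>))\<^sup>2"
  let ?F = "\<lambda>\<xi> t. ennreal (?S \<xi> * (indicator {0<..} t * (t powr (\<alpha> - 1) * exp (- (\<kappa> + (norm \<xi>)\<^sup>2) * t))))"
  have "ennreal (Gamma \<alpha>) * (\<integral>\<^sup>+\<xi>. ennreal (?S \<xi> * (\<kappa> + (norm \<xi>)\<^sup>2) powr (- \<alpha>)) \<partial>lborel)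
    = (\<integral>\<^sup>+\<xi>. \<integral>\<^sup>+t. ?F \<xi> t \<partial>lborel \<partial>lborel)"
  proof (subst nn_integral_cmult[symmetric])
    show "(\<integral>\<^sup>+\<xi>. ennreal (Gamma \<alpha>) * ennreal (?S \<xi> * (\<kappa> + (norm \<xi>)\<^sup>2) powr (- \<alpha>)) \<partial>lborel)
      = (\<integral>\<^sup>+\<xi>. \<integral>\<^sup>+t. ?F \<xi> t \<partial>lborel \<partial>lborel)"
    proof (rule nn_integral_cong)
      fix \<xi> :: "real ^ 'n"
      have s: "0 < \<kappa> + (norm \<xi>)\<^sup>2" using \<kappa> by (simp add: add_pos_nonneg)
      have "(\<integral>\<^sup>+t. ?F \<xi> t \<partial>lborel) = ennreal (?S \<xi>) * (\<integral>\<^sup>+t. ennreal (indicator {0<..} t * (t powr (\<alpha> - 1) * exp (- (\<kappa> + (norm \<xi>)\<^sup>2) * t))) \<partial>lborel)"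
        by (subst nn_integral_cmult[symmetric]) (auto simp: ennreal_mult'[symmetric])
      also have "\<dots> = ennreal (Gamma \<alpha>) * ennreal (?S \<xi> * (\<kappa> + (norm \<xi>)\<^sup>2) powr (- \<alpha>))"
        unfolding bessel_potential_mixture[OF \<alpha>0 s] using \<Gamma> by (simp add: ennreal_mult'[symmetric] mult_ac)
      finally show "ennreal (Gamma \<alpha>) * ennreal (?S \<xi> * (\<kappa> + (norm \<xi>)\<^sup>2) powr (- \<alpha>)) = (\<integral>\<^sup>+t. ?F \<xi> t \<partial>lborel)" ..
    qed
  qed measurable
  also have "\<dots> = (\<integral>\<^sup>+t. \<integral>\<^sup>+\<xi>. ?F \<xi> t \<partial>lborel \<partial>lborel)"
  proof -
    have "(\<lambda>p. ?F (fst p) (snd p)) \<in> borel_measurable (lborel \<Otimes>\<^sub>M lborel)" by measurable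
    then show ?thesis by (intro lborel_pair.Fubini'[symmetric]) (simp add: case_prod_beta')
  qed
  also have "\<dots> = (\<integral>\<^sup>+t. ennreal (sqrt pi ^ CARD('n) * (indicator {0<..} t * (t powr (\<alpha> - d / 2 - 1) * exp (- \<kappa> * t) * quad (gauss t) A u))) \<partial>lborel)"
  proof (rule nn_integral_cong)
    fix t :: real
    show "(\<integral>\<^sup>+\<xi>. ?F \<xi> t \<partial>lborel) = ennreal (sqrt pi ^ CARD('n) * (indicator {0<..} t * (t powr (\<alpha> - d / 2 - 1) * exp (- \<kappa> * t) * quad (gauss t) A u)))"
    proof (cases "0 < t")
      case True
      have "(\<integral>\<^sup>+\<xi>. ?F \<xi> t \<partial>lborel) = (\<integral>\<^sup>+\<xi>. ennreal (t powr (\<alpha> - 1) * exp (- \<kappa> * t)) * ennreal (?S \<xi> * exp (- t * (norm \<xi>)\<^sup>2)) \<partial>lborel)"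
      proof (rule nn_integral_cong)
        fix \<xi> :: "real ^ 'n"
        have "exp (- (\<kappa> + (norm \<xi>)\<^sup>2) * t) = exp (- \<kappa> * t) * exp (- t * (norm \<xi>)\<^sup>2)"
          unfolding exp_add[symmetric] by (simp add: algebra_simps)
        then have "?F \<xi> t = ennreal ((t powr (\<alpha> - 1) * exp (- \<kappa> * t)) * (?S \<xi> * exp (- t * (norm \<xi>)\<^sup>2)))"
          using True by (simp add: mult_ac)
        also have "\<dots> = ennreal (t powr (\<alpha> - 1) * exp (- \<kappa> * t)) * ennreal (?S \<xi> * exp (- t * (norm \<xi>)\<^sup>2))"
          by (rule ennreal_mult') simp
        finally show "?F \<xi> t = ennreal (t powr (\<alpha> - 1) * exp (- \<kappa> * t)) * ennreal (?S \<xi> * exp (- t * (norm \<xi>)\<^sup>2))" .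
      qed
      also have "\<dots> = ennreal (t powr (\<alpha> - 1) * exp (- \<kappa> * t)) * (\<integral>\<^sup>+\<xi>. ennreal (?S \<xi> * exp (- t * (norm \<xi>)\<^sup>2)) \<partial>lborel)"
        by (subst nn_integral_cmult) auto
      also have "(\<integral>\<^sup>+\<xi>. ennreal (?S \<xi> * exp (- t * (norm \<xi>)\<^sup>2)) \<partial>lborel) = ennreal (sqrt (pi / t) ^ CARD('n) * quad (gauss t) A u)"
        using gauss_quad_fourier[OF True, of A u] unfolding has_bochner_integral_iff
        by (subst nn_integral_eq_integral) auto
      also have "ennreal (t powr (\<alpha> - 1) * exp (- \<kappa> * t)) * ennreal (sqrt (pi / t) ^ CARD('n) * quad (gauss t) A u)
         = ennreal (t powr (\<alpha> - 1) * exp (- \<kappa> * t) * (sqrt (pi / t) ^ CARD('n) * quad (gauss t) A u))"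
        by (rule ennreal_mult'[symmetric]) simp
      also have "sqrt (pi / t) ^ CARD('n) = sqrt pi ^ CARD('n) * t powr (- d / 2)"
      proof -
        have "sqrt t ^ CARD('n) = t powr (d / 2)"
        proof -
          have "sqrt t ^ CARD('n) = sqrt t powr d" using True by (simp add: powr_realpow d_def)
          also have "\<dots> = (t powr (1 / 2)) powr d" using True by (simp add: powr_half_sqrt)
          finally show ?thesis by (simp add: powr_powr)
        qed
        moreover have "sqrt (pi / t) ^ CARD('n) = sqrt pi ^ CARD('n) / sqrt t ^ CARD('n)"
          by (simp only: real_sqrt_divide power_divide)
        moreover have "t powr (- d / 2) = 1 / t powr (d / 2)" using powr_minus_divide[of t "d / 2"] by simp
        ultimately show ?thesis by simp
      qed
      also have "t powr (\<alpha> - 1) * exp (- \<kappa> * t) * (sqrt pi ^ CARD('n) * t powr (- d / 2) * quad (gauss t) A u)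
         = sqrt pi ^ CARD('n) * ((t powr (\<alpha> - 1) * t powr (- d / 2)) * exp (- \<kappa> * t) * quad (gauss t) A u)" by (simp only: mult_ac)
      also have "t powr (\<alpha> - 1) * t powr (- d / 2) = t powr (\<alpha> - d / 2 - 1)"
      proof -
        have "\<alpha> - 1 + - d / 2 = \<alpha> - d / 2 - 1" by simp
        then show ?thesis using powr_add[of t "\<alpha> - 1" "- d / 2"] by (simp only:)
      qed
      finally show ?thesis using True by simp
    qed simp
  qed
  also have "\<dots> = ennreal (sqrt pi ^ CARD('n) * quad (mix_kernel (\<alpha> - d / 2) \<kappa>) A u)"
  proof -
    let ?h = "\<lambda>t. indicator {0<..} t * (t powr (\<alpha> - d / 2 - 1) * exp (- \<kappa> * t) * quad (gauss t) A u)"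
    have "integrable lborel ?h"
      using set_integrable_quad_mix[OF a \<kappa>, of A u] by (simp add: set_integrable_def)
    moreover have "integral\<^sup>L lborel ?h = quad (mix_kernel (\<alpha> - d / 2) \<kappa>) A u"
      using quad_mix[OF a \<kappa>, of A u] by (simp add: set_lebesgue_integral_def)
    moreover have "0 \<le> ?h t" for t
      using quad_gauss_nonneg[of t A u] by (simp add: indicator_def)
    ultimately show ?thesis
      by (subst nn_integral_eq_integral) auto
  qed
  finally have "ennreal (1 / Gamma \<alpha>) * (ennreal (Gamma \<alpha>) * (\<integral>\<^sup>+\<xi>. ennreal (?S \<xi> * (\<kappa> + (norm \<xi>)\<^sup>2) powr (- \<alpha>)) \<partial>lborel))
    = ennreal (1 / Gamma \<alpha>) * ennreal (sqrt pi ^ CARD('n) * quad (mix_kernel (\<alpha> - d / 2) \<kappa>) A u)" by simp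
  also have "ennreal (1 / Gamma \<alpha>) * (ennreal (Gamma \<alpha>) * X) = X" for X
    using \<Gamma> by (simp add: mult.assoc[symmetric] ennreal_mult'[symmetric])
  also have "ennreal (1 / Gamma \<alpha>) * ennreal (sqrt pi ^ CARD('n) * quad (mix_kernel (\<alpha> - d / 2) \<kappa>) A u)
     = ennreal (sqrt pi ^ CARD('n) / Gamma \<alpha> * quad (mix_kernel (\<alpha> - d / 2) \<kappa>) A u)"
    using \<Gamma> by (subst ennreal_mult'[symmetric]) auto
  finally show ?thesis by (simp add: d_def)
qed

lemma bessel_potential_integrable:
  assumes "real CARD('n) / 2 < \<alpha>"
  shows "(\<integral>\<^sup>+(\<xi>::real^'n). ennreal ((1 + (norm \<xi>)\<^sup>2) powr (- \<alpha>)) \<partial>lborel) < \<infinity>"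
  \<comment> \<open>For a single point with coefficient 1 the exponential sum has modulus 1.\<close>
  using expsum_bessel_potential[OF assms, of 1 "{0::real^'n}" "\<lambda>_. 1"]
  by (simp add: expsum_def)

lemma quad_mix_nonneg:
  fixes A :: "'a::euclidean_space set"
  assumes "0 < \<nu>" "0 < \<kappa>"
  shows "0 \<le> quad (mix_kernel \<nu> \<kappa>) A u"
  unfolding quad_mix[OF assms] set_lebesgue_integral_def
  by (intro Bochner_Integration.integral_nonneg) (auto simp: indicator_def quad_gauss_nonneg)

text \<open>Exchanges the 1 in the Sobolev weight for the constant \<kappa> of the kernel.\<close>

lemma shift_powr_le:
  fixes s \<kappa> \<alpha> :: real
  assumes "0 \<le> s" "0 < \<kappa>" "0 < \<alpha>"
  shows "(1 + s) powr (- \<alpha>) \<le> max 1 \<kappa> powr \<alpha> * (\<kappa> + s) powr (- \<alpha>)"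
proof -
  have "\<kappa> + s \<le> max 1 \<kappa> * (1 + s)"
    using assms mult_right_mono[of 1 "max 1 \<kappa>" s] by (simp add: distrib_left)
  then have "(max 1 \<kappa> * (1 + s)) powr (- \<alpha>) \<le> (\<kappa> + s) powr (- \<alpha>)"
    using assms by (intro powr_mono2') auto
  then have "max 1 \<kappa> powr \<alpha> * (max 1 \<kappa> * (1 + s)) powr (- \<alpha>) \<le> max 1 \<kappa> powr \<alpha> * (\<kappa> + s) powr (- \<alpha>)"
    by (intro mult_left_mono) auto
  moreover have "max 1 \<kappa> powr \<alpha> * (max 1 \<kappa> * (1 + s)) powr (- \<alpha>) = (1 + s) powr (- \<alpha>)"
    using assms by (simp add: powr_mult powr_minus mult.assoc[symmetric])
  ultimately show ?thesis by simp
qed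

text \<open>Replacing \<open>f\<close> by its Gaussian means avoids pointwise Fourier inversion.\<close>

lemma sobolev_quad_bound:
  fixes f :: "real ^ 'n \<Rightarrow> real" and A :: "(real ^ 'n) set"
  assumes \<alpha>: "real CARD('n) / 2 < \<alpha>" and \<kappa>: "0 < \<kappa>"
    and f: "square_integrable f" and cont: "continuous_on UNIV f"
    and ft: "is_fourier_transform f g"
    and E: "(\<integral>\<^sup>+\<xi>. ennreal ((1 + (norm \<xi>)\<^sup>2) powr \<alpha> * (cmod (g \<xi>))\<^sup>2) \<partial>lborel) \<le> ennreal E" and E0: "0 \<le> E"
    and fin: "finite A"
  shows "(\<Sum>x\<in>A. u x * f x)\<^sup>2 \<le>
    max 1 \<kappa> powr \<alpha> * sqrt pi ^ CARD('n) / Gamma \<alpha> / ((2 * pi) ^ CARD('n))\<^sup>2 * E * quad (mix_kernel (\<alpha> - real CARD('n) / 2) \<kappa>) A u"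
proof -
  have [measurable]: "f \<in> borel_measurable borel" "g \<in> borel_measurable borel"
    using f ft by (auto simp: is_fourier_transform_def square_integrable_def)
  have \<alpha>0: "0 < \<alpha>" using \<alpha> by (meson divide_nonneg_pos of_nat_0_le_iff order_le_less_trans zero_less_numeral)
  let ?S = "\<lambda>\<xi>. cmod (expsum A u \<xi>)"
  let ?C = "(2 * pi) ^ CARD('n)"
  define W where "W = max 1 \<kappa> powr \<alpha> * (sqrt pi ^ CARD('n) / Gamma \<alpha> * quad (mix_kernel (\<alpha> - real CARD('n) / 2) \<kappa>) A u)"
  have W0: "0 \<le> W"
    unfolding W_def using \<alpha> \<kappa> Gamma_real_pos[OF \<alpha>0] by (intro mult_nonneg_nonneg quad_mix_nonneg) auto
  have W: "(\<integral>\<^sup>+\<xi>. ennreal ((?S \<xi>)\<^sup>2 * (1 + (norm \<xi>)\<^sup>2) powr (- \<alpha>)) \<partial>lborel) \<le> ennreal W"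
  proof -
    have "(\<integral>\<^sup>+\<xi>. ennreal ((?S \<xi>)\<^sup>2 * (1 + (norm \<xi>)\<^sup>2) powr (- \<alpha>)) \<partial>lborel)
      \<le> (\<integral>\<^sup>+\<xi>. ennreal (max 1 \<kappa> powr \<alpha>) * ennreal ((?S \<xi>)\<^sup>2 * (\<kappa> + (norm \<xi>)\<^sup>2) powr (- \<alpha>)) \<partial>lborel)"
    proof (rule nn_integral_mono)
      fix \<xi> :: "real ^ 'n"
      have "(?S \<xi>)\<^sup>2 * (1 + (norm \<xi>)\<^sup>2) powr (- \<alpha>) \<le> (?S \<xi>)\<^sup>2 * (max 1 \<kappa> powr \<alpha> * (\<kappa> + (norm \<xi>)\<^sup>2) powr (- \<alpha>))"
        using \<kappa> \<alpha>0 by (intro mult_left_mono shift_powr_le) auto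
      then show "ennreal ((?S \<xi>)\<^sup>2 * (1 + (norm \<xi>)\<^sup>2) powr (- \<alpha>)) \<le> ennreal (max 1 \<kappa> powr \<alpha>) * ennreal ((?S \<xi>)\<^sup>2 * (\<kappa> + (norm \<xi>)\<^sup>2) powr (- \<alpha>))"
        by (subst ennreal_mult'[symmetric]) (auto intro!: ennreal_leI simp: mult_ac)
    qed
    also have "\<dots> = ennreal W"
      by (subst nn_integral_cmult) (auto simp: expsum_bessel_potential[OF \<alpha> \<kappa>] ennreal_mult'[symmetric] W_def)
    finally show ?thesis .
  qed
  define B where "B = sqrt (E * W)"
  have damped: "\<bar>\<Sum>x\<in>A. u x * gauss_conv t f x\<bar> \<le> B" if t: "0 < t" for t
  proof -
    let ?e = "\<lambda>\<xi>::real^'n. exp (- t * (norm \<xi>)\<^sup>2)"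
    let ?T = "\<lambda>R. ft (ball_cut R f)"
    define Q where "Q = sqrt (pi / (2 * t)) ^ CARD('n) * quad (gauss (2 * t)) A u"
    have Q0: "0 \<le> Q" unfolding Q_def using t by (intro mult_nonneg_nonneg quad_gauss_nonneg) auto
    \<comment> \<open>This finite integral turns the L^2-convergence of the truncated transforms
      into convergence of the integrals against the damped exponential sum.\<close>
    have Q: "(\<integral>\<^sup>+\<xi>. ennreal ((?S \<xi> * ?e \<xi>)\<^sup>2) \<partial>lborel) = ennreal Q"
    proof -
      have "(?S \<xi> * ?e \<xi>)\<^sup>2 = (?S \<xi>)\<^sup>2 * exp (- (2 * t) * (norm \<xi>)\<^sup>2)" for \<xi>
        by (simp add: power_mult_distrib exp_double[symmetric] mult_ac)
      then show ?thesis
        using gauss_quad_fourier[of "2 * t" A u] t unfolding has_bochner_integral_iff Q_def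
        by (simp only:) (subst nn_integral_eq_integral, auto)
    qed
    \<comment> \<open>Cauchy-Schwarz with the powers \<alpha>/2 and - \<alpha>/2 of 1 + |\<xi>|^2
      separates the Sobolev energy from the kernel form. The bound B is free of t, so the damping
      can be removed at the end.\<close>
    have main: "(\<integral>\<^sup>+\<xi>. ennreal (cmod (g \<xi>)) * ennreal (?S \<xi> * ?e \<xi>) \<partial>lborel) \<le> ennreal B"
      unfolding B_def
    proof (rule ennreal_sqrt_bound)
      have pp: "(X powr (b / 2))\<^sup>2 = X powr b" for X b :: real
        by (simp add: power2_eq_square powr_add[symmetric])
      let ?p = "\<lambda>\<xi>. ennreal ((1 + (norm \<xi>)\<^sup>2) powr (\<alpha> / 2) * cmod (g \<xi>))"
      let ?q = "\<lambda>\<xi>. ennreal (?S \<xi> * (1 + (norm \<xi>)\<^sup>2) powr (- \<alpha> / 2))"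
      have "(\<integral>\<^sup>+\<xi>. ennreal (cmod (g \<xi>)) * ennreal (?S \<xi> * ?e \<xi>) \<partial>lborel) \<le> (\<integral>\<^sup>+\<xi>. ?p \<xi> * ?q \<xi> \<partial>lborel)"
      proof (rule nn_integral_mono)
        fix \<xi> :: "real ^ 'n"
        have pos: "0 < 1 + (norm \<xi>)\<^sup>2" by (simp add: add_pos_nonneg)
        have "cmod (g \<xi>) * (?S \<xi> * ?e \<xi>) \<le> cmod (g \<xi>) * (?S \<xi> * 1)"
          using t by (intro mult_left_mono) auto
        also have "\<dots> = ((1 + (norm \<xi>)\<^sup>2) powr (\<alpha> / 2) * (1 + (norm \<xi>)\<^sup>2) powr (- \<alpha> / 2)) * (cmod (g \<xi>) * ?S \<xi>)"
          using pos by (simp add: powr_add[symmetric])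
        also have "\<dots> = ((1 + (norm \<xi>)\<^sup>2) powr (\<alpha> / 2) * cmod (g \<xi>)) * (?S \<xi> * (1 + (norm \<xi>)\<^sup>2) powr (- \<alpha> / 2))"
          by (simp only: mult_ac)
        finally show "ennreal (cmod (g \<xi>)) * ennreal (?S \<xi> * ?e \<xi>) \<le> ?p \<xi> * ?q \<xi>"
          by (simp add: ennreal_mult'[symmetric] ennreal_leI)
      qed
      then have "(\<integral>\<^sup>+\<xi>. ennreal (cmod (g \<xi>)) * ennreal (?S \<xi> * ?e \<xi>) \<partial>lborel)\<^sup>2 \<le> (\<integral>\<^sup>+\<xi>. ?p \<xi> * ?q \<xi> \<partial>lborel)\<^sup>2"
        by (intro power_mono) auto
      also have "\<dots> \<le> (\<integral>\<^sup>+\<xi>. (?p \<xi>)\<^sup>2 \<partial>lborel) * (\<integral>\<^sup>+\<xi>. (?q \<xi>)\<^sup>2 \<partial>lborel)"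
        by (rule Cauchy_Schwarz_nn_integral) measurable
      also have "(\<integral>\<^sup>+\<xi>. (?p \<xi>)\<^sup>2 \<partial>lborel) = (\<integral>\<^sup>+\<xi>. ennreal ((1 + (norm \<xi>)\<^sup>2) powr \<alpha> * (cmod (g \<xi>))\<^sup>2) \<partial>lborel)"
        by (intro nn_integral_cong, subst ennreal_power, simp, simp only: power_mult_distrib pp)
      also have "(\<integral>\<^sup>+\<xi>. (?q \<xi>)\<^sup>2 \<partial>lborel) = (\<integral>\<^sup>+\<xi>. ennreal ((?S \<xi>)\<^sup>2 * (1 + (norm \<xi>)\<^sup>2) powr (- \<alpha>)) \<partial>lborel)"
        by (intro nn_integral_cong, subst ennreal_power, simp, simp only: power_mult_distrib pp)
      also have "(\<integral>\<^sup>+\<xi>. ennreal ((1 + (norm \<xi>)\<^sup>2) powr \<alpha> * (cmod (g \<xi>))\<^sup>2) \<partial>lborel) * (\<integral>\<^sup>+\<xi>. ennreal ((?S \<xi>)\<^sup>2 * (1 + (norm \<xi>)\<^sup>2) powr (- \<alpha>)) \<partial>lborel)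
          \<le> ennreal E * ennreal W" by (intro mult_mono E W) auto
      also have "\<dots> = ennreal (E * W)" using E0 by (simp add: ennreal_mult')
      finally show "(\<integral>\<^sup>+\<xi>. ennreal (cmod (g \<xi>)) * ennreal (?S \<xi> * ?e \<xi>) \<partial>lborel)\<^sup>2 \<le> ennreal (E * W)" .
      show "0 \<le> E * W" using E0 W0 by simp
    qed
    have id: "complex_of_real (\<Sum>x\<in>A. u x * gauss_conv t (ball_cut R f) x)
        = (LINT \<xi>|lborel. ?T R \<xi> * (expsum A u \<xi> * complex_of_real (?e \<xi>)))" for R
    proof -
      note ic = integrable_cut[OF f, of R]
      have i: "integrable lborel (\<lambda>\<xi>. ?T R \<xi> * (cis (x \<bullet> \<xi>) * complex_of_real (?e \<xi>)))" for x
      proof (rule Bochner_Integration.integrable_bound)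
        show "integrable lborel (\<lambda>\<xi>. complex_of_real (LINT x|lborel. \<bar>ball_cut R f x\<bar>) * (cis (x \<bullet> \<xi>) * complex_of_real (?e \<xi>)))"
          by (rule integrable_mult_right[OF integrable_gauss_weight[OF t]])
        show "AE \<xi> in lborel. norm (?T R \<xi> * (cis (x \<bullet> \<xi>) * complex_of_real (?e \<xi>)))
          \<le> norm (complex_of_real (LINT x|lborel. \<bar>ball_cut R f x\<bar>) * (cis (x \<bullet> \<xi>) * complex_of_real (?e \<xi>)))"
          using cmod_ft_le[OF ic] by (intro AE_I2) (auto simp: norm_mult intro!: mult_right_mono)
      qed measurable
      have "(LINT \<xi>|lborel. ?T R \<xi> * (expsum A u \<xi> * complex_of_real (?e \<xi>)))
        = (LINT \<xi>|lborel. (\<Sum>x\<in>A. complex_of_real (u x) * (?T R \<xi> * (cis (x \<bullet> \<xi>) * complex_of_real (?e \<xi>)))))"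
        by (intro Bochner_Integration.integral_cong refl)
           (simp add: expsum_def sum_distrib_left sum_distrib_right mult_ac)
      also have "\<dots> = (\<Sum>x\<in>A. complex_of_real (u x) * (LINT \<xi>|lborel. ?T R \<xi> * (cis (x \<bullet> \<xi>) * complex_of_real (?e \<xi>))))"
        using i by (subst Bochner_Integration.integral_sum) auto
      also have "\<dots> = (\<Sum>x\<in>A. complex_of_real (u x) * complex_of_real (gauss_conv t (ball_cut R f) x))"
        by (simp only: ft_gauss_inversion[OF t ic])
      finally show ?thesis by simp
    qed
    have cutbound: "ennreal \<bar>\<Sum>x\<in>A. u x * gauss_conv t (ball_cut R f) x\<bar> \<le>
        (\<integral>\<^sup>+\<xi>. ennreal (cmod (?T R \<xi> - g \<xi>)) * ennreal (?S \<xi> * ?e \<xi>) \<partial>lborel) + ennreal B" for R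
    proof -
      have "ennreal \<bar>\<Sum>x\<in>A. u x * gauss_conv t (ball_cut R f) x\<bar> = ennreal (cmod (LINT \<xi>|lborel. ?T R \<xi> * (expsum A u \<xi> * complex_of_real (?e \<xi>))))"
        unfolding id[symmetric] by (simp only: norm_of_real)
      also have "\<dots> \<le> (\<integral>\<^sup>+\<xi>. ennreal (norm (?T R \<xi> * (expsum A u \<xi> * complex_of_real (?e \<xi>)))) \<partial>lborel)"
        using integral_norm_bound_ennreal[of lborel "\<lambda>\<xi>. ?T R \<xi> * (expsum A u \<xi> * complex_of_real (?e \<xi>))"]
          not_integrable_integral_eq[of lborel "\<lambda>\<xi>. ?T R \<xi> * (expsum A u \<xi> * complex_of_real (?e \<xi>))"]
        by (cases "integrable lborel (\<lambda>\<xi>. ?T R \<xi> * (expsum A u \<xi> * complex_of_real (?e \<xi>)))") auto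
      also have "\<dots> \<le> (\<integral>\<^sup>+\<xi>. ennreal (cmod (?T R \<xi> - g \<xi>)) * ennreal (?S \<xi> * ?e \<xi>) + ennreal (cmod (g \<xi>)) * ennreal (?S \<xi> * ?e \<xi>) \<partial>lborel)"
      proof (rule nn_integral_mono)
        fix \<xi>
        have "cmod (?T R \<xi>) \<le> cmod (?T R \<xi> - g \<xi>) + cmod (g \<xi>)"
          using norm_triangle_ineq[of "?T R \<xi> - g \<xi>" "g \<xi>"] by simp
        then have "cmod (?T R \<xi>) * (?S \<xi> * ?e \<xi>) \<le> (cmod (?T R \<xi> - g \<xi>) + cmod (g \<xi>)) * (?S \<xi> * ?e \<xi>)"
          by (intro mult_right_mono) auto
        then have "ennreal (cmod (?T R \<xi>) * (?S \<xi> * ?e \<xi>)) \<le> ennreal (cmod (?T R \<xi> - g \<xi>) * (?S \<xi> * ?e \<xi>) + cmod (g \<xi>) * (?S \<xi> * ?e \<xi>))"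
          by (intro ennreal_leI) (simp only: distrib_right)
        also have "\<dots> = ennreal (cmod (?T R \<xi> - g \<xi>)) * ennreal (?S \<xi> * ?e \<xi>) + ennreal (cmod (g \<xi>)) * ennreal (?S \<xi> * ?e \<xi>)"
          by (simp add: ennreal_mult')
        finally show "ennreal (norm (?T R \<xi> * (expsum A u \<xi> * complex_of_real (?e \<xi>)))) \<le> ennreal (cmod (?T R \<xi> - g \<xi>)) * ennreal (?S \<xi> * ?e \<xi>) + ennreal (cmod (g \<xi>)) * ennreal (?S \<xi> * ?e \<xi>)"
          by (simp add: norm_mult)
      qed
      also have "\<dots> = (\<integral>\<^sup>+\<xi>. ennreal (cmod (?T R \<xi> - g \<xi>)) * ennreal (?S \<xi> * ?e \<xi>) \<partial>lborel) + (\<integral>\<^sup>+\<xi>. ennreal (cmod (g \<xi>)) * ennreal (?S \<xi> * ?e \<xi>) \<partial>lborel)"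
        by (rule nn_integral_add) measurable
      also have "\<dots> \<le> (\<integral>\<^sup>+\<xi>. ennreal (cmod (?T R \<xi> - g \<xi>)) * ennreal (?S \<xi> * ?e \<xi>) \<partial>lborel) + ennreal B"
        by (intro add_left_mono main)
      finally show ?thesis .
    qed
    have limR: "((\<lambda>R. \<Sum>x\<in>A. u x * gauss_conv t (ball_cut R f) x) \<longlongrightarrow> (\<Sum>x\<in>A. u x * gauss_conv t f x)) at_top"
    proof (intro tendsto_sum tendsto_mult tendsto_const)
      fix x :: "real ^ 'n"
      have [measurable]: "gauss t x \<in> borel_measurable borel" unfolding gauss_def[abs_def] by measurable
      show "((\<lambda>R. gauss_conv t (ball_cut R f) x) \<longlongrightarrow> gauss_conv t f x) at_top"
        unfolding gauss_conv_def
      proof (rule integral_dominated_convergence_at_top)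
        have "integrable lborel (\<lambda>y. sqrt (pi / t) ^ CARD('n) * \<bar>f y * gauss t x y\<bar>)"
          by (intro integrable_mult_right integrable_abs integrable_times_gauss f t)
        then show "integrable lborel (\<lambda>y. \<bar>f y\<bar> * (sqrt (pi / t) ^ CARD('n) * gauss t x y))"
          by (simp add: abs_mult gauss_def mult_ac)
        show "AE y in lborel. ((\<lambda>R. ball_cut R f y * (sqrt (pi / t) ^ CARD('n) * gauss t x y)) \<longlongrightarrow> f y * (sqrt (pi / t) ^ CARD('n) * gauss t x y)) at_top"
        proof (intro AE_I2 tendsto_mult tendsto_const tendsto_eventually)
          fix y
          show "\<forall>\<^sub>F R in at_top. ball_cut R f y = f y"
            using eventually_gt_at_top[of "norm y"] by eventually_elim (simp add: ball_cut_def)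
        qed
        show "\<forall>\<^sub>F R in at_top. AE y in lborel. norm (ball_cut R f y * (sqrt (pi / t) ^ CARD('n) * gauss t x y)) \<le> \<bar>f y\<bar> * (sqrt (pi / t) ^ CARD('n) * gauss t x y)"
          using t by (intro always_eventually allI AE_I2) (auto simp: ball_cut_def abs_mult gauss_def)
      qed measurable
    qed
    \<comment> \<open>Here e bounds the squared L^2-distance between the truncated transforms and g;
      it is sent to 0 once R has tended to infinity.\<close>
    have "\<bar>\<Sum>x\<in>A. u x * gauss_conv t f x\<bar> \<le> sqrt (e * Q) + B" if e: "0 < e" for e
    proof (rule tendsto_upperbound[OF tendsto_rabs[OF limR]])
      have "\<forall>\<^sub>F R in at_top. (\<integral>\<^sup>+\<xi>. ennreal ((cmod (?T R \<xi> - g \<xi>))\<^sup>2) \<partial>lborel) < ennreal e"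
        using ft e unfolding is_fourier_transform_def truncated_fourier_conv_ft
        by (auto intro!: order_tendstoD(2))
      then show "\<forall>\<^sub>F R in at_top. \<bar>\<Sum>x\<in>A. u x * gauss_conv t (ball_cut R f) x\<bar> \<le> sqrt (e * Q) + B"
      proof eventually_elim
        case (elim R)
        have "(\<integral>\<^sup>+\<xi>. ennreal (cmod (?T R \<xi> - g \<xi>)) * ennreal (?S \<xi> * ?e \<xi>) \<partial>lborel) \<le> ennreal (sqrt (e * Q))"
        proof (rule ennreal_sqrt_bound)
          have "(\<integral>\<^sup>+\<xi>. ennreal (cmod (?T R \<xi> - g \<xi>)) * ennreal (?S \<xi> * ?e \<xi>) \<partial>lborel)\<^sup>2
            \<le> (\<integral>\<^sup>+\<xi>. (ennreal (cmod (?T R \<xi> - g \<xi>)))\<^sup>2 \<partial>lborel) * (\<integral>\<^sup>+\<xi>. (ennreal (?S \<xi> * ?e \<xi>))\<^sup>2 \<partial>lborel)"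
            by (rule Cauchy_Schwarz_nn_integral) measurable
          also have "\<dots> = (\<integral>\<^sup>+\<xi>. ennreal ((cmod (?T R \<xi> - g \<xi>))\<^sup>2) \<partial>lborel) * ennreal Q"
            unfolding Q[symmetric] by (simp add: ennreal_power)
          also have "\<dots> \<le> ennreal e * ennreal Q"
            using elim by (intro mult_right_mono) auto
          also have "\<dots> = ennreal (e * Q)" using e by (simp add: ennreal_mult')
          finally show "(\<integral>\<^sup>+\<xi>. ennreal (cmod (?T R \<xi> - g \<xi>)) * ennreal (?S \<xi> * ?e \<xi>) \<partial>lborel)\<^sup>2 \<le> ennreal (e * Q)" .
        qed (use e Q0 in auto)
        then have "ennreal \<bar>\<Sum>x\<in>A. u x * gauss_conv t (ball_cut R f) x\<bar> \<le> ennreal (sqrt (e * Q)) + ennreal B"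
          using cutbound[of R] by (meson add_right_mono order_trans)
        also have "\<dots> = ennreal (sqrt (e * Q) + B)"
          by (rule ennreal_plus[symmetric]) (use e Q0 E0 W0 in \<open>auto simp: B_def\<close>)
        finally show ?case
          by (subst (asm) ennreal_le_iff) (use e Q0 E0 W0 in \<open>auto simp: B_def\<close>)
      qed
    qed simp
    then have "\<forall>\<^sub>F e in at_right 0. \<bar>\<Sum>x\<in>A. u x * gauss_conv t f x\<bar> \<le> sqrt (e * Q) + B"
      by (auto simp: eventually_at_right_field intro!: exI[of _ 1])
    moreover have "((\<lambda>e. sqrt (e * Q) + B) \<longlongrightarrow> sqrt (0 * Q) + B) (at_right 0)"
      by (intro tendsto_intros)
    ultimately have "\<bar>\<Sum>x\<in>A. u x * gauss_conv t f x\<bar> \<le> sqrt (0 * Q) + B"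
      by (intro tendsto_lowerbound[of _ _ "at_right (0::real)"]) auto
    then show ?thesis by simp
  qed
  have "((\<lambda>t. \<bar>\<Sum>x\<in>A. u x * gauss_conv t f x\<bar>) \<longlongrightarrow> \<bar>\<Sum>x\<in>A. u x * (?C * f x)\<bar>) (at_right 0)"
    by (intro tendsto_rabs tendsto_sum tendsto_mult tendsto_const gauss_conv_tendsto f cont)
  then have "\<bar>\<Sum>x\<in>A. u x * (?C * f x)\<bar> \<le> B"
    by (rule tendsto_upperbound) (auto simp: eventually_at_right_field damped intro!: exI[of _ 1])
  also have "(\<Sum>x\<in>A. u x * (?C * f x)) = ?C * (\<Sum>x\<in>A. u x * f x)"
    by (simp add: sum_distrib_left mult_ac)
  finally have "\<bar>?C * (\<Sum>x\<in>A. u x * f x)\<bar>\<^sup>2 \<le> B\<^sup>2" by (intro power_mono) auto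
  then have "?C\<^sup>2 * (\<Sum>x\<in>A. u x * f x)\<^sup>2 \<le> E * W"
    using E0 W0 by (simp add: B_def power_mult_distrib)
  moreover have "0 < ?C\<^sup>2" by simp
  ultimately have "(\<Sum>x\<in>A. u x * f x)\<^sup>2 \<le> E * W / ?C\<^sup>2" by (simp only: pos_le_divide_eq mult.commute)
  then show ?thesis by (simp add: W_def mult_ac)
qed

section \<open>Fill distance and separation radius\<close>

lemma finite_pair_distances:
  "finite {norm (x i - x j) | i j. i \<in> {1..n} \<and> j \<in> {1..n::nat} \<and> i \<noteq> j}"
proof -
  have "{norm (x i - x j) | i j. i \<in> {1..n} \<and> j \<in> {1..n} \<and> i \<noteq> j} \<subseteq> (\<lambda>(i, j). norm (x i - x j)) ` ({1..n} \<times> {1..n})"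
    by auto
  then show ?thesis by (rule finite_subset) auto
qed

lemma separation_radius_le:
  assumes "i \<in> {1..n}" "j \<in> {1..n}" "i \<noteq> j"
  shows "2 * separation_radius x n \<le> norm (x i - x j)"
proof -
  have "norm (x i - x j) \<in> {norm (x i - x j) | i j. i \<in> {1..n} \<and> j \<in> {1..n} \<and> i \<noteq> j}"
    using assms by blast
  from Min_le[OF finite_pair_distances this] show ?thesis by (simp add: separation_radius_def)
qed

lemma separation_radius_pos:
  assumes "inj_on x {1..}" "2 \<le> n"
  shows "0 < separation_radius x n"
proof -
  have "norm (x 1 - x 2) \<in> {norm (x i - x j) | i j. i \<in> {1..n} \<and> j \<in> {1..n} \<and> i \<noteq> j}"
    using assms(2) by fastforce
  then have ne: "{norm (x i - x j) | i j. i \<in> {1..n} \<and> j \<in> {1..n} \<and> i \<noteq> j} \<noteq> {}" by blast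
  have "0 < Min {norm (x i - x j) | i j. i \<in> {1..n} \<and> j \<in> {1..n} \<and> i \<noteq> j}"
    unfolding Min_gr_iff[OF finite_pair_distances ne] using assms(1) by (auto simp: inj_on_def)
  then show ?thesis by (simp add: separation_radius_def)
qed

lemma fill_distance_nearest:
  fixes \<Omega> :: "'a::real_normed_vector set"
  assumes "bounded \<Omega>" "y \<in> \<Omega>" "1 \<le> n"
  obtains i where "i \<in> {1..n}" "norm (y - x i) \<le> fill_distance \<Omega> x n"
proof -
  obtain R where R: "\<And>y. y \<in> \<Omega> \<Longrightarrow> norm y \<le> R" using assms(1) by (auto simp: bounded_iff)
  have fin: "finite ((\<lambda>i. norm (y - x i)) ` {1..n})" for y by simp
  have ne: "(\<lambda>i. norm (y - x i)) ` {1..n} \<noteq> {}" for y using assms(3) by auto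
  have "bdd_above ((\<lambda>y. MIN i\<in>{1..n}. norm (y - x i)) ` \<Omega>)"
  proof (rule bdd_aboveI2)
    fix z assume "z \<in> \<Omega>"
    have "(MIN i\<in>{1..n}. norm (z - x i)) \<le> norm (z - x 1)" using assms(3) by (intro Min_le fin) auto
    also have "\<dots> \<le> norm z + norm (x 1)" by (rule norm_triangle_ineq4)
    also have "\<dots> \<le> R + norm (x 1)" using R[OF \<open>z \<in> \<Omega>\<close>] by simp
    finally show "(MIN i\<in>{1..n}. norm (z - x i)) \<le> R + norm (x 1)" .
  qed
  then have "(MIN i\<in>{1..n}. norm (y - x i)) \<le> fill_distance \<Omega> x n"
    unfolding fill_distance_def using assms(2) by (rule cSUP_upper2) simp
  moreover obtain i where "i \<in> {1..n}" "(MIN i\<in>{1..n}. norm (y - x i)) = norm (y - x i)"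
    using Min_in[OF fin ne, of y] by auto
  ultimately show ?thesis using that by auto
qed

lemma root_le_powr:
  fixes C d :: real
  assumes d: "0 < d" and n: "0 < n" and h: "0 \<le> h" and C: "0 < C" and le: "C \<le> n * h powr d"
  shows "C powr (1 / d) * n powr (- 1 / d) \<le> h"
proof -
  have "C * n powr - 1 \<le> h powr d"
    using le n by (simp add: powr_minus field_simps)
  then have "(C * n powr - 1) powr (1 / d) \<le> (h powr d) powr (1 / d)"
    using C n d by (intro powr_mono2) auto
  moreover have "(C * n powr - 1) powr (1 / d) = C powr (1 / d) * n powr (- 1 / d)"
  proof -
    have "(C * n powr - 1) powr (1 / d) = C powr (1 / d) * (n powr - 1) powr (1 / d)"
      by (rule powr_mult)
    moreover have "(n powr - 1) powr (1 / d) = n powr (- 1 / d)" unfolding powr_powr by simp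
    ultimately show ?thesis by (simp only:)
  qed
  moreover have "(h powr d) powr (1 / d) = h" using h d by (simp add: powr_powr)
  ultimately show ?thesis by (simp only:)
qed

lemma powr_le_root:
  fixes C d :: real
  assumes d: "0 < d" and n: "0 < n" and h: "0 \<le> h" and C: "0 < C" and le: "n * h powr d \<le> C"
  shows "h \<le> C powr (1 / d) * n powr (- 1 / d)"
proof -
  have "h powr d \<le> C * n powr - 1"
    using le n by (simp add: powr_minus field_simps)
  then have "(h powr d) powr (1 / d) \<le> (C * n powr - 1) powr (1 / d)"
    using C n d by (intro powr_mono2) auto
  moreover have "(C * n powr - 1) powr (1 / d) = C powr (1 / d) * n powr (- 1 / d)"
  proof -
    have "(C * n powr - 1) powr (1 / d) = C powr (1 / d) * (n powr - 1) powr (1 / d)"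
      by (rule powr_mult)
    moreover have "(n powr - 1) powr (1 / d) = n powr (- 1 / d)" unfolding powr_powr by simp
    ultimately show ?thesis by (simp only:)
  qed
  moreover have "(h powr d) powr (1 / d) = h" using h d by (simp add: powr_powr)
  ultimately show ?thesis by (simp only:)
qed

lemma measure_cball_powr:
  fixes a :: "'a::euclidean_space"
  assumes "0 \<le> r"
  shows "measure lborel (cball a r) = unit_ball_vol (DIM('a)) * r powr DIM('a)"
  using content_cball[OF assms, of a] assms by (cases "r = 0") (auto simp: powr_realpow)

lemma measure_ball_powr:
  fixes a :: "'a::euclidean_space"
  assumes "0 \<le> r"
  shows "measure lborel (ball a r) = unit_ball_vol (DIM('a)) * r powr DIM('a)"
  using content_ball[OF assms, of a] assms by (cases "r = 0") (auto simp: powr_realpow)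

text \<open>Comparing volumes: \<open>n\<close> balls of radius \<open>h\<close> cover \<open>\<Omega>\<close>, while \<open>n\<close> balls of radius \<open>q\<close>
  are disjoint and contained in a bounded set.\<close>

lemma fill_distance_lower:
  fixes \<Omega> :: "'a::euclidean_space set"
  assumes b: "bounded \<Omega>" and o: "open \<Omega>" and x: "\<And>i. 1 \<le> i \<Longrightarrow> x i \<in> \<Omega>"
  obtains c where "0 < c" "\<And>n. 2 \<le> n \<Longrightarrow> c * real n powr (- 1 / DIM('a)) \<le> fill_distance \<Omega> x n"
proof -
  let ?d = "real DIM('a)" and ?v = "unit_ball_vol (real DIM('a))"
  have v: "0 < ?v" by simp
  have fm: "\<Omega> \<in> fmeasurable lborel" using b o by (intro fmeasurableI emeasure_bounded_finite) auto
  have "\<Omega> \<noteq> {}" using x by auto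
  then obtain a e where e: "0 < e" "ball a e \<subseteq> \<Omega>" using o by (meson all_not_in_conv openE)
  have le: "measure lborel (ball a e) \<le> measure lborel \<Omega>" using e fm by (intro measure_mono_fmeasurable) auto
  have pos: "0 < measure lborel (ball a e)" using e by (subst measure_ball_powr) auto
  have m: "0 < measure lborel \<Omega>" by (rule less_le_trans[OF pos le])
  define C where "C = measure lborel \<Omega> / ?v"
  have C: "0 < C" using m v by (simp add: C_def)
  show ?thesis
  proof (rule that[of "C powr (1 / ?d)"])
    show "0 < C powr (1 / ?d)" using C by simp
    fix n :: nat assume n: "2 \<le> n"
    let ?h = "fill_distance \<Omega> x n"
    have h0: "0 \<le> ?h"
    proof -
      obtain i where "norm (x 1 - x i) \<le> ?h" using fill_distance_nearest[OF b x[of 1], of n x] n by auto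
      then show ?thesis using norm_ge_zero order_trans by blast
    qed
    have cov: "\<Omega> \<subseteq> (\<Union>i\<in>{1..n}. cball (x i) ?h)"
    proof
      fix y assume "y \<in> \<Omega>"
      then obtain i where "i \<in> {1..n}" "norm (y - x i) \<le> ?h" using fill_distance_nearest[OF b, of y n x] n by auto
      then show "y \<in> (\<Union>i\<in>{1..n}. cball (x i) ?h)" by (auto simp: dist_norm norm_minus_commute)
    qed
    have fmc: "cball (x i) ?h \<in> fmeasurable lborel" for i by (intro fmeasurableI emeasure_bounded_finite) auto
    have "measure lborel \<Omega> \<le> measure lborel (\<Union>i\<in>{1..n}. cball (x i) ?h)"
      using cov fm fmc by (intro measure_mono_fmeasurable fmeasurable.finite_UN) auto
    also have "\<dots> \<le> (\<Sum>i\<in>{1..n}. measure lborel (cball (x i) ?h))"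
      by (intro measure_UNION_le) auto
    also have "\<dots> = real n * ?h powr ?d * ?v" using h0 by (simp add: measure_cball_powr)
    finally have "C \<le> real n * ?h powr ?d" using v by (simp add: C_def divide_le_eq)
    then show "C powr (1 / ?d) * real n powr (- 1 / ?d) \<le> ?h"
      using n h0 C by (intro root_le_powr) auto
  qed
qed

lemma separation_radius_upper:
  fixes \<Omega> :: "'a::euclidean_space set"
  assumes b: "bounded \<Omega>" and x: "\<And>i. 1 \<le> i \<Longrightarrow> x i \<in> \<Omega>" and inj: "inj_on x {1..}"
  obtains c where "0 < c" "\<And>n. 2 \<le> n \<Longrightarrow> separation_radius x n \<le> c * real n powr (- 1 / DIM('a))"
proof -
  let ?d = "real DIM('a)" and ?v = "unit_ball_vol (real DIM('a))"
  have v: "0 < ?v" by simp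
  obtain R where R: "0 < R" "\<And>y. y \<in> \<Omega> \<Longrightarrow> norm y \<le> R" using b by (auto simp: bounded_pos)
  \<comment> \<open>The first two points are at most 2 R apart, so q \<le> R, and the balls of
    radius q about the points lie in the ball of radius 2 R.\<close>
  define C where "C = (2 * R) powr ?d"
  have C: "0 < C" using R by (simp add: C_def)
  show ?thesis
  proof (rule that[of "C powr (1 / ?d)"])
    show "0 < C powr (1 / ?d)" using C by simp
    fix n :: nat assume n: "2 \<le> n"
    let ?q = "separation_radius x n"
    have q0: "0 < ?q" by (rule separation_radius_pos[OF inj n])
    have "2 * ?q \<le> norm (x 1 - x 2)" using n by (intro separation_radius_le) auto
    also have "\<dots> \<le> norm (x 1) + norm (x 2)" by (rule norm_triangle_ineq4)
    also have "\<dots> \<le> R + R" by (intro add_mono R x) auto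
    finally have qR: "?q \<le> R" by simp
    have disj: "disjoint_family_on (\<lambda>i. ball (x i) ?q) {1..n}"
      unfolding disjoint_family_on_def
    proof (intro ballI impI)
      fix i j assume ij: "i \<in> {1..n}" "j \<in> {1..n}" "i \<noteq> j"
      show "ball (x i) ?q \<inter> ball (x j) ?q = {}"
      proof (rule ccontr)
        assume "ball (x i) ?q \<inter> ball (x j) ?q \<noteq> {}"
        then obtain y where "dist (x i) y < ?q" "dist (x j) y < ?q" by auto
        then have "dist (x i) (x j) < 2 * ?q" using dist_triangle2[of "x i" "x j" y] by simp
        then show False using separation_radius_le[OF ij, of x] by (simp add: dist_norm)
      qed
    qed
    have fmb: "ball a r \<in> fmeasurable lborel" for a :: 'a and r by (intro fmeasurableI emeasure_bounded_finite) auto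
    have "real n * ?q powr ?d * ?v = (\<Sum>i\<in>{1..n}. measure lborel (ball (x i) ?q))"
      using q0 by (simp add: measure_ball_powr)
    also have "\<dots> = measure lborel (\<Union>i\<in>{1..n}. ball (x i) ?q)"
    proof (intro measure_finite_Union[symmetric] disj)
      show "emeasure lborel (ball (x i) ?q) \<noteq> \<infinity>" for i
        using emeasure_bounded_finite[of "ball (x i) ?q"] by simp
    qed auto
    also have "\<dots> \<le> measure lborel (ball (0::'a) (2 * R))"
    proof (intro measure_mono_fmeasurable fmb)
      show "(\<Union>i\<in>{1..n}. ball (x i) ?q) \<subseteq> ball 0 (2 * R)"
      proof
        fix y assume "y \<in> (\<Union>i\<in>{1..n}. ball (x i) ?q)"
        then obtain i where i: "i \<in> {1..n}" "norm (y - x i) < ?q" by (auto simp: dist_norm norm_minus_commute)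
        have "norm y \<le> norm (x i) + norm (y - x i)" using norm_triangle_sub by blast
        also have "\<dots> < R + R" using R(2)[OF x[of i]] i qR by (intro add_le_less_mono) auto
        finally show "y \<in> ball 0 (2 * R)" by simp
      qed
    qed auto
    also have "\<dots> = C * ?v" using R by (simp add: measure_ball_powr C_def)
    finally have "real n * ?q powr ?d \<le> C" using v by simp
    then show "?q \<le> C powr (1 / ?d) * real n powr (- 1 / ?d)"
      using n q0 C by (intro powr_le_root) auto
  qed
qed

section \<open>Grid cells and the pigeonhole principle\<close>

definition grid_cell :: "real \<Rightarrow> real ^ 'n \<Rightarrow> 'n \<Rightarrow> int" where
  "grid_cell \<delta> x = (\<lambda>i. \<lfloor>vec_nth x i / \<delta>\<rfloor>)"

lemma grid_cell_diameter:
  assumes "0 < \<delta>" "grid_cell \<delta> x = grid_cell \<delta> y"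
  shows "norm (x - y :: real ^ 'n) \<le> real CARD('n) * \<delta>"
proof -
  have "\<bar>vec_nth (x - y) i\<bar> \<le> \<delta>" for i
  proof -
    have "\<lfloor>vec_nth x i / \<delta>\<rfloor> = \<lfloor>vec_nth y i / \<delta>\<rfloor>"
      using fun_cong[OF assms(2), of i] by (simp add: grid_cell_def)
    then have "\<bar>vec_nth x i / \<delta> - vec_nth y i / \<delta>\<bar> < 1" by linarith
    then have "\<bar>vec_nth x i - vec_nth y i\<bar> / \<delta> < 1"
      using assms(1) by (simp add: diff_divide_distrib[symmetric])
    then show ?thesis using assms(1) by simp
  qed
  then have "(\<Sum>i\<in>UNIV. \<bar>vec_nth (x - y) i\<bar>) \<le> (\<Sum>i\<in>(UNIV::'n set). \<delta>)" by (intro sum_mono)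
  then show ?thesis using norm_le_l1_cart[of "x - y"] by simp
qed

lemma card_grid_cells:
  fixes \<Omega> :: "(real ^ 'n) set"
  assumes "bounded \<Omega>"
  obtains C where "0 < C" "\<And>\<delta>. 0 < \<delta> \<Longrightarrow> \<delta> \<le> 1 \<Longrightarrow>
     finite (grid_cell \<delta> ` \<Omega>) \<and> real (card (grid_cell \<delta> ` \<Omega>)) \<le> C * \<delta> powr (- real CARD('n))"
proof -
  obtain R where R: "0 < R" "\<And>y. y \<in> \<Omega> \<Longrightarrow> norm y \<le> R" using assms by (auto simp: bounded_pos)
  \<comment> \<open>Per axis there are 2 L + 1 \<le> 2 (R/\<delta> + 2) + 1 indices, and 5 \<le>
    5/\<delta> because \<delta> \<le> 1.\<close>
  define C where "C = (2 * R + 5) ^ CARD('n)"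
  show ?thesis
  proof (rule that[of C])
    show "0 < C" using R by (simp add: C_def)
    fix \<delta> :: real assume \<delta>: "0 < \<delta>" "\<delta> \<le> 1"
    define L where "L = \<lceil>R / \<delta>\<rceil> + 1"
    have sub: "grid_cell \<delta> ` \<Omega> \<subseteq> PiE UNIV (\<lambda>_. {- L..L})"
    proof (intro image_subsetI PiE_I)
      fix y i assume "y \<in> \<Omega>"
      then have "\<bar>vec_nth y i\<bar> \<le> R" using R(2) component_le_norm_cart[of y i] by fastforce
      then have "\<bar>vec_nth y i / \<delta>\<bar> \<le> R / \<delta>" using \<delta> by (simp add: divide_right_mono)
      then have "\<lfloor>vec_nth y i / \<delta>\<rfloor> \<le> L" "- L \<le> \<lfloor>vec_nth y i / \<delta>\<rfloor>" unfolding L_def by linarith+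
      then show "grid_cell \<delta> y i \<in> {- L..L}" by (simp add: grid_cell_def)
    qed auto
    have fin: "finite (PiE (UNIV::'n set) (\<lambda>_. {- L..L}))" by (intro finite_PiE) auto
    have "real (card (grid_cell \<delta> ` \<Omega>)) \<le> real (card (PiE (UNIV::'n set) (\<lambda>_. {- L..L})))"
      using card_mono[OF fin sub] by simp
    also have "\<dots> = (real (nat (2 * L + 1))) ^ CARD('n)" by (simp add: card_PiE)
    also have "\<dots> \<le> ((2 * R + 5) / \<delta>) ^ CARD('n)"
    proof (intro power_mono)
      have "0 \<le> R / \<delta>" using R \<delta> by simp
      then have "0 \<le> \<lceil>R / \<delta>\<rceil>" by (metis ceiling_mono ceiling_zero)
      then have "0 \<le> L" by (simp add: L_def)
      then have "0 \<le> 2 * L + 1" by simp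
      then have "real (nat (2 * L + 1)) = 2 * real_of_int L + 1" by simp
      also have "\<dots> \<le> 2 * (R / \<delta> + 2) + 1"
      proof -
        have "real_of_int L = real_of_int \<lceil>R / \<delta>\<rceil> + 1" by (simp add: L_def)
        also have "\<dots> \<le> (R / \<delta> + 1) + 1" by (intro add_right_mono of_int_ceiling_le_add_one)
        finally have "real_of_int L \<le> R / \<delta> + 2" by simp
        then show ?thesis by (intro add_right_mono mult_left_mono) auto
      qed
      also have "\<dots> = 2 * R / \<delta> + 5 * 1" by simp
      also have "\<dots> \<le> 2 * R / \<delta> + 5 * (1 / \<delta>)" using \<delta> by (intro add_left_mono mult_left_mono) auto
      finally show "real (nat (2 * L + 1)) \<le> (2 * R + 5) / \<delta>" by (simp add: add_divide_distrib)
    qed simp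
    also have "\<dots> = C * \<delta> powr (- real CARD('n))"
    proof -
      have "\<delta> powr (- real CARD('n)) = 1 / \<delta> ^ CARD('n)" using \<delta> by (simp add: powr_minus_divide powr_realpow)
      then show ?thesis by (simp add: C_def power_divide)
    qed
    finally show "finite (grid_cell \<delta> ` \<Omega>) \<and> real (card (grid_cell \<delta> ` \<Omega>)) \<le> C * \<delta> powr (- real CARD('n))"
      using finite_subset[OF sub fin] by simp
  qed
qed

lemma crowded_cell:
  assumes fin: "finite P" and cells: "finite (g ` P)" "card (g ` P) \<le> N" and many: "D * N < card P"
  obtains Q where "Q \<subseteq> P" "card Q = Suc D" "\<And>x y. x \<in> Q \<Longrightarrow> y \<in> Q \<Longrightarrow> g x = g y"
proof -
  have "\<exists>z\<in>g ` P. D < card {x \<in> P. g x = z}"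
  proof (rule ccontr)
    assume "\<not> ?thesis"
    then have le: "card {x \<in> P. g x = z} \<le> D" if "z \<in> g ` P" for z using that by (meson not_le)
    have "card P = card (\<Union>z\<in>g ` P. {x \<in> P. g x = z})" by (rule arg_cong[where f=card]) auto
    also have "\<dots> \<le> (\<Sum>z\<in>g ` P. card {x \<in> P. g x = z})" by (rule card_UN_le[OF cells(1)])
    also have "\<dots> \<le> (\<Sum>z\<in>g ` P. D)" by (intro sum_mono le)
    also have "\<dots> \<le> D * N" using cells(2) by (simp add: mult.commute)
    finally show False using many by simp
  qed
  then obtain z where "D < card {x \<in> P. g x = z}" by blast
  then have z: "Suc D \<le> card {x \<in> P. g x = z}" by simp
  obtain Q where Q: "Q \<subseteq> {x \<in> P. g x = z}" "card Q = Suc D"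
    using obtain_subset_with_card_n[OF z] by metis
  show ?thesis by (rule that[OF _ Q(2)]) (use Q(1) in blast)+
qed

section \<open>Series of bumps\<close>

text \<open>A polynomial on its support that vanishes to order m at both ends: m integrations by
  parts give a transform decaying to order m, with no boundary terms. The parameter m is later
  chosen large enough for the Sobolev order.\<close>

definition bump1 :: "nat \<Rightarrow> real \<Rightarrow> real" where
  "bump1 m s = (if s \<in> {-1..1} then (1 - s\<^sup>2) ^ m else 0)"

text \<open>The polynomial p is carried along because integration by parts lowers m and changes p;
  the bump itself has p = 1.\<close>

definition bump1_ft :: "real poly \<Rightarrow> nat \<Rightarrow> real \<Rightarrow> complex" where
  "bump1_ft p m \<omega> = integral {-1..1} (\<lambda>s. complex_of_real (poly p s * (1 - s\<^sup>2) ^ m) * cis (- (s * \<omega>)))"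

lemma continuous_on_bump1_ft_integrand:
  "continuous_on S (\<lambda>s. complex_of_real (poly p s * (1 - s\<^sup>2) ^ m) * cis (- (s * \<omega>)))"
  by (intro continuous_intros)

text \<open>Integration by parts: \<open>p (1 - s\<^sup>2)\<^sup>m\<^sup>+\<^sup>1\<close> vanishes at the end points.\<close>

lemma bump1_ft_by_parts:
  "\<i> * complex_of_real \<omega> * bump1_ft p (Suc m) \<omega>
    = bump1_ft (pderiv p * [:1, 0, -1:] + p * [:0, - 2 * real (Suc m):]) m \<omega>"
proof -
  define q where "q = pderiv p * [:1, 0, -1:] + p * [:0, - 2 * real (Suc m):]"
  let ?G = "\<lambda>s. complex_of_real (poly p s * (1 - s\<^sup>2) ^ Suc m) * cis (- (s * \<omega>))"
  let ?a = "\<lambda>s. complex_of_real (poly q s * (1 - s\<^sup>2) ^ m) * cis (- (s * \<omega>))"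
  have q: "poly q s * (1 - s\<^sup>2) ^ m = poly (pderiv p) s * (1 - s\<^sup>2) ^ Suc m + poly p s * (real (Suc m) * (1 - s\<^sup>2) ^ m * (- 2 * s))" for s
    by (simp add: q_def power2_eq_square algebra_simps)
  have der: "(?G has_vector_derivative (?a s - \<i> * complex_of_real \<omega> * ?G s)) (at s within {-1..1})" for s
  proof -
    have d1: "((\<lambda>s. poly p s * (1 - s\<^sup>2) ^ Suc m) has_real_derivative poly q s * (1 - s\<^sup>2) ^ m) (at s within {-1..1})"
      unfolding q by (auto intro!: derivative_eq_intros simp del: power_Suc)
    have d2: "((\<lambda>s. cis (- (s * \<omega>))) has_vector_derivative (- \<i> * complex_of_real \<omega> * cis (- (s * \<omega>)))) (at s within {-1..1})"
    proof -
      have "((\<lambda>s. exp (- \<i> * complex_of_real \<omega> * complex_of_real s)) has_vector_derivative (- \<i> * complex_of_real \<omega> * exp (- \<i> * complex_of_real \<omega> * complex_of_real s))) (at s within {-1..1})"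
        by (rule has_vector_derivative_real_field) (auto intro!: derivative_eq_intros)
      moreover have "cis (- (s * \<omega>)) = exp (- \<i> * complex_of_real \<omega> * complex_of_real s)" for s
        by (simp add: cis_conv_exp mult_ac)
      ultimately show ?thesis by simp
    qed
    show ?thesis
      using has_vector_derivative_mult[OF has_vector_derivative_of_real[OF d1] d2] by (simp add: algebra_simps)
  qed
  have "((\<lambda>s. ?a s - \<i> * complex_of_real \<omega> * ?G s) has_integral ?G 1 - ?G (-1)) {-1..1}"
    using der by (intro fundamental_theorem_of_calculus) auto
  then have "integral {-1..1} (\<lambda>s. ?a s - \<i> * complex_of_real \<omega> * ?G s) = 0"
    by (simp add: integral_unique)
  moreover have "integral {-1..1} (\<lambda>s. ?a s - \<i> * complex_of_real \<omega> * ?G s) = bump1_ft q m \<omega> - \<i> * complex_of_real \<omega> * bump1_ft p (Suc m) \<omega>"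
    unfolding bump1_ft_def integral_mult_right[symmetric]
    by (intro integral_diff integrable_continuous_interval continuous_intros)
  ultimately show ?thesis by (simp add: q_def)
qed

lemma bump1_ft_decay: "\<exists>C\<ge>0. \<forall>\<omega>. \<bar>\<omega>\<bar> ^ m * cmod (bump1_ft p m \<omega>) \<le> C"
proof (induction m arbitrary: p)
  case 0
  have "compact (poly p ` {-1..1})" by (intro compact_continuous_image continuous_intros) auto
  then have "bounded (poly p ` {-1..1})" by (rule compact_imp_bounded)
  then obtain B where "\<forall>y\<in>poly p ` {-1..1}. norm y \<le> B" unfolding bounded_iff by blast
  then have B: "\<bar>poly p s\<bar> \<le> B" if "s \<in> {-1..1}" for s using that by simp
  have "0 \<le> B" using B[of 0] by force
  have "cmod (bump1_ft p 0 \<omega>) \<le> B * (1 - (-1))" for \<omega>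
    unfolding bump1_ft_def
    by (rule integral_bound) (use B in \<open>auto simp: norm_mult intro!: continuous_intros\<close>)
  then show ?case using \<open>0 \<le> B\<close> by (intro exI[of _ "2 * B"]) (auto simp: mult.commute)
next
  case (Suc m)
  obtain C where C: "0 \<le> C" "\<And>\<omega>. \<bar>\<omega>\<bar> ^ m * cmod (bump1_ft (pderiv p * [:1, 0, -1:] + p * [:0, - 2 * real (Suc m):]) m \<omega>) \<le> C"
    using Suc by blast
  have "\<bar>\<omega>\<bar> ^ Suc m * cmod (bump1_ft p (Suc m) \<omega>) \<le> C" for \<omega>
  proof -
    have "\<bar>\<omega>\<bar> ^ Suc m * cmod (bump1_ft p (Suc m) \<omega>) = \<bar>\<omega>\<bar> ^ m * cmod (\<i> * complex_of_real \<omega> * bump1_ft p (Suc m) \<omega>)"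
      by (simp add: norm_mult)
    then show ?thesis using C(2)[of \<omega>] by (simp only: bump1_ft_by_parts)
  qed
  then show ?case using C(1) by blast
qed

lemma bump1_bounds: "0 \<le> bump1 m s" "bump1 m s \<le> 1"
proof -
  have "s\<^sup>2 \<le> 1" if "s \<in> {-1..1}" using that by (simp add: abs_square_le_1 abs_le_iff)
  then show "0 \<le> bump1 m s" "bump1 m s \<le> 1" by (auto simp: bump1_def intro!: power_le_one)
qed

lemma continuous_on_bump1:
  assumes "0 < m"
  shows "continuous_on UNIV (bump1 m)"
proof -
  have "bump1 m s = (max 0 (1 - s\<^sup>2)) ^ m" for s
  proof (cases "s \<in> {-1..1}")
    case True
    then have "s\<^sup>2 \<le> 1" by (simp add: abs_square_le_1 abs_le_iff)
    then show ?thesis using True by (simp add: bump1_def)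
  next
    case False
    then have "1 < \<bar>s\<bar>" by auto
    then have "1 < s\<^sup>2" using abs_square_less_1 abs_square_le_1 by (metis not_le abs_square_le_1)
    then show ?thesis unfolding bump1_def if_not_P[OF False] using assms by simp
  qed
  then show ?thesis by (simp add: continuous_intros)
qed

lemma bump1_fourier:
  "has_bochner_integral lborel (\<lambda>s. complex_of_real (bump1 m s) * cis (- (s * \<omega>))) (bump1_ft 1 m \<omega>)"
proof -
  let ?f = "\<lambda>s. complex_of_real (poly 1 s * (1 - s\<^sup>2) ^ m) * cis (- (s * \<omega>))"
  have i: "set_integrable lborel {-1..1} ?f"
    by (rule borel_integrable_atLeastAtMost') (rule continuous_on_bump1_ft_integrand)
  have e: "(\<lambda>s. indicator {-1..1} s *\<^sub>R ?f s) = (\<lambda>s. complex_of_real (bump1 m s) * cis (- (s * \<omega>)))"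
    by (auto simp: bump1_def indicator_def)
  show ?thesis
    using i set_borel_integral_eq_integral(2)[OF i]
    unfolding has_bochner_integral_iff set_integrable_def set_lebesgue_integral_def e bump1_ft_def by auto
qed

section \<open>Tensor-product bumps in several variables\<close>

definition bump :: "nat \<Rightarrow> 'a::euclidean_space \<Rightarrow> real" where
  "bump m x = (\<Prod>b\<in>Basis. bump1 m (x \<bullet> b))"

lemma bump_bounds: "0 \<le> bump m x" "bump m x \<le> 1"
  unfolding bump_def using bump1_bounds by (auto intro: prod_nonneg prod_le_1)

lemma bump_0 [simp]: "bump m 0 = 1"
  by (simp add: bump_def bump1_def)

lemma bump_eq_0:
  assumes "real DIM('a) < norm (x::'a::euclidean_space)"
  shows "bump m x = 0"
proof -
  have "\<exists>b\<in>Basis. 1 < \<bar>x \<bullet> b\<bar>"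
  proof (rule ccontr)
    assume "\<not> ?thesis"
    then have "(\<Sum>b\<in>Basis. \<bar>x \<bullet> b\<bar>) \<le> (\<Sum>b\<in>(Basis::'a set). 1)" by (intro sum_mono) auto
    then show False using norm_le_l1[of x] assms by simp
  qed
  then obtain b where b: "b \<in> Basis" "1 < \<bar>x \<bullet> b\<bar>" by blast
  then have "x \<bullet> b \<notin> {-1..1}" by auto
  then have "bump1 m (x \<bullet> b) = 0" unfolding bump1_def by (rule if_not_P)
  with b(1) show ?thesis unfolding bump_def by (intro prod_zero) auto
qed

lemma continuous_on_bump: "0 < m \<Longrightarrow> continuous_on UNIV (bump m)"
  unfolding bump_def[abs_def]
  by (intro continuous_on_prod continuous_on_compose2[OF continuous_on_bump1] continuous_intros) auto

lemma bump_fourier: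
  "has_bochner_integral lborel (\<lambda>x. complex_of_real (bump m x) * cis (- (x \<bullet> \<xi>))) (\<Prod>b\<in>Basis. bump1_ft 1 m ((\<xi> :: 'a::euclidean_space) \<bullet> b))"
proof -
  have cs: "cis (\<Sum>b\<in>B. g b) = (\<Prod>b\<in>B. cis (g b))" if "finite B" for g and B :: "'a set"
    using that by (induction B rule: finite_induct) (auto simp: cis_mult[symmetric])
  let ?f = "\<lambda>b s. complex_of_real (bump1 m s) * cis (- (s * (\<xi> \<bullet> b)))"
  have e: "(\<Prod>b\<in>Basis. ?f b (x \<bullet> b)) = complex_of_real (bump m x) * cis (- (x \<bullet> \<xi>))" for x
    by (subst euclidean_inner[of x \<xi>]) (simp add: prod.distrib cs bump_def sum_negf[symmetric])
  show ?thesis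
    using integrable_lborel_prod[of ?f] integral_lborel_prod[of ?f] bump1_fourier
    unfolding e has_bochner_integral_iff by auto
qed

text \<open>The transform is the product of one-dimensional transforms. If b is the direction of the
  coordinate of \<xi> with largest modulus, then the norm of \<xi> is at most d times that modulus,
  so the decay of this one factor suffices and the others are merely bounded.\<close>

lemma bump_ft_decay:
  obtains C where "0 < C" "\<And>\<xi>. cmod (ft (bump m) (\<xi> :: real ^ 'n)) \<le> C" "\<And>\<xi>. norm (\<xi> :: real ^ 'n) ^ m * cmod (ft (bump m) \<xi>) \<le> C"
proof -
  obtain C1 where C1: "0 \<le> C1" "\<And>\<omega>. \<bar>\<omega>\<bar> ^ m * cmod (bump1_ft 1 m \<omega>) \<le> C1" using bump1_ft_decay by blast
  have C2: "cmod (bump1_ft 1 m \<omega>) \<le> 2" for \<omega>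
  proof -
    have "cmod (bump1_ft 1 m \<omega>) \<le> 1 * (1 - (-1))"
      unfolding bump1_ft_def
    proof (rule integral_bound)
      fix s :: real assume s: "s \<in> {-1..1}"
      then have "norm ((1 - s\<^sup>2) ^ m) \<le> 1" using bump1_bounds[of m s] by (simp add: bump1_def)
      then show "norm (complex_of_real (poly 1 s * (1 - s\<^sup>2) ^ m) * cis (- (s * \<omega>))) \<le> 1"
        by (simp add: norm_mult del: of_real_power of_real_diff)
    next
      show "continuous_on {-1..1} (\<lambda>s. complex_of_real (poly 1 s * (1 - s\<^sup>2) ^ m) * cis (- (s * \<omega>)))"
        by (rule continuous_on_bump1_ft_integrand)
    qed simp
    then show ?thesis by simp
  qed
  define C where "C = max 2 C1"
  have C: "2 \<le> C" "C1 \<le> C" by (auto simp: C_def)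
  let ?\<phi> = "\<lambda>\<xi> b :: real ^ 'n. cmod (bump1_ft 1 m (\<xi> \<bullet> b))"
  have f: "cmod (ft (bump m) \<xi>) = (\<Prod>b\<in>Basis. ?\<phi> \<xi> b)" for \<xi> :: "real ^ 'n"
    using bump_fourier[of m \<xi>] by (simp add: ft_def has_bochner_integral_iff prod_norm)
  have prodle: "(\<Prod>b\<in>B. ?\<phi> \<xi> b) \<le> C ^ card B" for \<xi> and B :: "(real ^ 'n) set"
  proof -
    have "(\<Prod>b\<in>B. ?\<phi> \<xi> b) \<le> (\<Prod>b\<in>B. C)" using C2 C by (intro prod_mono) (auto intro: order_trans)
    then show ?thesis by simp
  qed
  have cm: "C ^ k \<le> C ^ CARD('n)" if "k \<le> CARD('n)" for k using C that by (intro power_increasing) auto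
  show ?thesis
  proof (rule that[of "real CARD('n) ^ m * C ^ CARD('n)"])
    show "0 < real CARD('n) ^ m * C ^ CARD('n)" using C by simp
    have one: "C ^ CARD('n) \<le> real CARD('n) ^ m * C ^ CARD('n)" using C by (simp add: mult_le_cancel_right1)
    show "cmod (ft (bump m) \<xi>) \<le> real CARD('n) ^ m * C ^ CARD('n)" for \<xi> :: "real ^ 'n"
      unfolding f using prodle[of \<xi> Basis] one by simp
    show "norm \<xi> ^ m * cmod (ft (bump m) \<xi>) \<le> real CARD('n) ^ m * C ^ CARD('n)" for \<xi> :: "real ^ 'n"
    proof -
      obtain b where b: "b \<in> Basis" "\<And>c. c \<in> Basis \<Longrightarrow> \<bar>\<xi> \<bullet> c\<bar> \<le> \<bar>\<xi> \<bullet> b\<bar>"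
      proof -
        let ?I = "(\<lambda>c. \<bar>\<xi> \<bullet> c\<bar>) ` Basis"
        have "Max ?I \<in> ?I" by (rule Max_in) auto
        then obtain b where b: "Max ?I = \<bar>\<xi> \<bullet> b\<bar>" "b \<in> Basis" by (rule imageE)
        have "\<bar>\<xi> \<bullet> c\<bar> \<le> \<bar>\<xi> \<bullet> b\<bar>" if "c \<in> Basis" for c
          unfolding b(1)[symmetric] using that by (intro Max_ge) auto
        then show ?thesis using that b(2) by blast
      qed
      have "norm \<xi> \<le> (\<Sum>c\<in>Basis. \<bar>\<xi> \<bullet> c\<bar>)" by (rule norm_le_l1)
      also have "\<dots> \<le> (\<Sum>c\<in>(Basis :: (real ^ 'n) set). \<bar>\<xi> \<bullet> b\<bar>)" by (intro sum_mono b(2))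
      finally have "norm \<xi> \<le> real CARD('n) * \<bar>\<xi> \<bullet> b\<bar>" by simp
      then have "norm \<xi> ^ m \<le> real CARD('n) ^ m * \<bar>\<xi> \<bullet> b\<bar> ^ m"
        by (metis norm_ge_zero power_mono power_mult_distrib)
      then have "norm \<xi> ^ m * cmod (ft (bump m) \<xi>) \<le> (real CARD('n) ^ m * \<bar>\<xi> \<bullet> b\<bar> ^ m) * cmod (ft (bump m) \<xi>)"
        by (intro mult_right_mono) auto
      also have "\<dots> = real CARD('n) ^ m * ((\<bar>\<xi> \<bullet> b\<bar> ^ m * ?\<phi> \<xi> b) * (\<Prod>c\<in>Basis - {b}. ?\<phi> \<xi> c))"
        unfolding f using b(1) by (subst prod.remove[of Basis b]) auto
      also have "\<dots> \<le> real CARD('n) ^ m * (C * C ^ card ((Basis :: (real ^ 'n) set) - {b}))"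
        using C1(2)[of "\<xi> \<bullet> b"] C by (intro mult_left_mono mult_mono prodle prod_nonneg) auto
      also have "C * C ^ card ((Basis :: (real ^ 'n) set) - {b}) = C ^ CARD('n)"
        using b(1) card_Suc_Diff1[of "Basis :: (real ^ 'n) set" b] by (metis DIM_cart DIM_real finite_Basis mult_1_right power_Suc)
      finally show ?thesis .
    qed
  qed
qed


lemma ft_scaled_bump:
  fixes z :: "real ^ 'n"
  assumes s: "0 < s"
  shows "ft (\<lambda>x. bump m ((1 / s) *\<^sub>R (x - z))) \<xi> = complex_of_real (s ^ CARD('n)) * cis (- (z \<bullet> \<xi>)) * ft (bump m) (s *\<^sub>R \<xi>)"
    and integrable_scaled_bump: "integrable lborel (\<lambda>x. bump m ((1 / s) *\<^sub>R (x - z)))"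
    and integral_scaled_bump: "(LINT x|lborel. bump m ((1 / s) *\<^sub>R (x - z))) = s ^ CARD('n) * (LINT x|lborel. bump m (x :: real ^ 'n))"
proof -
  have s0: "1 / s \<noteq> 0" "s \<noteq> 0" using s by auto
  have ib: "integrable lborel (bump m :: real ^ 'n \<Rightarrow> real)"
    using bump_fourier[of m "0 :: real ^ 'n"] by (simp add: has_bochner_integral_iff complex_of_real_integrable_eq)
  have aff: "- (1 / s) *\<^sub>R z + (1 / s) *\<^sub>R x = (1 / s) *\<^sub>R (x - z)" for x
    by (simp add: scaleR_right_diff_distrib)
  show i: "integrable lborel (\<lambda>x. bump m ((1 / s) *\<^sub>R (x - z)))"
    using integrable_lborel_affine[OF s0(1) ib, of "- (1 / s) *\<^sub>R z"] by (simp only: aff)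
  have inv: "(1 / s) *\<^sub>R ((z + s *\<^sub>R x) - z) = x" for x using s by simp
  show "(LINT x|lborel. bump m ((1 / s) *\<^sub>R (x - z))) = s ^ CARD('n) * (LINT x|lborel. bump m (x :: real ^ 'n))"
    using integral_lborel_affine[OF s0(2) i, of z] s unfolding inv by simp
  have "ft (\<lambda>x. bump m ((1 / s) *\<^sub>R (x - z))) \<xi>
     = \<bar>s\<bar> ^ DIM(real ^ 'n) *\<^sub>R (LINT x|lborel. complex_of_real (bump m ((1 / s) *\<^sub>R ((z + s *\<^sub>R x) - z))) * cis (- ((z + s *\<^sub>R x) \<bullet> \<xi>)))"
    unfolding ft_def by (rule integral_lborel_affine[OF s0(2) ft_integrable_integrand[OF i]])
  also have "(LINT x|lborel. complex_of_real (bump m ((1 / s) *\<^sub>R ((z + s *\<^sub>R x) - z))) * cis (- ((z + s *\<^sub>R x) \<bullet> \<xi>)))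
     = (LINT x|lborel. cis (- (z \<bullet> \<xi>)) * (complex_of_real (bump m x) * cis (- (x \<bullet> (s *\<^sub>R \<xi>)))))"
  proof (rule Bochner_Integration.integral_cong[OF refl])
    fix x :: "real ^ 'n"
    have "cis (- ((z + s *\<^sub>R x) \<bullet> \<xi>)) = cis (- (z \<bullet> \<xi>)) * cis (- (x \<bullet> (s *\<^sub>R \<xi>)))"
      by (simp add: cis_mult inner_add_left)
    then show "complex_of_real (bump m ((1 / s) *\<^sub>R ((z + s *\<^sub>R x) - z))) * cis (- ((z + s *\<^sub>R x) \<bullet> \<xi>))
      = cis (- (z \<bullet> \<xi>)) * (complex_of_real (bump m x) * cis (- (x \<bullet> (s *\<^sub>R \<xi>))))"
      unfolding inv by (simp only: mult_ac)
  qed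
  also have "\<dots> = cis (- (z \<bullet> \<xi>)) * ft (bump m) (s *\<^sub>R \<xi>)" by (simp add: ft_def)
  finally show "ft (\<lambda>x. bump m ((1 / s) *\<^sub>R (x - z))) \<xi> = complex_of_real (s ^ CARD('n)) * cis (- (z \<bullet> \<xi>)) * ft (bump m) (s *\<^sub>R \<xi>)"
    using s by (simp add: scaleR_conv_of_real)
qed

text \<open>Interpolates between boundedness and decay of order m, with explicit dependence on the
  scale: for s \<le> 1 the maximum of 1 and |\<xi>| is at most the maximum of 1 and s |\<xi>|,
  divided by s, which produces s^(- \<gamma>).\<close>

lemma bump_ft_polynomial_decay:
  assumes \<gamma>: "0 \<le> \<gamma>" "\<gamma> \<le> real m"
  obtains C where "0 < C" "\<And>\<xi> s. 0 < s \<Longrightarrow> s \<le> 1 \<Longrightarrow>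
     cmod (ft (bump m) (s *\<^sub>R \<xi> :: real ^ 'n)) * (1 + (norm \<xi>)\<^sup>2) powr (\<gamma> / 2) \<le> C * s powr (- \<gamma>)"
proof -
  obtain C where C: "0 < C" "\<And>\<xi>. cmod (ft (bump m) (\<xi> :: real ^ 'n)) \<le> C" "\<And>\<xi>. norm (\<xi> :: real ^ 'n) ^ m * cmod (ft (bump m) \<xi>) \<le> C"
    using bump_ft_decay by metis
  show ?thesis
  proof (rule that[of "2 powr (\<gamma> / 2) * C"])
    show "0 < 2 powr (\<gamma> / 2) * C" using C by simp
    fix \<xi> :: "real ^ 'n" and s :: real assume s: "0 < s" "s \<le> 1"
    let ?b = "cmod (ft (bump m) (s *\<^sub>R \<xi>))"
    have main: "?b * (max 1 (s * norm \<xi>)) powr \<gamma> \<le> C"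
    proof (cases "s * norm \<xi> \<le> 1")
      case True
      then show ?thesis using C(2)[of "s *\<^sub>R \<xi>"] by simp
    next
      case False
      then have "(s * norm \<xi>) powr \<gamma> \<le> (s * norm \<xi>) powr real m" using \<gamma> by (intro powr_mono) auto
      also have "\<dots> = norm (s *\<^sub>R \<xi>) ^ m" using False s by (simp add: powr_realpow)
      finally have "?b * (s * norm \<xi>) powr \<gamma> \<le> ?b * norm (s *\<^sub>R \<xi>) ^ m" by (intro mult_left_mono) auto
      also have "\<dots> \<le> C" using C(3)[of "s *\<^sub>R \<xi>"] by (simp add: mult.commute)
      finally show ?thesis using False by simp
    qed
    have "1 + (norm \<xi>)\<^sup>2 \<le> 2 * (max 1 (norm \<xi>))\<^sup>2"
    proof (cases "norm \<xi> \<le> 1")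
      case True then show ?thesis using power_mono[OF True, of 2] by simp
    next
      case False then show ?thesis using one_le_power[of "norm \<xi>" 2] by simp
    qed
    then have "(1 + (norm \<xi>)\<^sup>2) powr (\<gamma> / 2) \<le> (2 * (max 1 (norm \<xi>))\<^sup>2) powr (\<gamma> / 2)"
      using \<gamma> by (intro powr_mono2) auto
    also have "\<dots> = 2 powr (\<gamma> / 2) * ((max 1 (norm \<xi>))\<^sup>2) powr (\<gamma> / 2)" by (rule powr_mult)
    also have "((max 1 (norm \<xi>))\<^sup>2) powr (\<gamma> / 2) = (max 1 (norm \<xi>)) powr \<gamma>"
    proof -
      have "(max 1 (norm \<xi>))\<^sup>2 = (max 1 (norm \<xi>)) powr 2" by simp
      then have "((max 1 (norm \<xi>))\<^sup>2) powr (\<gamma> / 2) = ((max 1 (norm \<xi>)) powr 2) powr (\<gamma> / 2)" by (simp only:)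
      then show ?thesis unfolding powr_powr by simp
    qed
    finally have 1: "(1 + (norm \<xi>)\<^sup>2) powr (\<gamma> / 2) \<le> 2 powr (\<gamma> / 2) * (max 1 (norm \<xi>)) powr \<gamma>" .
    have "(max 1 (norm \<xi>)) powr \<gamma> \<le> (s powr - 1 * max 1 (s * norm \<xi>)) powr \<gamma>"
    proof (rule powr_mono2)
      have "1 \<le> (1 / s) * 1" using s by simp
      also have "\<dots> \<le> (1 / s) * max 1 (s * norm \<xi>)" using s by (intro mult_left_mono) auto
      finally have a: "1 \<le> (1 / s) * max 1 (s * norm \<xi>)" .
      have "norm \<xi> = (1 / s) * (s * norm \<xi>)" using s by simp
      also have "\<dots> \<le> (1 / s) * max 1 (s * norm \<xi>)" using s by (intro mult_left_mono) auto
      finally show "max 1 (norm \<xi>) \<le> s powr - 1 * max 1 (s * norm \<xi>)"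
        using a s by (simp add: powr_minus inverse_eq_divide)
    qed (use \<gamma> in auto)
    also have "\<dots> = s powr (- \<gamma>) * (max 1 (s * norm \<xi>)) powr \<gamma>"
      unfolding powr_mult powr_powr by simp
    finally have 2: "(max 1 (norm \<xi>)) powr \<gamma> \<le> s powr (- \<gamma>) * (max 1 (s * norm \<xi>)) powr \<gamma>" .
    have "?b * (1 + (norm \<xi>)\<^sup>2) powr (\<gamma> / 2) \<le> ?b * (2 powr (\<gamma> / 2) * (s powr (- \<gamma>) * (max 1 (s * norm \<xi>)) powr \<gamma>))"
      by (intro mult_left_mono order_trans[OF 1] 2) auto
    also have "\<dots> = 2 powr (\<gamma> / 2) * s powr (- \<gamma>) * (?b * (max 1 (s * norm \<xi>)) powr \<gamma>)" by (simp only: mult_ac)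
    also have "\<dots> \<le> 2 powr (\<gamma> / 2) * s powr (- \<gamma>) * C" by (intro mult_left_mono main) auto
    finally show "?b * (1 + (norm \<xi>)\<^sup>2) powr (\<gamma> / 2) \<le> 2 powr (\<gamma> / 2) * C * s powr (- \<gamma>)" by (simp only: mult_ac)
  qed
qed

text \<open>For a function of bounded support large truncations change nothing, so the limit is the
  plain integral.\<close>

lemma is_fourier_transform_ft:
  assumes [measurable]: "f \<in> borel_measurable borel" and supp: "\<And>x. R \<le> norm x \<Longrightarrow> f x = 0"
  shows "is_fourier_transform f (ft f)"
  unfolding is_fourier_transform_def truncated_fourier_conv_ft
proof
  show "ft f \<in> borel_measurable lborel" by measurable
  have "ball_cut S f = f" if "R \<le> S" for S using that supp by (force simp: ball_cut_def)
  then have "(\<integral>\<^sup>+\<xi>. ennreal ((cmod (ft (ball_cut S f) \<xi> - ft f \<xi>))\<^sup>2) \<partial>lborel) = 0" if "R \<le> S" for S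
    using that by simp
  then show "((\<lambda>S. \<integral>\<^sup>+\<xi>. ennreal ((cmod (ft (ball_cut S f) \<xi> - ft f \<xi>))\<^sup>2) \<partial>lborel) \<longlongrightarrow> 0) at_top"
    by (intro tendsto_eventually eventually_at_top_linorderI[of R]) auto
qed

text \<open>A bump of height r^\<beta> and width c r has a transform of size r^(\<beta> + d), and
  decay of order \<gamma> costs r^(- \<gamma>). Summing over the scales requires \<gamma> < \<beta>
  + d, finite energy of order \<alpha> requires \<gamma> > \<alpha> + d/2, and both can be met
  because \<beta> > \<alpha> - d/2.\<close>

lemma bump_series_sobolev:
  fixes z :: "nat \<Rightarrow> real ^ 'n" and r :: "nat \<Rightarrow> real"
  assumes \<alpha>: "real CARD('n) / 2 < \<alpha>" and \<beta>: "\<alpha> - real CARD('n) / 2 < \<beta>"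
    and m: "\<beta> + real CARD('n) \<le> real m"
    and c: "0 < c" "c \<le> 1" and r: "\<And>k. 0 < r k" "\<And>k. r k \<le> 1"
    and sum: "\<And>p. 0 < p \<Longrightarrow> summable (\<lambda>k. r k powr p)"
    and z: "\<And>k. norm (z k) \<le> R"
  defines "f \<equiv> \<lambda>x. \<Sum>k. r k powr \<beta> * bump m ((1 / (c * r k)) *\<^sub>R (x - z k))"
  shows "f \<in> sobolev_space \<alpha>" "continuous_on UNIV f"
proof -
  define d where "d = real CARD('n)"
  have d: "0 < d" by (simp add: d_def)
  have \<beta>0: "0 < \<beta>" using \<alpha> \<beta> by (simp add: d_def)
  have m0: "0 < m" using m \<beta>0 by (metis add_pos_nonneg less_le_trans of_nat_0_le_iff of_nat_0_less_iff)
  define g where "g k x = r k powr \<beta> * bump m ((1 / (c * r k)) *\<^sub>R (x - z k))" for k x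
  have g0: "0 \<le> g k x" "g k x \<le> r k powr \<beta>" for k x
    by (auto simp: g_def bump_bounds intro!: mult_left_le)
  have gsupp: "g k x = 0" if "R + d + 1 \<le> norm x" for k x
  proof -
    have "norm x - R \<le> norm (x - z k)" using norm_triangle_ineq2[of x "z k"] z[of k] by simp
    then have "d < norm (x - z k)" using that by simp
    also have "norm (x - z k) \<le> (1 / (c * r k)) * norm (x - z k)"
    proof -
      have "c * r k \<le> 1" using c r[of k] by (simp add: mult_le_one)
      then show ?thesis using c r[of k] mult_right_mono[of 1 "1 / (c * r k)" "norm (x - z k)"] by simp
    qed
    also have "\<dots> = norm ((1 / (c * r k)) *\<^sub>R (x - z k))" using c r[of k] by simp
    finally show ?thesis unfolding g_def by (subst bump_eq_0) (auto simp: d_def)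
  qed
  have gcont: "continuous_on UNIV (g k)" for k
    unfolding g_def[abs_def] by (intro continuous_intros continuous_on_compose2[OF continuous_on_bump[OF m0]]) auto
  have sg: "summable (\<lambda>k. g k x)" for x
    by (rule summable_comparison_test'[OF sum[OF \<beta>0]]) (use g0 in auto)
  have f: "f x = (\<Sum>k. g k x)" for x by (simp add: f_def g_def)
  have ul: "uniform_limit UNIV (\<lambda>n x. \<Sum>k<n. g k x) (\<lambda>x. \<Sum>k. g k x) sequentially"
    by (rule Weierstrass_m_test[OF _ sum[OF \<beta>0]]) (use g0 in auto)
  show cont: "continuous_on UNIV f"
    unfolding f[abs_def]
    by (rule uniform_limit_theorem[OF always_eventually ul]) (auto intro!: continuous_intros gcont)
  then have fm [measurable]: "f \<in> borel_measurable borel" by (rule borel_measurable_continuous_onI)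
  have gm [measurable]: "g k \<in> borel_measurable borel" for k by (rule borel_measurable_continuous_onI[OF gcont])
  have fsupp: "f x = 0" if "R + d + 1 \<le> norm x" for x using gsupp[OF that] by (simp add: f)
  define M where "M = (\<Sum>k. r k powr \<beta>)"
  have fb: "0 \<le> f x" "f x \<le> M" for x
    unfolding f M_def using g0 sg sum[OF \<beta>0] by (auto intro: suminf_nonneg suminf_le)
  have sq: "square_integrable f"
    unfolding square_integrable_def
  proof
    show "f \<in> borel_measurable lborel" by measurable
    have "emeasure lborel (cball (0 :: real ^ 'n) (R + d + 1)) < \<infinity>" by (rule emeasure_bounded_finite) simp
    then have "integrable lborel (\<lambda>x :: real ^ 'n. M\<^sup>2 * indicator (cball 0 (R + d + 1)) x)"
      by (intro integrable_mult_right integrable_real_indicator) auto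
    then show "integrable lborel (\<lambda>x. (f x)\<^sup>2)"
    proof (rule Bochner_Integration.integrable_bound)
      show "AE x in lborel. norm ((f x)\<^sup>2) \<le> norm (M\<^sup>2 * indicator (cball 0 (R + d + 1)) x)"
      proof (intro AE_I2)
        fix x
        show "norm ((f x)\<^sup>2) \<le> norm (M\<^sup>2 * indicator (cball 0 (R + d + 1)) x)"
          using fb[of x] fsupp[of x] power_mono[of "f x" M 2] by (cases "R + d + 1 \<le> norm x") (auto simp: indicator_def)
      qed
    qed measurable
  qed
  have is_ft: "is_fourier_transform f (ft f)" by (rule is_fourier_transform_ft[OF fm fsupp])
  have s: "0 < c * r k" "c * r k \<le> 1" for k using c r[of k] by (auto simp: mult_le_one)
  define J where "J = (LINT x|lborel. bump m (x :: real ^ 'n))"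
  have ig: "integrable lborel (g k)" for k
    unfolding g_def[abs_def] by (intro integrable_mult_right integrable_scaled_bump s)
  have intg: "(LINT x|lborel. g k x) = r k powr \<beta> * ((c * r k) ^ CARD('n) * J)" for k
    by (simp add: g_def integral_scaled_bump[OF s(1)] J_def)
  have ftsum: "ft f \<xi> = (\<Sum>k. ft (g k) \<xi>)" for \<xi>
  proof -
    let ?h = "\<lambda>k x. complex_of_real (g k x) * cis (- (x \<bullet> \<xi>))"
    have nh: "norm (?h k x) = g k x" for k x using g0 by (simp add: norm_mult)
    have J0: "0 \<le> J" unfolding J_def by (intro Bochner_Integration.integral_nonneg) (simp add: bump_bounds)
    have "(LINT x|lborel. (\<Sum>k. ?h k x)) = (\<Sum>k. LINT x|lborel. ?h k x)"
    proof (rule integral_suminf)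
      show "integrable lborel (?h k)" for k by (rule ft_integrable_integrand[OF ig])
      show "AE x in lborel. summable (\<lambda>k. norm (?h k x))" unfolding nh using sg by simp
      show "summable (\<lambda>k. LINT x|lborel. norm (?h k x))"
        unfolding nh intg
      proof (rule summable_comparison_test'[OF summable_mult2[OF sum[OF \<beta>0], of J]])
        fix k
        have "(c * r k) ^ CARD('n) * J \<le> 1 * J" using s[of k] J0 by (intro mult_right_mono power_le_one) auto
        then show "norm (r k powr \<beta> * ((c * r k) ^ CARD('n) * J)) \<le> r k powr \<beta> * J"
          using s[of k] J0 by (simp add: abs_mult mult_left_mono)
      qed
    qed
    moreover have "(\<Sum>k. ?h k x) = complex_of_real (f x) * cis (- (x \<bullet> \<xi>))" for x
    proof -
      have "complex_of_real (f x) = (\<Sum>k. complex_of_real (g k x))" unfolding f by (rule suminf_of_real[OF sg])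
      then show ?thesis using suminf_mult2[OF summable_of_real[OF sg[of x]], of "cis (- (x \<bullet> \<xi>))"] by simp
    qed
    ultimately show ?thesis by (simp add: ft_def)
  qed
  \<comment> \<open>The midpoint of \<alpha> + d/2 and \<beta> + d.\<close>
  define \<gamma> where "\<gamma> = \<alpha> / 2 + \<beta> / 2 + 3 / 4 * d"
  note params = \<alpha>[folded d_def] \<beta>[folded d_def] m[folded d_def] d \<beta>0
  have \<gamma>1: "0 \<le> \<gamma>" unfolding \<gamma>_def using params by linarith
  have \<gamma>2: "\<gamma> \<le> real m" unfolding \<gamma>_def using params by linarith
  have \<gamma>3: "\<gamma> < \<beta> + d" unfolding \<gamma>_def using params by linarith
  have \<gamma>4: "d / 2 < \<gamma> - \<alpha>" unfolding \<gamma>_def using params by linarith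
  note \<gamma> = \<gamma>1 \<gamma>2 \<gamma>3 \<gamma>4
  obtain C where C: "0 < C" "\<And>\<xi> s. 0 < s \<Longrightarrow> s \<le> 1 \<Longrightarrow>
     cmod (ft (bump m) (s *\<^sub>R \<xi> :: real ^ 'n)) * (1 + (norm \<xi>)\<^sup>2) powr (\<gamma> / 2) \<le> C * s powr (- \<gamma>)"
    using bump_ft_polynomial_decay[OF \<gamma>(1,2)] by metis
  define A where "A k = C * c powr (d - \<gamma>) * r k powr (\<beta> + d - \<gamma>)" for k
  have gk: "cmod (ft (g k) \<xi>) \<le> A k * (1 + (norm \<xi>)\<^sup>2) powr (- \<gamma> / 2)" for k \<xi>
  proof -
    let ?w = "(1 + (norm \<xi>)\<^sup>2) powr (\<gamma> / 2)"
    have pos: "0 < 1 + (norm \<xi>)\<^sup>2" by (simp add: add_pos_nonneg)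
    then have w: "0 < ?w" by simp
    have "ft (g k) \<xi> = complex_of_real (r k powr \<beta>) * ft (\<lambda>x. bump m ((1 / (c * r k)) *\<^sub>R (x - z k))) \<xi>"
      by (simp add: g_def ft_def mult.assoc)
    then have "cmod (ft (g k) \<xi>) = r k powr \<beta> * (c * r k) ^ CARD('n) * cmod (ft (bump m) ((c * r k) *\<^sub>R \<xi>))"
      unfolding ft_scaled_bump[OF s(1)] using s[of k] c(1) r(1)[of k] by (simp add: norm_mult norm_power abs_mult power_mult_distrib)
    then have "cmod (ft (g k) \<xi>) * ?w = r k powr \<beta> * (c * r k) ^ CARD('n) * (cmod (ft (bump m) ((c * r k) *\<^sub>R \<xi>)) * ?w)"
      by (simp only: mult.assoc)
    also have "\<dots> \<le> r k powr \<beta> * (c * r k) ^ CARD('n) * (C * (c * r k) powr (- \<gamma>))"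
      using s[of k] by (intro mult_left_mono C) auto
    also have "(c * r k) ^ CARD('n) = (c * r k) powr d" using s[of k] by (simp add: powr_realpow d_def)
    also have "r k powr \<beta> * (c * r k) powr d * (C * (c * r k) powr (- \<gamma>)) = C * r k powr \<beta> * ((c * r k) powr d * (c * r k) powr (- \<gamma>))"
      by (simp only: mult_ac)
    also have "(c * r k) powr d * (c * r k) powr (- \<gamma>) = c powr (d - \<gamma>) * r k powr (d - \<gamma>)"
      unfolding powr_add[symmetric] by (simp add: powr_mult)
    also have "C * r k powr \<beta> * (c powr (d - \<gamma>) * r k powr (d - \<gamma>)) = C * c powr (d - \<gamma>) * (r k powr \<beta> * r k powr (d - \<gamma>))"
      by (simp only: mult_ac)
    also have "r k powr \<beta> * r k powr (d - \<gamma>) = r k powr (\<beta> + d - \<gamma>)"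
      unfolding powr_add[symmetric] by (simp add: add_diff_eq)
    finally have "cmod (ft (g k) \<xi>) * ?w \<le> A k" by (simp only: A_def)
    then have "cmod (ft (g k) \<xi>) \<le> A k / ?w" using w by (simp add: pos_le_divide_eq)
    moreover have "(1 + (norm \<xi>)\<^sup>2) powr (- \<gamma> / 2) = 1 / ?w"
      using powr_minus_divide[of "1 + (norm \<xi>)\<^sup>2" "\<gamma> / 2"] by simp
    ultimately show ?thesis by simp
  qed
  have sA: "summable A" unfolding A_def[abs_def] using \<gamma> by (intro summable_mult sum) auto
  have ftb: "cmod (ft f \<xi>) \<le> suminf A * (1 + (norm \<xi>)\<^sup>2) powr (- \<gamma> / 2)" for \<xi>
  proof -
    let ?w = "(1 + (norm \<xi>)\<^sup>2) powr (- \<gamma> / 2)"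
    have "summable (\<lambda>k. A k * ?w)" by (rule summable_mult2[OF sA])
    then have "cmod (\<Sum>k. ft (g k) \<xi>) \<le> (\<Sum>k. A k * ?w)" using gk by (intro norm_suminf_le) auto
    then show ?thesis using sA by (simp add: ftsum suminf_mult2)
  qed
  have "sobolev_energy \<alpha> f = (\<integral>\<^sup>+\<xi>. ennreal ((1 + (norm \<xi>)\<^sup>2) powr \<alpha> * (cmod (ft f \<xi>))\<^sup>2) \<partial>lborel)"
    unfolding sobolev_energy_def
    using is_fourier_transform_unique[OF sq fourier_transform_is[OF sq] is_ft]
    by (intro nn_integral_cong_AE) (auto elim!: eventually_mono)
  also have "\<dots> \<le> (\<integral>\<^sup>+\<xi>. ennreal ((suminf A)\<^sup>2) * ennreal ((1 + (norm \<xi>)\<^sup>2) powr (- (\<gamma> - \<alpha>))) \<partial>(lborel :: (real ^ 'n) measure))"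
  proof (rule nn_integral_mono)
    fix \<xi> :: "real ^ 'n"
    let ?X = "1 + (norm \<xi>)\<^sup>2"
    have "(cmod (ft f \<xi>))\<^sup>2 \<le> (suminf A * ?X powr (- \<gamma> / 2))\<^sup>2" by (intro power_mono ftb) auto
    also have "\<dots> = (suminf A)\<^sup>2 * ?X powr (- \<gamma>)"
      unfolding power_mult_distrib by (simp add: power2_eq_square powr_add[symmetric])
    finally have "?X powr \<alpha> * (cmod (ft f \<xi>))\<^sup>2 \<le> ?X powr \<alpha> * ((suminf A)\<^sup>2 * ?X powr (- \<gamma>))" by (intro mult_left_mono) auto
    also have "\<dots> = (suminf A)\<^sup>2 * (?X powr \<alpha> * ?X powr (- \<gamma>))" by (simp only: mult_ac)
    also have "?X powr \<alpha> * ?X powr (- \<gamma>) = ?X powr (- (\<gamma> - \<alpha>))" unfolding powr_add[symmetric] by simp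
    finally show "ennreal (?X powr \<alpha> * (cmod (ft f \<xi>))\<^sup>2) \<le> ennreal ((suminf A)\<^sup>2) * ennreal (?X powr (- (\<gamma> - \<alpha>)))"
      by (simp add: ennreal_mult'[symmetric] ennreal_leI)
  qed
  also have "\<dots> = ennreal ((suminf A)\<^sup>2) * (\<integral>\<^sup>+\<xi>. ennreal ((1 + (norm \<xi>)\<^sup>2) powr (- (\<gamma> - \<alpha>))) \<partial>(lborel :: (real ^ 'n) measure))"
    by (rule nn_integral_cmult) measurable
  also have "\<dots> < \<infinity>"
    using bessel_potential_integrable[where 'n='n, of "\<gamma> - \<alpha>"] \<gamma>(4)
    by (simp add: ennreal_mult_less_top d_def)
  finally show "f \<in> sobolev_space \<alpha>" using sq by (simp add: sobolev_space_def)
qed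

section \<open>Bounds for the objective functions\<close>

lemma distinct_first_points:
  assumes "inj_on x {1..}"
  shows "distinct (first_points x n)"
proof -
  have "inj_on x {1..<Suc n}" by (rule inj_on_subset[OF assms]) auto
  then show ?thesis unfolding first_points_def distinct_map set_upt by (intro conjI distinct_upt)
qed

lemma set_first_points [simp]: "set (first_points x n) = x ` {1..n}"
  by (simp add: first_points_def atLeastLessThanSuc_atLeastAtMost del: upt_Suc)

lemma length_first_points [simp]: "length (first_points x n) = n"
  by (simp add: first_points_def)

lemma det_kernel_matrix_Nil: "Determinant.det (kernel_matrix K []) = 1"
  by (simp add: kernel_matrix_def det_dim_zero)

lemma quad_single:
  assumes "finite A" "x \<in> A"
  shows "quad K A (\<lambda>y. of_bool (y = x)) = K x x"
proof -
  have "quad K A (\<lambda>y. of_bool (y = x)) = quad K {x} (\<lambda>y. of_bool (y = x))"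
    by (rule quad_mono_neutral) (use assms in auto)
  then show ?thesis by (simp add: quad_def)
qed

text \<open>The determinant is a product of conditional variances, each of them a quadratic form
  with one coefficient equal to 1 and hence at least b.\<close>

lemma det_lower_bound:
  assumes pd: "pos_def_on (set Y) K" and dist: "distinct Y" and b: "0 < b"
    and low: "\<And>A u. A \<subseteq> set Y \<Longrightarrow> b * (\<Sum>y\<in>A. (u y)\<^sup>2) \<le> quad K A u"
  shows "b ^ length Y \<le> Determinant.det (kernel_matrix K Y)"
  using pd dist low
proof (induction Y rule: rev_induct)
  case Nil
  then show ?case by (simp add: det_kernel_matrix_Nil)
next
  case (snoc y Y)
  have ins: "set (Y @ [y]) = insert y (set Y)" by auto
  have pd': "pos_def_on (set Y) K" by (rule pos_def_on_subset[OF snoc.prems(1)]) auto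
  have Y: "distinct Y" "y \<notin> set Y" using snoc.prems(2) by auto
  have IH: "b ^ length Y \<le> Determinant.det (kernel_matrix K Y)"
    using snoc.IH[OF pd' Y(1)] snoc.prems(3) by auto
  obtain u where u: "u y = 1" "cond_var K Y y = quad K (insert y (set Y)) u"
    using cond_var_variational[OF Y snoc.prems(1)[unfolded ins]] by metis
  have "b * 1 \<le> b * (\<Sum>z\<in>insert y (set Y). (u z)\<^sup>2)"
  proof (rule mult_left_mono)
    have "(u y)\<^sup>2 \<le> (\<Sum>z\<in>insert y (set Y). (u z)\<^sup>2)" by (rule member_le_sum) auto
    then show "1 \<le> (\<Sum>z\<in>insert y (set Y). (u z)\<^sup>2)" using u(1) by simp
  qed (use b in auto)
  also have "\<dots> \<le> cond_var K Y y" unfolding u(2) using snoc.prems(3)[of "insert y (set Y)" u] by simp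
  finally have V: "b \<le> cond_var K Y y" by simp
  have "b ^ length Y * b \<le> Determinant.det (kernel_matrix K Y) * cond_var K Y y"
    using IH V b by (intro mult_mono) (auto intro: order_trans[of 0 "b ^ length Y"])
  then show ?case using det_kernel_matrix_snoc[OF Y snoc.prems(1)[unfolded ins]] by (simp add: mult.commute)
qed

lemma cond_var_lower_bound:
  assumes pd: "pos_def_on (insert y (set Y)) K" and Y: "distinct Y" "y \<notin> set Y" and b: "0 < b"
    and low: "\<And>u. b * (\<Sum>y\<in>insert y (set Y). (u y)\<^sup>2) \<le> quad K (insert y (set Y)) u"
  shows "b \<le> cond_var K Y y"
proof -
  obtain u where u: "u y = 1" "cond_var K Y y = quad K (insert y (set Y)) u"
    using cond_var_variational[OF Y pd] by metis
  have "b * 1 \<le> b * (\<Sum>z\<in>insert y (set Y). (u z)\<^sup>2)"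
  proof (rule mult_left_mono)
    have "(u y)\<^sup>2 \<le> (\<Sum>z\<in>insert y (set Y). (u z)\<^sup>2)" by (rule member_le_sum) auto
    then show "1 \<le> (\<Sum>z\<in>insert y (set Y). (u z)\<^sup>2)" using u(1) by simp
  qed (use b in auto)
  also have "\<dots> \<le> cond_var K Y y" unfolding u(2) by (rule low)
  finally show ?thesis by simp
qed

lemma cond_var_le_kernel:
  assumes pd: "pos_def_on (insert y (set Y)) K" and Y: "distinct Y" "y \<notin> set Y"
  shows "cond_var K Y y \<le> K y y"
proof -
  obtain u where u: "\<And>v. v y = 1 \<Longrightarrow> cond_var K Y y \<le> quad K (insert y (set Y)) v"
    using cond_var_variational[OF Y pd] by metis
  show ?thesis using u[of "\<lambda>z. of_bool (z = y)"] quad_single[of "insert y (set Y)" y K] by simp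
qed

text \<open>\<open>quad K P v\<close> with \<open>v y = 1\<close> bounds the conditional variance at \<open>y\<close> given the other points of \<open>P\<close>.\<close>

definition predictable :: "('a \<Rightarrow> 'a \<Rightarrow> real) \<Rightarrow> 'a set \<Rightarrow> nat \<Rightarrow> real \<Rightarrow> bool" where
  "predictable K S N e \<longleftrightarrow>
     (\<forall>P. P \<subseteq> S \<longrightarrow> finite P \<longrightarrow> N < card P \<longrightarrow> (\<exists>y\<in>P. \<exists>v. v y = 1 \<and> quad K P v \<le> e))"

lemma removeAll_distinct:
  assumes "distinct X" "y \<in> set X"
  shows "distinct (removeAll y X)" "y \<notin> set (removeAll y X)" "insert y (set (removeAll y X)) = set X"
  using assms by (auto simp: distinct_removeAll)

text \<open>As long as more than N points remain, a predictable one is peeled off with variance at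
  most e; the last N points are charged with the diagonal. Which point is peeled depends on those
  that remain, so the induction runs over all lists of distinct points of a given length, and
  permutation invariance of the determinant puts the chosen point last.\<close>

lemma ln_det_upper_bound:
  assumes pred: "predictable K (set X) N e" and e: "0 < e"
    and pd: "pos_def_on (set X) K" and dist: "distinct X"
    and diag: "\<And>y. y \<in> set X \<Longrightarrow> ln (K y y) \<le> L"
  shows "ln (Determinant.det (kernel_matrix K X)) \<le> real (length X - N) * ln e + real (min (length X) N) * L"
    and "0 < Determinant.det (kernel_matrix K X)"
proof -
  have "Y \<in> {Y. distinct Y \<and> set Y \<subseteq> set X \<and> length Y = k} \<Longrightarrow> 0 < Determinant.det (kernel_matrix K Y) \<and>
      ln (Determinant.det (kernel_matrix K Y)) \<le> real (length Y - N) * ln e + real (min (length Y) N) * L" for Y k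
  proof (induction k arbitrary: Y)
    case 0
    then show ?case by (simp add: det_kernel_matrix_Nil)
  next
    case (Suc k)
    then have Y: "distinct Y" "set Y \<subseteq> set X" "length Y = Suc k" by auto
    have pdY: "pos_def_on (set Y) K" by (rule pos_def_on_subset[OF pd _ Y(2)]) simp
    have step: "0 < Determinant.det (kernel_matrix K Y) \<and> (\<exists>Z. distinct Z \<and> set Z \<subseteq> set X \<and> length Z = k \<and>
        ln (Determinant.det (kernel_matrix K Y)) \<le> ln (Determinant.det (kernel_matrix K Z)) + ln B)"
      if y: "y \<in> set Y" and B: "cond_var K (removeAll y Y) y \<le> B" for y B
    proof -
      let ?Z = "removeAll y Y"
      note Z = removeAll_distinct[OF Y(1) y]
      have len: "length ?Z = k"
        using Y(3) y by (metis Y(1) distinct_remove1_removeAll length_remove1 diff_Suc_1)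
      have "mset Y = mset (?Z @ [y])"
        using y Y(1) by (simp add: distinct_remove1_removeAll[symmetric])
      then have det: "Determinant.det (kernel_matrix K Y) = Determinant.det (kernel_matrix K ?Z) * cond_var K ?Z y"
        using det_kernel_matrix_perm det_kernel_matrix_snoc[OF Z(1,2)] pdY Z(3) by metis
      have V: "0 < cond_var K ?Z y" using cond_var_pos[OF Z(1,2)] pdY Z(3) by simp
      have sub: "set ?Z \<subseteq> set X" using Y(2) by auto
      have d: "0 < Determinant.det (kernel_matrix K ?Z)" using Suc.IH[of ?Z] Z(1) len sub by simp
      have "ln (cond_var K ?Z y) \<le> ln B" using V B by simp
      then show ?thesis using d V Z(1) len sub unfolding det by (auto simp: ln_mult intro!: exI[of _ ?Z])
    qed
    show ?case
    proof (cases "N < length Y")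
      case True
      have "N < card (set Y)" using True Y(1) by (simp add: distinct_card)
      then obtain y v where y: "y \<in> set Y" and v: "v y = 1" "quad K (set Y) v \<le> e"
        using pred Y(2) unfolding predictable_def by (meson List.finite_set)
      note Z = removeAll_distinct[OF Y(1) y]
      have "cond_var K (removeAll y Y) y \<le> quad K (set Y) v"
        using cond_var_variational[OF Z(1,2)] pdY Z(3) v(1) by metis
      then have "cond_var K (removeAll y Y) y \<le> e" using v(2) by simp
      from step[OF y this] obtain Z where Z: "0 < Determinant.det (kernel_matrix K Y)" "distinct Z" "set Z \<subseteq> set X" "length Z = k"
        "ln (Determinant.det (kernel_matrix K Y)) \<le> ln (Determinant.det (kernel_matrix K Z)) + ln e" by blast
      have "ln (Determinant.det (kernel_matrix K Z)) \<le> real (k - N) * ln e + real (min k N) * L"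
        using Suc.IH[of Z] Z(2-4) by auto
      moreover have "real (Suc k - N) = real (k - N) + 1" "min (Suc k) N = N" "min k N = N" using True Y(3) by auto
      ultimately show ?thesis using Z(1,5) Y(3) by (simp add: algebra_simps)
    next
      case False
      obtain y where y: "y \<in> set Y" using Y(3) by (metis length_0_conv nat.distinct(1) list.set_intros(1) neq_Nil_conv)
      note Z = removeAll_distinct[OF Y(1) y]
      have "cond_var K (removeAll y Y) y \<le> K y y"
        using cond_var_le_kernel[OF _ Z(1,2)] pdY Z(3) by simp
      from step[OF y this] obtain Z where Z: "0 < Determinant.det (kernel_matrix K Y)" "distinct Z" "set Z \<subseteq> set X" "length Z = k"
        "ln (Determinant.det (kernel_matrix K Y)) \<le> ln (Determinant.det (kernel_matrix K Z)) + ln (K y y)" by blast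
      have "ln (Determinant.det (kernel_matrix K Z)) \<le> real (k - N) * ln e + real (min k N) * L"
        using Suc.IH[of Z] Z(2-4) by auto
      moreover have "ln (K y y) \<le> L" using diag y Y(2) by auto
      moreover have "Suc k - N = 0" "k - N = 0" "min (Suc k) N = Suc k" "min k N = k" using False Y(3) by auto
      ultimately show ?thesis using Z(1,5) Y(3) by (simp add: distrib_right)
    qed
  qed
  from this[of X "length X"] dist show "ln (Determinant.det (kernel_matrix K X)) \<le> real (length X - N) * ln e + real (min (length X) N) * L"
    "0 < Determinant.det (kernel_matrix K X)" by auto
qed

text \<open>At most N points have a conditional variance above e: otherwise predictability, applied
  to these points alone, would give one of them a variance of at most e, and conditioning on further
  points only lowers it. Each squared residual over its variance is the quotient of (\<Sum> u f)^2
  and the form at the same u, hence at most F.\<close>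

lemma loss_CV_upper_bound:
  assumes pred: "predictable K (set X) N e" and e: "0 < e" "e \<le> 1"
    and pd: "pos_def_on (set X) K" and dist: "distinct X"
    and diag: "\<And>y. y \<in> set X \<Longrightarrow> ln (K y y) \<le> L" and L: "0 \<le> L"
    and fit: "\<And>u. (\<Sum>y\<in>set X. u y * f y)\<^sup>2 \<le> F * quad K (set X) u"
  shows "loss_CV K f X \<le> real (length X) * F + real (length X - N) * ln e + real N * L"
proof -
  define V where "V y = cond_var K (removeAll y X) y" for y
  define bad where "bad = {y \<in> set X. e < V y}"
  have bad: "card bad \<le> N"
  proof (rule ccontr)
    assume "\<not> card bad \<le> N"
    then obtain y v where y: "y \<in> bad" and v: "v y = 1" "quad K bad v \<le> e"
      using pred unfolding predictable_def by (metis (no_types, lifting) List.finite_set bad_def finite_subset mem_Collect_eq not_le subsetI)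
    have yX: "y \<in> set X" using y by (simp add: bad_def)
    note Z = removeAll_distinct[OF dist yX]
    define w where "w z = (if z \<in> bad then v z else 0)" for z
    have "V y \<le> quad K (set X) w"
      unfolding V_def using cond_var_variational[OF Z(1,2)] pd Z(3) v(1) y w_def by metis
    also have "\<dots> = quad K bad w" by (rule quad_mono_neutral) (auto simp: w_def bad_def)
    also have "\<dots> = quad K bad v" by (rule quad_cong) (simp add: w_def)
    finally have "V y \<le> e" using v(2) by simp
    then show False using y by (simp add: bad_def)
  qed
  have summand: "(f y - cond_mean K f (removeAll y X) y)\<^sup>2 / V y + ln (V y) \<le> F + (if y \<in> bad then L else ln e)"
    if y: "y \<in> set X" for y
  proof -
    note Z = removeAll_distinct[OF dist y]
    obtain u where u: "u y = 1" "V y = quad K (set X) u"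
      "f y - cond_mean K f (removeAll y X) y = (\<Sum>z\<in>set X. u z * f z)"
      using cond_var_variational[OF Z(1,2)] pd Z(3) unfolding V_def by metis
    have Vp: "0 < V y" unfolding V_def using cond_var_pos[OF Z(1,2)] pd Z(3) by simp
    have "(f y - cond_mean K f (removeAll y X) y)\<^sup>2 / V y \<le> F"
      unfolding u(3) using fit[of u] Vp u(2) by (simp add: divide_le_eq)
    moreover have "ln (V y) \<le> (if y \<in> bad then L else ln e)"
    proof (cases "y \<in> bad")
      case True
      have "V y \<le> K y y" unfolding V_def using cond_var_le_kernel[OF _ Z(1,2)] pd Z(3) by simp
      then have "ln (V y) \<le> ln (K y y)" using Vp by simp
      then show ?thesis using diag[OF y] True by simp
    next
      case False
      then have "V y \<le> e" using y by (simp add: bad_def)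
      then show ?thesis using Vp False by simp
    qed
    ultimately show ?thesis by simp
  qed
  have "loss_CV K f X = (\<Sum>y\<in>set X. (f y - cond_mean K f (removeAll y X) y)\<^sup>2 / V y + ln (V y))"
    unfolding loss_CV_def V_def by (simp add: sum.distinct_set_conv_list[OF dist])
  also have "\<dots> \<le> (\<Sum>y\<in>set X. F + (if y \<in> bad then L else ln e))" by (intro sum_mono summand)
  also have "\<dots> = real (length X) * F + (\<Sum>y\<in>set X. if y \<in> bad then L else ln e)"
    using dist by (simp add: sum.distrib distinct_card)
  also have "(\<Sum>y\<in>set X. if y \<in> bad then L else ln e) = (\<Sum>y\<in>bad. L) + (\<Sum>y\<in>set X - bad. ln e)"
  proof -
    have "bad \<subseteq> set X" by (auto simp: bad_def)
    then have "(\<Sum>y\<in>set X. if y \<in> bad then L else ln e) = (\<Sum>y\<in>set X - bad. if y \<in> bad then L else ln e) + (\<Sum>y\<in>bad. if y \<in> bad then L else ln e)"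
      by (intro sum.subset_diff) auto
    then show ?thesis by (simp add: add.commute)
  qed
  also have "\<dots> \<le> real N * L + real (length X - N) * ln e"
  proof (rule add_mono)
    show "(\<Sum>y\<in>bad. L) \<le> real N * L" using bad L by (simp add: mult_right_mono)
    have sub: "bad \<subseteq> set X" by (auto simp: bad_def)
    then have "card (set X - bad) = length X - card bad"
      using dist by (simp add: card_Diff_subset finite_subset[OF sub] distinct_card)
    then have "real (length X - N) \<le> real (card (set X - bad))" using bad by simp
    \<comment> \<open>As e \<le> 1, its logarithm is not positive, so additional well-predicted
      points only lower the sum.\<close>
    then have "real (card (set X - bad)) * ln e \<le> real (length X - N) * ln e"
      using e by (intro mult_right_mono_neg) auto
    then show "(\<Sum>y\<in>set X - bad. ln e) \<le> real (length X - N) * ln e" by simp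
  qed
  finally show ?thesis by simp
qed

lemma loss_ML_lower_bound:
  assumes pd: "pos_def_on (set X) K" and dist: "distinct X" and b: "0 < b"
    and low: "\<And>A u. A \<subseteq> set X \<Longrightarrow> b * (\<Sum>y\<in>A. (u y)\<^sup>2) \<le> quad K A u"
  shows "data_fit K f X + real (length X) * ln b \<le> loss_ML K f X"
proof -
  have "b ^ length X \<le> Determinant.det (kernel_matrix K X)" by (rule det_lower_bound[OF pd dist b low])
  then have "ln (b ^ length X) \<le> ln (Determinant.det (kernel_matrix K X))"
    using b by (intro ln_mono) auto
  then show ?thesis using b by (simp add: loss_ML_def data_fit_def ln_realpow)
qed

lemma loss_CV_lower_bound:
  assumes pd: "pos_def_on (set X) K" and dist: "distinct X" and b: "0 < b"
    and low: "\<And>u. b * (\<Sum>y\<in>set X. (u y)\<^sup>2) \<le> quad K (set X) u"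
  shows "real (length X) * ln b \<le> loss_CV K f X"
proof -
  have "ln b \<le> (f y - cond_mean K f (removeAll y X) y)\<^sup>2 / cond_var K (removeAll y X) y + ln (cond_var K (removeAll y X) y)"
    if y: "y \<in> set X" for y
  proof -
    note Z = removeAll_distinct[OF dist y]
    have V: "b \<le> cond_var K (removeAll y X) y"
      using cond_var_lower_bound[OF _ Z(1,2) b] pd low Z(3) by simp
    then have "ln b \<le> ln (cond_var K (removeAll y X) y)" using b by (intro ln_mono) auto
    moreover have "0 \<le> (f y - cond_mean K f (removeAll y X) y)\<^sup>2 / cond_var K (removeAll y X) y" using V b by simp
    ultimately show ?thesis by simp
  qed
  then have "(\<Sum>y\<in>set X. ln b) \<le> (\<Sum>y\<in>set X. (f y - cond_mean K f (removeAll y X) y)\<^sup>2 / cond_var K (removeAll y X) y + ln (cond_var K (removeAll y X) y))"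
    by (intro sum_mono)
  then show ?thesis
    unfolding loss_CV_def using dist by (simp add: sum.distinct_set_conv_list[OF dist, symmetric] distinct_card)
qed

section \<open>Lower bounds for the estimators\<close>

text \<open>The left side is the upper bound for the loss at the comparison parameter, the right
  side the lower bound for all parameters up to y. Divided by n ln n the two sides tend to - g and -
  s, and every other term vanishes. The term with F is the data fit of cross-validation, the one
  with F' that of maximum likelihood.\<close>

lemma asymptotic_gap:
  fixes A b g s \<nu> L F F' q p C l :: real
  assumes "b < 1" "q < 1" "s < g"
  shows "\<forall>\<^sub>F n in sequentially. (real n - A * real n powr b) * (l - g * ln (real n)) + A * real n powr b * L + F * real n
      + F' * (real n powr q * ln (2 * real n) powr p) < real n * (C - s * ln (real n) - \<nu> * ln (ln (2 * real n)))"
proof -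
  let ?x1 = "\<lambda>n. real n powr b / real n" and ?x2 = "\<lambda>n. 1 / ln (real n)"
    and ?x3 = "\<lambda>n. ln (ln (2 * real n)) / ln (real n)" and ?x4 = "\<lambda>n. real n powr q * ln (2 * real n) powr p / (real n * ln (real n))"
  let ?E = "\<lambda>n. C * ?x2 n - s - \<nu> * ?x3 n - ((1 - A * ?x1 n) * (l * ?x2 n - g) + A * ?x1 n * (L * ?x2 n) + F * ?x2 n + F' * ?x4 n)"
  have "?x1 \<longlonglongrightarrow> 0" using assms(1) by real_asymp
  moreover have "?x2 \<longlonglongrightarrow> 0" by real_asymp
  moreover have "?x3 \<longlonglongrightarrow> 0" by real_asymp
  moreover have "?x4 \<longlonglongrightarrow> 0" using assms(2) by real_asymp
  ultimately have "?E \<longlonglongrightarrow> C * 0 - s - \<nu> * 0 - ((1 - A * 0) * (l * 0 - g) + A * 0 * (L * 0) + F * 0 + F' * 0)"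
    by (intro tendsto_intros)
  then have "\<forall>\<^sub>F n in sequentially. 0 < ?E n"
    using assms(3) by (intro order_tendstoD(1)) auto
  moreover have "\<forall>\<^sub>F n :: nat in sequentially. 2 \<le> n" by (rule eventually_ge_at_top)
  ultimately show ?thesis
  proof eventually_elim
    case (elim n)
    have ln: "0 < ln (real n)" and n: "0 < real n" using elim by auto
    then have "0 < (real n * ln (real n)) * ?E n" using elim by (intro mult_pos_pos) auto
    also have "(real n * ln (real n)) * ?E n = real n * (C - s * ln (real n) - \<nu> * ln (ln (2 * real n)))
      - ((real n - A * real n powr b) * (l - g * ln (real n)) + A * real n powr b * L + F * real n + F' * (real n powr q * ln (2 * real n) powr p))"
    proof -
      have gen: "(N * E) * (C * (1 / E) - s - \<nu> * (W / E) - ((1 - A * (P / N)) * (l * (1 / E) - g) + A * (P / N) * (L * (1 / E)) + F * (1 / E) + F' * (Z / (N * E))))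
         = N * (C - s * E - \<nu> * W) - ((N - A * P) * (l - g * E) + A * P * L + F * N + F' * Z)"
        if "0 < N" "0 < E" for N E W P Z :: real
        using that by (simp add: field_simps)
      show ?thesis by (rule gen[OF n ln])
    qed
    finally show ?case by simp
  qed
qed

lemma sobolev_bounded_quad:
  fixes B :: "(real ^ 'n \<Rightarrow> real) set" and \<Omega> :: "(real ^ 'n) set"
  assumes B: "sobolev_bounded \<alpha> \<Omega> B" and \<alpha>: "real CARD('n) / 2 < \<alpha>" and \<kappa>: "0 < \<kappa>"
  obtains F where "0 \<le> F" "\<And>f A u. f \<in> B \<Longrightarrow> A \<subseteq> \<Omega> \<Longrightarrow> finite A \<Longrightarrow>
    (\<Sum>x\<in>A. u x * f x)\<^sup>2 \<le> F * quad (mix_kernel (\<alpha> - real CARD('n) / 2) \<kappa>) A u"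
proof -
  obtain M where M: "\<And>f. f \<in> B \<Longrightarrow> sobolev_norm_on \<alpha> \<Omega> f \<le> M" and sub: "B \<subseteq> sobolev_space_on \<alpha> \<Omega>"
    using B by (auto simp: sobolev_bounded_def)
  \<comment> \<open>The norm on the domain is an infimum; a bound strictly above M yields an
    extension of norm less than R.\<close>
  define R where "R = max M 0 + 1"
  have R: "0 < R" by (simp add: R_def)
  have \<alpha>0: "0 < \<alpha>" using \<alpha> by (meson divide_nonneg_pos of_nat_0_le_iff order_le_less_trans zero_less_numeral)
  define C where "C = max 1 \<kappa> powr \<alpha> * sqrt pi ^ CARD('n) / Gamma \<alpha> / ((2 * pi) ^ CARD('n))\<^sup>2"
  have C: "0 \<le> C" unfolding C_def using Gamma_real_pos[OF \<alpha>0] by simp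
  show ?thesis
  proof (rule that[of "C * R\<^sup>2"])
    show "0 \<le> C * R\<^sup>2" using C by simp
    fix f A u assume f: "f \<in> B" and A: "A \<subseteq> \<Omega>" "finite A"
    have ne: "sobolev_extensions \<alpha> \<Omega> f \<noteq> {}" using f sub by (auto simp: sobolev_space_on_def)
    have "sobolev_norm_on \<alpha> \<Omega> f < R" using M[OF f] by (simp add: R_def)
    then obtain g where g: "g \<in> sobolev_extensions \<alpha> \<Omega> f" "sobolev_norm \<alpha> g < R"
      unfolding sobolev_norm_on_def
      by (subst (asm) cINF_less_iff[OF ne]) (auto intro!: bdd_belowI2[of _ 0] simp: sobolev_norm_def)
    then have gs: "square_integrable g" "sobolev_energy \<alpha> g < \<infinity>" "continuous_on UNIV g" "\<And>x. x \<in> \<Omega> \<Longrightarrow> g x = f x"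
      by (auto simp: sobolev_extensions_def sobolev_space_def)
    have "sqrt (enn2real (sobolev_energy \<alpha> g)) \<le> R" using g(2) by (simp add: sobolev_norm_def)
    then have "enn2real (sobolev_energy \<alpha> g) \<le> R\<^sup>2" by (rule sqrt_le_D)
    then have E: "sobolev_energy \<alpha> g \<le> ennreal (R\<^sup>2)"
      using gs(2) by (metis ennreal_enn2real ennreal_leI infinity_ennreal_def)
    have "(\<Sum>x\<in>A. u x * g x)\<^sup>2 \<le> C * R\<^sup>2 * quad (mix_kernel (\<alpha> - real CARD('n) / 2) \<kappa>) A u"
      unfolding C_def
      by (rule sobolev_quad_bound[OF \<alpha> \<kappa> gs(1) gs(3) fourier_transform_is[OF gs(1)] E[unfolded sobolev_energy_def] _ A(2)]) simp
    moreover have "(\<Sum>x\<in>A. u x * g x) = (\<Sum>x\<in>A. u x * f x)" using A(1) gs(4) by (intro sum.cong) auto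
    ultimately show "(\<Sum>x\<in>A. u x * f x)\<^sup>2 \<le> C * R\<^sup>2 * quad (mix_kernel (\<alpha> - real CARD('n) / 2) \<kappa>) A u" by simp
  qed
qed

lemma predictable_subset: "predictable K S N e \<Longrightarrow> S' \<subseteq> S \<Longrightarrow> predictable K S' N e"
  by (auto simp: predictable_def)

section \<open>Matern kernels on a quasi-uniform sequence of points\<close>

locale matern_design =
  fixes \<nu>min \<nu>max \<sigma> lam :: real and c :: "real \<Rightarrow> real" and \<Omega> :: "(real ^ 'n) set" and x :: "nat \<Rightarrow> real ^ 'n"
  assumes \<nu>min: "0 < \<nu>min" "\<nu>min \<le> \<nu>max" and \<sigma>: "0 < \<sigma>" and lam: "0 < lam"
    and c_pos: "\<And>\<nu>. \<nu> \<in> {\<nu>min..\<nu>max} \<Longrightarrow> 0 < c \<nu>"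
    and c_inf: "0 < (INF \<nu>\<in>{\<nu>min..\<nu>max}. c \<nu>)"
    and bdd: "bounded \<Omega>" and opn: "open \<Omega>"
    and x_in: "\<And>i. 1 \<le> i \<Longrightarrow> x i \<in> \<Omega>" and inj: "inj_on x {1..}"
    and qu: "quasi_uniform \<Omega> x"
begin

abbreviation \<Theta> :: "real set" where "\<Theta> \<equiv> {\<nu>min..\<nu>max}"
abbreviation K :: "real \<Rightarrow> real ^ 'n \<Rightarrow> real ^ 'n \<Rightarrow> real" where "K \<equiv> matern \<sigma> lam c"
abbreviation X :: "nat \<Rightarrow> (real ^ 'n) list" where "X \<equiv> first_points x"

text \<open>For times up to this scale, the Gram matrix of \<^term>\<open>gauss t\<close> at the first \<open>n\<close> points differs from
  the identity by at most \<open>1/2\<close>.\<close>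

definition gauss_scale :: "nat \<Rightarrow> real" where
  "gauss_scale n = (separation_radius x n)\<^sup>2 / ln (2 * real n)"

lemma d_pos: "0 < real CARD('n)" by simp

lemma \<Theta>_pos: "\<nu> \<in> \<Theta> \<Longrightarrow> 0 < \<nu>" using \<nu>min by auto

lemma X_subset: "set (X n) \<subseteq> \<Omega>" using x_in by auto

lemma distinct_X: "distinct (X n)" by (rule distinct_first_points[OF inj])

lemma pos_def_K: "\<nu> \<in> \<Theta> \<Longrightarrow> finite A \<Longrightarrow> pos_def_on A (K \<nu>)"
  by (intro pos_def_matern lam \<sigma> \<Theta>_pos c_pos)

text \<open>Volumes bound the fill distance from below and the separation radius from above by
  multiples of n^(-1/d); the two remaining bounds, here and in \<open>fill_upper\<close>, come from
  quasi-uniformity.\<close>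

lemma separation_lower:
  obtains a where "0 < a" "\<And>n. 2 \<le> n \<Longrightarrow> a * real n powr (- 1 / real CARD('n)) \<le> separation_radius x n"
proof -
  obtain a where a: "0 < a" "\<And>n. 2 \<le> n \<Longrightarrow> a * real n powr (- 1 / real CARD('n)) \<le> fill_distance \<Omega> x n"
    using fill_distance_lower[where x = x, OF bdd opn x_in] by auto
  obtain C where C: "0 < C" "\<And>n. 2 \<le> n \<Longrightarrow> fill_distance \<Omega> x n \<le> C * separation_radius x n"
    using qu by (auto simp: quasi_uniform_def)
  show ?thesis
  proof (rule that[of "a / C"])
    show "0 < a / C" using a C by simp
    fix n :: nat assume n: "2 \<le> n"
    have "a * real n powr (- 1 / real CARD('n)) \<le> separation_radius x n * C"
      using a(2)[OF n] C(2)[OF n] by (simp add: mult.commute)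
    then show "a / C * real n powr (- 1 / real CARD('n)) \<le> separation_radius x n"
      using C(1) by (simp add: pos_divide_le_eq)
  qed
qed

lemma fill_upper:
  obtains b where "0 < b" "\<And>n. 2 \<le> n \<Longrightarrow> fill_distance \<Omega> x n \<le> b * real n powr (- 1 / real CARD('n))"
proof -
  obtain a where a: "0 < a" "\<And>n. 2 \<le> n \<Longrightarrow> separation_radius x n \<le> a * real n powr (- 1 / real CARD('n))"
    using separation_radius_upper[OF bdd x_in inj] by auto
  obtain C where C: "0 < C" "\<And>n. 2 \<le> n \<Longrightarrow> fill_distance \<Omega> x n \<le> C * separation_radius x n"
    using qu by (auto simp: quasi_uniform_def)
  show ?thesis
  proof (rule that[of "C * a"])
    show "0 < C * a" using a C by simp
    fix n :: nat assume n: "2 \<le> n"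
    have "C * separation_radius x n \<le> C * (a * real n powr (- 1 / real CARD('n)))" using a(2)[OF n] C(1) by simp
    then show "fill_distance \<Omega> x n \<le> C * a * real n powr (- 1 / real CARD('n))" using C(2)[OF n] by simp
  qed
qed

lemma gauss_scale_pos: "2 \<le> n \<Longrightarrow> 0 < gauss_scale n"
  using separation_radius_pos[OF inj, of n] by (simp add: gauss_scale_def)

lemma gauss_scale_lower:
  obtains a where "0 < a" "\<And>n. 2 \<le> n \<Longrightarrow> a * (real n powr (- 2 / real CARD('n)) / ln (2 * real n)) \<le> gauss_scale n"
proof -
  obtain a where a: "0 < a" "\<And>n. 2 \<le> n \<Longrightarrow> a * real n powr (- 1 / real CARD('n)) \<le> separation_radius x n"
    using separation_lower by auto
  show ?thesis
  proof (rule that[of "a\<^sup>2"])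
    show "0 < a\<^sup>2" using a by simp
    fix n :: nat assume n: "2 \<le> n"
    have "(a * real n powr (- 1 / real CARD('n)))\<^sup>2 \<le> (separation_radius x n)\<^sup>2" using a n by (intro power_mono) auto
    moreover have "(real n powr (- 1 / real CARD('n)))\<^sup>2 = real n powr (- 2 / real CARD('n))" by (simp add: power2_eq_square powr_add[symmetric])
    ultimately have "a\<^sup>2 * real n powr (- 2 / real CARD('n)) \<le> (separation_radius x n)\<^sup>2" by (simp add: power_mult_distrib)
    then have "a\<^sup>2 * real n powr (- 2 / real CARD('n)) / ln (2 * real n) \<le> gauss_scale n"
      unfolding gauss_scale_def using n by (intro divide_right_mono) auto
    then show "a\<^sup>2 * (real n powr (- 2 / real CARD('n)) / ln (2 * real n)) \<le> gauss_scale n" by simp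
  qed
qed

lemma gauss_scale_le_1: "\<forall>\<^sub>F n in sequentially. gauss_scale n \<le> 1"
proof -
  obtain a where a: "0 < a" "\<And>n. 2 \<le> n \<Longrightarrow> separation_radius x n \<le> a * real n powr (- 1 / real CARD('n))"
    using separation_radius_upper[OF bdd x_in inj] by auto
  have "(\<lambda>n. (a * real n powr (- 1 / real CARD('n)))\<^sup>2 / ln (2 * real n)) \<longlonglongrightarrow> 0"
  proof -
    have "(\<lambda>n. (a * real n powr (- h))\<^sup>2 / ln (2 * real n)) \<longlonglongrightarrow> 0" if "0 < h" for h :: real
      using that a(1) by real_asymp
    from this[of "1 / real CARD('n)"] show ?thesis by simp
  qed
  then have "\<forall>\<^sub>F n in sequentially. (a * real n powr (- 1 / real CARD('n)))\<^sup>2 / ln (2 * real n) < 1"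
    by (rule order_tendstoD) simp
  moreover have "\<forall>\<^sub>F n :: nat in sequentially. 2 \<le> n" by (rule eventually_ge_at_top)
  ultimately show ?thesis
  proof eventually_elim
    case (elim n)
    have "(separation_radius x n)\<^sup>2 \<le> (a * real n powr (- 1 / real CARD('n)))\<^sup>2"
      using a(2)[OF elim(2)] separation_radius_pos[OF inj elim(2)] by (intro power_mono) auto
    then have "gauss_scale n \<le> (a * real n powr (- 1 / real CARD('n)))\<^sup>2 / ln (2 * real n)"
      unfolding gauss_scale_def using elim by (intro divide_right_mono) auto
    then show ?case using elim(1) by linarith
  qed
qed

text \<open>The infimum of c makes the constant uniform in \<nu>, as the minimiser is not known in
  advance. The scale is that of all n points also when A is a subset.\<close>

lemma K_lower:
  obtains m where "0 < m" "\<And>\<nu> n A u. \<nu> \<in> \<Theta> \<Longrightarrow> 2 \<le> n \<Longrightarrow> gauss_scale n \<le> 1 \<Longrightarrow> A \<subseteq> set (X n) \<Longrightarrow>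
     m * gauss_scale n powr \<nu> * (\<Sum>y\<in>A. (u y)\<^sup>2) \<le> quad (K \<nu>) A u"
proof -
  obtain m where m: "0 < m"
    "\<And>\<nu> n q (A :: (real ^ 'n) set) u c. \<nu> \<in> \<Theta> \<Longrightarrow> finite A \<Longrightarrow> card A \<le> n \<Longrightarrow> 1 \<le> n \<Longrightarrow> 0 < q \<Longrightarrow>
       (\<And>x y. x \<in> A \<Longrightarrow> y \<in> A \<Longrightarrow> x \<noteq> y \<Longrightarrow> 2 * q \<le> norm (x - y)) \<Longrightarrow> q\<^sup>2 / ln (2 * real n) \<le> 1 \<Longrightarrow> 0 \<le> c \<nu> \<Longrightarrow>
       m * c \<nu> * (q\<^sup>2 / ln (2 * real n)) powr \<nu> * (\<Sum>x\<in>A. (u x)\<^sup>2) \<le> quad (matern \<sigma> lam c \<nu>) A u"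
    using quad_matern_lower[OF lam \<sigma> \<nu>min] by blast
  define c0 where "c0 = (INF \<nu>\<in>\<Theta>. c \<nu>)"
  have c0: "0 < c0" using c_inf by (simp add: c0_def)
  have cl: "c0 \<le> c \<nu>" if "\<nu> \<in> \<Theta>" for \<nu>
    unfolding c0_def using that c_pos by (intro cINF_lower bdd_belowI2[of _ 0]) (auto intro: less_imp_le)
  show ?thesis
  proof (rule that[of "m * c0"])
    show "0 < m * c0" using m c0 by simp
    fix \<nu> n A and u :: "real ^ 'n \<Rightarrow> real"
    assume \<nu>: "\<nu> \<in> \<Theta>" and n: "2 \<le> (n::nat)" and T: "gauss_scale n \<le> 1" and A: "A \<subseteq> set (X n)"
    have "card A \<le> card (set (X n))" using A by (intro card_mono) auto
    then have cA: "card A \<le> n" using distinct_X by (simp add: distinct_card del: set_first_points)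
    have sep: "2 * separation_radius x n \<le> norm (y - z)" if yz: "y \<in> A" "z \<in> A" "y \<noteq> z" for y z
    proof -
      have "y \<in> x ` {1..n}" "z \<in> x ` {1..n}" using A yz(1,2) by auto
      then obtain i j where "i \<in> {1..n}" "y = x i" "j \<in> {1..n}" "z = x j" by (elim imageE)
      then show ?thesis using yz(3) separation_radius_le[of i n j x] by auto
    qed
    have "m * c \<nu> * gauss_scale n powr \<nu> * (\<Sum>y\<in>A. (u y)\<^sup>2) \<le> quad (K \<nu>) A u"
      unfolding gauss_scale_def
      by (rule m(2)[OF \<nu> finite_subset[OF A] cA _ separation_radius_pos[OF inj n] sep T[unfolded gauss_scale_def]])
         (use n c_pos[OF \<nu>] in auto)
    moreover have "m * c0 * (gauss_scale n powr \<nu> * (\<Sum>y\<in>A. (u y)\<^sup>2)) \<le> m * c \<nu> * (gauss_scale n powr \<nu> * (\<Sum>y\<in>A. (u y)\<^sup>2))"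
      using cl[OF \<nu>] m(1) by (intro mult_right_mono mult_left_mono) (auto intro!: mult_nonneg_nonneg sum_nonneg)
    ultimately show "m * c0 * gauss_scale n powr \<nu> * (\<Sum>y\<in>A. (u y)\<^sup>2) \<le> quad (K \<nu>) A u"
      by (simp only: mult.assoc)
  qed
qed

text \<open>With more than D points per cell on average, some cell contains D + 1, one more than the
  number of conditions, so annihilating coefficients with an entry 1 exist there. As k exceeds
  \<nu>max, the form is then of order \<delta>^(2 \<nu>).\<close>

lemma predictable_K:
  assumes \<nu>: "\<nu> \<in> \<Theta>"
  obtains M A where "0 < M" "0 < A"
    "\<And>\<delta>. 0 < \<delta> \<Longrightarrow> \<delta> \<le> 1 \<Longrightarrow> \<exists>N. real N \<le> A * \<delta> powr (- real CARD('n)) \<and> predictable (K \<nu>) \<Omega> N (M * \<delta> powr (2 * \<nu>))"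
proof -
  obtain k :: nat where k: "\<nu>max < real k" using reals_Archimedean2 by blast
  obtain M0 where M0: "0 < M0"
    "\<And>\<nu> \<delta> (A :: (real ^ 'n) set) u c. \<nu> \<in> \<Theta> \<Longrightarrow> annihilates k A u \<Longrightarrow> 0 < \<delta> \<Longrightarrow>
       (\<And>x y. x \<in> A \<Longrightarrow> y \<in> A \<Longrightarrow> norm (x - y) \<le> \<delta>) \<Longrightarrow> 0 \<le> c \<nu> \<Longrightarrow>
       quad (matern \<sigma> lam c \<nu>) A u \<le> M0 * c \<nu> * (\<Sum>x\<in>A. \<bar>u x\<bar>)\<^sup>2 * \<delta> powr (2 * \<nu>)"
    using quad_matern_annihilates[OF lam \<sigma> \<nu>min k] by blast
  obtain C where C: "0 < C" "\<And>\<delta>. 0 < \<delta> \<Longrightarrow> \<delta> \<le> 1 \<Longrightarrow>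
     finite (grid_cell \<delta> ` \<Omega>) \<and> real (card (grid_cell \<delta> ` \<Omega>)) \<le> C * \<delta> powr (- real CARD('n))"
    using card_grid_cells[OF bdd] by blast
  define D where "D = card (monomial_index k :: (nat \<times> (nat \<Rightarrow> (real ^ 'n) + bool)) set)"
  define M where "M = M0 * c \<nu> * (real (Suc D))\<^sup>2 * real CARD('n) powr (2 * \<nu>)"
  have M: "0 < M" using M0(1) c_pos[OF \<nu>] by (simp add: M_def)
  show ?thesis
  proof (rule that[of M "(real D + 1) * C"])
    show "0 < M" by (rule M)
    show "0 < (real D + 1) * C" using C by simp
    fix \<delta> :: real assume \<delta>: "0 < \<delta>" "\<delta> \<le> 1"
    define N where "N = card (grid_cell \<delta> ` \<Omega>)"
    have fin: "finite (grid_cell \<delta> ` \<Omega>)" and N: "real N \<le> C * \<delta> powr (- real CARD('n))" using C(2)[OF \<delta>] by (auto simp: N_def)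
    have "real (D * N) \<le> (real D + 1) * (C * \<delta> powr (- real CARD('n)))"
      unfolding of_nat_mult using N by (intro mult_mono) auto
    moreover have "predictable (K \<nu>) \<Omega> (D * N) (M * \<delta> powr (2 * \<nu>))"
      unfolding predictable_def
    proof (intro allI impI)
      fix P assume P: "P \<subseteq> \<Omega>" "finite P" "D * N < card P"
      have sub: "grid_cell \<delta> ` P \<subseteq> grid_cell \<delta> ` \<Omega>" using P(1) by blast
      have "finite (grid_cell \<delta> ` P)" "card (grid_cell \<delta> ` P) \<le> N"
        using finite_subset[OF sub fin] card_mono[OF fin sub] by (auto simp: N_def)
      from crowded_cell[OF P(2) this P(3)] obtain Q where
        Q: "Q \<subseteq> P" "card Q = Suc D" "\<And>y z. y \<in> Q \<Longrightarrow> z \<in> Q \<Longrightarrow> grid_cell \<delta> y = grid_cell \<delta> z" by metis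
      have finQ: "finite Q" using finite_subset[OF Q(1) P(2)] .
      have "card (monomial_index k :: (nat \<times> (nat \<Rightarrow> (real ^ 'n) + bool)) set) < card Q" using Q(2) by (simp add: D_def)
      from ex_annihilating_coefficients[OF finQ this] obtain u y where
        u: "y \<in> Q" "u y = 1" "\<And>p. p \<in> Q \<Longrightarrow> \<bar>u p\<bar> \<le> 1" "annihilates k Q u" by metis
      have "quad (K \<nu>) Q u \<le> M0 * c \<nu> * (\<Sum>p\<in>Q. \<bar>u p\<bar>)\<^sup>2 * (real CARD('n) * \<delta>) powr (2 * \<nu>)"
      proof (rule M0(2)[OF \<nu> u(4)])
        show "0 < real CARD('n) * \<delta>" using \<delta> by simp
        show "norm (y - z) \<le> real CARD('n) * \<delta>" if "y \<in> Q" "z \<in> Q" for y z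
          by (rule grid_cell_diameter[OF \<delta>(1) Q(3)[OF that]])
        show "0 \<le> c \<nu>" using c_pos[OF \<nu>] by simp
      qed
      also have "\<dots> \<le> M0 * c \<nu> * (real (Suc D))\<^sup>2 * (real CARD('n) * \<delta>) powr (2 * \<nu>)"
      proof (intro mult_right_mono mult_left_mono power_mono)
        have "(\<Sum>p\<in>Q. \<bar>u p\<bar>) \<le> (\<Sum>p\<in>Q. 1)" by (intro sum_mono u(3))
        then show "(\<Sum>p\<in>Q. \<bar>u p\<bar>) \<le> real (Suc D)" using Q(2) by simp
      qed (use M0(1) c_pos[OF \<nu>] in \<open>auto intro: sum_nonneg\<close>)
      also have "\<dots> = M * \<delta> powr (2 * \<nu>)" by (simp add: M_def powr_mult)
      finally have le: "quad (K \<nu>) Q u \<le> M * \<delta> powr (2 * \<nu>)" .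
      define v where "v p = (if p \<in> Q then u p else 0)" for p
      have "quad (K \<nu>) P v = quad (K \<nu>) Q v" by (rule quad_mono_neutral[OF P(2) Q(1)]) (simp add: v_def)
      also have "\<dots> = quad (K \<nu>) Q u" by (rule quad_cong) (simp add: v_def)
      finally show "\<exists>y\<in>P. \<exists>v. v y = 1 \<and> quad (K \<nu>) P v \<le> M * \<delta> powr (2 * \<nu>)"
        using le u(1,2) Q(1) by (intro bexI[of _ y] exI[of _ v]) (auto simp: v_def)
    qed
    ultimately show "\<exists>N. real N \<le> (real D + 1) * C * \<delta> powr (- real CARD('n)) \<and> predictable (K \<nu>) \<Omega> N (M * \<delta> powr (2 * \<nu>))"
      by (intro exI[of _ "D * N"]) (simp only: mult.assoc simp_thms)
  qed
qed

text \<open>With \<open>\<delta> = n\<^bsup>-b/d\<^esup>\<close>, \<open>b < 1\<close>, there are only \<open>O(n\<^sup>b)\<close> cells, so all but a vanishing proportion of the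
  points are predicted by the others up to a variance of order \<open>\<delta>\<^bsup>2\<nu>\<^esup>\<close>.\<close>

lemma predictable_X:
  assumes \<nu>: "\<nu> \<in> \<Theta>" and b: "0 < b"
  obtains l A where "0 < A" "\<forall>\<^sub>F n in sequentially. \<exists>N e. 0 < e \<and> e \<le> 1 \<and> predictable (K \<nu>) (set (X n)) N e \<and>
     (\<forall>L\<ge>0. real (n - N) * ln e + real N * L
        \<le> (real n - A * real n powr b) * (l - 2 * b * \<nu> / real CARD('n) * ln (real n)) + A * real n powr b * L)"
proof -
  obtain M A where MA: "0 < M" "0 < A"
    "\<And>\<delta>. 0 < \<delta> \<Longrightarrow> \<delta> \<le> 1 \<Longrightarrow> \<exists>N. real N \<le> A * \<delta> powr (- real CARD('n)) \<and> predictable (K \<nu>) \<Omega> N (M * \<delta> powr (2 * \<nu>))"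
    using predictable_K[OF \<nu>] by metis
  have \<nu>0: "0 < \<nu>" by (rule \<Theta>_pos[OF \<nu>])
  have "(\<lambda>n. M * real n powr (- (2 * b * \<nu> / real CARD('n)))) \<longlonglongrightarrow> 0"
  proof -
    have "0 < 2 * b * \<nu> / real CARD('n)" using b \<nu>0 by simp
    then show ?thesis by real_asymp
  qed
  then have "\<forall>\<^sub>F n in sequentially. M * real n powr (- (2 * b * \<nu> / real CARD('n))) < 1" by (rule order_tendstoD) simp
  moreover have "\<forall>\<^sub>F n :: nat in sequentially. 2 \<le> n" by (rule eventually_ge_at_top)
  ultimately have "\<forall>\<^sub>F n in sequentially. \<exists>N e. 0 < e \<and> e \<le> 1 \<and> predictable (K \<nu>) (set (X n)) N e \<and>
     (\<forall>L\<ge>0. real (n - N) * ln e + real N * L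
        \<le> (real n - A * real n powr b) * (ln M - 2 * b * \<nu> / real CARD('n) * ln (real n)) + A * real n powr b * L)"
  proof eventually_elim
    case (elim n)
    define \<delta> where "\<delta> = real n powr (- b / real CARD('n))"
    define e where "e = M * real n powr (- (2 * b * \<nu> / real CARD('n)))"
    have \<delta>: "0 < \<delta>" using elim by (simp add: \<delta>_def)
    have "\<delta> \<le> real n powr 0" unfolding \<delta>_def using elim b by (intro powr_mono) auto
    then have \<delta>1: "\<delta> \<le> 1" using elim by simp
    have d1: "\<delta> powr (- real CARD('n)) = real n powr b" and d2: "M * \<delta> powr (2 * \<nu>) = e"
      unfolding \<delta>_def e_def powr_powr by (simp_all add: mult_ac)
    obtain N where N: "real N \<le> A * real n powr b" "predictable (K \<nu>) \<Omega> N e"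
      using MA(3)[OF \<delta> \<delta>1] unfolding d1 d2 by blast
    have e: "0 < e" "e \<le> 1" using elim MA(1) by (auto simp: e_def)
    have lne: "ln e = ln M - 2 * b * \<nu> / real CARD('n) * ln (real n)"
      unfolding e_def using MA(1) elim by (simp add: ln_mult ln_powr)
    have "real (n - N) * ln e + real N * L \<le> (real n - A * real n powr b) * ln e + A * real n powr b * L" if L: "0 \<le> L" for L
    proof (rule add_mono)
      have "real n - A * real n powr b \<le> real (n - N)" using N(1) by linarith
      then show "real (n - N) * ln e \<le> (real n - A * real n powr b) * ln e" using e by (intro mult_right_mono_neg) auto
      show "real N * L \<le> A * real n powr b * L" using N(1) L by (rule mult_right_mono)
    qed
    then show ?case
      unfolding lne[symmetric] using e predictable_subset[OF N(2) X_subset] by blast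
  qed
  with MA(2) show ?thesis by (rule that)
qed

text \<open>Since the scale is at most 1, its logarithm is not positive, and the bound at \<nu>
  \<le> s is no worse than at s. The term s ln a is absorbed by - \<nu>max |ln a|, which makes C
  independent of s and \<nu>.\<close>

lemma ln_lower_bound:
  assumes m: "0 < m"
  obtains C where "\<And>n \<nu> s. 2 \<le> n \<Longrightarrow> gauss_scale n \<le> 1 \<Longrightarrow> 0 \<le> s \<Longrightarrow> \<nu> \<le> s \<Longrightarrow> s \<le> \<nu>max \<Longrightarrow>
    real n * (C - 2 * s / real CARD('n) * ln (real n) - s * ln (ln (2 * real n))) \<le> real n * ln (m * gauss_scale n powr \<nu>)"
proof -
  obtain a where a: "0 < a" "\<And>n. 2 \<le> n \<Longrightarrow> a * (real n powr (- 2 / real CARD('n)) / ln (2 * real n)) \<le> gauss_scale n"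
    using gauss_scale_lower by metis
  show ?thesis
  proof (rule that[of "ln m - \<nu>max * \<bar>ln a\<bar>"])
    fix n :: nat and \<nu> s :: real
    assume n: "2 \<le> n" and T1: "gauss_scale n \<le> 1" and s: "0 \<le> s" "\<nu> \<le> s" "s \<le> \<nu>max"
    have T: "0 < gauss_scale n" by (rule gauss_scale_pos[OF n])
    have l2: "0 < ln (2 * real n)" using n by simp
    have "ln a - 2 / real CARD('n) * ln (real n) - ln (ln (2 * real n)) = ln (a * (real n powr (- 2 / real CARD('n)) / ln (2 * real n)))"
      using a(1) n l2 by (simp add: ln_mult ln_div ln_powr)
    also have "\<dots> \<le> ln (gauss_scale n)" using a n l2 by (intro ln_mono) auto
    finally have "s * (ln a - 2 / real CARD('n) * ln (real n) - ln (ln (2 * real n))) \<le> s * ln (gauss_scale n)"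
      using s(1) by (rule mult_left_mono)
    also have "\<dots> \<le> \<nu> * ln (gauss_scale n)" using T T1 s by (intro mult_right_mono_neg) auto
    finally have 1: "s * (ln a - 2 / real CARD('n) * ln (real n) - ln (ln (2 * real n))) \<le> \<nu> * ln (gauss_scale n)" .
    have 2: "- (\<nu>max * \<bar>ln a\<bar>) \<le> s * ln a"
    proof -
      have "s * \<bar>ln a\<bar> \<le> \<nu>max * \<bar>ln a\<bar>" using s by (intro mult_right_mono) auto
      moreover have "- (s * \<bar>ln a\<bar>) \<le> s * ln a" using mult_left_mono[OF abs_ge_minus_self[of "ln a"] s(1)] by simp
      ultimately show ?thesis by simp
    qed
    have "ln (m * gauss_scale n powr \<nu>) = ln m + \<nu> * ln (gauss_scale n)" using m T by (simp add: ln_mult ln_powr)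
    then have "ln m - \<nu>max * \<bar>ln a\<bar> - 2 * s / real CARD('n) * ln (real n) - s * ln (ln (2 * real n)) \<le> ln (m * gauss_scale n powr \<nu>)"
      using 1 2 by (simp add: algebra_simps)
    then show "real n * (ln m - \<nu>max * \<bar>ln a\<bar> - 2 * s / real CARD('n) * ln (real n) - s * ln (ln (2 * real n))) \<le> real n * ln (m * gauss_scale n powr \<nu>)"
      by (intro mult_left_mono) auto
  qed
qed

text \<open>The kernel is constant on its diagonal; the maximum with 0 provides the nonnegative L of
  the loss bounds.\<close>

lemma diag_bound: "\<nu> \<in> \<Theta> \<Longrightarrow> ln (K \<nu> y y) \<le> max 0 (ln (K \<nu> 0 0))"
  by (simp add: matern_def)

text \<open>The Sobolev bound controls f by the form of order a = \<nu>0 - d/2, uniformly over B,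
  and \<open>quad_mix_compare\<close> at the scale of the data passes to order \<nu> at the cost
  T^(a - \<nu>), which is n^(2 (\<nu> - a)/d) up to logarithms. The exponent is less than 1 exactly
  for \<nu> < \<nu>0.\<close>

lemma data_fit_growth:
  assumes B: "sobolev_bounded \<nu>0 \<Omega> B" and \<nu>0: "real CARD('n) / 2 < \<nu>0"
    and \<nu>: "\<nu> \<in> \<Theta>" "\<nu>0 - real CARD('n) / 2 \<le> \<nu>"
  obtains F where "0 \<le> F" "\<And>f n. f \<in> B \<Longrightarrow> 2 \<le> n \<Longrightarrow> gauss_scale n \<le> 1 \<Longrightarrow>
     data_fit (K \<nu>) f (X n) \<le> F * (real n powr (2 * (\<nu> - (\<nu>0 - real CARD('n) / 2)) / real CARD('n)) * ln (2 * real n) powr (\<nu> - (\<nu>0 - real CARD('n) / 2)))"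
proof -
  define a where "a = \<nu>0 - real CARD('n) / 2"
  have a: "0 < a" "a \<le> \<nu>" using \<nu>0 \<nu> by (auto simp: a_def)
  have \<nu>p: "0 < \<nu>" by (rule \<Theta>_pos[OF \<nu>(1)])
  define \<kappa> where "\<kappa> = 2 * \<nu> / lam\<^sup>2"
  have \<kappa>: "0 < \<kappa>" using \<nu>p lam by (simp add: \<kappa>_def)
  obtain F1 where F1: "0 \<le> F1" "\<And>f A u. f \<in> B \<Longrightarrow> A \<subseteq> \<Omega> \<Longrightarrow> finite A \<Longrightarrow>
    (\<Sum>x\<in>A. u x * f x)\<^sup>2 \<le> F1 * quad (mix_kernel a \<kappa>) A u"
  proof (rule sobolev_bounded_quad[OF B \<nu>0 \<kappa>, folded a_def])
  qed (rule that)
  obtain t where t: "0 < t" "\<And>n. 2 \<le> n \<Longrightarrow> t * (real n powr (- 2 / real CARD('n)) / ln (2 * real n)) \<le> gauss_scale n"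
    using gauss_scale_lower by metis
  define F2 where "F2 = F1 * (3 * \<nu> / a * exp \<kappa> + 1)"
  have F2: "0 \<le> F2" using F1 a \<nu>p by (simp add: F2_def)
  have mf: "0 < c \<nu> * matern_factor \<sigma> lam \<nu>" using c_pos[OF \<nu>(1)] matern_factor_pos[OF \<sigma> lam \<nu>p] by simp
  define F where "F = F2 * t powr (a - \<nu>) / (c \<nu> * matern_factor \<sigma> lam \<nu>)"
  show ?thesis
  proof (rule that[of F])
    show "0 \<le> F" unfolding F_def using F2 mf by (intro divide_nonneg_pos mult_nonneg_nonneg) auto
    fix f n assume f: "f \<in> B" and n: "2 \<le> (n::nat)" and T1: "gauss_scale n \<le> 1"
    let ?A = "set (X n)" and ?T = "gauss_scale n"
    have T: "0 < ?T" by (rule gauss_scale_pos[OF n])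
    let ?G = "real n powr (2 * (\<nu> - a) / real CARD('n)) * ln (2 * real n) powr (\<nu> - a)"
    have TG: "?T powr (a - \<nu>) \<le> t powr (a - \<nu>) * ?G"
    proof -
      have l2: "0 < ln (2 * real n)" using n by simp
      have "?T powr (a - \<nu>) \<le> (t * (real n powr (- 2 / real CARD('n)) / ln (2 * real n))) powr (a - \<nu>)"
        using t n l2 a by (intro powr_mono2') auto
      also have "\<dots> = t powr (a - \<nu>) * (real n powr (- 2 / real CARD('n) * (a - \<nu>)) / ln (2 * real n) powr (a - \<nu>))"
        unfolding powr_mult powr_divide powr_powr ..
      also have "real n powr (- 2 / real CARD('n) * (a - \<nu>)) / ln (2 * real n) powr (a - \<nu>) = ?G"
      proof -
        have "- 2 / real CARD('n) * (a - \<nu>) = 2 * (\<nu> - a) / real CARD('n)" by (simp add: field_simps)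
        moreover have "ln (2 * real n) powr (\<nu> - a) = 1 / ln (2 * real n) powr (a - \<nu>)"
          using powr_minus_divide[of "ln (2 * real n)" "a - \<nu>"] by simp
        ultimately show ?thesis by simp
      qed
      finally show ?thesis .
    qed
    have pd: "pos_def_on ?A (K \<nu>)" by (rule pos_def_K[OF \<nu>(1)]) simp
    have "data_fit (K \<nu>) f (X n) \<le> F * ?G"
    proof (rule data_fit_le[OF distinct_X pd])
      show "0 \<le> F * ?G" using \<open>0 \<le> F\<close> by simp
      fix u :: "real ^ 'n \<Rightarrow> real"
      define S where "S = (\<Sum>y\<in>?A. (u y)\<^sup>2)"
      have S: "0 \<le> S" by (simp add: S_def sum_nonneg)
      have near: "\<bar>quad (gauss s) ?A u - S\<bar> \<le> S / 2" if s: "0 < s" "s \<le> ?T" for s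
        unfolding S_def
      proof (rule quad_gauss_near_diagonal[OF _ _ _ separation_radius_pos[OF inj n] _ s[unfolded gauss_scale_def]])
        show "card ?A \<le> n" using distinct_X[of n] by (metis card_length length_first_points)
        show "1 \<le> n" using n by simp
        fix y z assume "y \<in> ?A" "z \<in> ?A" "y \<noteq> z"
        then obtain i j where "i \<in> {1..n}" "y = x i" "j \<in> {1..n}" "z = x j" by auto
        then show "2 * separation_radius x n \<le> norm (y - z)" using \<open>y \<noteq> z\<close> separation_radius_le[of i n j x] by auto
      qed simp
      let ?Q = "quad (mix_kernel \<nu> \<kappa>) ?A u"
      have Q: "0 \<le> ?Q" by (rule quad_mix_nonneg[OF \<nu>p \<kappa>])
      have "(\<Sum>y\<in>?A. u y * f y)\<^sup>2 \<le> F1 * quad (mix_kernel a \<kappa>) ?A u" by (rule F1(2)[OF f X_subset]) simp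
      also have "\<dots> \<le> F1 * ((3 * \<nu> / a * exp (\<kappa> * ?T) + 1) * ?T powr (a - \<nu>) * ?Q)"
        by (intro mult_left_mono quad_mix_compare[OF a \<kappa> T S near] F1)
      also have "\<dots> \<le> F1 * ((3 * \<nu> / a * exp \<kappa> + 1) * (t powr (a - \<nu>) * ?G) * ?Q)"
      proof (intro mult_left_mono mult_right_mono mult_mono add_right_mono TG F1 Q)
        show "exp (\<kappa> * ?T) \<le> exp \<kappa>" using \<kappa> T1 by (simp add: mult_left_le)
      qed (use a \<nu>p t(1) in auto)
      also have "\<dots> = F * ?G * (c \<nu> * matern_factor \<sigma> lam \<nu> * ?Q)"
        using mf by (auto simp: F_def F2_def)
      also have "c \<nu> * matern_factor \<sigma> lam \<nu> * ?Q = quad (K \<nu>) ?A u"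
        by (simp add: quad_matern[OF lam \<nu>p] \<kappa>_def)
      finally show "(\<Sum>y\<in>?A. u y * f y)\<^sup>2 \<le> F * ?G * quad (K \<nu>) ?A u" .
    qed
    then show "data_fit (K \<nu>) f (X n) \<le> F * (real n powr (2 * (\<nu> - (\<nu>0 - real CARD('n) / 2)) / real CARD('n)) * ln (2 * real n) powr (\<nu> - (\<nu>0 - real CARD('n) / 2)))"
      by (simp add: a_def)
  qed
qed

text \<open>Parameters up to y have loss at least about - (2 y/d) n ln n, uniformly in f, whereas
  the loss at a suitable \<nu> is at most about - (2 b \<nu>/d) n ln n for every f in B. As y < b
  \<nu>, no parameter up to y is a minimiser.\<close>

lemma est_ML_eventually_above:
  assumes B: "sobolev_bounded \<nu>0 \<Omega> B" and \<nu>0: "real CARD('n) / 2 < \<nu>0" "\<nu>0 \<le> \<nu>max"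
    and est: "estimator_ML K \<Theta> x B est" and y: "y < \<nu>0"
  shows "\<forall>\<^sub>F n in sequentially. \<forall>f\<in>B. y < est f n"
proof (cases "y < \<nu>min")
  \<comment> \<open>The estimate lies in the parameter interval by definition. This case also covers
    \<nu>0 \<le> \<nu>min, so that in the other case the comparison parameter belongs to the
    interval.\<close>
  case True
  then have "\<forall>f\<in>B. y < est f n" if "1 \<le> n" for n
    using est that by (force simp: estimator_ML_def is_arg_min_def)
  then show ?thesis by (rule eventually_sequentiallyI)
next
  case False
  \<comment> \<open>Above y, for a smaller determinant, and between \<nu>0 - d/2 and \<nu>0, where
    the data fit is of lower order than n.\<close>
  define \<nu> where "\<nu> = (max y (\<nu>0 - real CARD('n) / 2) + \<nu>0) / 2"
  have \<nu>: "y < \<nu>" "\<nu> < \<nu>0" "\<nu>0 - real CARD('n) / 2 \<le> \<nu>" using y d_pos by (auto simp: \<nu>_def max_def field_simps)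
  have \<nu>\<Theta>: "\<nu> \<in> \<Theta>" using \<nu> False \<nu>0 by auto
  have y0: "0 < y" using False \<nu>min by simp
  have yn: "y / \<nu> < 1" "0 < y / \<nu>" using \<nu>(1) y0 by auto
  \<comment> \<open>The cells have size n^(-b/d): b > y/\<nu> keeps the rate 2 b \<nu>/d above 2
    y/d, and b < 1 leaves a vanishing proportion of exceptional points.\<close>
  obtain b where "y / \<nu> < b" "b < 1" using dense[OF yn(1)] by auto
  then have b: "0 < b" "b < 1" "y / \<nu> < b" using yn(2) by auto
  then have yb: "y < b * \<nu>" using \<nu>(1) y0 by (simp add: divide_less_eq)
  obtain m where m: "0 < m" "\<And>\<nu> n A u. \<nu> \<in> \<Theta> \<Longrightarrow> 2 \<le> n \<Longrightarrow> gauss_scale n \<le> 1 \<Longrightarrow> A \<subseteq> set (X n) \<Longrightarrow>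
     m * gauss_scale n powr \<nu> * (\<Sum>y\<in>A. (u y)\<^sup>2) \<le> quad (K \<nu>) A u"
    using K_lower by blast
  obtain C where C: "\<And>n \<nu> s. 2 \<le> n \<Longrightarrow> gauss_scale n \<le> 1 \<Longrightarrow> 0 \<le> s \<Longrightarrow> \<nu> \<le> s \<Longrightarrow> s \<le> \<nu>max \<Longrightarrow>
    real n * (C - 2 * s / real CARD('n) * ln (real n) - s * ln (ln (2 * real n))) \<le> real n * ln (m * gauss_scale n powr \<nu>)"
    using ln_lower_bound[OF m(1)] by metis
  obtain F where F: "0 \<le> F" "\<And>f n. f \<in> B \<Longrightarrow> 2 \<le> n \<Longrightarrow> gauss_scale n \<le> 1 \<Longrightarrow>
     data_fit (K \<nu>) f (X n) \<le> F * (real n powr (2 * (\<nu> - (\<nu>0 - real CARD('n) / 2)) / real CARD('n)) * ln (2 * real n) powr (\<nu> - (\<nu>0 - real CARD('n) / 2)))"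
    using data_fit_growth[OF B \<nu>0(1) \<nu>\<Theta> \<nu>(3)] by metis
  obtain l A where lA: "0 < A" "\<forall>\<^sub>F n in sequentially. \<exists>N e. 0 < e \<and> e \<le> 1 \<and> predictable (K \<nu>) (set (X n)) N e \<and>
     (\<forall>L\<ge>0. real (n - N) * ln e + real N * L
        \<le> (real n - A * real n powr b) * (l - 2 * b * \<nu> / real CARD('n) * ln (real n)) + A * real n powr b * L)"
    by (rule predictable_X[OF \<nu>\<Theta> b(1)])
  define L where "L = max 0 (ln (K \<nu> 0 0))"
  have "2 * (\<nu> - (\<nu>0 - real CARD('n) / 2)) / real CARD('n) < 1" using \<nu>(2) by (simp add: divide_less_eq)
  moreover have "2 * y / real CARD('n) < 2 * b * \<nu> / real CARD('n)" using yb by (simp add: divide_strict_right_mono mult.assoc)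
  ultimately have gap: "\<forall>\<^sub>F n in sequentially. (real n - A * real n powr b) * (l - 2 * b * \<nu> / real CARD('n) * ln (real n)) + A * real n powr b * L + 0 * real n
      + F * (real n powr (2 * (\<nu> - (\<nu>0 - real CARD('n) / 2)) / real CARD('n)) * ln (2 * real n) powr (\<nu> - (\<nu>0 - real CARD('n) / 2)))
      < real n * (C - 2 * y / real CARD('n) * ln (real n) - y * ln (ln (2 * real n)))"
    by (rule asymptotic_gap[OF b(2)])
  from lA(2) gap gauss_scale_le_1 eventually_ge_at_top[of "2::nat"] show ?thesis
  proof eventually_elim
    case (elim n)
    obtain N e where e: "0 < e" "e \<le> 1" and pred: "predictable (K \<nu>) (set (X n)) N e"
      and bound: "\<And>L. 0 \<le> L \<Longrightarrow> real (n - N) * ln e + real N * L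
        \<le> (real n - A * real n powr b) * (l - 2 * b * \<nu> / real CARD('n) * ln (real n)) + A * real n powr b * L"
      using elim(1) by blast
    show ?case
    proof (intro ballI, rule ccontr)
      fix f assume f: "f \<in> B" and "\<not> y < est f n"
      then have le: "est f n \<le> y" by simp
      have arg: "est f n \<in> \<Theta>" "\<And>\<nu>. \<nu> \<in> \<Theta> \<Longrightarrow> loss_ML (K (est f n)) f (X n) \<le> loss_ML (K \<nu>) f (X n)"
        using est f elim(4) by (force simp: estimator_ML_def is_arg_min_def not_less)+
      have pd: "\<nu> \<in> \<Theta> \<Longrightarrow> pos_def_on (set (X n)) (K \<nu>)" for \<nu> by (rule pos_def_K) auto
      have T: "0 < gauss_scale n" by (rule gauss_scale_pos[OF elim(4)])
      have "real n * (C - 2 * y / real CARD('n) * ln (real n) - y * ln (ln (2 * real n))) \<le> real n * ln (m * gauss_scale n powr est f n)"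
        by (rule C[OF elim(4,3)]) (use y0 le y \<nu>0 in auto)
      also have "\<dots> \<le> data_fit (K (est f n)) f (X n) + real (length (X n)) * ln (m * gauss_scale n powr est f n)"
        using data_fit_nonneg[OF distinct_X pd[OF arg(1)]] by simp
      also have "\<dots> \<le> loss_ML (K (est f n)) f (X n)"
        by (rule loss_ML_lower_bound[OF pd[OF arg(1)] distinct_X _ m(2)[OF arg(1) elim(4,3)]]) (use m(1) T in auto)
      also have "\<dots> \<le> loss_ML (K \<nu>) f (X n)" by (rule arg(2)[OF \<nu>\<Theta>])
      also have "\<dots> \<le> F * (real n powr (2 * (\<nu> - (\<nu>0 - real CARD('n) / 2)) / real CARD('n)) * ln (2 * real n) powr (\<nu> - (\<nu>0 - real CARD('n) / 2)))
         + (real (length (X n) - N) * ln e + real (min (length (X n)) N) * L)"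
        unfolding loss_ML_def data_fit_def[symmetric]
        by (intro add_mono F(2)[OF f elim(4,3)] ln_det_upper_bound(1)[OF pred e(1) pd[OF \<nu>\<Theta>] distinct_X])
           (simp add: L_def diag_bound[OF \<nu>\<Theta>])
      also have "real (min (length (X n)) N) * L \<le> real N * L" by (intro mult_right_mono) (auto simp: L_def)
      also have "real (length (X n) - N) * ln e + real N * L
         \<le> (real n - A * real n powr b) * (l - 2 * b * \<nu> / real CARD('n) * ln (real n)) + A * real n powr b * L"
        using bound[of L] by (simp add: L_def)
      finally show False using elim(2) by simp
    qed
  qed
qed

text \<open>The comparison is made at \<nu> = \<nu>0 - d/2 itself, where the Sobolev bound controls
  the form directly and every residual quotient is at most F. The total F n is of lower order than n
  ln n.\<close>

lemma est_CV_eventually_above: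
  assumes B: "sobolev_bounded \<nu>0 \<Omega> B" and \<nu>0: "real CARD('n) / 2 < \<nu>0" "\<nu>0 \<le> \<nu>max"
    and est: "estimator_CV K \<Theta> x B est" and y: "y < \<nu>0 - real CARD('n) / 2"
  shows "\<forall>\<^sub>F n in sequentially. \<forall>f\<in>B. y < est f n"
proof (cases "y < \<nu>min")
  case True
  then have "\<forall>f\<in>B. y < est f n" if "1 \<le> n" for n
    using est that by (force simp: estimator_CV_def is_arg_min_def)
  then show ?thesis by (rule eventually_sequentiallyI)
next
  case False
  define \<nu> where "\<nu> = \<nu>0 - real CARD('n) / 2"
  have \<nu>: "y < \<nu>" "\<nu> \<le> \<nu>0" using y by (auto simp: \<nu>_def)
  have \<nu>\<Theta>: "\<nu> \<in> \<Theta>" using \<nu> False \<nu>0 by auto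
  have \<nu>p: "0 < \<nu>" by (rule \<Theta>_pos[OF \<nu>\<Theta>])
  have y0: "0 < y" using False \<nu>min by simp
  have yn: "y / \<nu> < 1" "0 < y / \<nu>" using \<nu>(1) y0 by auto
  obtain b where "y / \<nu> < b" "b < 1" using dense[OF yn(1)] by auto
  then have b: "0 < b" "b < 1" "y / \<nu> < b" using yn(2) by auto
  then have yb: "y < b * \<nu>" using \<nu>(1) y0 by (simp add: divide_less_eq)
  obtain m where m: "0 < m" "\<And>\<nu> n A u. \<nu> \<in> \<Theta> \<Longrightarrow> 2 \<le> n \<Longrightarrow> gauss_scale n \<le> 1 \<Longrightarrow> A \<subseteq> set (X n) \<Longrightarrow>
     m * gauss_scale n powr \<nu> * (\<Sum>y\<in>A. (u y)\<^sup>2) \<le> quad (K \<nu>) A u"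
    using K_lower by blast
  obtain C where C: "\<And>n \<nu> s. 2 \<le> n \<Longrightarrow> gauss_scale n \<le> 1 \<Longrightarrow> 0 \<le> s \<Longrightarrow> \<nu> \<le> s \<Longrightarrow> s \<le> \<nu>max \<Longrightarrow>
    real n * (C - 2 * s / real CARD('n) * ln (real n) - s * ln (ln (2 * real n))) \<le> real n * ln (m * gauss_scale n powr \<nu>)"
    using ln_lower_bound[OF m(1)] by metis
  define \<kappa> where "\<kappa> = 2 * \<nu> / lam\<^sup>2"
  have \<kappa>: "0 < \<kappa>" using \<nu>p lam by (simp add: \<kappa>_def)
  obtain F1 where F1: "0 \<le> F1" "\<And>f A u. f \<in> B \<Longrightarrow> A \<subseteq> \<Omega> \<Longrightarrow> finite A \<Longrightarrow>
    (\<Sum>x\<in>A. u x * f x)\<^sup>2 \<le> F1 * quad (mix_kernel \<nu> \<kappa>) A u"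
  proof (rule sobolev_bounded_quad[OF B \<nu>0(1) \<kappa>, folded \<nu>_def])
  qed (rule that)
  have mf: "0 < c \<nu> * matern_factor \<sigma> lam \<nu>" using c_pos[OF \<nu>\<Theta>] matern_factor_pos[OF \<sigma> lam \<nu>p] by simp
  define F where "F = F1 / (c \<nu> * matern_factor \<sigma> lam \<nu>)"
  have F: "(\<Sum>x\<in>set (X n). u x * f x)\<^sup>2 \<le> F * quad (K \<nu>) (set (X n)) u" if "f \<in> B" for f u n
  proof -
    have "F * quad (K \<nu>) (set (X n)) u = F1 * quad (mix_kernel \<nu> \<kappa>) (set (X n)) u"
      unfolding quad_matern[OF lam \<nu>p] F_def \<kappa>_def using mf by auto
    then show ?thesis using F1(2)[OF that X_subset[of n], of u] by (simp del: set_first_points)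
  qed
  obtain l A where lA: "0 < A" "\<forall>\<^sub>F n in sequentially. \<exists>N e. 0 < e \<and> e \<le> 1 \<and> predictable (K \<nu>) (set (X n)) N e \<and>
     (\<forall>L\<ge>0. real (n - N) * ln e + real N * L
        \<le> (real n - A * real n powr b) * (l - 2 * b * \<nu> / real CARD('n) * ln (real n)) + A * real n powr b * L)"
    by (rule predictable_X[OF \<nu>\<Theta> b(1)])
  define L where "L = max 0 (ln (K \<nu> 0 0))"
  have "2 * y / real CARD('n) < 2 * b * \<nu> / real CARD('n)" using yb by (simp add: divide_strict_right_mono mult.assoc)
  moreover have "(0::real) < 1" by simp
  ultimately have gap: "\<forall>\<^sub>F n in sequentially. (real n - A * real n powr b) * (l - 2 * b * \<nu> / real CARD('n) * ln (real n)) + A * real n powr b * L + F * real n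
      + 0 * (real n powr 0 * ln (2 * real n) powr 0)
      < real n * (C - 2 * y / real CARD('n) * ln (real n) - y * ln (ln (2 * real n)))"
    by (intro asymptotic_gap[OF b(2)])
  from lA(2) gap gauss_scale_le_1 eventually_ge_at_top[of "2::nat"] show ?thesis
  proof eventually_elim
    case (elim n)
    obtain N e where e: "0 < e" "e \<le> 1" and pred: "predictable (K \<nu>) (set (X n)) N e"
      and bound: "\<And>L. 0 \<le> L \<Longrightarrow> real (n - N) * ln e + real N * L
        \<le> (real n - A * real n powr b) * (l - 2 * b * \<nu> / real CARD('n) * ln (real n)) + A * real n powr b * L"
      using elim(1) by blast
    show ?case
    proof (intro ballI, rule ccontr)
      fix f assume f: "f \<in> B" and "\<not> y < est f n"
      then have le: "est f n \<le> y" by simp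
      have arg: "est f n \<in> \<Theta>" "\<And>\<nu>. \<nu> \<in> \<Theta> \<Longrightarrow> loss_CV (K (est f n)) f (X n) \<le> loss_CV (K \<nu>) f (X n)"
        using est f elim(4) by (force simp: estimator_CV_def is_arg_min_def not_less)+
      have pd: "\<nu> \<in> \<Theta> \<Longrightarrow> pos_def_on (set (X n)) (K \<nu>)" for \<nu> by (rule pos_def_K) auto
      have T: "0 < gauss_scale n" by (rule gauss_scale_pos[OF elim(4)])
      have "real n * (C - 2 * y / real CARD('n) * ln (real n) - y * ln (ln (2 * real n))) \<le> real n * ln (m * gauss_scale n powr est f n)"
        by (rule C[OF elim(4,3)]) (use y0 le \<nu> \<nu>0 in auto)
      also have "\<dots> = real (length (X n)) * ln (m * gauss_scale n powr est f n)" by simp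
      also have "\<dots> \<le> loss_CV (K (est f n)) f (X n)"
        by (rule loss_CV_lower_bound[OF pd[OF arg(1)] distinct_X _ m(2)[OF arg(1) elim(4,3) order_refl]]) (use m(1) T in auto)
      also have "\<dots> \<le> loss_CV (K \<nu>) f (X n)" by (rule arg(2)[OF \<nu>\<Theta>])
      also have "\<dots> \<le> real (length (X n)) * F + real (length (X n) - N) * ln e + real N * L"
        by (rule loss_CV_upper_bound[OF pred e pd[OF \<nu>\<Theta>] distinct_X _ _ F[OF f]]) (auto simp: L_def diag_bound[OF \<nu>\<Theta>])
      also have "\<dots> = F * real n + (real (n - N) * ln e + real N * L)" by simp
      also have "\<dots> \<le> F * real n + ((real n - A * real n powr b) * (l - 2 * b * \<nu> / real CARD('n) * ln (real n)) + A * real n powr b * L)"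
        using bound[of L] by (intro add_left_mono) (simp add: L_def)
      finally show False using elim(2) by simp
    qed
  qed
qed

end

lemma liminf_INF_ge:
  fixes est :: "'a \<Rightarrow> nat \<Rightarrow> real"
  assumes "\<And>y. y < a \<Longrightarrow> \<forall>\<^sub>F n in sequentially. \<forall>f\<in>B. y < est f n"
  shows "ereal a \<le> liminf (\<lambda>n. INF f\<in>B. ereal (est f n))"
  unfolding le_Liminf_iff
proof (intro allI impI)
  fix y assume "y < ereal a"
  \<comment> \<open>Estimates above z only give an infimum of at least z, hence a real number
    strictly between y and a.\<close>
  then obtain z where z: "y < ereal z" "ereal z < ereal a" using ereal_dense2 by blast
  then have "z < a" by simp
  from assms[OF this] show "\<forall>\<^sub>F n in sequentially. y < (INF f\<in>B. ereal (est f n))"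
  proof eventually_elim
    case (elim n)
    have "ereal z \<le> (INF f\<in>B. ereal (est f n))" using elim by (intro INF_greatest) auto
    then show ?case using z(1) by (rule less_le_trans[rotated])
  qed
qed

section \<open>Sharpness\<close>

text \<open>Here the data fit decides: at large parameters it is of order n^(1 + \<delta>) and
  outweighs the log-determinant, which is bounded below by a multiple of - n ln n, as well as the
  loss at the comparison parameter, which is of order n up to logarithms.\<close>

lemma asymptotic_gap_ML:
  fixes C \<delta> F p L C' s \<nu> :: real
  assumes "0 < C" "0 < \<delta>"
  shows "\<forall>\<^sub>F n in sequentially. F * (real n powr 1 * ln (2 * real n) powr p) + real n * L
    < C * real n powr (1 + \<delta>) + real n * (C' - s * ln (real n) - \<nu> * ln (ln (2 * real n)))"
proof -
  let ?x1 = "\<lambda>n. ln (2 * real n) powr p / real n powr \<delta>" and ?x2 = "\<lambda>n. 1 / real n powr \<delta>"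
    and ?x3 = "\<lambda>n. ln (ln (2 * real n)) / real n powr \<delta>" and ?x4 = "\<lambda>n. ln (real n) / real n powr \<delta>"
  let ?E = "\<lambda>n. C + (C' * ?x2 n - s * ?x4 n - \<nu> * ?x3 n) - (F * ?x1 n + L * ?x2 n)"
  have "?x1 \<longlonglongrightarrow> 0" using assms(2) by real_asymp
  moreover have "?x2 \<longlonglongrightarrow> 0" using assms(2) by real_asymp
  moreover have "?x3 \<longlonglongrightarrow> 0" using assms(2) by real_asymp
  moreover have "?x4 \<longlonglongrightarrow> 0" using assms(2) by real_asymp
  ultimately have "?E \<longlonglongrightarrow> C + (C' * 0 - s * 0 - \<nu> * 0) - (F * 0 + L * 0)"
    by (intro tendsto_intros)
  then have "\<forall>\<^sub>F n in sequentially. 0 < ?E n"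
    using assms(1) by (intro order_tendstoD(1)) auto
  moreover have "\<forall>\<^sub>F n :: nat in sequentially. 2 \<le> n" by (rule eventually_ge_at_top)
  ultimately show ?thesis
  proof eventually_elim
    case (elim n)
    have n: "0 < real n" "0 < real n powr \<delta>" using elim by auto
    then have "0 < (real n * real n powr \<delta>) * ?E n" using elim by (intro mult_pos_pos) auto
    also have "(real n * real n powr \<delta>) * ?E n = C * (real n * real n powr \<delta>) + real n * (C' - s * ln (real n) - \<nu> * ln (ln (2 * real n)))
      - (F * (real n * ln (2 * real n) powr p) + real n * L)"
    proof -
      have gen: "(N * P) * (C + (C' * (1 / P) - s * (E / P) - \<nu> * (W / P)) - (F * (Z / P) + L * (1 / P)))
         = C * (N * P) + N * (C' - s * E - \<nu> * W) - (F * (N * Z) + N * L)"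
        if "0 < P" for N E W P Z :: real
        using that by (simp add: field_simps)
      show ?thesis by (rule gen[OF n(2)])
    qed
    finally show ?case using n(1) by (simp add: powr_add)
  qed
qed

abbreviation mesh :: "nat \<Rightarrow> nat \<Rightarrow> real" where "mesh d n \<equiv> real n powr (- 1 / real d)"

context matern_design begin

text \<open>Nearest data points to \<open>D + 1\<close> points on a line spaced by three fill distances are distinct.\<close>

lemma annihilating_cluster:
  obtains M where "0 < M" "\<And>n p. 2 \<le> n \<Longrightarrow> cball p (M * mesh CARD('n) n) \<subseteq> \<Omega> \<Longrightarrow>
    \<exists>Q u z. Q \<subseteq> set (X n) \<and> Q \<subseteq> cball p (M * mesh CARD('n) n) \<and> z \<in> Q \<and> u z = 1 \<and> (\<Sum>y\<in>Q. \<bar>u y\<bar>) \<le> M \<and> annihilates k Q u"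
proof -
  obtain H where H: "0 < H" "\<And>n. 2 \<le> n \<Longrightarrow> fill_distance \<Omega> x n \<le> H * mesh CARD('n) n" using fill_upper by auto
  define D where "D = card (monomial_index k :: (nat \<times> (nat \<Rightarrow> (real ^ 'n) + bool)) set)"
  define M where "M = H * (3 * real D + 1) + real (Suc D)"
  obtain e :: "real ^ 'n" where e: "norm e = 1" using vector_choose_size[of 1] by auto
  show ?thesis
  proof (rule that[of M])
    show "0 < M" using H(1) by (simp add: M_def add_nonneg_pos)
    fix n :: nat and p assume n: "2 \<le> n" and sub: "cball p (M * mesh CARD('n) n) \<subseteq> \<Omega>"
    define h where "h = H * mesh CARD('n) n"
    have h: "0 < h" using H(1) n by (simp add: h_def)
    have hM: "h * (3 * real D + 1) \<le> M * mesh CARD('n) n" by (simp add: h_def M_def algebra_simps)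
    define y where "y i = p + (3 * h * real i) *\<^sub>R e" for i :: nat
    have py: "norm (p - y i) = 3 * h * real i" for i using e h by (simp add: y_def)
    have y_in: "y i \<in> \<Omega>" if "i \<le> D" for i
    proof -
      have "h * (3 * real i) \<le> h * (3 * real D + 1)" using that h by (intro mult_left_mono) auto
      then show ?thesis using sub hM py[of i] by (auto simp: dist_norm subset_iff mult_ac)
    qed
    have "\<forall>i\<in>{..D}. \<exists>j. j \<in> {1..n} \<and> norm (y i - x j) \<le> h"
    proof
      fix i assume "i \<in> {..D}"
      then obtain j where "j \<in> {1..n}" "norm (y i - x j) \<le> fill_distance \<Omega> x n"
        using fill_distance_nearest[OF bdd y_in, of i n x] n by auto
      then show "\<exists>j. j \<in> {1..n} \<and> norm (y i - x j) \<le> h" using H(2)[OF n] by (auto simp: h_def)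
    qed
    then obtain g where g: "\<And>i. i \<le> D \<Longrightarrow> g i \<in> {1..n} \<and> norm (y i - x (g i)) \<le> h" by (auto dest!: bchoice)
    define Q where "Q = (\<lambda>i. x (g i)) ` {..D}"
    have "inj_on (\<lambda>i. x (g i)) {..D}"
    proof (rule inj_onI, rule ccontr)
      fix i j assume ij: "i \<in> {..D}" "j \<in> {..D}" "x (g i) = x (g j)" "i \<noteq> j"
      have "1 \<le> \<bar>real i - real j\<bar>" using ij(4) by linarith
      then have "3 * h \<le> 3 * h * \<bar>real i - real j\<bar>" using h by simp
      also have "\<dots> = norm (y i - y j)"
      proof -
        have "y i - y j = (3 * h * (real i - real j)) *\<^sub>R e" by (simp add: y_def algebra_simps)
        then show ?thesis using e h by (simp add: abs_mult)
      qed
      also have "\<dots> \<le> norm (y i - x (g i)) + norm (y j - x (g j))"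
        using norm_triangle_ineq4[of "y i - x (g i)" "y j - x (g j)"] ij(3) by simp
      also have "\<dots> \<le> 2 * h" using g[of i] g[of j] ij by simp
      finally show False using h by simp
    qed
    then have cQ: "card Q = Suc D" by (simp add: Q_def card_image)
    have finQ: "finite Q" by (simp add: Q_def)
    have "card (monomial_index k :: (nat \<times> (nat \<Rightarrow> (real ^ 'n) + bool)) set) < card Q" using cQ by (simp add: D_def)
    from ex_annihilating_coefficients[OF finQ this] obtain u z where
      u: "z \<in> Q" "u z = 1" "\<And>q. q \<in> Q \<Longrightarrow> \<bar>u q\<bar> \<le> 1" "annihilates k Q u" by metis
    have "(\<Sum>q\<in>Q. \<bar>u q\<bar>) \<le> (\<Sum>q\<in>Q. 1)" by (intro sum_mono u(3))
    also have "\<dots> = real (Suc D)" using cQ by simp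
    also have "\<dots> \<le> M" using H(1) by (simp add: M_def)
    finally have su: "(\<Sum>q\<in>Q. \<bar>u q\<bar>) \<le> M" .
    have "Q \<subseteq> set (X n)" using g by (auto simp: Q_def)
    moreover have "Q \<subseteq> cball p (M * mesh CARD('n) n)"
    proof
      fix q assume "q \<in> Q"
      then obtain i where i: "i \<le> D" "q = x (g i)" by (auto simp: Q_def)
      have "norm (p - q) \<le> norm (p - y i) + norm (y i - q)" using norm_triangle_ineq[of "p - y i" "y i - q"] by simp
      also have "\<dots> \<le> 3 * h * real i + h" using py[of i] g[OF i(1)] i(2) by simp
      also have "\<dots> = h * (3 * real i + 1)" by (simp add: algebra_simps)
      also have "\<dots> \<le> h * (3 * real D + 1)" using i h by (intro mult_left_mono) auto
      finally show "q \<in> cball p (M * mesh CARD('n) n)" using hM by (simp add: dist_norm)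
    qed
    ultimately show "\<exists>Q u z. Q \<subseteq> set (X n) \<and> Q \<subseteq> cball p (M * mesh CARD('n) n) \<and> z \<in> Q \<and> u z = 1 \<and> (\<Sum>y\<in>Q. \<bar>u y\<bar>) \<le> M \<and> annihilates k Q u"
      using su u by blast
  qed
qed

lemma mesh_power: "mesh CARD('n) (2 ^ (k + j)) = mesh CARD('n) (2 ^ k) * mesh CARD('n) (2 ^ j)"
  by (simp add: power_add powr_mult)

lemma mesh_mono: "1 \<le> m \<Longrightarrow> m \<le> n \<Longrightarrow> mesh CARD('n) n \<le> mesh CARD('n) m"
  by (rule powr_mono2') auto

lemma mesh_tendsto: "(\<lambda>k. mesh CARD('n) (2 ^ k)) \<longlonglongrightarrow> 0"
proof -
  have "(\<lambda>k. real (2 ^ k) powr (- h)) \<longlonglongrightarrow> 0" if "0 < h" for h :: real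
    using that by simp real_asymp
  from this[of "1 / real CARD('n)"] show ?thesis by simp
qed

lemma summable_mesh: "0 < p \<Longrightarrow> summable (\<lambda>j. mesh CARD('n) (2 ^ (k + j)) powr p)"
proof -
  assume p: "0 < p"
  define q where "q = (2::real) powr (- p / real CARD('n))"
  have q: "0 < q" "q < 1" using p by (auto simp: q_def powr_less_one)
  have "mesh CARD('n) (2 ^ (k + j)) powr p = q ^ (k + j)" for j
  proof -
    have "mesh CARD('n) (2 ^ (k + j)) = 2 powr (real (k + j) * (- 1 / real CARD('n)))"
    proof -
      have "real (2 ^ (k + j)) = 2 powr real (k + j)" by (simp add: powr_realpow del: of_nat_add)
      then show ?thesis by (simp only: powr_powr)
    qed
    then show ?thesis unfolding q_def by (simp add: powr_powr powr_power mult_ac)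
  qed
  moreover have "summable (\<lambda>j. q ^ (k + j))" using q by (simp add: power_add summable_mult summable_geometric)
  ultimately show ?thesis by simp
qed

text \<open>The centres lie on a line at distances s k, the square roots of the mesh sizes, from x
  1. These distances shrink geometrically by the factor \<theta> = s 1, so the gap from s k to any
  later one is at least (1 - \<theta>) s k, while the radii are of the order of the square of s k
  and eventually fit into the gaps.\<close>

lemma disjoint_balls:
  assumes M: "0 < M"
  obtains p k0 where "1 \<le> k0" "\<And>k. k0 \<le> k \<Longrightarrow> cball (p k) (M * mesh CARD('n) (2 ^ k)) \<subseteq> \<Omega>"
    "\<And>k l. k0 \<le> k \<Longrightarrow> k < l \<Longrightarrow> M * (mesh CARD('n) (2 ^ k) + mesh CARD('n) (2 ^ l)) < norm (p k - p l)"
proof -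
  have w: "x 1 \<in> \<Omega>" by (rule x_in) simp
  then obtain \<rho> where \<rho>: "0 < \<rho>" "cball (x 1) \<rho> \<subseteq> \<Omega>" using opn open_contains_cball by metis
  obtain e :: "real ^ 'n" where e: "norm e = 1" using vector_choose_size[of 1] by auto
  define s where "s k = sqrt (mesh CARD('n) (2 ^ k))" for k
  define \<theta> where "\<theta> = s 1"
  have spos: "0 < s k" for k by (simp add: s_def)
  have ss: "s k * s k = mesh CARD('n) (2 ^ k)" for k by (simp add: s_def)
  have m1: "mesh CARD('n) (2 ^ 1) < 1" by (simp add: powr_less_one)
  have \<theta>0: "0 < \<theta>" unfolding \<theta>_def by (rule spos)
  have \<theta>: "\<theta> < 1" using m1 unfolding \<theta>_def s_def by (simp only: real_sqrt_lt_1_iff)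
  have s0: "s \<longlonglongrightarrow> 0" using tendsto_real_sqrt[OF mesh_tendsto] by (simp add: s_def[abs_def])
  have "(\<lambda>k. s k + M * (s k * s k)) \<longlonglongrightarrow> 0 + M * (0 * 0)" by (intro tendsto_intros s0)
  then have "\<forall>\<^sub>F k in sequentially. s k + M * (s k * s k) < \<rho>" using \<rho>(1) by (intro order_tendstoD(2)) auto
  moreover have "\<forall>\<^sub>F k in sequentially. s k < (1 - \<theta>) / (2 * M)" using s0 \<theta> M by (intro order_tendstoD(2)) auto
  ultimately have "\<forall>\<^sub>F k in sequentially. s k + M * (s k * s k) < \<rho> \<and> s k < (1 - \<theta>) / (2 * M)" by (rule eventually_conj)
  then obtain k1 where k1: "\<And>k. k1 \<le> k \<Longrightarrow> s k + M * (s k * s k) < \<rho> \<and> s k < (1 - \<theta>) / (2 * M)"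
    by (auto simp: eventually_sequentially)
  define p where "p k = x 1 + s k *\<^sub>R e" for k
  show ?thesis
  proof (rule that[of "max 1 k1" p])
    fix k l assume kl: "max 1 k1 \<le> k" "k < l"
    obtain i where i: "l = k + Suc i" using kl(2) less_iff_Suc_add by auto
    have "mesh CARD('n) (2 ^ l) \<le> mesh CARD('n) (2 ^ (k + 1))" unfolding i by (intro mesh_mono power_increasing) auto
    also have "\<dots> = (s k * \<theta>) * (s k * \<theta>)" unfolding mesh_power unfolding \<theta>_def ss[symmetric] by (simp only: mult_ac)
    finally have "(s l)\<^sup>2 \<le> (s k * \<theta>)\<^sup>2" by (simp only: power2_eq_square ss)
    then have sl: "s l \<le> s k * \<theta>" by (rule power2_le_imp_le) (intro mult_nonneg_nonneg less_imp_le spos \<theta>0)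
    then have "s l \<le> s k" using mult_left_mono[OF less_imp_le[OF \<theta>] less_imp_le[OF spos[of k]]] by linarith
    then have "s l * s l \<le> s k * s k" using spos[of l] spos[of k] by (intro mult_mono) auto
    then have "M * (mesh CARD('n) (2 ^ k) + mesh CARD('n) (2 ^ l)) \<le> M * (s k * s k + s k * s k)"
      unfolding ss[symmetric] using M by (intro mult_left_mono add_left_mono) auto
    also have "\<dots> = s k * (2 * M * s k)" by simp
    also have "\<dots> < s k * (1 - \<theta>)"
    proof (rule mult_strict_left_mono[OF _ spos])
      have "s k < (1 - \<theta>) / (2 * M)" using k1[of k] kl by simp
      then show "2 * M * s k < 1 - \<theta>" using M by (simp add: pos_less_divide_eq mult_ac)
    qed
    also have "\<dots> \<le> \<bar>s k - s l\<bar>" using sl by (simp add: right_diff_distrib)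
    also have "\<dots> = norm (p k - p l)"
    proof -
      have "p k - p l = (s k - s l) *\<^sub>R e" by (simp add: p_def algebra_simps)
      then show ?thesis using e by simp
    qed
    finally show "M * (mesh CARD('n) (2 ^ k) + mesh CARD('n) (2 ^ l)) < norm (p k - p l)" .
  next
    fix k assume k: "max 1 k1 \<le> k"
    have "cball (p k) (M * mesh CARD('n) (2 ^ k)) \<subseteq> cball (x 1) \<rho>"
    proof
      fix y assume "y \<in> cball (p k) (M * mesh CARD('n) (2 ^ k))"
      then have "norm (p k - y) \<le> M * (s k * s k)" by (simp add: dist_norm ss)
      moreover have "norm (x 1 - p k) = s k" using e spos[of k] by (simp add: p_def)
      moreover have "norm (x 1 - y) \<le> norm (x 1 - p k) + norm (p k - y)" using norm_triangle_ineq[of "x 1 - p k" "p k - y"] by simp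
      ultimately show "y \<in> cball (x 1) \<rho>" using k1[of k] k by (simp add: dist_norm)
    qed
    then show "cball (p k) (M * mesh CARD('n) (2 ^ k)) \<subseteq> \<Omega>" using \<rho>(2) by blast
  qed simp
qed

text \<open>The function is a lacunary series of bumps, one at each scale \<open>2\<^bsup>-j/d\<^esup>\<close>; every bump is seen by exactly one
  point of its cluster, so the annihilating coefficients of the cluster extract its height.\<close>

lemma ex_rough_function:
  assumes \<alpha>: "real CARD('n) / 2 < \<alpha>" and \<beta>: "\<alpha> - real CARD('n) / 2 < \<beta>"
  obtains f k0 M where "f \<in> sobolev_space \<alpha>" "continuous_on UNIV f" "0 < M"
    "\<And>j. k0 \<le> j \<Longrightarrow> \<exists>Q u. Q \<subseteq> set (X (2 ^ j)) \<and> annihilates k Q u \<and> (\<forall>y\<in>Q. \<forall>z\<in>Q. norm (y - z) \<le> M * mesh CARD('n) (2 ^ j)) \<and>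
       (\<Sum>y\<in>Q. \<bar>u y\<bar>) \<le> M \<and> (\<Sum>y\<in>Q. u y * f y) = mesh CARD('n) (2 ^ j) powr \<beta>"
proof -
  let ?d = "real CARD('n)"
  obtain M where M: "0 < M" "\<And>n p. 2 \<le> n \<Longrightarrow> cball p (M * mesh CARD('n) n) \<subseteq> \<Omega> \<Longrightarrow>
    \<exists>Q u z. Q \<subseteq> set (X n) \<and> Q \<subseteq> cball p (M * mesh CARD('n) n) \<and> z \<in> Q \<and> u z = 1 \<and> (\<Sum>y\<in>Q. \<bar>u y\<bar>) \<le> M \<and> annihilates k Q u"
    using annihilating_cluster[where k = k] by blast
  \<comment> \<open>The additional d leaves room for the support of a bump whose width is at most
    the mesh, so that it cannot reach a cluster in another ball.\<close>
  define M' where "M' = M + ?d"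
  have M': "0 < M'" using M(1) by (simp add: M'_def add_pos_nonneg)
  obtain p k0 where k0: "1 \<le> k0" and ball: "\<And>j. k0 \<le> j \<Longrightarrow> cball (p j) (M' * mesh CARD('n) (2 ^ j)) \<subseteq> \<Omega>"
    and disj: "\<And>j l. k0 \<le> j \<Longrightarrow> j < l \<Longrightarrow> M' * (mesh CARD('n) (2 ^ j) + mesh CARD('n) (2 ^ l)) < norm (p j - p l)"
    using disjoint_balls[OF M'] by metis
  have disj': "M' * (mesh CARD('n) (2 ^ j) + mesh CARD('n) (2 ^ l)) < norm (p j - p l)" if "k0 \<le> j" "k0 \<le> l" "j \<noteq> l" for j l
    using disj[of j l] disj[of l j] that by (cases "j < l") (auto simp: add.commute norm_minus_commute)
  have two: "2 \<le> (2::nat) ^ j" if "k0 \<le> j" for j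
    using power_increasing[of 1 j "2::nat"] that k0 by simp
  define P where "P j Q u z \<longleftrightarrow> Q \<subseteq> set (X (2 ^ j)) \<and> Q \<subseteq> cball (p j) (M * mesh CARD('n) (2 ^ j)) \<and> z \<in> Q \<and>
    u z = 1 \<and> (\<Sum>y\<in>Q. \<bar>u y\<bar>) \<le> M \<and> annihilates k Q u" for j Q z and u :: "real ^ 'n \<Rightarrow> real"
  have cl: "\<exists>Q u z. P j Q u z"
    if j: "k0 \<le> j" for j
    unfolding P_def
  proof (rule M(2)[OF two[OF j]])
    have "cball (p j) (M * mesh CARD('n) (2 ^ j)) \<subseteq> cball (p j) (M' * mesh CARD('n) (2 ^ j))"
      by (intro subset_cball mult_right_mono) (auto simp: M'_def)
    then show "cball (p j) (M * mesh CARD('n) (2 ^ j)) \<subseteq> \<Omega>" using ball[OF j] by blast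
  qed
  have "\<forall>j. \<exists>t. k0 \<le> j \<longrightarrow> P j (fst t) (fst (snd t)) (snd (snd t))"
  proof
    fix j
    show "\<exists>t. k0 \<le> j \<longrightarrow> P j (fst t) (fst (snd t)) (snd (snd t))"
    proof (cases "k0 \<le> j")
      case True
      from cl[OF this] obtain Q u z where "P j Q u z" by blast
      then show ?thesis by (intro exI[of _ "(Q, u, z)"]) simp
    qed simp
  qed
  from choice[OF this] obtain t where t: "\<forall>j. k0 \<le> j \<longrightarrow> P j (fst (t j)) (fst (snd (t j))) (snd (snd (t j)))" by (rule exE)
  define Q u z where "Q j = fst (t j)" and "u j = fst (snd (t j))" and "z j = snd (snd (t j))" for j
  have PQ: "P j (Q j) (u j) (z j)" if "k0 \<le> j" for j using t that by (simp add: Q_def u_def z_def)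
  have Q: "Q j \<subseteq> set (X (2 ^ j)) \<and> Q j \<subseteq> cball (p j) (M * mesh CARD('n) (2 ^ j)) \<and> z j \<in> Q j \<and> u j (z j) = 1 \<and> (\<Sum>y\<in>Q j. \<bar>u j y\<bar>) \<le> M \<and> annihilates k (Q j) (u j)" if "k0 \<le> j" for j using PQ[OF that] by (simp only: P_def)
  obtain a where a: "0 < a" "\<And>n. 2 \<le> n \<Longrightarrow> a * mesh CARD('n) n \<le> separation_radius x n" using separation_lower by auto
  \<comment> \<open>A bump of width b r vanishes beyond the distance d b r \<le> a r, which is less
    than twice the separation radius, so among the data of its level it is seen only at its
    centre.\<close>
  define b where "b = min 1 (a / ?d)"
  have b: "0 < b" "b \<le> 1" using a(1) by (auto simp: b_def)
  have "b \<le> a / ?d" by (simp add: b_def)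
  then have bd: "?d * b \<le> a" by (simp add: pos_le_divide_eq mult.commute)
  obtain m where m: "\<beta> + ?d \<le> real m" using real_arch_simple by blast
  define r where "r j = mesh CARD('n) (2 ^ (k0 + j))" for j
  define f where "f y = (\<Sum>j. r j powr \<beta> * bump m ((1 / (b * r j)) *\<^sub>R (y - z (k0 + j))))" for y
  have r: "0 < r j" "r j \<le> 1" for j using mesh_mono[of 1 "2 ^ (k0 + j)"] by (auto simp: r_def)
  have summ: "summable (\<lambda>j. r j powr p)" if "0 < p" for p unfolding r_def by (rule summable_mesh[OF that])
  obtain R where R: "\<And>y. y \<in> \<Omega> \<Longrightarrow> norm y \<le> R" using bdd by (auto simp: bounded_iff)
  have zR: "norm (z (k0 + j)) \<le> R" for j using Q[of "k0 + j"] X_subset[of "2 ^ (k0 + j)"] by (intro R) auto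
  have fs: "f \<in> sobolev_space \<alpha>" "continuous_on UNIV f"
    using bump_series_sobolev[OF \<alpha> \<beta> m b r summ zR] unfolding f_def by simp_all
  have scale: "bump m ((1 / (b * r i)) *\<^sub>R v) = 0" if "?d * b * r i < norm v" for i and v :: "real ^ 'n"
  proof (rule bump_eq_0)
    have "?d < norm v / (b * r i)" using that b(1) r(1)[of i] by (simp add: pos_less_divide_eq mult_ac)
    then show "real DIM(real ^ 'n) < norm ((1 / (b * r i)) *\<^sub>R v)" using b(1) r(1)[of i] by simp
  qed
  have val: "f y = (if y = z (k0 + j) then r j powr \<beta> else 0)" if y: "y \<in> Q (k0 + j)" for y j
  proof -
    have "r i powr \<beta> * bump m ((1 / (b * r i)) *\<^sub>R (y - z (k0 + i))) = 0" if i: "i \<notin> {j}" for i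
    proof -
      have "M' * (r j + r i) < norm (p (k0 + j) - p (k0 + i))" unfolding r_def using i by (intro disj') auto
      also have "\<dots> \<le> norm (p (k0 + j) - y) + norm (y - z (k0 + i)) + norm (p (k0 + i) - z (k0 + i))"
        using norm_triangle_ineq[of "p (k0 + j) - y + (y - z (k0 + i))" "z (k0 + i) - p (k0 + i)"]
          norm_triangle_ineq[of "p (k0 + j) - y" "y - z (k0 + i)"]
        by (simp add: norm_minus_commute)
      also have "norm (p (k0 + j) - y) \<le> M * r j" using Q[of "k0 + j"] y by (auto simp: dist_norm r_def)
      also have "norm (p (k0 + i) - z (k0 + i)) \<le> M * r i" using Q[of "k0 + i"] by (auto simp: dist_norm r_def)
      finally have "?d * r j + ?d * r i < norm (y - z (k0 + i))" by (simp add: M'_def algebra_simps)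
      moreover have "0 \<le> ?d * r j" using r(1)[of j] by simp
      moreover have "?d * b * r i \<le> ?d * r i" using b(2) r(1)[of i] by simp
      ultimately have "?d * b * r i < norm (y - z (k0 + i))" by linarith
      then show ?thesis by (simp only: scale mult_zero_right)
    qed
    then have "f y = (\<Sum>i\<in>{j}. r i powr \<beta> * bump m ((1 / (b * r i)) *\<^sub>R (y - z (k0 + i))))"
      unfolding f_def by (intro suminf_finite) auto
    also have "\<dots> = (if y = z (k0 + j) then r j powr \<beta> else 0)"
    proof (cases "y = z (k0 + j)")
      case False
      have "y \<in> x ` {1..2 ^ (k0 + j)}" "z (k0 + j) \<in> x ` {1..2 ^ (k0 + j)}" using y Q[of "k0 + j"] by auto
      then obtain i l where il: "i \<in> {1..2 ^ (k0 + j)}" "y = x i" "l \<in> {1..2 ^ (k0 + j)}" "z (k0 + j) = x l" by (elim imageE)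
      have "?d * b * r j \<le> a * r j" using bd r(1)[of j] by (intro mult_right_mono) auto
      also have "\<dots> < 2 * (a * r j)" using a(1) r(1)[of j] by simp
      also have "\<dots> \<le> 2 * separation_radius x (2 ^ (k0 + j))" using a(2)[OF two[of "k0 + j"]] by (simp add: r_def)
      also have "\<dots> \<le> norm (y - z (k0 + j))" using False il by (auto intro!: separation_radius_le)
      finally show ?thesis using False by (simp add: scale)
    qed simp
    finally show ?thesis .
  qed
  \<comment> \<open>The factor 2 turns the radius of a cluster into a bound for its
    diameter.\<close>
  have key: "\<exists>Q u. Q \<subseteq> set (X (2 ^ j)) \<and> annihilates k Q u \<and> (\<forall>y\<in>Q. \<forall>z\<in>Q. norm (y - z) \<le> 2 * M * mesh CARD('n) (2 ^ j)) \<and>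
       (\<Sum>y\<in>Q. \<bar>u y\<bar>) \<le> 2 * M \<and> (\<Sum>y\<in>Q. u y * f y) = mesh CARD('n) (2 ^ j) powr \<beta>" if j: "k0 \<le> j" for j
  proof (intro exI[of _ "Q j"] exI[of _ "u j"] conjI ballI)
    fix y y' assume "y \<in> Q j" "y' \<in> Q j"
    then have "norm (p j - y) \<le> M * mesh CARD('n) (2 ^ j)" "norm (p j - y') \<le> M * mesh CARD('n) (2 ^ j)" using Q[OF j] by (auto simp: dist_norm)
    then show "norm (y - y') \<le> 2 * M * mesh CARD('n) (2 ^ j)"
      using norm_triangle_ineq4[of "p j - y'" "p j - y"] by simp
  next
    have "(\<Sum>y\<in>Q j. \<bar>u j y\<bar>) \<le> M" using Q[OF j] by blast
    then show "(\<Sum>y\<in>Q j. \<bar>u j y\<bar>) \<le> 2 * M" using M(1) by linarith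
    have "Q j \<subseteq> set (X (2 ^ j))" using Q[OF j] by blast
    then have fin: "finite (Q j)" by (rule finite_subset) (rule List.finite_set)
    obtain i where i: "j = k0 + i" using j le_Suc_ex by blast
    have "(\<Sum>y\<in>Q j. u j y * f y) = (\<Sum>y\<in>Q j. if y = z j then u j y * r i powr \<beta> else 0)"
      unfolding i by (intro sum.cong) (auto simp: val)
    also have "\<dots> = r i powr \<beta>" using fin Q[OF j] by simp
    finally show "(\<Sum>y\<in>Q j. u j y * f y) = mesh CARD('n) (2 ^ j) powr \<beta>" by (simp add: r_def i)
  qed (use Q[OF j] in auto)
  show ?thesis by (rule that[OF fs _ key]) (use M(1) in auto)
qed

text \<open>For 2^j \<le> n < 2^(j+1) the cluster of scale r = 2^(-j/d) belongs to the first n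
  points. Its coefficients, extended by zero, give f the value r^\<beta>, while the form is at most
  of order r^(2 \<nu>1) because r \<le> 1 and \<nu> \<ge> \<nu>1. The quotient r^(2 \<beta> - 2
  \<nu>1) is the claimed power of 2^j > n/2, whence the power of 1/2 in C. The upper bound of c
  makes the estimate uniform in \<nu>.\<close>

lemma data_fit_rough_function:
  assumes \<nu>1: "0 < \<nu>1" and cb: "bdd_above (c ` \<Theta>)"
    and \<alpha>: "real CARD('n) / 2 < \<alpha>" and \<beta>: "\<alpha> - real CARD('n) / 2 < \<beta>" "\<beta> \<le> \<nu>1"
  obtains f C where "f \<in> sobolev_space \<alpha>" "continuous_on UNIV f" "0 < C"
    "\<forall>\<^sub>F n in sequentially. \<forall>\<nu>\<in>\<Theta>. \<nu>1 \<le> \<nu> \<longrightarrow> C * real n powr (2 * (\<nu>1 - \<beta>) / real CARD('n)) \<le> data_fit (K \<nu>) f (X n)"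
proof -
  let ?d = "real CARD('n)"
  obtain k :: nat where k: "\<nu>max < real k" using reals_Archimedean2 by blast
  obtain M0 where M0: "0 < M0"
    "\<And>\<nu> \<delta> (A :: (real ^ 'n) set) u c. \<nu> \<in> \<Theta> \<Longrightarrow> annihilates k A u \<Longrightarrow> 0 < \<delta> \<Longrightarrow>
       (\<And>x y. x \<in> A \<Longrightarrow> y \<in> A \<Longrightarrow> norm (x - y) \<le> \<delta>) \<Longrightarrow> 0 \<le> c \<nu> \<Longrightarrow>
       quad (matern \<sigma> lam c \<nu>) A u \<le> M0 * c \<nu> * (\<Sum>x\<in>A. \<bar>u x\<bar>)\<^sup>2 * \<delta> powr (2 * \<nu>)"
    using quad_matern_annihilates[OF lam \<sigma> \<nu>min k] by blast
  obtain f k0 M where f: "f \<in> sobolev_space \<alpha>" "continuous_on UNIV f" and M: "0 < M"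
    and Q: "\<And>j. k0 \<le> j \<Longrightarrow> \<exists>Q u. Q \<subseteq> set (X (2 ^ j)) \<and> annihilates k Q u \<and> (\<forall>y\<in>Q. \<forall>z\<in>Q. norm (y - z) \<le> M * mesh CARD('n) (2 ^ j)) \<and>
       (\<Sum>y\<in>Q. \<bar>u y\<bar>) \<le> M \<and> (\<Sum>y\<in>Q. u y * f y) = mesh CARD('n) (2 ^ j) powr \<beta>"
  proof (rule ex_rough_function[OF \<alpha> \<beta>(1), where k = k])
  qed (rule that)
  obtain c1 where c1: "\<And>\<nu>. \<nu> \<in> \<Theta> \<Longrightarrow> c \<nu> \<le> c1"
    using cb unfolding bdd_above_def by (auto simp del: atLeastAtMost_iff)
  have c1p: "0 < c1" using c1[of \<nu>min] c_pos[of \<nu>min] \<nu>min by simp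
  \<comment> \<open>To be uniform in \<nu>, c \<nu> is replaced by its bound and the power 2 \<nu>
    of M by the power 2 \<nu>max of the maximum of 1 and M.\<close>
  define M1 where "M1 = M0 * c1 * M\<^sup>2 * (max 1 M) powr (2 * \<nu>max)"
  have M1: "0 < M1" using M0(1) c1p M by (simp add: M1_def)
  define g where "g = 2 * (\<nu>1 - \<beta>) / ?d"
  have g: "0 \<le> g" using \<beta> by (simp add: g_def)
  define C where "C = (1 / 2) powr g / M1"
  have C: "0 < C" using M1 by (simp add: C_def)
  have main: "C * real n powr g \<le> data_fit (K \<nu>) f (X n)" if n: "2 ^ k0 \<le> n" and \<nu>: "\<nu> \<in> \<Theta>" "\<nu>1 \<le> \<nu>" for n \<nu>
  proof -
    have n1: "1 \<le> n" using n by (rule order_trans[rotated]) simp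
    obtain j where j: "2 ^ j \<le> n" "n < 2 ^ (j + 1)" using ex_power_ivl1[of 2 n] n1 by auto
    have "(2::nat) ^ k0 < 2 ^ (j + 1)" using n j(2) by (rule le_less_trans)
    then have "k0 < j + 1" by (rule power_less_imp_less_exp[rotated]) simp
    then have "k0 \<le> j" by simp
    from Q[OF this] obtain P u where P: "P \<subseteq> set (X (2 ^ j))" "annihilates k P u" "\<And>y z. y \<in> P \<Longrightarrow> z \<in> P \<Longrightarrow> norm (y - z) \<le> M * mesh CARD('n) (2 ^ j)"
      "(\<Sum>y\<in>P. \<bar>u y\<bar>) \<le> M" "(\<Sum>y\<in>P. u y * f y) = mesh CARD('n) (2 ^ j) powr \<beta>" by blast
    define r where "r = mesh CARD('n) (2 ^ j)"
    have r: "0 < r" "r \<le> 1" using mesh_mono[of 1 "2 ^ j"] by (auto simp: r_def)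
    have "set (X (2 ^ j)) \<subseteq> set (X n)" using j(1) by auto
    then have PX: "P \<subseteq> set (X n)" using P(1) by blast
    have "quad (K \<nu>) P u \<le> M0 * c \<nu> * (\<Sum>y\<in>P. \<bar>u y\<bar>)\<^sup>2 * (M * r) powr (2 * \<nu>)"
      by (rule M0(2)[OF \<nu>(1) P(2)]) (use P(3) M r c_pos[OF \<nu>(1)] in \<open>auto simp: r_def\<close>)
    also have "\<dots> = M0 * c \<nu> * (\<Sum>y\<in>P. \<bar>u y\<bar>)\<^sup>2 * (M powr (2 * \<nu>) * r powr (2 * \<nu>))" by (simp add: powr_mult)
    also have "\<dots> \<le> M0 * c1 * M\<^sup>2 * (max 1 M powr (2 * \<nu>max) * r powr (2 * \<nu>1))"
    proof (intro mult_mono power_mono c1 \<nu> P(4))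
      have "M powr (2 * \<nu>) \<le> max 1 M powr (2 * \<nu>)" using M \<Theta>_pos[OF \<nu>(1)] by (intro powr_mono2) auto
      also have "\<dots> \<le> max 1 M powr (2 * \<nu>max)" using \<nu>(1) by (intro powr_mono) auto
      finally show "M powr (2 * \<nu>) \<le> max 1 M powr (2 * \<nu>max)" .
      show "r powr (2 * \<nu>) \<le> r powr (2 * \<nu>1)" using r \<nu>(2) by (intro powr_mono') auto
    qed (use M0(1) c1p M c_pos[OF \<nu>(1)] in \<open>auto intro!: sum_nonneg\<close>)
    finally have le: "quad (K \<nu>) P u \<le> M1 * r powr (2 * \<nu>1)" by (simp add: M1_def mult_ac)
    define v where "v y = (if y \<in> P then u y else 0)" for y
    have "quad (K \<nu>) (set (X n)) v = quad (K \<nu>) P v" by (rule quad_mono_neutral[OF _ PX]) (auto simp: v_def)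
    also have "\<dots> = quad (K \<nu>) P u" by (rule quad_cong) (simp add: v_def)
    finally have qv: "quad (K \<nu>) (set (X n)) v = quad (K \<nu>) P u" .
    have "(\<Sum>y\<in>set (X n). v y * f y) = (\<Sum>y\<in>P. v y * f y)" by (rule sum.mono_neutral_right[OF _ PX]) (auto simp: v_def)
    also have "\<dots> = r powr \<beta>" using P(5) by (simp add: v_def r_def)
    finally have "(r powr \<beta>)\<^sup>2 \<le> quad (K \<nu>) P u * data_fit (K \<nu>) f (X n)"
      using data_fit_ge(1)[OF distinct_X[of n] pos_def_K[OF \<nu>(1) List.finite_set[of "X n"]], of v f] by (simp only: qv)
    also have "\<dots> \<le> M1 * r powr (2 * \<nu>1) * data_fit (K \<nu>) f (X n)"
      using le data_fit_nonneg[OF distinct_X[of n] pos_def_K[OF \<nu>(1) List.finite_set[of "X n"]]] by (rule mult_right_mono)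
    finally have "r powr (2 * \<beta>) / (M1 * r powr (2 * \<nu>1)) \<le> data_fit (K \<nu>) f (X n)"
      using M1 r(1) by (simp add: pos_divide_le_eq mult_ac power2_eq_square powr_add[symmetric])
    moreover have "r powr (2 * \<beta>) / (M1 * r powr (2 * \<nu>1)) = r powr (2 * \<beta> - 2 * \<nu>1) / M1"
      by (simp add: powr_diff)
    moreover have "C * real n powr g \<le> r powr (2 * \<beta> - 2 * \<nu>1) / M1"
    proof -
      have "r powr (2 * \<beta> - 2 * \<nu>1) = real (2 ^ j) powr g"
        unfolding r_def powr_powr g_def by (rule arg_cong[where f = "(powr) _"]) (simp add: field_simps)
      moreover have "(real n / 2) powr g \<le> real (2 ^ j) powr g"
      proof (rule powr_mono2[OF g])
        have "real n \<le> real (2 ^ (j + 1))" using j(2) by (metis less_imp_le of_nat_le_iff)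
        then show "real n / 2 \<le> real (2 ^ j)" by simp
      qed simp
      moreover have "(real n / 2) powr g = (1 / 2) powr g * real n powr g" by (simp add: powr_mult[symmetric])
      ultimately show ?thesis using M1 by (simp add: C_def divide_right_mono)
    qed
    ultimately show ?thesis by linarith
  qed
  show ?thesis
    by (rule that[OF f C], rule eventually_sequentiallyI[of "2 ^ k0"]) (use main in \<open>auto simp: g_def\<close>)
qed

text \<open>The loss at \<nu>0 is at most of order n up to logarithms, while at every \<nu> \<ge>
  \<nu>0 + \<epsilon> the data fit of the rough function is of larger order than n ln n; so no such
  \<nu> is a minimiser.\<close>

lemma est_ML_eventually_below:
  assumes cb: "bdd_above (c ` \<Theta>)" and \<nu>0: "real CARD('n) / 2 < \<nu>0" "\<nu>min \<le> \<nu>0" "\<nu>0 \<le> \<nu>max" and \<epsilon>: "0 < \<epsilon>"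
    and est: "estimator_ML K \<Theta> x (sobolev_space_on \<nu>0 \<Omega>) est"
  obtains f where "f \<in> sobolev_space_on \<nu>0 \<Omega>" "\<forall>\<^sub>F n in sequentially. est f n < \<nu>0 + \<epsilon>"
proof -
  let ?d = "real CARD('n)"
  \<comment> \<open>Slightly above \<nu>0 - d/2, as membership in the Sobolev space requires, yet so
    small that 2 (\<nu>0 + \<epsilon> - \<beta>)/d = 1 + \<epsilon>/d exceeds 1.\<close>
  define \<beta> where "\<beta> = \<nu>0 - ?d / 2 + \<epsilon> / 2"
  have \<beta>: "\<nu>0 - ?d / 2 < \<beta>" "\<beta> \<le> \<nu>0 + \<epsilon>" and \<nu>1: "0 < \<nu>0 + \<epsilon>" using \<epsilon> \<nu>0 \<nu>min by (auto simp: \<beta>_def)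
  obtain f C where f: "f \<in> sobolev_space \<nu>0" "continuous_on UNIV f" and C: "0 < C"
    and fit: "\<forall>\<^sub>F n in sequentially. \<forall>\<nu>\<in>\<Theta>. \<nu>0 + \<epsilon> \<le> \<nu> \<longrightarrow> C * real n powr (2 * (\<nu>0 + \<epsilon> - \<beta>) / ?d) \<le> data_fit (K \<nu>) f (X n)"
  proof (rule data_fit_rough_function[OF \<nu>1 cb \<nu>0(1) \<beta>])
  qed (rule that)
  have exp: "2 * (\<nu>0 + \<epsilon> - \<beta>) / ?d = 1 + \<epsilon> / ?d" by (simp add: \<beta>_def field_simps)
  have fB: "f \<in> sobolev_space_on \<nu>0 \<Omega>" using f by (auto simp: sobolev_space_on_def sobolev_extensions_def)
  then have B: "sobolev_bounded \<nu>0 \<Omega> {f}" by (auto simp: sobolev_bounded_def)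
  have \<nu>\<Theta>: "\<nu>0 \<in> \<Theta>" using \<nu>0 by simp
  have le: "\<nu>0 - ?d / 2 \<le> \<nu>0" by simp
  obtain F where F: "0 \<le> F" "\<And>f' n. f' \<in> {f} \<Longrightarrow> 2 \<le> n \<Longrightarrow> gauss_scale n \<le> 1 \<Longrightarrow>
     data_fit (K \<nu>0) f' (X n) \<le> F * (real n powr (2 * (\<nu>0 - (\<nu>0 - ?d / 2)) / ?d) * ln (2 * real n) powr (\<nu>0 - (\<nu>0 - ?d / 2)))"
    using data_fit_growth[OF B \<nu>0(1) \<nu>\<Theta> le] by metis
  have exp2: "2 * (\<nu>0 - (\<nu>0 - ?d / 2)) / ?d = 1" by simp
  obtain m where m: "0 < m" "\<And>\<nu> n A u. \<nu> \<in> \<Theta> \<Longrightarrow> 2 \<le> n \<Longrightarrow> gauss_scale n \<le> 1 \<Longrightarrow> A \<subseteq> set (X n) \<Longrightarrow>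
     m * gauss_scale n powr \<nu> * (\<Sum>y\<in>A. (u y)\<^sup>2) \<le> quad (K \<nu>) A u"
    using K_lower by blast
  obtain C' where C': "\<And>n \<nu> s. 2 \<le> n \<Longrightarrow> gauss_scale n \<le> 1 \<Longrightarrow> 0 \<le> s \<Longrightarrow> \<nu> \<le> s \<Longrightarrow> s \<le> \<nu>max \<Longrightarrow>
    real n * (C' - 2 * s / ?d * ln (real n) - s * ln (ln (2 * real n))) \<le> real n * ln (m * gauss_scale n powr \<nu>)"
    using ln_lower_bound[OF m(1)] by metis
  define L where "L = max 0 (ln (K \<nu>0 0 0))"
  have "0 < \<epsilon> / ?d" using \<epsilon> by simp
  then have gap: "\<forall>\<^sub>F n in sequentially. F * (real n powr 1 * ln (2 * real n) powr (\<nu>0 - (\<nu>0 - ?d / 2))) + real n * L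
    < C * real n powr (1 + \<epsilon> / ?d) + real n * (C' - 2 * \<nu>max / ?d * ln (real n) - \<nu>max * ln (ln (2 * real n)))"
    by (rule asymptotic_gap_ML[OF C])
  from gap fit gauss_scale_le_1 eventually_ge_at_top[of "2::nat"] have "\<forall>\<^sub>F n in sequentially. est f n < \<nu>0 + \<epsilon>"
  proof eventually_elim
    case (elim n)
    show ?case
    proof (rule ccontr)
      assume "\<not> est f n < \<nu>0 + \<epsilon>"
      then have ge: "\<nu>0 + \<epsilon> \<le> est f n" by simp
      have arg: "est f n \<in> \<Theta>" "\<And>\<nu>. \<nu> \<in> \<Theta> \<Longrightarrow> loss_ML (K (est f n)) f (X n) \<le> loss_ML (K \<nu>) f (X n)"
        using est fB elim(4) by (force simp: estimator_ML_def is_arg_min_def not_less)+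
      have pd: "\<nu> \<in> \<Theta> \<Longrightarrow> pos_def_on (set (X n)) (K \<nu>)" for \<nu> by (rule pos_def_K) auto
      have T: "0 < gauss_scale n" by (rule gauss_scale_pos[OF elim(4)])
      have "C * real n powr (1 + \<epsilon> / ?d) \<le> data_fit (K (est f n)) f (X n)" using elim(2) arg(1) ge unfolding exp by blast
      moreover have "real n * (C' - 2 * \<nu>max / ?d * ln (real n) - \<nu>max * ln (ln (2 * real n))) \<le> real n * ln (m * gauss_scale n powr est f n)"
        by (rule C'[OF elim(4,3)]) (use arg(1) \<nu>min in auto)
      ultimately have "C * real n powr (1 + \<epsilon> / ?d) + real n * (C' - 2 * \<nu>max / ?d * ln (real n) - \<nu>max * ln (ln (2 * real n)))
        \<le> data_fit (K (est f n)) f (X n) + real (length (X n)) * ln (m * gauss_scale n powr est f n)" by simp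
      also have "\<dots> \<le> loss_ML (K (est f n)) f (X n)"
        by (rule loss_ML_lower_bound[OF pd[OF arg(1)] distinct_X _ m(2)[OF arg(1) elim(4,3)]]) (use m(1) T in auto)
      also have "\<dots> \<le> loss_ML (K \<nu>0) f (X n)" by (rule arg(2)[OF \<nu>\<Theta>])
      also have "\<dots> \<le> F * (real n powr 1 * ln (2 * real n) powr (\<nu>0 - (\<nu>0 - ?d / 2))) + (real (length (X n) - n) * ln 1 + real (min (length (X n)) n) * L)"
        unfolding loss_ML_def data_fit_def[symmetric]
      proof (intro add_mono ln_det_upper_bound(1)[OF _ _ pd[OF \<nu>\<Theta>] distinct_X])
        show "data_fit (K \<nu>0) f (X n) \<le> F * (real n powr 1 * ln (2 * real n) powr (\<nu>0 - (\<nu>0 - ?d / 2)))"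
          using F(2)[OF _ elim(4,3)] unfolding exp2 by simp
        \<comment> \<open>With N = n the condition is vacuous, as no subset has more than n points.
          The determinant bound then charges every point with the diagonal.\<close>
        show "predictable (K \<nu>0) (set (X n)) n 1"
          unfolding predictable_def
        proof (intro allI impI)
          fix P assume "P \<subseteq> set (X n)" and "n < card P"
          then have "n < card (set (X n))" using card_mono[OF List.finite_set \<open>P \<subseteq> set (X n)\<close>] by linarith
          then show "\<exists>y\<in>P. \<exists>v. v y = 1 \<and> quad (K \<nu>0) P v \<le> 1" using card_length[of "X n"] by (simp only: length_first_points)
        qed
      qed (simp_all add: L_def diag_bound[OF \<nu>\<Theta>])
      also have "\<dots> = F * (real n powr 1 * ln (2 * real n) powr (\<nu>0 - (\<nu>0 - ?d / 2))) + real n * L" by simp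
      finally show False using elim(1) by simp
    qed
  qed
  then show ?thesis by (rule that[OF fB])
qed

end

theorem theorem3p11:
  fixes \<nu>min \<nu>max \<nu>0 \<sigma> lam :: real
    and c :: "real \<Rightarrow> real"
    and \<Omega> :: "(real ^ 'n) set"
    and x :: "nat \<Rightarrow> real ^ 'n"
  assumes "0 < \<nu>min" and "\<nu>min \<le> \<nu>max" and "real CARD('n) / 2 < \<nu>max"
    and "0 < \<sigma>" and "0 < lam"
    and "\<And>\<nu>. \<nu> \<in> {\<nu>min..\<nu>max} \<Longrightarrow> 0 < c \<nu>"
    and "0 < (INF \<nu>\<in>{\<nu>min..\<nu>max}. c \<nu>)"
    and "bounded \<Omega>" and "connected \<Omega>" and "open \<Omega>"
    and "interior_cone_condition \<Omega>" and "lipschitz_boundary \<Omega>"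
    and "\<And>i. 1 \<le> i \<Longrightarrow> x i \<in> \<Omega>" and "inj_on x {1..}"
    and "quasi_uniform \<Omega> x"
    and "real CARD('n) / 2 < \<nu>0" and "\<nu>0 \<le> \<nu>max"
  shows
    "(\<forall>B. sobolev_bounded \<nu>0 \<Omega> B \<longrightarrow>
        (\<forall>est. estimator_ML (matern \<sigma> lam c) {\<nu>min..\<nu>max} x B est \<longrightarrow>
           liminf (\<lambda>n. INF f\<in>B. ereal (est f n)) \<ge> ereal \<nu>0) \<and>
        (\<forall>est. estimator_CV (matern \<sigma> lam c) {\<nu>min..\<nu>max} x B est \<longrightarrow>
           liminf (\<lambda>n. INF f\<in>B. ereal (est f n)) \<ge> ereal (\<nu>0 - real CARD('n) / 2)))
     \<and>
     (bdd_above (c ` {\<nu>min..\<nu>max}) \<and> \<nu>min \<le> \<nu>0 \<longrightarrow>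
        (\<forall>est. estimator_ML (matern \<sigma> lam c) {\<nu>min..\<nu>max} x
                 (sobolev_space_on \<nu>0 \<Omega>) est \<longrightarrow>
           (\<forall>\<epsilon>>0. \<exists>f\<in>sobolev_space_on \<nu>0 \<Omega>.
              limsup (\<lambda>n. ereal (est f n)) \<le> ereal (\<nu>0 + \<epsilon>))))"
proof -
  interpret matern_design \<nu>min \<nu>max \<sigma> lam c \<Omega> x
    using assms by unfold_locales
  note d = \<open>real CARD('n) / 2 < \<nu>0\<close> and max = \<open>\<nu>0 \<le> \<nu>max\<close>
  show ?thesis
  proof (intro conjI allI impI)
    fix B est assume B: "sobolev_bounded \<nu>0 \<Omega> B"
    show "liminf (\<lambda>n. INF f\<in>B. ereal (est f n)) \<ge> ereal \<nu>0"
      if "estimator_ML (matern \<sigma> lam c) {\<nu>min..\<nu>max} x B est"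
      by (rule liminf_INF_ge) (rule est_ML_eventually_above[OF B d max that])
    show "liminf (\<lambda>n. INF f\<in>B. ereal (est f n)) \<ge> ereal (\<nu>0 - real CARD('n) / 2)"
      if "estimator_CV (matern \<sigma> lam c) {\<nu>min..\<nu>max} x B est"
      by (rule liminf_INF_ge) (rule est_CV_eventually_above[OF B d max that])
  next
    fix est and \<epsilon> :: real
    assume "bdd_above (c ` {\<nu>min..\<nu>max}) \<and> \<nu>min \<le> \<nu>0" "0 < \<epsilon>"
      and "estimator_ML (matern \<sigma> lam c) {\<nu>min..\<nu>max} x (sobolev_space_on \<nu>0 \<Omega>) est"
    then obtain f where f: "f \<in> sobolev_space_on \<nu>0 \<Omega>" "\<forall>\<^sub>F n in sequentially. est f n < \<nu>0 + \<epsilon>"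
      using est_ML_eventually_below[OF _ d _ max] by metis
    then have "\<forall>\<^sub>F n in sequentially. ereal (est f n) \<le> ereal (\<nu>0 + \<epsilon>)" by (auto elim: eventually_mono)
    then have "limsup (\<lambda>n. ereal (est f n)) \<le> ereal (\<nu>0 + \<epsilon>)" by (rule Limsup_bounded)
    then show "\<exists>f\<in>sobolev_space_on \<nu>0 \<Omega>. limsup (\<lambda>n. ereal (est f n)) \<le> ereal (\<nu>0 + \<epsilon>)" using f(1) by blast
  qed
qed

end
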